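(* Let $\mu$ be a finite non-negative Borel measure on $\mathbb T$, $n\in\mathbb N$, $\lambda_1,\ldots,\lambda_n\in\mathbb T$ distinct points and $c_1,\ldots,c_n>0$. Let $\pmb\mu=(\mu,\sum_{j=1}^nc_j\delta_{\lambda_j})$. If $\mathcal M$ is a non-zero closed subspace of $\mathcal H_{\pmb\mu}$ invariant under multiplication by $z$, then $\dim(\mathcal M\ominus z\mathcal M)=1$.
   Context: $\mathbb D$ open unit disc, $\mathbb T$ unit circle, $dA$ normalized area measure, $H^2$ Hardy space, $\delta_\lambda$ Dirac measure at $\lambda$. For a measure $\nu$, $P_\nu(z)=\int_{\mathbb T}\frac{1-|z|^2}{|z-\zeta|^2}d\nu(\zeta)$ and $D_{\nu,j}(f)=\frac{1}{j!(j-1)!}\int_{\mathbb D}|f^{(j)}|^2P_\nu(1-|z|^2)^{j-1}dA$ ($j\ge1$); $\mathcal H_{\nu,j}=\{f\in\mathcal O(\mathbb D):D_{\nu,j}(f)<\infty\}$ if $\nu\ne0$ and $H^2$ if $\nu=0$. For $\pmb\mu=(\mu_1,\mu_2)$, $\mathcal H_{\pmb\mu}=\mathcal H_{\mu_1,1}\cap\mathcal H_{\mu_2,2}$, a Hilbert space with norm $\|f\|^2=\|f\|_{H^2}^2+D_{\mu_1,1}(f)+D_{\mu_2,2}(f)$. $\mathcal M\ominus z\mathcal M$ is the orthogonal complement of $z\mathcal M$ in $\mathcal M$. *)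

theory Defs
  imports "HOL-Analysis.Analysis"
begin

definition dA :: "complex measure" where
  "dA = density lborel (\<lambda>_. ennreal (1 / pi))"

definition poisson :: "complex measure \<Rightarrow> complex \<Rightarrow> ennreal" where
  "poisson \<nu> z = (\<integral>\<^sup>+ \<zeta>. ennreal ((1 - (cmod z)^2) / (cmod (z - \<zeta>))^2) \<partial>\<nu>)"

definition Dint :: "complex measure \<Rightarrow> nat \<Rightarrow> (complex \<Rightarrow> complex) \<Rightarrow> ennreal" where
  "Dint \<nu> j f = ennreal (1 / (fact j * fact (j - 1))) *
     (\<integral>\<^sup>+ z \<in> ball 0 1. ennreal ((cmod ((deriv ^^ j) f z))^2 * (1 - (cmod z)^2)^(j - 1))
                         * poisson \<nu> z \<partial>dA)"

definition Dinner :: "complex measure \<Rightarrow> nat \<Rightarrow> (complex \<Rightarrow> complex) \<Rightarrow> (complex \<Rightarrow> complex) \<Rightarrow> complex" where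
  "Dinner \<nu> j f g = complex_of_real (1 / (fact j * fact (j - 1))) *
     (\<integral> z. indicator (ball 0 1) z *\<^sub>R
        ((deriv ^^ j) f z * cnj ((deriv ^^ j) g z) *
         complex_of_real ((1 - (cmod z)^2)^(j - 1) * enn2real (poisson \<nu> z))) \<partial>dA)"

definition taylor_coeff :: "(complex \<Rightarrow> complex) \<Rightarrow> nat \<Rightarrow> complex" where
  "taylor_coeff f k = (deriv ^^ k) f 0 / fact k"

definition H2_normsq :: "(complex \<Rightarrow> complex) \<Rightarrow> ennreal" where
  "H2_normsq f = (\<Sum>k. ennreal ((cmod (taylor_coeff f k))^2))"

definition H2_inner :: "(complex \<Rightarrow> complex) \<Rightarrow> (complex \<Rightarrow> complex) \<Rightarrow> complex" where
  "H2_inner f g = (\<Sum>k. taylor_coeff f k * cnj (taylor_coeff g k))"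

definition H2 :: "(complex \<Rightarrow> complex) set" where
  "H2 = {f. f holomorphic_on ball 0 1 \<and> H2_normsq f < \<infinity>}"

definition Hsp :: "complex measure \<Rightarrow> nat \<Rightarrow> (complex \<Rightarrow> complex) set" where
  "Hsp \<nu> j = (if emeasure \<nu> (space \<nu>) = 0 then H2
              else {f. f holomorphic_on ball 0 1 \<and> Dint \<nu> j f < \<infinity>})"

definition HH :: "complex measure \<Rightarrow> complex measure \<Rightarrow> (complex \<Rightarrow> complex) set" where
  "HH \<mu>1 \<mu>2 = Hsp \<mu>1 1 \<inter> Hsp \<mu>2 2"

definition HH_normsq :: "complex measure \<Rightarrow> complex measure \<Rightarrow> (complex \<Rightarrow> complex) \<Rightarrow> ennreal" where
  "HH_normsq \<mu>1 \<mu>2 f = H2_normsq f + Dint \<mu>1 1 f + Dint \<mu>2 2 f"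

definition HH_inner :: "complex measure \<Rightarrow> complex measure \<Rightarrow> (complex \<Rightarrow> complex) \<Rightarrow> (complex \<Rightarrow> complex) \<Rightarrow> complex" where
  "HH_inner \<mu>1 \<mu>2 f g = H2_inner f g + Dinner \<mu>1 1 f g + Dinner \<mu>2 2 f g"

definition dirac_sum :: "nat \<Rightarrow> (nat \<Rightarrow> complex) \<Rightarrow> (nat \<Rightarrow> real) \<Rightarrow> complex measure" where
  "dirac_sum n lam c = measure_of UNIV (sets borel)
      (\<lambda>A. \<Sum>j<n. ennreal (c j) * indicator A (lam j))"

definition closed_z_invariant_subspace ::
  "complex measure \<Rightarrow> complex measure \<Rightarrow> (complex \<Rightarrow> complex) set \<Rightarrow> bool" where
  "closed_z_invariant_subspace \<mu>1 \<mu>2 M \<longleftrightarrow>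
     M \<subseteq> HH \<mu>1 \<mu>2 \<and>
     (\<lambda>_. 0) \<in> M \<and>
     (\<forall>f\<in>M. \<forall>g\<in>M. (\<lambda>z. f z + g z) \<in> M) \<and>
     (\<forall>f\<in>M. \<forall>a::complex. (\<lambda>z. a * f z) \<in> M) \<and>
     (\<forall>F f. (\<forall>k::nat. F k \<in> M) \<and> f \<in> HH \<mu>1 \<mu>2 \<and>
            ((\<lambda>k. HH_normsq \<mu>1 \<mu>2 (\<lambda>z. F k z - f z)) \<longlonglongrightarrow> 0) \<longrightarrow> f \<in> M) \<and>
     (\<forall>f\<in>M. (\<lambda>z. z * f z) \<in> M)"

definition wandering :: "complex measure \<Rightarrow> complex measure \<Rightarrow> (complex \<Rightarrow> complex) set \<Rightarrow> (complex \<Rightarrow> complex) set" where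
  "wandering \<mu>1 \<mu>2 M = {f \<in> M. \<forall>g\<in>M. HH_inner \<mu>1 \<mu>2 f (\<lambda>z. z * g z) = 0}"

definition dim_one_on_disc :: "(complex \<Rightarrow> complex) set \<Rightarrow> bool" where
  "dim_one_on_disc W \<longleftrightarrow>
     (\<exists>e\<in>W. (\<exists>z\<in>ball 0 1. e z \<noteq> 0) \<and> (\<forall>f\<in>W. \<exists>a::complex. \<forall>z\<in>ball 0 1. f z = a * e z))"

end

theory Submission
  imports Defs "HOL-Complex_Analysis.Complex_Analysis" "HOL-Library.Diagonal_Subsequence"
begin

text \<open>The Poisson integrals turn the norm into local Dirichlet integrals
  \<open>Dloc f \<zeta> = \<parallel>(f - f(\<zeta>)) / (z - \<zeta>)\<parallel>\<^sup>2\<close> integrated against the measures, with an analogous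
  weighted expression of second order. For \<open>f\<close> and \<open>g\<close> one takes the outer-type multiplier
  \<open>u = 1 / (1 + V)\<close>, \<open>V\<close> being holomorphic with real part \<open>\<bar>f\<bar>\<^sup>2 + \<bar>g\<bar>\<^sup>2\<close> on the circle, so that \<open>u\<close>, \<open>u f\<close>,
  \<open>u g\<close> are bounded and have local Dirichlet integrals controlled by those of \<open>f\<close> and \<open>g\<close>.
  Polynomial approximants \<open>q\<close>, \<open>q'\<close> of \<open>u\<^sup>2 g\<close>, \<open>u\<^sup>2 f\<close> then make \<open>q f - q' g\<close> tend to zero with bounded norm,
  once a polynomial vanishing at the \<open>\<lambda>\<^sub>j\<close> has been factored in to tame the second order part. If \<open>f\<close>
  vanishes at the origin to higher order than \<open>g\<close> and both lie in \<open>\<M>\<close>, a weak limit shows that \<open>f / z\<close> lies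
  in \<open>\<M>\<close>. Hence \<open>z \<M>\<close> has codimension one in \<open>\<M>\<close>; since multiplication by \<open>z\<close> is expansive, \<open>z \<M>\<close> is closed,
  and the orthogonal projection exists.\<close>

section \<open>Area integrals as local Dirichlet integrals\<close>

text \<open>The obstacle is that \<open>M\<close> is invariant only under polynomials. The relation
  \<open>(u\<^sup>2 g) f - (u\<^sup>2 f) g = 0\<close> has bounded coefficients, but replacing them
  by polynomials costs boundary weights: the local Dirichlet integral of \<open>q f\<close> at
  \<open>\<zeta>\<close> involves \<open>|f(\<zeta>)|\<^sup>2\<close> times that of
  \<open>q\<close>, and \<open>f\<close> may be unbounded. Hence \<open>u\<close> is built so that
  its own local integrals carry the factor \<open>|u(\<zeta>)|\<^sup>2\<close>, which absorbs such a
  weight. Second order integrals are never estimated for these products. Once a factor vanishes at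
  an atom, the second order integral there is at most the Dirichlet integral of the cofactor, and
  the Dirichlet integral is the circle mean of first order local ones, so one family of local bounds
  serves everything. The extra factor is removed at the end because its roots are non-zero:
  \<open>z h\<close> and \<open>(z - a) h\<close> together give \<open>a h\<close>. All integrals
  are rewritten as series in Taylor coefficients. The norm is then lower semicontinuous under
  coefficientwise convergence, and weak limits can be taken coefficient by coefficient.\<close>

lemma lborel_complex_eq_distr:
  "(lborel :: complex measure) = distr (lborel \<Otimes>\<^sub>M lborel) borel (\<lambda>(x, y). Complex x y)"
proof (rule lborel_eqI)
  have [measurable]: "(\<lambda>(x, y). Complex x y) \<in> borel_measurable (lborel \<Otimes>\<^sub>M lborel)"
    unfolding Complex_eq case_prod_beta by measurable
  show "sets (distr (lborel \<Otimes>\<^sub>M lborel) borel (\<lambda>(x, y). Complex x y)) = sets borel"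
    by simp
  fix l u :: complex
  assume lu: "\<And>b. b \<in> Basis \<Longrightarrow> l \<bullet> b \<le> u \<bullet> b"
  have "(\<lambda>(x, y). Complex x y) -` box l u \<inter> space (lborel \<Otimes>\<^sub>M lborel)
      = {Re l<..<Re u} \<times> {Im l<..<Im u}"
    by (auto simp: box_def Basis_complex_def space_pair_measure)
  then show "emeasure (distr (lborel \<Otimes>\<^sub>M lborel) borel (\<lambda>(x, y). Complex x y)) (box l u)
      = ennreal (\<Prod>b\<in>Basis. (u - l) \<bullet> b)"
    using lu[of 1] lu[of \<i>]
    by (subst emeasure_distr) (auto simp: lborel.emeasure_pair_measure_Times Basis_complex_def ennreal_mult)
qed

lemma nn_integral_lborel_complex:
  assumes [measurable]: "G \<in> borel_measurable borel"
  shows "(\<integral>\<^sup>+z. G z \<partial>(lborel :: complex measure)) = (\<integral>\<^sup>+x. \<integral>\<^sup>+y. G (Complex x y) \<partial>lborel \<partial>lborel)"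
proof -
  have [measurable]: "(\<lambda>(x, y). Complex x y) \<in> borel_measurable (lborel \<Otimes>\<^sub>M lborel)"
    unfolding Complex_eq case_prod_beta by measurable
  show ?thesis
    by (subst lborel_complex_eq_distr, subst nn_integral_distr)
       (auto simp: lborel.nn_integral_fst[symmetric] case_prod_beta)
qed

lemma nn_integral_lborel_complex':
  assumes [measurable]: "G \<in> borel_measurable borel"
  shows "(\<integral>\<^sup>+z. G z \<partial>(lborel :: complex measure)) = (\<integral>\<^sup>+y. \<integral>\<^sup>+x. G (Complex x y) \<partial>lborel \<partial>lborel)"
proof -
  have [measurable]: "(\<lambda>(x, y). Complex x y) \<in> borel_measurable (lborel \<Otimes>\<^sub>M lborel)"
    unfolding Complex_eq case_prod_beta by measurable
  show ?thesis
    unfolding nn_integral_lborel_complex[OF assms]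
    by (subst lborel_pair.Fubini') (auto simp: case_prod_beta)
qed

lemma nn_integral_translate:
  fixes G :: "real \<Rightarrow> ennreal"
  assumes [measurable]: "G \<in> borel_measurable borel"
  shows "(\<integral>\<^sup>+x. G (x + a) \<partial>lborel) = (\<integral>\<^sup>+x. G x \<partial>lborel)"
  using nn_integral_real_affine[of G 1 a] by (simp add: add.commute)

text \<open>On each horizontal line the shear is a translation, so the inner one of the iterated
  integrals does not change.\<close>

lemma nn_integral_lborel_shear_Re:
  assumes [measurable]: "G \<in> borel_measurable borel"
  shows "(\<integral>\<^sup>+z. G (z + of_real (a * Im z)) \<partial>lborel) = (\<integral>\<^sup>+z. G z \<partial>lborel)"
proof -
  have "(\<integral>\<^sup>+z. G (z + of_real (a * Im z)) \<partial>lborel)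
      = (\<integral>\<^sup>+y. \<integral>\<^sup>+x. G (Complex (x + a * y) y) \<partial>lborel \<partial>lborel)"
  proof -
    have "(\<lambda>z. G (z + of_real (a * Im z))) \<in> borel_measurable borel"
      by measurable
    from nn_integral_lborel_complex'[OF this] show ?thesis
      by (simp add: complex_of_real_def plus_complex.code)
  qed
  also have "\<dots> = (\<integral>\<^sup>+y. \<integral>\<^sup>+x. G (Complex x y) \<partial>lborel \<partial>lborel)"
    by (intro nn_integral_cong nn_integral_translate[where G = "\<lambda>x. G (Complex x _)"])
       (auto simp: Complex_eq)
  finally show ?thesis
    by (simp add: nn_integral_lborel_complex')
qed

lemma nn_integral_lborel_shear_Im:
  assumes [measurable]: "G \<in> borel_measurable borel"
  shows "(\<integral>\<^sup>+z. G (z + \<i> * of_real (a * Re z)) \<partial>lborel) = (\<integral>\<^sup>+z. G z \<partial>lborel)"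
proof -
  have "(\<integral>\<^sup>+z. G (z + \<i> * of_real (a * Re z)) \<partial>lborel)
      = (\<integral>\<^sup>+x. \<integral>\<^sup>+y. G (Complex x (y + a * x)) \<partial>lborel \<partial>lborel)"
  proof -
    have "(\<lambda>z. G (z + \<i> * of_real (a * Re z))) \<in> borel_measurable borel"
      by measurable
    moreover have "Complex x y + \<i> * of_real (a * Re (Complex x y)) = Complex x (y + a * x)" for x y
      by (simp add: complex_eq_iff)
    ultimately show ?thesis
      using nn_integral_lborel_complex by simp
  qed
  also have "\<dots> = (\<integral>\<^sup>+x. \<integral>\<^sup>+y. G (Complex x y) \<partial>lborel \<partial>lborel)"
    by (intro nn_integral_cong nn_integral_translate[where G = "\<lambda>y. G (Complex _ y)"])
       (auto simp: Complex_eq)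
  finally show ?thesis
    by (simp add: nn_integral_lborel_complex)
qed

text \<open>A rotation with non-zero sine is a product of three shears.\<close>
lemma nn_integral_lborel_rotate:
  assumes G [measurable]: "G \<in> borel_measurable borel" and t: "sin t \<noteq> 0"
  shows "(\<integral>\<^sup>+z. G (cis t * z) \<partial>lborel) = (\<integral>\<^sup>+z. G z \<partial>lborel)"
proof -
  \<comment> \<open>This is \<open>- tan (t / 2)\<close>. The outer shears \<open>S\<close> carry it
    and the middle shear \<open>R\<close> carries \<open>sin t\<close>; the identities below are
    matrix entries of \<open>S R S\<close>.\<close>
  define a where "a = (cos t - 1) / sin t"
  define S where "S = (\<lambda>z. z + of_real (a * Im z))"
  define R where "R = (\<lambda>z. z + \<i> * of_real (sin t * Re z))"
  have Sz: "S z = z + of_real (a * Im z)" and Rz: "R z = z + \<i> * of_real (sin t * Re z)" for z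
    by (simp_all add: S_def R_def)
  have as: "a * sin t = cos t - 1"
    using t by (simp add: a_def)
  have "1 + a * sin t = cos t"
    using as by simp
  moreover have "a * (1 + sin t * a) + a = - sin t"
  proof -
    have "sin t * (a * (1 + sin t * a) + a) = (a * sin t) * (2 + a * sin t)"
      by (simp add: algebra_simps)
    also have "\<dots> = (cos t)\<^sup>2 - 1"
      unfolding as by (simp add: algebra_simps power2_eq_square)
    also have "\<dots> = sin t * (- sin t)"
      using sin_squared_eq[of t] by (simp add: power2_eq_square)
    finally show ?thesis using t by (simp only: mult_cancel_left) auto
  qed
  ultimately have c: "1 + a * sin t = cos t" and s: "a * (1 + sin t * a) + a = - sin t"
    by simp_all
  have *: "cis t * z = S (R (S z))" for z
  proof (rule complex_eqI)
    have "Re (S (R (S z))) = (1 + a * sin t) * Re z + (a * (1 + sin t * a) + a) * Im z"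
      by (simp add: S_def R_def algebra_simps)
    also have "\<dots> = cos t * Re z - sin t * Im z"
      unfolding c s by simp
    finally show "Re (cis t * z) = Re (S (R (S z)))"
      by simp
    have "Im (S (R (S z))) = sin t * Re z + (1 + a * sin t) * Im z"
      by (simp add: S_def R_def algebra_simps)
    then show "Im (cis t * z) = Im (S (R (S z)))"
      using c by simp
  qed
  have S [measurable]: "S \<in> borel \<rightarrow>\<^sub>M borel" and R [measurable]: "R \<in> borel \<rightarrow>\<^sub>M borel"
    unfolding S_def R_def by (auto intro!: borel_measurable_continuous_onI continuous_intros)
  have 1: "(\<lambda>z. G (S z)) \<in> borel_measurable borel" "(\<lambda>z. G (S (R z))) \<in> borel_measurable borel"
    by (auto intro!: measurable_compose[OF S] measurable_compose[OF R] G)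
  have "(\<integral>\<^sup>+z. G (cis t * z) \<partial>lborel) = (\<integral>\<^sup>+z. G (S (R (S z))) \<partial>lborel)"
    by (simp add: *)
  also have "\<dots> = (\<integral>\<^sup>+z. G (S (R z)) \<partial>lborel)"
    using nn_integral_lborel_shear_Re[OF 1(2), of a] unfolding Sz[symmetric] .
  also have "\<dots> = (\<integral>\<^sup>+z. G (S z) \<partial>lborel)"
    using nn_integral_lborel_shear_Im[OF 1(1), of "sin t"] unfolding Rz[symmetric] .
  also have "\<dots> = (\<integral>\<^sup>+z. G z \<partial>lborel)"
    using nn_integral_lborel_shear_Re[OF G, of a] unfolding Sz[symmetric] .
  finally show ?thesis .
qed


section \<open>Fourier series on the unit circle, parametrised by \<open>{0..1}\<close> so that arc
  length is normalised\<close>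

definition circ :: "real \<Rightarrow> complex" where "circ t = cis (2 * pi * t)"

lemma norm_circ [simp]: "cmod (circ t) = 1"
  by (simp add: circ_def)

lemma continuous_on_circ [continuous_intros]: "continuous_on S circ"
  unfolding circ_def by (intro continuous_intros)

lemma measurable_circ [measurable]: "circ \<in> borel_measurable borel"
  by (intro borel_measurable_continuous_onI continuous_intros)

lemma circ_mult_cnj [simp]: "circ t * cnj (circ t) = 1" "cnj (circ t) * circ t = 1"
  by (simp_all add: complex_norm_square[symmetric] mult.commute)

lemma circ_orthogonal:
  "((\<lambda>t. circ t ^ m * cnj (circ t) ^ l) has_integral (if m = l then 1 else 0)) {0..1}"
proof (cases "m = l")
  case True
  then have "circ t ^ m * cnj (circ t) ^ l = 1" for t
    by (simp flip: power_mult_distrib)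
  then show ?thesis using True has_integral_const_real[of "1::complex" 0 1] by simp
next
  case False
  define k where "k = 2 * pi * (real m - real l)"
  have k: "k \<noteq> 0" using False by (simp add: k_def)
  have eq: "circ t ^ m * cnj (circ t) ^ l = exp (\<i> * of_real k * of_real t)" for t
  proof -
    have p: "circ t ^ n = cis (real n * (2 * pi * t))" for n
      unfolding circ_def by (simp add: Complex.DeMoivre)
    have "circ t ^ m * cnj (circ t) ^ l = cis (real m * (2 * pi * t)) * cis (- (real l * (2 * pi * t)))"
      unfolding complex_cnj_power[symmetric] p cis_cnj ..
    also have "\<dots> = cis (k * t)"
      by (simp only: cis_mult) (simp add: k_def algebra_simps)
    also have "\<dots> = exp (\<i> * of_real k * of_real t)"
      by (simp add: cis_conv_exp mult.assoc)
    finally show ?thesis .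
  qed
  have "((\<lambda>t. exp (\<i> * of_real k * of_real t)) has_integral
      (exp (\<i> * of_real k * of_real 1) / (\<i> * of_real k) - exp (\<i> * of_real k * of_real 0) / (\<i> * of_real k))) {0..1}"
    by (rule fundamental_theorem_of_calculus)
       (use k in \<open>auto intro!: derivative_eq_intros has_vector_derivative_real_field simp: field_simps\<close>)
  moreover have "exp (\<i> * of_real k * of_real 1) = (1 :: complex)"
  proof -
    have "exp (\<i> * of_real k) = cis (2 * pi * of_int (int m - int l))"
      by (simp add: cis_conv_exp k_def mult.commute)
    then show ?thesis by (simp only: cis_multiple_2pi[OF Ints_of_int] of_real_1 mult_1_right)
  qed
  ultimately show ?thesis using False by (simp add: eq)
qed

text \<open>Absolute summability makes the series converge uniformly in \<open>t\<close>, so it may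
  be integrated term by term against a continuous factor.\<close>

lemma circ_series_integral:
  assumes a: "summable (\<lambda>m. cmod (a m))" and g: "continuous_on {0..1} g"
  shows "(\<lambda>m. a m * integral {0..1} (\<lambda>t. circ t ^ m * g t)) sums
           integral {0..1} (\<lambda>t. (\<Sum>m. a m * circ t ^ m) * g t)"
    and "(\<lambda>t. (\<Sum>m. a m * circ t ^ m) * g t) integrable_on {0..1}"
    and "continuous_on {0..1} (\<lambda>t. \<Sum>m. a m * circ t ^ m)"
proof -
  obtain C where C: "\<And>t. t \<in> {0..1} \<Longrightarrow> cmod (g t) \<le> C"
    using compact_imp_bounded[OF compact_continuous_image[OF g compact_Icc]]
    by (meson bounded_iff imageI)
  have s: "summable (\<lambda>m. a m * circ t ^ m)" for t
    by (rule summable_norm_cancel) (simp add: norm_mult norm_power a)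
  have lim: "(\<lambda>n. \<Sum>m<n. a m * circ t ^ m * g t) \<longlonglongrightarrow> (\<Sum>m. a m * circ t ^ m) * g t" for t
    using summable_LIMSEQ[OF summable_mult2[OF s, of t "g t"]] suminf_mult2[OF s, of t "g t"] by simp
  have u: "uniform_limit {0..1} (\<lambda>n t. \<Sum>m<n. a m * circ t ^ m * g t)
      (\<lambda>t. (\<Sum>m. a m * circ t ^ m * g t)) sequentially"
    by (rule Weierstrass_m_test[where M = "\<lambda>m. cmod (a m) * C"])
       (auto simp: norm_mult norm_power intro!: mult_left_mono C summable_mult2 a)
  have u': "uniform_limit {0..1} (\<lambda>n t. \<Sum>m<n. a m * circ t ^ m * g t)
      (\<lambda>t. (\<Sum>m. a m * circ t ^ m) * g t) sequentially"
    using u suminf_mult2[OF s, symmetric] by simp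
  show "continuous_on {0..1} (\<lambda>t. \<Sum>m. a m * circ t ^ m)"
  proof (rule uniform_limit_theorem)
    show "uniform_limit {0..1} (\<lambda>n t. \<Sum>m<n. a m * circ t ^ m) (\<lambda>t. \<Sum>m. a m * circ t ^ m) sequentially"
      by (rule Weierstrass_m_test[where M = "\<lambda>m. cmod (a m)"])
         (auto simp: norm_mult norm_power intro!: a)
  qed (auto intro!: always_eventually continuous_intros)
  obtain I J where I: "\<And>n. ((\<lambda>t. \<Sum>m<n. a m * circ t ^ m * g t) has_integral I n) {0..1}"
    and J: "((\<lambda>t. (\<Sum>m. a m * circ t ^ m) * g t) has_integral J) {0..1}" and IJ: "I \<longlonglongrightarrow> J"
    by (rule uniform_limit_integral[OF u']) (auto intro!: continuous_intros g)
  show "(\<lambda>t. (\<Sum>m. a m * circ t ^ m) * g t) integrable_on {0..1}"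
    using J by blast
  have "I n = (\<Sum>m<n. a m * integral {0..1} (\<lambda>t. circ t ^ m * g t))" for n
  proof -
    have int: "(\<lambda>t. circ t ^ m * g t) integrable_on {0..1}" for m
      by (intro integrable_continuous_real continuous_intros g)
    have "I n = integral {0..1} (\<lambda>t. \<Sum>m<n. a m * (circ t ^ m * g t))"
      using I[of n] by (simp add: integral_unique mult.assoc)
    also have "\<dots> = (\<Sum>m<n. a m * integral {0..1} (\<lambda>t. circ t ^ m * g t))"
      by (subst integral_sum) (auto intro!: integrable_on_mult_right int)
    finally show ?thesis .
  qed
  then have "I = (\<lambda>n. \<Sum>m<n. a m * integral {0..1} (\<lambda>t. circ t ^ m * g t))"
    by blast
  then show "(\<lambda>m. a m * integral {0..1} (\<lambda>t. circ t ^ m * g t)) sums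
           integral {0..1} (\<lambda>t. (\<Sum>m. a m * circ t ^ m) * g t)"
    using IJ integral_unique[OF J] by (simp only: sums_def)
qed

lemma circ_coeff:
  assumes a: "summable (\<lambda>m. cmod (a m))"
  shows "integral {0..1} (\<lambda>t. (\<Sum>m. a m * circ t ^ m) * cnj (circ t) ^ l) = a l"
proof -
  have "(\<lambda>m. a m * (if m = l then 1 else 0)) sums integral {0..1} (\<lambda>t. (\<Sum>m. a m * circ t ^ m) * cnj (circ t) ^ l)"
    using circ_series_integral(1)[OF a, of "\<lambda>t. cnj (circ t) ^ l"]
    by (simp add: integral_unique[OF circ_orthogonal] continuous_on_cnj continuous_on_power continuous_on_circ)
  moreover have "(\<lambda>m. a m * (if m = l then 1 else 0)) sums a l"
    using sums_single[of l a] by (simp add: if_distrib cong: if_cong)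
  ultimately show ?thesis by (rule sums_unique2)
qed

text \<open>An analytic boundary function has no Fourier coefficients of negative index; for
  \<open>l = 0\<close> this says that \<open>z F(z)\<close> has mean zero on the circle.\<close>

lemma circ_coeff_neg:
  assumes a: "summable (\<lambda>m. cmod (a m))"
  shows "integral {0..1} (\<lambda>t. (\<Sum>m. a m * circ t ^ m) * circ t ^ Suc l) = 0"
proof -
  have "integral {0..1} (\<lambda>t. circ t ^ m * circ t ^ Suc l) = 0" for m
    using integral_unique[OF circ_orthogonal[of "m + Suc l" 0]] by (simp only: power_add) simp
  then have "(\<lambda>m. a m * 0) sums integral {0..1} (\<lambda>t. (\<Sum>m. a m * circ t ^ m) * circ t ^ Suc l)"
    using circ_series_integral(1)[OF a, of "\<lambda>t. circ t ^ Suc l"] by (simp del: power_Suc add: continuous_on_power continuous_on_circ)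
  then show ?thesis by (simp add: sums_unique2 sums_0)
qed

text \<open>The series is integrated against its own conjugate, whose moments are the conjugated
  coefficients.\<close>

lemma circ_parseval:
  assumes a: "summable (\<lambda>m. cmod (a m))"
  shows "((\<lambda>t. (cmod (\<Sum>m. a m * circ t ^ m))\<^sup>2) has_integral (\<Sum>m. (cmod (a m))\<^sup>2)) {0..1}"
    and "summable (\<lambda>m. (cmod (a m))\<^sup>2)"
proof -
  define F where "F = (\<lambda>t. \<Sum>m. a m * circ t ^ m)"
  have F: "continuous_on {0..1} F"
    unfolding F_def by (rule circ_series_integral(3)[OF a, of "\<lambda>_. 0"]) simp
  have "integral {0..1} (\<lambda>t. circ t ^ m * cnj (F t)) = cnj (a m)" for m
  proof -
    have "integral {0..1} (\<lambda>t. circ t ^ m * cnj (F t)) = integral {0..1} (\<lambda>t. cnj (F t * cnj (circ t) ^ m))"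
      by (simp add: mult.commute)
    also have "\<dots> = cnj (a m)"
      using arg_cong[OF circ_coeff[OF a, of m], of cnj] by (simp only: F_def integral_cnj)
    finally show ?thesis .
  qed
  then have s: "(\<lambda>m. a m * cnj (a m)) sums integral {0..1} (\<lambda>t. F t * cnj (F t))"
    using circ_series_integral(1)[OF a, of "\<lambda>t. cnj (F t)"] F by (simp add: F_def continuous_on_cnj)
  have "((\<lambda>t. F t * cnj (F t)) has_integral integral {0..1} (\<lambda>t. F t * cnj (F t))) {0..1}"
    by (intro integrable_integral integrable_continuous_real continuous_intros F)
  then have "((\<lambda>t. Re (F t * cnj (F t))) has_integral Re (integral {0..1} (\<lambda>t. F t * cnj (F t)))) {0..1}"
    by (rule has_integral_Re)
  moreover have s': "(\<lambda>m. (cmod (a m))\<^sup>2) sums Re (integral {0..1} (\<lambda>t. F t * cnj (F t)))"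
    using sums_Re[OF s] by (simp add: complex_norm_square[symmetric])
  ultimately show "((\<lambda>t. (cmod (\<Sum>m. a m * circ t ^ m))\<^sup>2) has_integral (\<Sum>m. (cmod (a m))\<^sup>2)) {0..1}"
    unfolding F_def complex_norm_square[symmetric] Re_complex_of_real of_real_power[symmetric]
    by (simp add: sums_iff)
  show "summable (\<lambda>m. (cmod (a m))\<^sup>2)"
    using s' by (rule sums_summable)
qed

text \<open>The disc of radius \<open>sqrt x\<close> has normalised area \<open>x\<close>, so
  \<open>|z|\<^sup>2\<close> is uniformly distributed. This turns radial area integrals into beta
  integrals.\<close>

lemma distr_norm_sq_dA:
  "distr (density dA (indicator (ball 0 1))) borel (\<lambda>z. (cmod z)\<^sup>2) = density lborel (indicator {0..1})"
proof (rule measure_eqI_lessThan)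
  let ?M = "distr (density dA (indicator (ball 0 1))) borel (\<lambda>z. (cmod z)\<^sup>2)"
  have [measurable]: "(\<lambda>z::complex. (cmod z)\<^sup>2) \<in> borel_measurable borel" by measurable
  have ball: "emeasure dA (ball 0 r) = ennreal (r\<^sup>2)" if "0 \<le> r" for r
    using that unfolding dA_def
    by (subst emeasure_density)
       (auto simp: nn_integral_cmult_indicator emeasure_ball unit_ball_vol_2 ennreal_mult[symmetric])
  have cball: "emeasure dA (cball 0 r) = ennreal (r\<^sup>2)" if "0 \<le> r" for r
    using that unfolding dA_def
    by (subst emeasure_density)
       (auto simp: nn_integral_cmult_indicator emeasure_cball unit_ball_vol_2 ennreal_mult[symmetric])
  have sd [simp]: "sets dA = sets borel" "space dA = UNIV"
    by (auto simp: dA_def)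
  have md: "measurable dA N = measurable borel N" for N :: "'x measure"
    by (rule measurable_cong_sets) auto
  have M: "emeasure ?M {x<..} = emeasure dA (ball 0 1 \<inter> {z. x < (cmod z)\<^sup>2})" for x
  proof -
    have S: "{z::complex. x < (cmod z)\<^sup>2} \<in> sets dA" "ball (0::complex) 1 \<in> sets dA"
      by (auto intro!: borel_open open_Collect_less continuous_intros)
    have "emeasure ?M {x<..} = emeasure (density dA (indicator (ball 0 1))) {z. x < (cmod z)\<^sup>2}"
      by (subst emeasure_distr) (auto simp: md vimage_def)
    also have "\<dots> = (\<integral>\<^sup>+z. indicator (ball 0 1 \<inter> {z. x < (cmod z)\<^sup>2}) z \<partial>dA)"
      using S by (subst emeasure_density[OF borel_measurable_indicator[OF S(2)] S(1)])
        (intro nn_integral_cong, simp only: indicator_inter_arith)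
    also have "\<dots> = emeasure dA (ball 0 1 \<inter> {z. x < (cmod z)\<^sup>2})"
      using S by (subst nn_integral_indicator) auto
    finally show ?thesis .
  qed
  show "emeasure ?M {x<..} < \<infinity>" for x
  proof -
    have "emeasure ?M {x<..} \<le> emeasure dA (ball 0 1)"
      unfolding M by (intro emeasure_mono) auto
    then show ?thesis using ball[of 1] by (auto simp: order_le_less_trans)
  qed
  show "emeasure ?M {x<..} = emeasure (density lborel (indicator {0..1})) {x<..}" for x
  proof -
    have R: "emeasure (density lborel (indicator {0..1})) {x<..} = emeasure lborel ({0..1} \<inter> {x<..})"
      by (subst emeasure_density) (auto simp: indicator_inter_arith[symmetric])
    consider "x < 0" | "0 \<le> x" "x \<le> 1" | "1 < x" by linarith
    then show ?thesis
    proof cases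
      case 1
      have "ball (0::complex) 1 \<inter> {z. x < (cmod z)\<^sup>2} = ball 0 1"
        using 1 by (auto intro: less_le_trans)
      moreover have "{0..1} \<inter> {x<..} = {0..1}" using 1 by auto
      ultimately show ?thesis unfolding M R using ball[of 1] by simp
    next
      case 2
      have "ball (0::complex) 1 \<inter> {z. x < (cmod z)\<^sup>2} = ball 0 1 - cball 0 (sqrt x)"
        using 2 by (auto simp: not_le real_less_lsqrt real_less_rsqrt)
          (metis real_le_rsqrt not_le real_less_lsqrt real_less_rsqrt real_sqrt_less_iff real_sqrt_pow2 real_sqrt_unique norm_ge_zero)+
      moreover have "emeasure dA (ball 0 1 - cball 0 (sqrt x)) = ennreal 1 - ennreal x"
      proof (cases "x < 1")
        case True
        then have "sqrt x < 1" by simp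
        then have "cball (0::complex) (sqrt x) \<subseteq> ball 0 1" by (auto intro: le_less_trans simp del: real_sqrt_lt_1_iff)
        then show ?thesis
          using ball[of 1] cball[of "sqrt x"] 2 by (subst emeasure_Diff) auto
      next
        case False
        then have "x = 1" using 2 by simp
        then have "ball (0::complex) 1 - cball 0 (sqrt x) = {}" by auto
        then show ?thesis by (simp only:) (simp add: \<open>x = 1\<close>)
      qed
      moreover have "{0..1} \<inter> {x<..} = {x<..1}" using 2 by auto
      ultimately show ?thesis unfolding M R using 2 by (simp flip: ennreal_minus)
    next
      case 3
      have "\<not> x < (cmod z)\<^sup>2" if "cmod z < 1" for z :: complex
        using that 3 power_le_one[of "cmod z" 2] by simp
      then have "ball (0::complex) 1 \<inter> {z. x < (cmod z)\<^sup>2} = {}"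
        by auto
      moreover have "{0..1} \<inter> {x<..} = {}" using 3 by auto
      ultimately show ?thesis unfolding M R by simp
    qed
  qed
qed auto


lemma nn_integral_dA:
  "f \<in> borel_measurable borel \<Longrightarrow> (\<integral>\<^sup>+z. f z \<partial>dA) = ennreal (1 / pi) * (\<integral>\<^sup>+z. f z \<partial>lborel)"
  unfolding dA_def by (subst nn_integral_density) (auto simp: nn_integral_cmult)

lemma sets_dA [simp, measurable_cong]: "sets dA = sets borel"
  and space_dA [simp]: "space dA = UNIV"
  by (simp_all add: dA_def)

lemma nn_integral_dA_rotate_average:
  assumes [measurable]: "G \<in> borel_measurable borel"
  shows "(\<integral>\<^sup>+z. G z \<partial>dA) = (\<integral>\<^sup>+z. (\<integral>\<^sup>+t. G (circ t * z) * indicator {0..1} t \<partial>lborel) \<partial>dA)"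
proof -
  have rot: "(\<integral>\<^sup>+z. G (circ t * z) \<partial>lborel) = (\<integral>\<^sup>+z. G z \<partial>lborel)" if "t \<in> {0..1}" "t \<noteq> 0" "t \<noteq> 1/2" "t \<noteq> 1" for t
  proof -
    have "sin (2 * pi * t) \<noteq> 0"
    proof
      assume "sin (2 * pi * t) = 0"
      then obtain i :: int where "2 * pi * t = of_int i * pi"
        by (auto simp: sin_zero_iff_int2)
      then have "2 * t = of_int i" by simp
      moreover have "0 < 2 * t" "2 * t < 2" using that by auto
      ultimately have "i = 1" by linarith
      then show False using \<open>2 * t = of_int i\<close> that by simp
    qed
    then show ?thesis
      unfolding circ_def by (intro nn_integral_lborel_rotate) auto
  qed
  have "(\<integral>\<^sup>+z. G z \<partial>lborel) = (\<integral>\<^sup>+t. (\<integral>\<^sup>+z. G z \<partial>lborel) * indicator {0..1::real} t \<partial>lborel)"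
    by (simp add: nn_integral_cmult_indicator)
  also have "\<dots> = (\<integral>\<^sup>+t. (\<integral>\<^sup>+z. G (circ t * z) \<partial>lborel) * indicator {0..1} t \<partial>lborel)"
  proof (rule nn_integral_cong_AE)
    have "AE t in lborel. t \<notin> {0, 1/2, 1::real}"
      by (rule AE_not_in) (auto intro!: finite_imp_null_set_lborel)
    then show "AE t in lborel. (\<integral>\<^sup>+z. G z \<partial>lborel) * indicator {0..1::real} t
        = (\<integral>\<^sup>+z. G (circ t * z) \<partial>lborel) * indicator {0..1} t"
      by eventually_elim (use rot in \<open>auto simp: indicator_def\<close>)
  qed
  also have "\<dots> = (\<integral>\<^sup>+t. (\<integral>\<^sup>+z. G (circ t * z) * indicator {0..1} t \<partial>lborel) \<partial>lborel)"
    by (simp add: nn_integral_multc)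
  also have "\<dots> = (\<integral>\<^sup>+z. (\<integral>\<^sup>+t. G (circ t * z) * indicator {0..1} t \<partial>lborel) \<partial>lborel)"
    by (rule lborel_pair.Fubini') measurable
  finally show ?thesis
    by (simp add: nn_integral_dA)
qed

lemma taylor_sums:
  assumes "F holomorphic_on ball 0 1" "cmod z < 1"
  shows "(\<lambda>m. taylor_coeff F m * z ^ m) sums F z"
  using holomorphic_power_series[OF assms(1), of z] assms(2) by (simp add: taylor_coeff_def)

lemma taylor_abs_summable:
  assumes "F holomorphic_on ball 0 1" "cmod z < 1"
  shows "summable (\<lambda>m. cmod (taylor_coeff F m * z ^ m))"
proof -
  define r where "r = (1 + cmod z) / 2"
  have r: "cmod z < r" "r < 1" "0 \<le> r" using assms(2) by (auto simp: r_def add_nonneg_nonneg)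
  have "summable (\<lambda>m. taylor_coeff F m * of_real r ^ m)"
    using taylor_sums[OF assms(1), of "of_real r"] r by (auto simp: sums_iff)
  then show ?thesis
    by (rule powser_insidea) (use r in auto)
qed

lemma nn_integral_circle_norm_sq:
  assumes "F holomorphic_on ball 0 1" "cmod z < 1"
  shows "(\<integral>\<^sup>+t. ennreal ((cmod (F (circ t * z)))\<^sup>2) * indicator {0..1} t \<partial>lborel)
      = (\<Sum>m. ennreal ((cmod (taylor_coeff F m))\<^sup>2) * ennreal (((cmod z)\<^sup>2) ^ m))"
proof -
  define a where "a = (\<lambda>m. taylor_coeff F m * z ^ m)"
  have sa: "summable (\<lambda>m. cmod (a m))"
    unfolding a_def by (rule taylor_abs_summable[OF assms])
  have Fa: "F (circ t * z) = (\<Sum>m. a m * circ t ^ m)" for t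
    using taylor_sums[OF assms(1), of "circ t * z"] assms(2)
    by (simp add: a_def sums_iff norm_mult power_mult_distrib mult_ac)
  have "(\<integral>\<^sup>+t. ennreal ((cmod (F (circ t * z)))\<^sup>2) * indicator {0..1} t \<partial>lborel)
      = (\<integral>\<^sup>+t. ennreal (indicator {0..1} t * (cmod (F (circ t * z)))\<^sup>2) \<partial>lborel)"
    by (intro nn_integral_cong) (simp split: split_indicator)
  also have "\<dots> = ennreal (\<Sum>m. (cmod (a m))\<^sup>2)"
    using circ_parseval(1)[OF sa]
    by (intro nn_integral_has_integral_lebesgue) (auto simp: Fa)
  also have "\<dots> = (\<Sum>m. ennreal ((cmod (a m))\<^sup>2))"
    using circ_parseval(2)[OF sa] by (intro suminf_ennreal2[symmetric]) auto
  also have "\<dots> = (\<Sum>m. ennreal ((cmod (taylor_coeff F m))\<^sup>2) * ennreal (((cmod z)\<^sup>2) ^ m))"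
    by (simp add: a_def norm_mult norm_power power_mult_distrib ennreal_mult power_mult[symmetric] mult.commute)
  finally show ?thesis .
qed

text \<open>Averaging over rotations replaces \<open>|F|\<^sup>2\<close> by its mean on each circle,
  which Parseval turns into a power series in \<open>|z|\<^sup>2\<close>. What remains is radial and
  is pushed forward to \<open>{0..1}\<close>.\<close>

lemma nn_integral_dA_norm_sq:
  assumes F: "F holomorphic_on ball 0 1" and [measurable]: "\<psi> \<in> borel_measurable borel"
  shows "(\<integral>\<^sup>+z\<in>ball 0 1. ennreal ((cmod (F z))\<^sup>2) * \<psi> ((cmod z)\<^sup>2) \<partial>dA)
      = (\<Sum>m. ennreal ((cmod (taylor_coeff F m))\<^sup>2) * (\<integral>\<^sup>+t\<in>{0..1}. ennreal (t ^ m) * \<psi> t \<partial>lborel))"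
proof -
  \<comment> \<open>The values of \<open>F\<close> outside the disc are arbitrary, so it is cut off
    there to obtain a Borel function on the plane.\<close>
  define F' where "F' = (\<lambda>z. indicator (ball 0 1) z *\<^sub>R F z)"
  have F' [measurable]: "F' \<in> borel_measurable borel"
    unfolding F'_def using F
    by (intro borel_measurable_continuous_on_indicator holomorphic_on_imp_continuous_on) auto
  define G where "G = (\<lambda>z. ennreal ((cmod (F' z))\<^sup>2) * \<psi> ((cmod z)\<^sup>2) * indicator (ball 0 1) z)"
  have ind [measurable]: "indicator (ball 0 1) \<in> borel_measurable (borel :: complex measure)"
    by (intro borel_measurable_indicator) auto
  have [measurable]: "G \<in> borel_measurable borel"
    unfolding G_def by measurable
  have "(\<integral>\<^sup>+z\<in>ball 0 1. ennreal ((cmod (F z))\<^sup>2) * \<psi> ((cmod z)\<^sup>2) \<partial>dA) = (\<integral>\<^sup>+z. G z \<partial>dA)"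
    by (intro nn_integral_cong) (auto simp: G_def F'_def indicator_def)
  also have "\<dots> = (\<integral>\<^sup>+z. (\<integral>\<^sup>+t. G (circ t * z) * indicator {0..1} t \<partial>lborel) \<partial>dA)"
    by (rule nn_integral_dA_rotate_average) measurable
  also have "\<dots> = (\<integral>\<^sup>+z. (\<Sum>m. ennreal ((cmod (taylor_coeff F m))\<^sup>2) *
      (ennreal (((cmod z)\<^sup>2) ^ m) * \<psi> ((cmod z)\<^sup>2))) * indicator (ball 0 1) z \<partial>dA)"
  proof (intro nn_integral_cong)
    fix z :: complex
    show "(\<integral>\<^sup>+t. G (circ t * z) * indicator {0..1} t \<partial>lborel) = (\<Sum>m. ennreal ((cmod (taylor_coeff F m))\<^sup>2) *
      (ennreal (((cmod z)\<^sup>2) ^ m) * \<psi> ((cmod z)\<^sup>2))) * indicator (ball 0 1) z"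
    proof (cases "cmod z < 1")
      case True
      have "(\<integral>\<^sup>+t. G (circ t * z) * indicator {0..1} t \<partial>lborel)
          = (\<integral>\<^sup>+t. (ennreal ((cmod (F' (circ t * z)))\<^sup>2) * indicator {0..1} t) * \<psi> ((cmod z)\<^sup>2) \<partial>lborel)"
        using True by (intro nn_integral_cong) (auto simp: G_def norm_mult mult_ac)
      also have "\<dots> = (\<integral>\<^sup>+t. ennreal ((cmod (F' (circ t * z)))\<^sup>2) * indicator {0..1} t \<partial>lborel) * \<psi> ((cmod z)\<^sup>2)"
        by (rule nn_integral_multc) measurable
      also have "(\<integral>\<^sup>+t. ennreal ((cmod (F' (circ t * z)))\<^sup>2) * indicator {0..1} t \<partial>lborel)
          = (\<integral>\<^sup>+t. ennreal ((cmod (F (circ t * z)))\<^sup>2) * indicator {0..1} t \<partial>lborel)"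
        using True by (intro nn_integral_cong) (auto simp: F'_def norm_mult)
      also have "\<dots> = (\<Sum>m. ennreal ((cmod (taylor_coeff F m))\<^sup>2) * ennreal (((cmod z)\<^sup>2) ^ m))"
        by (rule nn_integral_circle_norm_sq[OF F True])
      finally show ?thesis using True
        by (simp add: mult.assoc flip: ennreal_suminf_multc)
    next
      case False
      then show ?thesis by (simp add: G_def norm_mult)
    qed
  qed
  also have "\<dots> = (\<integral>\<^sup>+z. (\<Sum>m. ennreal ((cmod (taylor_coeff F m))\<^sup>2) *
      (ennreal (((cmod z)\<^sup>2) ^ m) * \<psi> ((cmod z)\<^sup>2))) \<partial>density dA (indicator (ball 0 1)))"
    by (subst nn_integral_density) (auto simp: mult.commute)
  also have "\<dots> = (\<integral>\<^sup>+t. (\<Sum>m. ennreal ((cmod (taylor_coeff F m))\<^sup>2) * (ennreal (t ^ m) * \<psi> t))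
      \<partial>distr (density dA (indicator (ball 0 1))) borel (\<lambda>z. (cmod z)\<^sup>2))"
    by (subst nn_integral_distr) auto
  also have "\<dots> = (\<integral>\<^sup>+t. (\<Sum>m. ennreal ((cmod (taylor_coeff F m))\<^sup>2) * (ennreal (t ^ m) * \<psi> t))
      \<partial>density lborel (indicator {0..1}))"
    by (simp only: distr_norm_sq_dA)
  also have "\<dots> = (\<Sum>m. \<integral>\<^sup>+t. ennreal ((cmod (taylor_coeff F m))\<^sup>2) * (ennreal (t ^ m) * \<psi> t)
      \<partial>density lborel (indicator {0..1}))"
    by (rule nn_integral_suminf) measurable
  also have "\<dots> = (\<Sum>m. ennreal ((cmod (taylor_coeff F m))\<^sup>2) * (\<integral>\<^sup>+t\<in>{0..1}. ennreal (t ^ m) * \<psi> t \<partial>lborel))"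
    by (intro suminf_cong) (simp add: nn_integral_density nn_integral_cmult[symmetric] mult_ac)
  finally show ?thesis .
qed

text \<open>The beta integral with parameters \<open>m + 1\<close> and 2. Together with the next
  one, with parameters \<open>m + 1\<close> and 3, it produces the weights in \<open>Dloc\<close>
  and \<open>D2loc\<close>.\<close>

lemma beta_integral_1: "(\<integral>\<^sup>+t\<in>{0..1}. ennreal (t ^ m) * ennreal (1 - t) \<partial>lborel) = ennreal (1 / (real (m + 1) * real (m + 2)))"
proof -
  have "(\<integral>\<^sup>+t\<in>{0..1}. ennreal (t ^ m) * ennreal (1 - t) \<partial>lborel)
      = (\<integral>\<^sup>+t. ennreal (t ^ m * (1 - t)) * indicator {0..1} t \<partial>lborel)"
    by (intro nn_integral_cong) (auto simp: ennreal_mult split: split_indicator)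
  also have "\<dots> = ennreal ((1 ^ Suc m / real (m + 1) - 1 ^ Suc (Suc m) / real (m + 2)) - (0 ^ Suc m / real (m + 1) - 0 ^ Suc (Suc m) / real (m + 2)))"
  proof (rule nn_integral_FTC_Icc)
    fix x :: real
    show "((\<lambda>t. t ^ Suc m / real (m + 1) - t ^ Suc (Suc m) / real (m + 2))
      has_real_derivative x ^ m * (1 - x)) (at x)"
      by (rule derivative_eq_intros refl | simp)+ (simp add: field_simps)
  qed auto
  also have "\<dots> = ennreal (1 / (real (m + 1) * real (m + 2)))"
    by (simp add: field_simps)
  finally show ?thesis .
qed

lemma beta_integral_2: "(\<integral>\<^sup>+t\<in>{0..1}. ennreal (t ^ m) * ennreal ((1 - t)\<^sup>2) \<partial>lborel)
   = ennreal (2 / (real (m + 1) * real (m + 2) * real (m + 3)))"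
proof -
  have "(\<integral>\<^sup>+t\<in>{0..1}. ennreal (t ^ m) * ennreal ((1 - t)\<^sup>2) \<partial>lborel)
      = (\<integral>\<^sup>+t. ennreal (t ^ m * (1 - t)\<^sup>2) * indicator {0..1} t \<partial>lborel)"
    by (intro nn_integral_cong) (auto simp: ennreal_mult split: split_indicator)
  also have "\<dots> = ennreal ((1 ^ Suc m / real (m + 1) - 2 * 1 ^ Suc (Suc m) / real (m + 2) + 1 ^ Suc (Suc (Suc m)) / real (m + 3))
      - (0 ^ Suc m / real (m + 1) - 2 * 0 ^ Suc (Suc m) / real (m + 2) + 0 ^ Suc (Suc (Suc m)) / real (m + 3)))"
  proof (rule nn_integral_FTC_Icc)
    fix x :: real
    show "((\<lambda>t. t ^ Suc m / real (m + 1) - 2 * t ^ Suc (Suc m) / real (m + 2) + t ^ Suc (Suc (Suc m)) / real (m + 3))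
      has_real_derivative x ^ m * (1 - x)\<^sup>2) (at x)"
      by (rule derivative_eq_intros refl | simp)+ (simp add: field_simps power2_eq_square)
  qed auto
  also have "\<dots> = ennreal (2 / (real (m + 1) * real (m + 2) * real (m + 3)))"
  proof -
    have "1 / (x + 1) - 2 / (x + 2) + 1 / (x + 3) = 2 / ((x + 1) * (x + 2) * (x + 3))" if "0 \<le> x" for x :: real
      using that by (simp add: divide_simps) (simp add: algebra_simps)
    from this[of "real m"] show ?thesis by (simp add: add.commute)
  qed
  finally show ?thesis .
qed


section \<open>Calculus of Taylor coefficients at the origin\<close>

lemma taylor_coeff_eqI:
  assumes "r > 0" "\<And>z. cmod z < r \<Longrightarrow> (\<lambda>m. a m * z ^ m) sums f z"
  shows "taylor_coeff f m = a m"
proof -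
  have "\<forall>\<^sub>F z in nhds 0. (\<lambda>m. fps_nth (Abs_fps a) m * z ^ m) sums f z"
    unfolding eventually_nhds_metric using assms by (auto simp: dist_norm intro!: exI[of _ r])
  then have "f has_fps_expansion Abs_fps a"
    by (rule has_fps_expansionI)
  then show ?thesis
    using fps_nth_fps_expansion[of f "Abs_fps a" m] by (simp add: taylor_coeff_def)
qed

lemma taylor_coeff_cong:
  assumes "f holomorphic_on ball 0 1" "\<And>z. cmod z < 1 \<Longrightarrow> g z = f z"
  shows "taylor_coeff g m = taylor_coeff f m"
  using taylor_sums[OF assms(1)] by (intro taylor_coeff_eqI[of 1]) (auto simp: assms(2))

lemma eq_on_disc_if_taylor_coeff_eq:
  assumes "f holomorphic_on ball 0 1" "g holomorphic_on ball 0 1"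
    and "\<And>m. taylor_coeff f m = taylor_coeff g m" and "cmod z < 1"
  shows "f z = g z"
  using taylor_sums[OF assms(1,4)] taylor_sums[OF assms(2,4)] assms(3) sums_unique2 by simp

lemma taylor_coeff_mult:
  assumes "f holomorphic_on ball 0 1" "g holomorphic_on ball 0 1"
  shows "taylor_coeff (\<lambda>z. f z * g z) n = (\<Sum>i\<le>n. taylor_coeff f i * taylor_coeff g (n - i))"
proof -
  have "(deriv ^^ n) (\<lambda>z. f z * g z) 0
      = (\<Sum>i=0..n. of_nat (n choose i) * (deriv ^^ i) f 0 * (deriv ^^ (n - i)) g 0)"
    using higher_deriv_mult[OF assms open_ball, of 0 n] by simp
  also have "\<dots> = fact n * (\<Sum>i\<le>n. taylor_coeff f i * taylor_coeff g (n - i))"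
    unfolding sum_distrib_left atLeast0AtMost
    by (intro sum.cong refl) (simp add: taylor_coeff_def binomial_fact)
  finally show ?thesis by (simp add: taylor_coeff_def)
qed

lemma taylor_coeff_add:
  "f holomorphic_on ball 0 1 \<Longrightarrow> g holomorphic_on ball 0 1 \<Longrightarrow>
    taylor_coeff (\<lambda>z. f z + g z) n = taylor_coeff f n + taylor_coeff g n"
  using higher_deriv_add[of f "ball 0 1" g 0 n] by (simp add: taylor_coeff_def add_divide_distrib)

lemma taylor_coeff_diff:
  "f holomorphic_on ball 0 1 \<Longrightarrow> g holomorphic_on ball 0 1 \<Longrightarrow>
    taylor_coeff (\<lambda>z. f z - g z) n = taylor_coeff f n - taylor_coeff g n"
  using higher_deriv_diff[of f "ball 0 1" g 0 n] by (simp add: taylor_coeff_def diff_divide_distrib)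

lemma taylor_coeff_cmult:
  "f holomorphic_on ball 0 1 \<Longrightarrow> taylor_coeff (\<lambda>z. c * f z) n = c * taylor_coeff f n"
  using taylor_sums by (intro taylor_coeff_eqI[of 1]) (auto intro!: sums_mult simp: mult.assoc)

lemma taylor_coeff_z_mult:
  assumes "f holomorphic_on ball 0 1"
  shows "taylor_coeff (\<lambda>z. z * f z) n = (case n of 0 \<Rightarrow> 0 | Suc m \<Rightarrow> taylor_coeff f m)"
proof (rule taylor_coeff_eqI[of 1])
  fix z :: complex assume "cmod z < 1"
  then have "(\<lambda>m. z * (taylor_coeff f m * z ^ m)) sums (z * f z)"
    by (intro sums_mult taylor_sums assms)
  then have "(\<lambda>m. (case Suc m of 0 \<Rightarrow> 0 | Suc m \<Rightarrow> taylor_coeff f m) * z ^ Suc m) sums (z * f z)"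
    by (simp add: mult_ac)
  then show "(\<lambda>m. (case m of 0 \<Rightarrow> 0 | Suc m \<Rightarrow> taylor_coeff f m) * z ^ m) sums (z * f z)"
    by (subst (asm) sums_Suc_iff) simp
qed simp

lemma taylor_coeff_const: "taylor_coeff (\<lambda>z. c) n = (if n = 0 then c else 0)"
  by (rule taylor_coeff_eqI[of 1]) (use sums_If_finite_set[of "{0}" "\<lambda>_. c"] in \<open>auto simp: if_distrib if_distribR cong: if_cong\<close>)

lemma taylor_coeff_higher_deriv:
  "taylor_coeff ((deriv ^^ j) f) n = (fact (n + j) / fact n) * taylor_coeff f (n + j)"
  by (simp add: taylor_coeff_def funpow_add[symmetric, unfolded o_def, THEN fun_cong] flip: funpow_add[THEN fun_cong, unfolded o_def])

text \<open>Multiplication by a geometric series turns coefficients into weighted partial sums; this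
  is the source of the partial sums in \<open>Dloc\<close> and \<open>D2loc\<close>.\<close>

lemma taylor_coeff_div_linear:
  assumes "f holomorphic_on ball 0 1" "cmod c = 1"
  shows "taylor_coeff (\<lambda>z. f z / (1 - c * z)) n = (\<Sum>i\<le>n. taylor_coeff f i * c ^ (n - i))"
proof -
  have nz: "1 - c * z \<noteq> 0" if "cmod z < 1" for z
    using that assms(2) by (metis cmod_def eq_iff_diff_eq_0 less_irrefl mult_1 norm_mult norm_one)
  have h: "(\<lambda>z. 1 / (1 - c * z)) holomorphic_on ball 0 1"
    by (intro holomorphic_intros) (use nz in auto)
  have t: "taylor_coeff (\<lambda>z. 1 / (1 - c * z)) m = c ^ m" for m
  proof (rule taylor_coeff_eqI[of 1])
    fix z :: complex assume "cmod z < 1"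
    then show "(\<lambda>m. c ^ m * z ^ m) sums (1 / (1 - c * z))"
      using geometric_sums[of "c * z"] assms(2) by (simp add: norm_mult power_mult_distrib)
  qed simp
  show ?thesis
    using taylor_coeff_mult[OF assms(1) h, of n] by (simp add: t)
qed

text \<open>For unimodular \<open>\<zeta>\<close> this is the area integral of
  \<open>|f'|\<^sup>2\<close> against the Poisson kernel at \<open>\<zeta>\<close>, see
  \<open>Dloc_eq_integral\<close>. The series form gives measurability in \<open>\<zeta>\<close> and
  lower semicontinuity in the coefficients at once. The term at \<open>n = 0\<close> is 0 divided by
  0, which is 0.\<close>

definition Dloc :: "(complex \<Rightarrow> complex) \<Rightarrow> complex \<Rightarrow> ennreal" where
  "Dloc f \<zeta> = (\<Sum>n. ennreal ((cmod (\<Sum>m\<le>n. of_nat m * taylor_coeff f m * \<zeta> ^ m))\<^sup>2 / (real n * (real n + 1))))"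

text \<open>The second order analogue. At \<open>n = 0\<close> and \<open>n = 1\<close> numerator
  and denominator both vanish, so these terms are 0.\<close>

definition D2loc :: "(complex \<Rightarrow> complex) \<Rightarrow> complex \<Rightarrow> ennreal" where
  "D2loc f \<zeta> = (\<Sum>n. ennreal ((cmod (\<Sum>m\<le>n. of_nat m * (of_nat m - 1) * taylor_coeff f m * \<zeta> ^ m))\<^sup>2
       / ((real n - 1) * real n * (real n + 1))))"

lemma Dloc_borel_measurable [measurable]: "Dloc f \<in> borel_measurable borel"
  unfolding Dloc_def by measurable

lemma D2loc_borel_measurable [measurable]: "D2loc f \<in> borel_measurable borel"
  unfolding D2loc_def by measurable

text \<open>Since \<open>|z - \<zeta>| = |1 - cnj \<zeta> z|\<close>, the denominator of the Poisson
  kernel is absorbed into the holomorphic function \<open>g / (1 - cnj \<zeta> z)\<close> and its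
  numerator into the radial weight, and \<open>nn_integral_dA_norm_sq\<close> applies.\<close>

lemma nn_integral_dA_poisson_kernel:
  assumes g: "g holomorphic_on ball 0 1" and l: "cmod \<zeta> = 1" and [measurable]: "\<psi> \<in> borel_measurable borel"
  shows "(\<integral>\<^sup>+z\<in>ball 0 1. ennreal ((cmod (g z))\<^sup>2) * \<psi> ((cmod z)\<^sup>2) * ennreal ((1 - (cmod z)\<^sup>2) / (cmod (z - \<zeta>))\<^sup>2) \<partial>dA)
    = (\<Sum>n. ennreal ((cmod (\<Sum>i\<le>n. taylor_coeff g i * \<zeta> ^ i))\<^sup>2) *
        (\<integral>\<^sup>+t\<in>{0..1}. ennreal (t ^ n) * (\<psi> t * ennreal (1 - t)) \<partial>lborel))"
proof -
  define F where "F = (\<lambda>z. g z / (1 - cnj \<zeta> * z))"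
  have ll: "\<zeta> * cnj \<zeta> = 1" using l by (simp add: complex_norm_square[symmetric])
  have dist: "cmod (z - \<zeta>) = cmod (1 - cnj \<zeta> * z)" for z
  proof -
    have "z - \<zeta> = - \<zeta> * (1 - cnj \<zeta> * z)" using ll by (simp add: algebra_simps)
    then show ?thesis using l by (simp add: norm_mult)
  qed
  have F: "F holomorphic_on ball 0 1"
    unfolding F_def
  proof (intro holomorphic_intros g)
    fix z :: complex assume "z \<in> ball 0 1"
    then have "z \<noteq> \<zeta>" using l by auto
    then show "1 - cnj \<zeta> * z \<noteq> 0" using dist[of z] by auto
  qed
  \<comment> \<open>The coefficient differs from the partial sum at \<open>\<zeta>\<close> only by a
    power of \<open>\<zeta>\<close>, which the modulus does not see.\<close>
  have coeff: "cmod (taylor_coeff F n) = cmod (\<Sum>i\<le>n. taylor_coeff g i * \<zeta> ^ i)" for n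
  proof -
    have "(\<Sum>i\<le>n. taylor_coeff g i * \<zeta> ^ i) = \<zeta> ^ n * taylor_coeff F n"
      unfolding F_def taylor_coeff_div_linear[OF g, of "cnj \<zeta>" n, simplified, OF l] sum_distrib_left
    proof (intro sum.cong refl)
      fix i assume "i \<in> {..n}"
      then have "\<zeta> ^ n = \<zeta> ^ i * \<zeta> ^ (n - i)" by (simp flip: power_add)
      then have "\<zeta> ^ n * cnj \<zeta> ^ (n - i) = \<zeta> ^ i * (\<zeta> * cnj \<zeta>) ^ (n - i)"
        by (simp add: power_mult_distrib mult.assoc)
      then show "taylor_coeff g i * \<zeta> ^ i = \<zeta> ^ n * (taylor_coeff g i * cnj \<zeta> ^ (n - i))"
        by (simp add: ll mult_ac)
    qed
    then show ?thesis using l by (simp add: norm_mult norm_power)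
  qed
  have "(\<integral>\<^sup>+z\<in>ball 0 1. ennreal ((cmod (g z))\<^sup>2) * \<psi> ((cmod z)\<^sup>2) * ennreal ((1 - (cmod z)\<^sup>2) / (cmod (z - \<zeta>))\<^sup>2) \<partial>dA)
     = (\<integral>\<^sup>+z\<in>ball 0 1. ennreal ((cmod (F z))\<^sup>2) * (\<lambda>t. \<psi> t * ennreal (1 - t)) ((cmod z)\<^sup>2) \<partial>dA)"
  proof (intro nn_integral_cong)
    fix z :: complex
    show "ennreal ((cmod (g z))\<^sup>2) * \<psi> ((cmod z)\<^sup>2) * ennreal ((1 - (cmod z)\<^sup>2) / (cmod (z - \<zeta>))\<^sup>2) * indicator (ball 0 1) z
       = ennreal ((cmod (F z))\<^sup>2) * (\<lambda>t. \<psi> t * ennreal (1 - t)) ((cmod z)\<^sup>2) * indicator (ball 0 1) z"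
    proof (cases "cmod z < 1")
      case True
      then have "(cmod z)\<^sup>2 \<le> 1" by (simp add: power_le_one)
      have "ennreal ((cmod (g z))\<^sup>2) * ennreal ((1 - (cmod z)\<^sup>2) / (cmod (z - \<zeta>))\<^sup>2)
         = ennreal ((cmod (F z))\<^sup>2) * ennreal (1 - (cmod z)\<^sup>2)"
        using \<open>(cmod z)\<^sup>2 \<le> 1\<close>
        by (simp add: F_def dist norm_divide power_divide flip: ennreal_mult)
      then show ?thesis using True by (simp add: mult_ac)
    qed simp
  qed
  also have "\<dots> = (\<Sum>n. ennreal ((cmod (taylor_coeff F n))\<^sup>2) *
      (\<integral>\<^sup>+t\<in>{0..1}. ennreal (t ^ n) * (\<lambda>t. \<psi> t * ennreal (1 - t)) t \<partial>lborel))"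
    by (rule nn_integral_dA_norm_sq[OF F]) measurable
  finally show ?thesis by (simp add: coeff)
qed


lemma suminf_ennreal_offset:
  fixes f :: "nat \<Rightarrow> ennreal"
  assumes "\<And>i. i < k \<Longrightarrow> f i = 0"
  shows "(\<Sum>n. f (n + k)) = (\<Sum>n. f n)"
  using suminf_offset[of f k, OF summableI] assms by simp

lemma Dloc_eq_integral:
  assumes f: "f holomorphic_on ball 0 1" and l: "cmod \<zeta> = 1"
  shows "(\<integral>\<^sup>+z\<in>ball 0 1. ennreal ((cmod (deriv f z))\<^sup>2) * ennreal ((1 - (cmod z)\<^sup>2) / (cmod (z - \<zeta>))\<^sup>2) \<partial>dA) = Dloc f \<zeta>"
proof -
  have g: "deriv f holomorphic_on ball 0 1"
    by (intro holomorphic_deriv f) auto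
  define S where "S = (\<lambda>n. \<Sum>m\<le>n. of_nat m * taylor_coeff f m * \<zeta> ^ m)"
  have c: "cmod (\<Sum>i\<le>n. taylor_coeff (deriv f) i * \<zeta> ^ i) = cmod (S (Suc n))" for n
  proof -
    have "S (Suc n) = (\<Sum>i\<le>n. of_nat (Suc i) * taylor_coeff f (Suc i) * \<zeta> ^ Suc i)"
      unfolding S_def by (subst sum.atMost_Suc_shift) simp
    also have "\<dots> = \<zeta> * (\<Sum>i\<le>n. taylor_coeff (deriv f) i * \<zeta> ^ i)"
      using taylor_coeff_higher_deriv[of 1 f] unfolding sum_distrib_left
      by (intro sum.cong refl) simp
    finally show ?thesis using l by (simp add: norm_mult)
  qed
  have "(\<integral>\<^sup>+z\<in>ball 0 1. ennreal ((cmod (deriv f z))\<^sup>2) * ennreal ((1 - (cmod z)\<^sup>2) / (cmod (z - \<zeta>))\<^sup>2) \<partial>dA)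
      = (\<Sum>n. ennreal ((cmod (S (Suc n)))\<^sup>2) * ennreal (1 / (real (n + 1) * real (n + 2))))"
    using nn_integral_dA_poisson_kernel[OF g l, of "\<lambda>_. 1"] by (simp add: c beta_integral_1 add.commute)
  also have "\<dots> = (\<Sum>n. ennreal ((cmod (S (n + 1)))\<^sup>2 / (real (n + 1) * (real (n + 1) + 1))))"
    by (intro suminf_cong, subst ennreal_mult[symmetric]) (auto simp: add_ac)
  also have "\<dots> = (\<Sum>n. ennreal ((cmod (S n))\<^sup>2 / (real n * (real n + 1))))"
    by (rule suminf_ennreal_offset) simp
  finally show ?thesis by (simp add: Dloc_def S_def)
qed

lemma ennreal_mult3:
  "0 \<le> a \<Longrightarrow> 0 \<le> b \<Longrightarrow> 0 \<le> c \<Longrightarrow> ennreal a * (ennreal b * ennreal c) = ennreal (a * (b * c))"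
  by (simp add: ennreal_mult)

text \<open>The factor \<open>1 / 2\<close> is the one in \<open>Dint\<close> for
  \<open>j = 2\<close>; it cancels the 2 of the beta integral. Two derivatives shift the index by
  2.\<close>

lemma D2loc_eq_integral:
  assumes f: "f holomorphic_on ball 0 1" and l: "cmod \<zeta> = 1"
  shows "ennreal (1 / 2) * (\<integral>\<^sup>+z\<in>ball 0 1. ennreal ((cmod ((deriv ^^ 2) f z))\<^sup>2) * ennreal (1 - (cmod z)\<^sup>2)
            * ennreal ((1 - (cmod z)\<^sup>2) / (cmod (z - \<zeta>))\<^sup>2) \<partial>dA) = D2loc f \<zeta>"
proof -
  have g: "(deriv ^^ 2) f holomorphic_on ball 0 1"
    by (intro holomorphic_higher_deriv f) auto
  define S where "S = (\<lambda>n. \<Sum>m\<le>n. of_nat m * (of_nat m - 1) * taylor_coeff f m * \<zeta> ^ m)"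
  have c: "cmod (\<Sum>i\<le>n. taylor_coeff ((deriv ^^ 2) f) i * \<zeta> ^ i) = cmod (S (Suc (Suc n)))" for n
  proof -
    have "S (Suc (Suc n)) = (\<Sum>i\<le>n. of_nat (i + 2) * of_nat (i + 1) * taylor_coeff f (i + 2) * \<zeta> ^ (i + 2))"
      unfolding S_def by (subst sum.atMost_Suc_shift, subst sum.atMost_Suc_shift) simp
    also have "\<dots> = \<zeta>\<^sup>2 * (\<Sum>i\<le>n. taylor_coeff ((deriv ^^ 2) f) i * \<zeta> ^ i)"
      unfolding taylor_coeff_higher_deriv sum_distrib_left
      by (intro sum.cong refl) (simp add: power_add power2_eq_square mult_ac)
    finally show ?thesis using l by (simp add: norm_mult norm_power)
  qed
  have "ennreal (1 - t) * ennreal (1 - t) = ennreal ((1 - t)\<^sup>2)" if "t \<in> {0..1}" for t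
    using that by (simp add: power2_eq_square flip: ennreal_mult)
  then have b: "(\<integral>\<^sup>+t\<in>{0..1}. ennreal (t ^ n) * (ennreal (1 - t) * ennreal (1 - t)) \<partial>lborel)
      = ennreal (2 / (real (n + 1) * real (n + 2) * real (n + 3)))" for n
    unfolding beta_integral_2[symmetric] by (intro nn_integral_cong) (simp split: split_indicator)
  have "ennreal (1 / 2) * (\<integral>\<^sup>+z\<in>ball 0 1. ennreal ((cmod ((deriv ^^ 2) f z))\<^sup>2) * ennreal (1 - (cmod z)\<^sup>2)
            * ennreal ((1 - (cmod z)\<^sup>2) / (cmod (z - \<zeta>))\<^sup>2) \<partial>dA)
      = (\<Sum>n. ennreal (1 / 2) * (ennreal ((cmod (S (Suc (Suc n))))\<^sup>2) * ennreal (2 / (real (n + 1) * real (n + 2) * real (n + 3)))))"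
    using nn_integral_dA_poisson_kernel[OF g l, of "\<lambda>t. ennreal (1 - t)"] by (simp add: c b ennreal_suminf_cmult)
  also have "\<dots> = (\<Sum>n. ennreal ((cmod (S (n + 2)))\<^sup>2 / ((real (n + 2) - 1) * real (n + 2) * (real (n + 2) + 1))))"
    by (intro suminf_cong, subst ennreal_mult3) (auto intro!: arg_cong[where f = ennreal] simp: add_ac)
  also have "\<dots> = (\<Sum>n. ennreal ((cmod (S n))\<^sup>2 / ((real n - 1) * real n * (real n + 1))))"
    by (rule suminf_ennreal_offset) (auto simp: less_2_cases_iff)
  finally show ?thesis by (simp add: D2loc_def S_def)
qed

section \<open>From single boundary points to finite measures on the circle\<close>

context
  fixes \<nu> :: "complex measure"
  assumes sets_nu: "sets \<nu> = sets borel" and fin_nu: "finite_measure \<nu>"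
    and sphere_nu: "emeasure \<nu> (UNIV - sphere 0 1) = 0"
begin

lemma AE_sphere: "AE \<zeta> in \<nu>. cmod \<zeta> = 1"
proof -
  have "UNIV - sphere (0::complex) 1 \<in> null_sets \<nu>"
    using sphere_nu by (auto simp: null_sets_def sets_nu)
  from AE_not_in[OF this] show ?thesis
    by eventually_elim simp
qed

lemma nn_integral_poisson_swap:
  assumes g: "g holomorphic_on ball 0 1" and [measurable]: "\<psi> \<in> borel_measurable borel"
  shows "(\<integral>\<^sup>+z\<in>ball 0 1. ennreal ((cmod (g z))\<^sup>2) * \<psi> ((cmod z)\<^sup>2) * poisson \<nu> z \<partial>dA)
    = (\<integral>\<^sup>+\<zeta>. (\<integral>\<^sup>+z\<in>ball 0 1. ennreal ((cmod (g z))\<^sup>2) * \<psi> ((cmod z)\<^sup>2)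
          * ennreal ((1 - (cmod z)\<^sup>2) / (cmod (z - \<zeta>))\<^sup>2) \<partial>dA) \<partial>\<nu>)"
proof -
  interpret finite_measure \<nu> by (rule fin_nu)
  interpret pair_sigma_finite lborel \<nu> ..
  note [measurable_cong] = sets_nu
  define g' where "g' = (\<lambda>z. indicator (ball 0 1) z *\<^sub>R g z)"
  have [measurable]: "g' \<in> borel_measurable borel"
    unfolding g'_def using g
    by (intro borel_measurable_continuous_on_indicator holomorphic_on_imp_continuous_on) auto
  define h where "h = (\<lambda>z. ennreal ((cmod (g' z))\<^sup>2) * \<psi> ((cmod z)\<^sup>2))"
  have h [measurable]: "h \<in> borel_measurable borel" unfolding h_def by measurable
  define p where "p = (\<lambda>z \<zeta>. ennreal ((1 - (cmod z)\<^sup>2) / (cmod (z - \<zeta>))\<^sup>2) :: ennreal)"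
  have p [measurable]: "case_prod p \<in> borel_measurable (borel \<Otimes>\<^sub>M borel)"
    unfolding p_def by measurable
  have hp: "ennreal ((cmod (g z))\<^sup>2) * \<psi> ((cmod z)\<^sup>2) * x * indicator (ball 0 1) z = h z * x * indicator (ball 0 1) z" for z x
    by (simp add: h_def g'_def split: split_indicator)
  have B [measurable]: "ball (0::complex) 1 \<in> sets borel" by simp
  have "(\<integral>\<^sup>+z. h z * poisson \<nu> z * indicator (ball 0 1) z \<partial>dA)
      = (\<integral>\<^sup>+z. (\<integral>\<^sup>+\<zeta>. h z * p z \<zeta> * indicator (ball 0 1) z \<partial>\<nu>) \<partial>dA)"
    by (intro nn_integral_cong) (simp add: poisson_def p_def nn_integral_cmult nn_integral_multc)
  also have "\<dots> = ennreal (1 / pi) * (\<integral>\<^sup>+z. (\<integral>\<^sup>+\<zeta>. h z * p z \<zeta> * indicator (ball 0 1) z \<partial>\<nu>) \<partial>lborel)"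
    by (rule nn_integral_dA) measurable
  also have "\<dots> = ennreal (1 / pi) * (\<integral>\<^sup>+\<zeta>. (\<integral>\<^sup>+z. h z * p z \<zeta> * indicator (ball 0 1) z \<partial>lborel) \<partial>\<nu>)"
    by (subst Fubini') (auto simp: case_prod_beta)
  also have "\<dots> = (\<integral>\<^sup>+\<zeta>. (\<integral>\<^sup>+z. h z * p z \<zeta> * indicator (ball 0 1) z \<partial>dA) \<partial>\<nu>)"
    by (subst nn_integral_cmult[symmetric]) (auto simp: nn_integral_dA intro!: nn_integral_cong)
  finally show ?thesis
    by (simp add: hp p_def)
qed

lemma Dint_1_eq:
  assumes f: "f holomorphic_on ball 0 1"
  shows "Dint \<nu> 1 f = (\<integral>\<^sup>+\<zeta>. Dloc f \<zeta> \<partial>\<nu>)"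
proof -
  have "Dint \<nu> 1 f = (\<integral>\<^sup>+z\<in>ball 0 1. ennreal ((cmod (deriv f z))\<^sup>2) * (\<lambda>_. 1) ((cmod z)\<^sup>2) * poisson \<nu> z \<partial>dA)"
    by (simp add: Dint_def)
  also have "\<dots> = (\<integral>\<^sup>+\<zeta>. (\<integral>\<^sup>+z\<in>ball 0 1. ennreal ((cmod (deriv f z))\<^sup>2)
          * ennreal ((1 - (cmod z)\<^sup>2) / (cmod (z - \<zeta>))\<^sup>2) \<partial>dA) \<partial>\<nu>)"
    by (subst nn_integral_poisson_swap) (auto intro!: holomorphic_deriv f)
  also have "\<dots> = (\<integral>\<^sup>+\<zeta>. Dloc f \<zeta> \<partial>\<nu>)"
    using AE_sphere by (intro nn_integral_cong_AE) (auto elim!: eventually_mono simp: Dloc_eq_integral[OF f])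
  finally show ?thesis .
qed

lemma Dint_2_eq:
  assumes f: "f holomorphic_on ball 0 1"
  shows "Dint \<nu> 2 f = (\<integral>\<^sup>+\<zeta>. D2loc f \<zeta> \<partial>\<nu>)"
proof -
  let ?J = "\<lambda>\<zeta>. \<integral>\<^sup>+z\<in>ball 0 1. ennreal ((cmod ((deriv ^^ 2) f z))\<^sup>2) * ennreal (1 - (cmod z)\<^sup>2)
          * ennreal ((1 - (cmod z)\<^sup>2) / (cmod (z - \<zeta>))\<^sup>2) \<partial>dA"
  have "Dint \<nu> 2 f = ennreal (1 / 2) * (\<integral>\<^sup>+z\<in>ball 0 1. ennreal ((cmod ((deriv ^^ 2) f z))\<^sup>2)
      * (\<lambda>t. ennreal (1 - t)) ((cmod z)\<^sup>2) * poisson \<nu> z \<partial>dA)"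
    unfolding Dint_def
  proof (rule arg_cong2[where f = "(*)", OF _ nn_integral_cong])
    fix z :: complex
    show "ennreal ((cmod ((deriv ^^ 2) f z))\<^sup>2 * (1 - (cmod z)\<^sup>2) ^ (2 - 1)) * poisson \<nu> z * indicator (ball 0 1) z
       = ennreal ((cmod ((deriv ^^ 2) f z))\<^sup>2) * ennreal (1 - (cmod z)\<^sup>2) * poisson \<nu> z * indicator (ball 0 1) z"
      by (cases "cmod z < 1") (simp_all add: ennreal_mult power_le_one)
  qed simp
  also have "\<dots> = ennreal (1 / 2) * (\<integral>\<^sup>+\<zeta>. ?J \<zeta> \<partial>\<nu>)"
    by (subst nn_integral_poisson_swap) (auto intro!: holomorphic_higher_deriv f)
  also have "\<dots> = (\<integral>\<^sup>+\<zeta>. D2loc f \<zeta> \<partial>\<nu>)"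
  proof -
    define h where "h = ennreal (1 / 2)"
    have "ennreal 2 * h = ennreal (2 * (1 / 2))"
      unfolding h_def by (rule ennreal_mult[symmetric]) auto
    then have h: "2 * h = 1" by (simp only: ennreal_numeral) simp
    have "?J \<zeta> = 2 * D2loc f \<zeta>" if "cmod \<zeta> = 1" for \<zeta>
    proof -
      have "2 * D2loc f \<zeta> = (2 * h) * ?J \<zeta>"
        unfolding D2loc_eq_integral[OF f that, symmetric] h_def by (rule mult.assoc[symmetric])
      then show ?thesis unfolding h by simp
    qed
    then have J: "AE \<zeta> in \<nu>. ?J \<zeta> = 2 * D2loc f \<zeta>"
      using AE_sphere by (auto elim!: eventually_mono)
    have "(\<integral>\<^sup>+\<zeta>. ?J \<zeta> \<partial>\<nu>) = (\<integral>\<^sup>+\<zeta>. 2 * D2loc f \<zeta> \<partial>\<nu>)"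
      by (rule nn_integral_cong_AE[OF J])
    also have "\<dots> = 2 * (\<integral>\<^sup>+\<zeta>. D2loc f \<zeta> \<partial>\<nu>)"
      by (rule nn_integral_cmult) (simp add: measurable_cong_sets[OF sets_nu refl])
    finally have "h * (\<integral>\<^sup>+\<zeta>. ?J \<zeta> \<partial>\<nu>) = (2 * h) * (\<integral>\<^sup>+\<zeta>. D2loc f \<zeta> \<partial>\<nu>)"
      by (simp only: mult_ac)
    then show ?thesis unfolding h by (simp only: h_def mult_1_left)
  qed
  finally show ?thesis .
qed

end

section \<open>Difference quotients at a boundary point\<close>

text \<open>With \<open>C\<close> the sum of \<open>\<kappa> j\<close> over \<open>j < n\<close>,
  the last two terms on the right are consecutive values of one sequence, so summation over
  \<open>n\<close> telescopes.\<close>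

lemma cmod_sq_telescope1:
  fixes C \<kappa> :: complex
  assumes n: "n \<ge> 1"
  shows "(cmod (C - of_nat n * \<kappa>))\<^sup>2 / (real n * (real n + 1))
    = (cmod \<kappa>)\<^sup>2 + (cmod C)\<^sup>2 / real n - (cmod (C + \<kappa>))\<^sup>2 / (real n + 1)"
  using n unfolding cmod_power2 by (simp add: field_simps power2_eq_square)

lemma cmod_sq_telescope2:
  fixes E \<kappa> :: complex
  assumes n: "n \<ge> 2"
  shows "(cmod (E - of_nat n * (of_nat n - 1) * \<kappa>))\<^sup>2 / ((real n - 1) * real n * (real n + 1))
    = real n * (cmod \<kappa>)\<^sup>2 + (cmod E)\<^sup>2 / (2 * (real n - 1) * real n) - (cmod (E + 2 * of_nat n * \<kappa>))\<^sup>2 / (2 * real n * (real n + 1))"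
proof -
  define x where "x = real n"
  have x: "x \<ge> 2" using n by (simp add: x_def)
  have e: "of_nat n = complex_of_real x" by (simp add: x_def)
  show ?thesis
    unfolding e x_def[symmetric] cmod_power2
    using x by (simp add: divide_simps) (simp add: power2_eq_square algebra_simps)
qed

text \<open>Finite form of the identity between \<open>Dloc\<close> and the Hardy norm of the
  difference quotient. The error term is a square: dropping it gives an upper bound for every
  \<open>\<kappa>\<close>, and adding a constant to \<open>\<kappa>\<close> can make it
  vanish.\<close>

lemma weighted_sum_telescope1:
  fixes b \<kappa> :: "nat \<Rightarrow> complex"
  assumes b: "\<And>m. b (Suc m) = \<kappa> m - \<kappa> (Suc m)"
  shows "(\<Sum>n\<le>N. (cmod (\<Sum>m\<le>n. of_nat m * b m))\<^sup>2 / (real n * (real n + 1)))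
     = (\<Sum>n\<le>N. (cmod (\<kappa> n))\<^sup>2) - (cmod (\<Sum>j\<le>N. \<kappa> j))\<^sup>2 / (real N + 1)"
proof -
  define T where "T = (\<lambda>n. (cmod ((\<Sum>j<n. \<kappa> j) - of_nat n * \<kappa> n))\<^sup>2 / (real n * (real n + 1)))"
  have "(\<Sum>m\<le>n. of_nat m * b m) = (\<Sum>j<n. \<kappa> j) - of_nat n * \<kappa> n" for n
    by (induction n) (simp_all add: b algebra_simps)
  then have "(\<Sum>n\<le>N. (cmod (\<Sum>m\<le>n. of_nat m * b m))\<^sup>2 / (real n * (real n + 1))) = (\<Sum>n\<le>N. T n)"
    by (simp add: T_def)
  also have "\<dots> = (\<Sum>n\<le>N. (cmod (\<kappa> n))\<^sup>2) - (cmod (\<Sum>j\<le>N. \<kappa> j))\<^sup>2 / (real N + 1)"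
  proof (induction N)
    case (Suc N)
    then show ?case
      using cmod_sq_telescope1[of "Suc N" "\<Sum>j\<le>N. \<kappa> j" "\<kappa> (Suc N)"]
      by (simp add: T_def lessThan_Suc_atMost add_ac)
  qed (simp add: T_def)
  finally show ?thesis .
qed

lemma weighted_sum_telescope2:
  fixes b \<kappa> :: "nat \<Rightarrow> complex"
  assumes b: "\<And>m. b (Suc m) = \<kappa> m - \<kappa> (Suc m)"
  shows "(\<Sum>n\<le>N. (cmod (\<Sum>m\<le>n. of_nat m * (of_nat m - 1) * b m))\<^sup>2 / ((real n - 1) * real n * (real n + 1)))
     = (\<Sum>n\<le>N. real n * (cmod (\<kappa> n))\<^sup>2) - (cmod (\<Sum>j\<le>N. 2 * of_nat j * \<kappa> j))\<^sup>2 / (2 * real N * (real N + 1))"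
proof -
  define T where "T = (\<lambda>n. (cmod ((\<Sum>j<n. 2 * of_nat j * \<kappa> j) - of_nat n * (of_nat n - 1) * \<kappa> n))\<^sup>2
    / ((real n - 1) * real n * (real n + 1)))"
  have "(\<Sum>m\<le>n. of_nat m * (of_nat m - 1) * b m) = (\<Sum>j<n. 2 * of_nat j * \<kappa> j) - of_nat n * (of_nat n - 1) * \<kappa> n" for n
    by (induction n) (simp_all add: b algebra_simps)
  then have "(\<Sum>n\<le>N. (cmod (\<Sum>m\<le>n. of_nat m * (of_nat m - 1) * b m))\<^sup>2 / ((real n - 1) * real n * (real n + 1))) = (\<Sum>n\<le>N. T n)"
    by (simp add: T_def)
  also have "\<dots> = (\<Sum>n\<le>N. real n * (cmod (\<kappa> n))\<^sup>2) - (cmod (\<Sum>j\<le>N. 2 * of_nat j * \<kappa> j))\<^sup>2 / (2 * real N * (real N + 1))"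
  proof (induction N)
    case (Suc N)
    show ?case
    \<comment> \<open>For \<open>N = 0\<close> the correction term of the induction hypothesis has
      denominator 0, and \<open>cmod_sq_telescope2\<close> applies only from index 2 on.\<close>
    proof (cases "N = 0")
      case True
      then show ?thesis by (simp add: T_def norm_mult power_mult_distrib)
    next
      case False
      define E where "E = (\<Sum>j\<le>N. 2 * of_nat j * \<kappa> j)"
      have "T (Suc N) = real (Suc N) * (cmod (\<kappa> (Suc N)))\<^sup>2 + (cmod E)\<^sup>2 / (2 * real N * (real N + 1))
          - (cmod (E + 2 * of_nat (Suc N) * \<kappa> (Suc N)))\<^sup>2 / (2 * real (Suc N) * (real (Suc N) + 1))"
        using cmod_sq_telescope2[of "Suc N" E "\<kappa> (Suc N)"] False
        by (simp add: T_def E_def lessThan_Suc_atMost add_ac)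
      then show ?thesis
        using Suc.IH by (simp add: E_def)
    qed
  qed (simp add: T_def)
  finally show ?thesis .
qed

lemma suminf_ennreal_le_suminf:
  fixes f g :: "nat \<Rightarrow> real"
  assumes "\<And>n. 0 \<le> f n" "\<And>n. 0 \<le> g n" "\<And>N. (\<Sum>n\<le>N. f n) \<le> (\<Sum>n\<le>N. g n)"
  shows "(\<Sum>n. ennreal (f n)) \<le> (\<Sum>n. ennreal (g n))"
proof -
  have "(\<Sum>n<N. ennreal (f n)) \<le> (\<Sum>n. ennreal (g n))" for N
  proof -
    have "(\<Sum>n<N. ennreal (f n)) \<le> (\<Sum>n\<le>N. ennreal (f n))"
      by (intro sum_mono2) auto
    also have "\<dots> \<le> (\<Sum>n\<le>N. ennreal (g n))"
      using assms by (simp add: sum_ennreal ennreal_leI)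
    also have "\<dots> \<le> (\<Sum>n. ennreal (g n))"
      by (intro sum_le_suminf) auto
    finally show ?thesis .
  qed
  then show ?thesis
    by (intro suminf_le_const) auto
qed

lemma suminf_ennreal_le_realI:
  fixes f :: "nat \<Rightarrow> real"
  assumes "\<And>n. 0 \<le> f n" "\<And>N. (\<Sum>n\<le>N. f n) \<le> B"
  shows "(\<Sum>n. ennreal (f n)) \<le> ennreal B"
proof (rule suminf_le_const)
  fix N
  have "(\<Sum>n<N. ennreal (f n)) \<le> (\<Sum>n\<le>N. ennreal (f n))"
    by (intro sum_mono2) auto
  also have "\<dots> \<le> ennreal B"
    using assms by (simp add: sum_ennreal ennreal_leI)
  finally show "(\<Sum>n<N. ennreal (f n)) \<le> ennreal B" .
qed auto

lemma sum_le_if_suminf_ennreal_le: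
  fixes f :: "nat \<Rightarrow> real"
  assumes "\<And>n. 0 \<le> f n" "(\<Sum>n. ennreal (f n)) \<le> ennreal B" "0 \<le> B" "finite A"
  shows "sum f A \<le> B"
proof -
  have "ennreal (sum f A) = (\<Sum>n\<in>A. ennreal (f n))"
    using assms by (simp add: sum_ennreal)
  also have "\<dots> \<le> (\<Sum>n. ennreal (f n))"
    using assms by (intro sum_le_suminf) auto
  finally have "ennreal (sum f A) \<le> ennreal B"
    using assms(2) by (rule order_trans)
  then show ?thesis using assms(3) by (simp add: ennreal_le_iff)
qed

text \<open>The quotient sequence is fixed only up to an additive constant, and each truncation
  \<open>N\<close> comes with its own good constant. The positive weight at \<open>i\<close> keeps
  these constants bounded; since the terms are non-negative, a limit point works for every
  truncation.\<close>

lemma ex_constant_limit: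
  fixes \<kappa> :: "nat \<Rightarrow> complex" and w :: "nat \<Rightarrow> real"
  assumes w: "\<And>n. 0 \<le> w n" "w i > 0" and c: "\<And>N. N \<ge> i \<Longrightarrow> (\<Sum>n\<le>N. w n * (cmod (\<kappa> n + c N))\<^sup>2) \<le> D"
  shows "\<exists>c. \<forall>N. (\<Sum>n\<le>N. w n * (cmod (\<kappa> n + c))\<^sup>2) \<le> D"
proof -
  have "cmod (c (N + i)) \<le> cmod (\<kappa> i) + sqrt (D / w i)" for N
  proof -
    have "w i * (cmod (\<kappa> i + c (N + i)))\<^sup>2 \<le> (\<Sum>n\<le>N+i. w n * (cmod (\<kappa> n + c (N + i)))\<^sup>2)"
      by (rule member_le_sum) (auto simp: w)
    also have "\<dots> \<le> D" by (rule c) simp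
    finally have "(cmod (\<kappa> i + c (N + i)))\<^sup>2 \<le> D / w i"
      using w by (simp add: field_simps)
    then have "cmod (\<kappa> i + c (N + i)) \<le> sqrt (D / w i)"
      by (simp add: real_le_rsqrt)
    moreover have "cmod (c (N + i)) \<le> cmod (\<kappa> i) + cmod (\<kappa> i + c (N + i))"
      using norm_triangle_ineq4[of "\<kappa> i + c (N + i)" "\<kappa> i"] by simp
    ultimately show ?thesis by simp
  qed
  then have "bounded (range (\<lambda>N. c (N + i)))"
    by (auto simp: bounded_iff)
  then obtain l r where r: "strict_mono r" and l: "((\<lambda>N. c (N + i)) \<circ> r) \<longlonglongrightarrow> l"
    using bounded_imp_convergent_subsequence by blast
  have "(\<Sum>n\<le>N. w n * (cmod (\<kappa> n + l))\<^sup>2) \<le> D" for N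
  proof (rule tendsto_upperbound)
    show "((\<lambda>j. \<Sum>n\<le>N. w n * (cmod (\<kappa> n + c (r j + i)))\<^sup>2) \<longlongrightarrow> (\<Sum>n\<le>N. w n * (cmod (\<kappa> n + l))\<^sup>2)) sequentially"
      using l by (intro tendsto_intros) (auto simp: o_def)
    have "(\<Sum>n\<le>N. w n * (cmod (\<kappa> n + c (r j + i)))\<^sup>2) \<le> D" if "j \<ge> N" for j
    proof -
      have "N \<le> r j + i" using that seq_suble[OF r, of j] by simp
      then have "(\<Sum>n\<le>N. w n * (cmod (\<kappa> n + c (r j + i)))\<^sup>2) \<le> (\<Sum>n\<le>r j + i. w n * (cmod (\<kappa> n + c (r j + i)))\<^sup>2)"
        by (intro sum_mono2) (auto simp: w)
      also have "\<dots> \<le> D" by (rule c) simp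
      finally show ?thesis .
    qed
    then show "\<forall>\<^sub>F j in sequentially. (\<Sum>n\<le>N. w n * (cmod (\<kappa> n + c (r j + i)))\<^sup>2) \<le> D"
      by (auto simp: eventually_sequentially)
  qed auto
  then show ?thesis by blast
qed

text \<open>Here \<open>k\<close> plays the role of the coefficients of
  \<open>(f - f(\<zeta>)) / (z - \<zeta>)\<close>. The rotated sequence
  \<open>k m * \<zeta> ^ Suc m\<close> reduces the recursion to plain differences, and the square
  subtracted in the telescoped sum is dropped.\<close>

lemma
  assumes l: "cmod \<zeta> = 1" and k: "\<And>m. taylor_coeff f (Suc m) = k m - \<zeta> * k (Suc m)"
  shows Dloc_le: "Dloc f \<zeta> \<le> (\<Sum>m. ennreal ((cmod (k m))\<^sup>2))"
    and D2loc_le: "D2loc f \<zeta> \<le> (\<Sum>m. ennreal (real m * (cmod (k m))\<^sup>2))"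
proof -
  define \<kappa> where "\<kappa> = (\<lambda>m. k m * \<zeta> ^ Suc m)"
  define b where "b = (\<lambda>m. taylor_coeff f m * \<zeta> ^ m)"
  have b: "b (Suc m) = \<kappa> m - \<kappa> (Suc m)" for m
    by (simp add: b_def \<kappa>_def k algebra_simps)
  have n: "cmod (\<kappa> m) = cmod (k m)" for m
    using l by (simp add: \<kappa>_def norm_mult norm_power)
  have "(\<Sum>n. ennreal ((cmod (\<Sum>m\<le>n. of_nat m * b m))\<^sup>2 / (real n * (real n + 1)))) \<le> (\<Sum>m. ennreal ((cmod (\<kappa> m))\<^sup>2))"
    by (rule suminf_ennreal_le_suminf) (auto simp: weighted_sum_telescope1[where b = b and \<kappa> = \<kappa>, OF b])
  then show "Dloc f \<zeta> \<le> (\<Sum>m. ennreal ((cmod (k m))\<^sup>2))"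
    by (simp add: Dloc_def b_def n mult.assoc)
  have "0 \<le> (real n - 1) * real n * (real n + 1)" for n
    by (cases n) auto
  then have "(\<Sum>n. ennreal ((cmod (\<Sum>m\<le>n. of_nat m * (of_nat m - 1) * b m))\<^sup>2 / ((real n - 1) * real n * (real n + 1))))
      \<le> (\<Sum>m. ennreal (real m * (cmod (\<kappa> m))\<^sup>2))"
    by (intro suminf_ennreal_le_suminf) (auto simp: weighted_sum_telescope2[where b = b and \<kappa> = \<kappa>, OF b])
  then show "D2loc f \<zeta> \<le> (\<Sum>m. ennreal (real m * (cmod (k m))\<^sup>2))"
    by (simp add: D2loc_def b_def n mult.assoc)
qed

text \<open>Converse of \<open>Dloc_le\<close>. Solving the recursion leaves one free constant; for
  each truncation it is chosen to make the sum of the rotated quotients zero, so that the subtracted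
  square disappears, and \<open>ex_constant_limit\<close> merges the choices.\<close>

lemma Dloc_ex:
  assumes l: "cmod \<zeta> = 1" and fin: "Dloc f \<zeta> < \<infinity>"
  shows "\<exists>k. (\<forall>m. taylor_coeff f (Suc m) = k m - \<zeta> * k (Suc m)) \<and> (\<Sum>m. ennreal ((cmod (k m))\<^sup>2)) \<le> Dloc f \<zeta>"
proof -
  define b where "b = (\<lambda>m. taylor_coeff f m * \<zeta> ^ m)"
  define D where "D = enn2real (Dloc f \<zeta>)"
  have D: "Dloc f \<zeta> = ennreal D" "0 \<le> D"
    using fin by (auto simp: D_def less_top)
  define \<kappa> where "\<kappa> = (\<lambda>m. - (\<Sum>i<m. b (Suc i)))"
  have b: "b (Suc m) = (\<kappa> m + c) - (\<kappa> (Suc m) + c)" for m c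
    by (simp add: \<kappa>_def)
  define c where "c = (\<lambda>N. - (\<Sum>j\<le>N. \<kappa> j) / of_nat (Suc N))"
  have "(\<Sum>n\<le>N. 1 * (cmod (\<kappa> n + c N))\<^sup>2) \<le> D" for N
  proof -
    have "(\<Sum>j\<le>N. \<kappa> j + c N) = (\<Sum>j\<le>N. \<kappa> j) + of_nat (Suc N) * c N"
      by (simp add: sum.distrib)
    also have "\<dots> = 0"
      by (simp add: c_def del: of_nat_Suc)
    finally have "(\<Sum>n\<le>N. (cmod (\<kappa> n + c N))\<^sup>2)
        = (\<Sum>n\<le>N. (cmod (\<Sum>m\<le>n. of_nat m * b m))\<^sup>2 / (real n * (real n + 1)))"
      using weighted_sum_telescope1[of b "\<lambda>m. \<kappa> m + c N", OF b] by simp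
    also have "\<dots> \<le> D"
      by (rule sum_le_if_suminf_ennreal_le) (use D in \<open>auto simp: Dloc_def b_def mult.assoc\<close>)
    finally show ?thesis by simp
  qed
  from ex_constant_limit[of "\<lambda>_. 1" 0, OF _ _ this] obtain d where d: "\<And>N. (\<Sum>n\<le>N. (cmod (\<kappa> n + d))\<^sup>2) \<le> D"
    by auto
  define k where "k = (\<lambda>m. (\<kappa> m + d) * cnj \<zeta> ^ Suc m)"
  have ll: "\<zeta> * cnj \<zeta> = 1" using l by (simp add: complex_norm_square[symmetric])
  have "taylor_coeff f (Suc m) = k m - \<zeta> * k (Suc m)" for m
  proof -
    have "taylor_coeff f (Suc m) = taylor_coeff f (Suc m) * (\<zeta> * cnj \<zeta>) ^ Suc m"
      by (simp add: ll)
    also have "\<dots> = b (Suc m) * cnj \<zeta> ^ Suc m"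
      by (simp only: b_def power_mult_distrib mult.assoc)
    also have "\<dots> = k m - (\<kappa> (Suc m) + d) * cnj \<zeta> ^ Suc m"
      unfolding k_def b[of m d] by (simp only: left_diff_distrib)
    also have "(\<kappa> (Suc m) + d) * cnj \<zeta> ^ Suc m = (\<zeta> * cnj \<zeta>) * ((\<kappa> (Suc m) + d) * cnj \<zeta> ^ Suc m)"
      by (simp add: ll)
    also have "\<dots> = \<zeta> * k (Suc m)"
      by (simp add: k_def mult_ac)
    finally show ?thesis .
  qed
  moreover have "cmod (k m) = cmod (\<kappa> m + d)" for m
    using l by (simp add: k_def norm_mult norm_power)
  then have "(\<Sum>m. ennreal ((cmod (k m))\<^sup>2)) \<le> Dloc f \<zeta>"
    unfolding D(1) by (intro suminf_ennreal_le_realI) (auto simp: d)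
  ultimately show ?thesis by blast
qed

lemma D2loc_ex:
  assumes l: "cmod \<zeta> = 1" and fin: "D2loc f \<zeta> < \<infinity>"
  shows "\<exists>k. (\<forall>m. taylor_coeff f (Suc m) = k m - \<zeta> * k (Suc m)) \<and> (\<Sum>m. ennreal (real m * (cmod (k m))\<^sup>2)) \<le> D2loc f \<zeta>"
proof -
  define b where "b = (\<lambda>m. taylor_coeff f m * \<zeta> ^ m)"
  define D where "D = enn2real (D2loc f \<zeta>)"
  have D: "D2loc f \<zeta> = ennreal D" "0 \<le> D"
    using fin by (auto simp: D_def less_top)
  define \<kappa> where "\<kappa> = (\<lambda>m. - (\<Sum>i<m. b (Suc i)))"
  have b: "b (Suc m) = (\<kappa> m + c) - (\<kappa> (Suc m) + c)" for m c
    by (simp add: \<kappa>_def)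
  have pos: "0 \<le> (real n - 1) * real n * (real n + 1)" for n
    by (cases n) auto
  \<comment> \<open>Minus the mean of \<open>\<kappa>\<close> with weights \<open>2 j\<close>, whose
    total over \<open>j \<le> N\<close> is \<open>N (N + 1)\<close>; hence the restriction to
    \<open>N \<ge> 1\<close>.\<close>
  define c where "c = (\<lambda>N. - (\<Sum>j\<le>N. 2 * of_nat j * \<kappa> j) / (of_nat N * of_nat (Suc N)))"
  have gauss: "(\<Sum>j\<le>N. 2 * of_nat j) = (of_nat N * of_nat (Suc N) :: complex)" for N
    by (induction N) (simp_all add: algebra_simps)
  have "(\<Sum>n\<le>N. real n * (cmod (\<kappa> n + c N))\<^sup>2) \<le> D" if "N \<ge> 1" for N
  proof -
    have "(\<Sum>j\<le>N. 2 * of_nat j * (\<kappa> j + c N)) = (\<Sum>j\<le>N. 2 * of_nat j * \<kappa> j) + (\<Sum>j\<le>N. 2 * of_nat j) * c N"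
      by (simp add: sum.distrib distrib_left sum_distrib_right)
    also have "\<dots> = 0"
      unfolding gauss c_def using that by (simp del: of_nat_Suc)
    finally have "(\<Sum>n\<le>N. real n * (cmod (\<kappa> n + c N))\<^sup>2)
        = (\<Sum>n\<le>N. (cmod (\<Sum>m\<le>n. of_nat m * (of_nat m - 1) * b m))\<^sup>2 / ((real n - 1) * real n * (real n + 1)))"
      using weighted_sum_telescope2[of b "\<lambda>m. \<kappa> m + c N", OF b] by simp
    also have "\<dots> \<le> D"
      by (rule sum_le_if_suminf_ennreal_le) (use D pos in \<open>auto simp: D2loc_def b_def mult.assoc\<close>)
    finally show ?thesis by simp
  qed
  from ex_constant_limit[of "\<lambda>n. real n" 1, OF _ _ this] obtain d where d: "\<And>N. (\<Sum>n\<le>N. real n * (cmod (\<kappa> n + d))\<^sup>2) \<le> D"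
    by auto
  define k where "k = (\<lambda>m. (\<kappa> m + d) * cnj \<zeta> ^ Suc m)"
  have ll: "\<zeta> * cnj \<zeta> = 1" using l by (simp add: complex_norm_square[symmetric])
  have "taylor_coeff f (Suc m) = k m - \<zeta> * k (Suc m)" for m
  proof -
    have "taylor_coeff f (Suc m) = taylor_coeff f (Suc m) * (\<zeta> * cnj \<zeta>) ^ Suc m"
      by (simp add: ll)
    also have "\<dots> = b (Suc m) * cnj \<zeta> ^ Suc m"
      by (simp only: b_def power_mult_distrib mult.assoc)
    also have "\<dots> = k m - (\<kappa> (Suc m) + d) * cnj \<zeta> ^ Suc m"
      unfolding k_def b[of m d] by (simp only: left_diff_distrib)
    also have "(\<kappa> (Suc m) + d) * cnj \<zeta> ^ Suc m = (\<zeta> * cnj \<zeta>) * ((\<kappa> (Suc m) + d) * cnj \<zeta> ^ Suc m)"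
      by (simp add: ll)
    also have "\<dots> = \<zeta> * k (Suc m)"
      by (simp add: k_def mult_ac)
    finally show ?thesis .
  qed
  moreover have "cmod (k m) = cmod (\<kappa> m + d)" for m
    using l by (simp add: k_def norm_mult norm_power)
  then have "(\<Sum>m. ennreal (real m * (cmod (k m))\<^sup>2)) \<le> D2loc f \<zeta>"
    unfolding D(1) by (intro suminf_ennreal_le_realI) (auto simp: d)
  ultimately show ?thesis by blast
qed

section \<open>Boundary decomposition and products\<close>

lemma ex_holomorphic_taylor:
  assumes "\<And>m. cmod (a m) \<le> B"
  shows "\<exists>f. f holomorphic_on ball 0 1 \<and> (\<forall>m. taylor_coeff f m = a m)"
proof -
  define f where "f = (\<lambda>z. \<Sum>m. a m * z ^ m)"
  have s: "(\<lambda>m. a m * z ^ m) sums f z" if "cmod z < 1" for z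
    unfolding f_def
  proof (intro summable_sums summable_norm_cancel[where f = "\<lambda>m. a m * z ^ m"])
    show "summable (\<lambda>m. cmod (a m * z ^ m))"
      by (rule summable_comparison_test'[where g = "\<lambda>m. B * cmod z ^ m" and N = 0])
         (use that assms in \<open>auto simp: norm_mult norm_power intro!: mult_right_mono summable_mult\<close>)
  qed
  have "f holomorphic_on ball 0 1"
    by (rule power_series_holomorphic[of 0 1 a]) (use s in auto)
  moreover have "taylor_coeff f m = a m" for m
    by (rule taylor_coeff_eqI[of 1]) (use s in auto)
  ultimately show ?thesis by blast
qed

lemma H2_normsq_real:
  assumes "H2_normsq f < \<infinity>"
  shows "summable (\<lambda>m. (cmod (taylor_coeff f m))\<^sup>2)"
    "H2_normsq f = ennreal (\<Sum>m. (cmod (taylor_coeff f m))\<^sup>2)"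
proof -
  show s: "summable (\<lambda>m. (cmod (taylor_coeff f m))\<^sup>2)"
    using assms unfolding H2_normsq_def
    by (intro summable_suminf_not_top) (auto simp: less_top)
  show "H2_normsq f = ennreal (\<Sum>m. (cmod (taylor_coeff f m))\<^sup>2)"
    unfolding H2_normsq_def using s by (intro suminf_ennreal2) auto
qed

lemma H2_normsq_ge_coeff: "ennreal ((cmod (taylor_coeff f m))\<^sup>2) \<le> H2_normsq f"
proof -
  have "(\<Sum>i\<in>{m}. ennreal ((cmod (taylor_coeff f i))\<^sup>2)) \<le> H2_normsq f"
    unfolding H2_normsq_def by (intro sum_le_suminf) auto
  then show ?thesis by simp
qed

text \<open>Cauchy-Schwarz against the geometric series in \<open>|z|\<^sup>2\<close>.\<close>

lemma H2_growth:
  assumes k: "k holomorphic_on ball 0 1" and K: "H2_normsq k \<le> ennreal K" "0 \<le> K" and z: "cmod z < 1"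
  shows "(cmod (k z))\<^sup>2 \<le> K / (1 - (cmod z)\<^sup>2)"
proof -
  have z2: "(cmod z)\<^sup>2 < 1" using z by (simp add: power_less_one_iff abs_square_less_1)
  have "(cmod (\<Sum>m<n. taylor_coeff k m * z ^ m))\<^sup>2 \<le> K / (1 - (cmod z)\<^sup>2)" for n
  proof -
    have "cmod (\<Sum>m<n. taylor_coeff k m * z ^ m) \<le> (\<Sum>m<n. \<bar>cmod (taylor_coeff k m)\<bar> * \<bar>cmod z ^ m\<bar>)"
      by (rule order_trans[OF norm_sum]) (simp add: norm_mult norm_power)
    also have "\<dots> \<le> L2_set (\<lambda>m. cmod (taylor_coeff k m)) {..<n} * L2_set (\<lambda>m. cmod z ^ m) {..<n}"
      by (rule L2_set_mult_ineq)
    finally have "(cmod (\<Sum>m<n. taylor_coeff k m * z ^ m))\<^sup>2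
        \<le> (L2_set (\<lambda>m. cmod (taylor_coeff k m)) {..<n} * L2_set (\<lambda>m. cmod z ^ m) {..<n})\<^sup>2"
      by (intro power_mono) auto
    also have "\<dots> = (\<Sum>m<n. (cmod (taylor_coeff k m))\<^sup>2) * (\<Sum>m<n. ((cmod z)\<^sup>2) ^ m)"
      by (simp add: L2_set_def power_mult_distrib sum_nonneg power_mult[symmetric] mult.commute)
    also have "\<dots> \<le> K * (1 / (1 - (cmod z)\<^sup>2))"
    proof (rule mult_mono)
      show "(\<Sum>m<n. (cmod (taylor_coeff k m))\<^sup>2) \<le> K"
        by (rule sum_le_if_suminf_ennreal_le) (use K in \<open>auto simp: H2_normsq_def\<close>)
      show "(\<Sum>m<n. ((cmod z)\<^sup>2) ^ m) \<le> 1 / (1 - (cmod z)\<^sup>2)"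
        using z2 sum_le_suminf[of "\<lambda>m. ((cmod z)\<^sup>2) ^ m" "{..<n}"] by (simp add: suminf_geometric)
    qed (use K in \<open>auto intro: sum_nonneg\<close>)
    finally show ?thesis by simp
  qed
  moreover have "(\<lambda>n. (cmod (\<Sum>m<n. taylor_coeff k m * z ^ m))\<^sup>2) \<longlonglongrightarrow> (cmod (k z))\<^sup>2"
    using taylor_sums[OF k z] by (intro tendsto_intros) (simp add: sums_def)
  ultimately show ?thesis
    by (intro LIMSEQ_le_const2) auto
qed

lemma H2_normsq_leI:
  assumes F: "F holomorphic_on ball 0 1" and K: "0 \<le> K"
    and le: "\<And>r. 0 < r \<Longrightarrow> r < 1 \<Longrightarrow>
      (\<integral>\<^sup>+t. ennreal ((cmod (F (circ t * of_real r)))\<^sup>2) * indicator {0..1} t \<partial>lborel) \<le> ennreal K"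
  shows "H2_normsq F \<le> ennreal K"
  unfolding H2_normsq_def
proof (rule suminf_ennreal_le_realI)
  fix N
  have *: "(\<Sum>m\<le>N. (cmod (taylor_coeff F m))\<^sup>2 * (r\<^sup>2) ^ m) \<le> K" if r: "0 < r" "r < 1" for r
  proof (rule sum_le_if_suminf_ennreal_le[OF _ _ K])
    show "(\<Sum>m. ennreal ((cmod (taylor_coeff F m))\<^sup>2 * (r\<^sup>2) ^ m)) \<le> ennreal K"
      using le[OF r] nn_integral_circle_norm_sq[OF F, of "of_real r"] r by (simp add: ennreal_mult)
  qed auto
  have "((\<lambda>r. \<Sum>m\<le>N. (cmod (taylor_coeff F m))\<^sup>2 * (r\<^sup>2) ^ m) \<longlongrightarrow> (\<Sum>m\<le>N. (cmod (taylor_coeff F m))\<^sup>2 * (1\<^sup>2) ^ m)) (at_left 1)"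
    by (intro tendsto_intros)
  moreover have "\<forall>\<^sub>F r in at_left 1. (\<Sum>m\<le>N. (cmod (taylor_coeff F m))\<^sup>2 * (r\<^sup>2) ^ m) \<le> K"
    using eventually_at_left_real[OF zero_less_one] by eventually_elim (use * in auto)
  ultimately show "(\<Sum>m\<le>N. (cmod (taylor_coeff F m))\<^sup>2) \<le> K"
    by (intro tendsto_upperbound[where F = "at_left (1::real)"]) auto
qed auto

lemma circle_integral_le_H2_normsq:
  assumes F: "F holomorphic_on ball 0 1" and r: "0 < r" "r < 1"
  shows "(\<integral>\<^sup>+t. ennreal ((cmod (F (circ t * of_real r)))\<^sup>2) * indicator {0..1} t \<partial>lborel) \<le> H2_normsq F"
proof -
  have "(\<Sum>m. ennreal ((cmod (taylor_coeff F m))\<^sup>2) * ennreal ((r\<^sup>2) ^ m)) \<le> (\<Sum>m. ennreal ((cmod (taylor_coeff F m))\<^sup>2))"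
  proof (intro suminf_le summableI)
    fix m
    have "ennreal ((r\<^sup>2) ^ m) \<le> 1"
      using r by (simp add: power_le_one)
    then show "ennreal ((cmod (taylor_coeff F m))\<^sup>2) * ennreal ((r\<^sup>2) ^ m) \<le> ennreal ((cmod (taylor_coeff F m))\<^sup>2)"
      using mult_left_mono[of "ennreal ((r\<^sup>2) ^ m)" 1 "ennreal ((cmod (taylor_coeff F m))\<^sup>2)"] by simp
  qed
  then show ?thesis
    using nn_integral_circle_norm_sq[OF F, of "of_real r"] r by (simp add: H2_normsq_def)
qed

text \<open>The bound is pointwise on each circle of radius \<open>r < 1\<close>; Parseval and the
  limit \<open>r\<close> to 1 transfer it to coefficients.\<close>

lemma H2_normsq_bounded_mult:
  assumes q: "q holomorphic_on ball 0 1" "\<And>z. cmod z < 1 \<Longrightarrow> cmod (q z) \<le> B"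
    and k: "k holomorphic_on ball 0 1" "H2_normsq k < \<infinity>"
  shows "H2_normsq (\<lambda>z. q z * k z) \<le> ennreal (B\<^sup>2) * H2_normsq k"
proof -
  have "cmod (q 0) \<le> B" by (rule q(2)) simp
  then have B: "0 \<le> B" by (rule order_trans[OF norm_ge_zero])
  have cont: "(\<lambda>t. F (circ t * of_real r)) \<in> borel_measurable borel" if "F holomorphic_on ball 0 1" "0 < r" "r < 1" for F r
  proof (rule borel_measurable_continuous_onI, rule continuous_on_compose2[OF holomorphic_on_imp_continuous_on[OF that(1)]])
    show "range (\<lambda>t. circ t * complex_of_real r) \<subseteq> ball 0 1" using that by (auto simp: norm_mult)
    show "continuous_on UNIV (\<lambda>t. circ t * complex_of_real r)" by (intro continuous_intros)
  qed
  obtain K where K: "H2_normsq k = ennreal K" "0 \<le> K"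
    using k(2) by (metis ennreal_cases infinity_ennreal_def order_less_irrefl)
  have "H2_normsq (\<lambda>z. q z * k z) \<le> ennreal (B\<^sup>2 * K)"
  proof (rule H2_normsq_leI)
    fix r :: real assume r: "0 < r" "r < 1"
    have "(\<integral>\<^sup>+t. ennreal ((cmod (q (circ t * of_real r) * k (circ t * of_real r)))\<^sup>2) * indicator {0..1} t \<partial>lborel)
       \<le> (\<integral>\<^sup>+t. ennreal (B\<^sup>2) * (ennreal ((cmod (k (circ t * of_real r)))\<^sup>2) * indicator {0..1} t) \<partial>lborel)"
    proof (intro nn_integral_mono)
      fix t
      have "cmod (q (circ t * of_real r)) \<le> B" using r by (intro q(2)) (simp add: norm_mult)
      then have "(cmod (q (circ t * of_real r) * k (circ t * of_real r)))\<^sup>2 \<le> B\<^sup>2 * (cmod (k (circ t * of_real r)))\<^sup>2"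
        by (simp add: norm_mult power_mult_distrib mult_right_mono power_mono)
      then show "ennreal ((cmod (q (circ t * of_real r) * k (circ t * of_real r)))\<^sup>2) * indicator {0..1} t
        \<le> ennreal (B\<^sup>2) * (ennreal ((cmod (k (circ t * of_real r)))\<^sup>2) * indicator {0..1} t)"
        unfolding mult.assoc[symmetric] ennreal_mult[OF zero_le_power2 zero_le_power2, symmetric]
        by (intro mult_right_mono ennreal_leI) auto
    qed
    also have "\<dots> = ennreal (B\<^sup>2) * (\<integral>\<^sup>+t. ennreal ((cmod (k (circ t * of_real r)))\<^sup>2) * indicator {0..1} t \<partial>lborel)"
    proof (rule nn_integral_cmult)
      note [measurable] = cont[OF k(1) r]
      show "(\<lambda>t. ennreal ((cmod (k (circ t * of_real r)))\<^sup>2) * indicator {0..1} t) \<in> borel_measurable lborel"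
        by measurable
    qed
    also have "\<dots> \<le> ennreal (B\<^sup>2) * ennreal K"
      unfolding K(1)[symmetric] by (intro mult_left_mono circle_integral_le_H2_normsq k r) auto
    finally show "(\<integral>\<^sup>+t. ennreal ((cmod (q (circ t * of_real r) * k (circ t * of_real r)))\<^sup>2) * indicator {0..1} t \<partial>lborel)
       \<le> ennreal (B\<^sup>2 * K)"
      using K by (simp add: ennreal_mult)
  qed (use K(2) in \<open>auto intro: holomorphic_on_mult q(1) k(1)\<close>)
  then show ?thesis using K by (simp add: ennreal_mult)
qed

lemma cmod_add_sq_le: "(cmod (a + b))\<^sup>2 \<le> 2 * (cmod a)\<^sup>2 + 2 * (cmod b)\<^sup>2"
proof -
  have "(cmod (a + b))\<^sup>2 \<le> (cmod a + cmod b)\<^sup>2"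
    by (intro power_mono norm_triangle_ineq) auto
  also have "\<dots> \<le> 2 * (cmod a)\<^sup>2 + 2 * (cmod b)\<^sup>2"
    using sum_squares_bound[of "cmod a" "cmod b"] by (simp add: power2_sum)
  finally show ?thesis .
qed

lemma suminf_weighted_add_le:
  fixes a b c :: "nat \<Rightarrow> complex" and w :: "nat \<Rightarrow> real"
  assumes "\<And>m. a m = b m + c m" "\<And>m. 0 \<le> w m"
  shows "(\<Sum>m. ennreal (w m * (cmod (a m))\<^sup>2))
    \<le> 2 * (\<Sum>m. ennreal (w m * (cmod (b m))\<^sup>2)) + 2 * (\<Sum>m. ennreal (w m * (cmod (c m))\<^sup>2))"
proof -
  have "(\<Sum>m. ennreal (w m * (cmod (a m))\<^sup>2))
      \<le> (\<Sum>m. 2 * ennreal (w m * (cmod (b m))\<^sup>2) + 2 * ennreal (w m * (cmod (c m))\<^sup>2))"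
  proof (intro suminf_le summableI)
    fix m
    have "w m * (cmod (a m))\<^sup>2 \<le> w m * (2 * (cmod (b m))\<^sup>2 + 2 * (cmod (c m))\<^sup>2)"
      unfolding assms(1) by (intro mult_left_mono cmod_add_sq_le assms)
    then have "ennreal (w m * (cmod (a m))\<^sup>2) \<le> ennreal (2 * (w m * (cmod (b m))\<^sup>2) + 2 * (w m * (cmod (c m))\<^sup>2))"
      by (intro ennreal_leI) (simp add: algebra_simps)
    also have "\<dots> = 2 * ennreal (w m * (cmod (b m))\<^sup>2) + 2 * ennreal (w m * (cmod (c m))\<^sup>2)"
      using assms(2)[of m] by (simp add: ennreal_mult)
    finally show "ennreal (w m * (cmod (a m))\<^sup>2) \<le> 2 * ennreal (w m * (cmod (b m))\<^sup>2) + 2 * ennreal (w m * (cmod (c m))\<^sup>2)" .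
  qed
  then show ?thesis
    by (simp add: suminf_add[OF summableI summableI, symmetric] ennreal_suminf_cmult)
qed

lemma H2_normsq_add_le:
  assumes "f holomorphic_on ball 0 1" "g holomorphic_on ball 0 1"
  shows "H2_normsq (\<lambda>z. f z + g z) \<le> 2 * H2_normsq f + 2 * H2_normsq g"
  unfolding H2_normsq_def
  using suminf_weighted_add_le[where w = "\<lambda>_. 1", OF taylor_coeff_add[OF assms] zero_le_one]
  by (simp only: mult_1_left)

lemma H2_normsq_cmult:
  assumes "f holomorphic_on ball 0 1"
  shows "H2_normsq (\<lambda>z. c * f z) = ennreal ((cmod c)\<^sup>2) * H2_normsq f"
  by (simp add: H2_normsq_def taylor_coeff_cmult[OF assms] norm_mult power_mult_distrib ennreal_mult
      ennreal_suminf_cmult)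

lemma H2_normsq_z_mult:
  assumes "f holomorphic_on ball 0 1"
  shows "H2_normsq (\<lambda>z. z * f z) = H2_normsq f"
proof -
  have "(\<Sum>n. ennreal ((cmod (taylor_coeff (\<lambda>z. z * f z) (n + 1)))\<^sup>2)) = H2_normsq (\<lambda>z. z * f z)"
    unfolding H2_normsq_def by (rule suminf_ennreal_offset) (simp add: taylor_coeff_z_mult[OF assms])
  then show ?thesis
    by (simp add: taylor_coeff_z_mult[OF assms] H2_normsq_def[of f])
qed

text \<open>Decomposition at a boundary point: \<open>\<alpha>\<close> stands for the boundary value
  and \<open>k\<close> for the difference quotient. No growth is imposed on \<open>k\<close>, so
  \<open>\<alpha>\<close> is determined only once \<open>k\<close> lies in the Hardy space.\<close>

definition bdec :: "complex \<Rightarrow> (complex \<Rightarrow> complex) \<Rightarrow> complex \<Rightarrow> (complex \<Rightarrow> complex) \<Rightarrow> bool" where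
  "bdec \<zeta> f \<alpha> k \<longleftrightarrow> k holomorphic_on ball 0 1 \<and> (\<forall>z. cmod z < 1 \<longrightarrow> f z = \<alpha> + (z - \<zeta>) * k z)"

lemma bdec_holomorphic:
  assumes "bdec \<zeta> f \<alpha> k"
  shows "f holomorphic_on ball 0 1"
proof -
  have "(\<lambda>z. \<alpha> + (z - \<zeta>) * k z) holomorphic_on ball 0 1"
    using assms by (auto simp: bdec_def intro!: holomorphic_intros)
  then show ?thesis
    by (rule holomorphic_transform) (use assms in \<open>auto simp: bdec_def\<close>)
qed

lemma bdec_coeff:
  assumes "bdec \<zeta> f \<alpha> k"
  shows "taylor_coeff f 0 = \<alpha> - \<zeta> * taylor_coeff k 0"
    and "taylor_coeff f (Suc m) = taylor_coeff k m - \<zeta> * taylor_coeff k (Suc m)"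
proof -
  have k: "k holomorphic_on ball 0 1" using assms by (simp add: bdec_def)
  have "taylor_coeff f n = taylor_coeff (\<lambda>z. \<alpha> + (z * k z - \<zeta> * k z)) n" for n
    using assms by (intro taylor_coeff_cong) (auto simp: bdec_def algebra_simps intro!: holomorphic_intros)
  also have "\<dots> n = (if n = 0 then \<alpha> else 0) + ((case n of 0 \<Rightarrow> 0 | Suc m \<Rightarrow> taylor_coeff k m) - \<zeta> * taylor_coeff k n)" for n
    using k by (simp add: taylor_coeff_add taylor_coeff_diff taylor_coeff_cmult taylor_coeff_z_mult taylor_coeff_const holomorphic_intros)
  finally have *: "taylor_coeff f n = (if n = 0 then \<alpha> else 0) + ((case n of 0 \<Rightarrow> 0 | Suc m \<Rightarrow> taylor_coeff k m) - \<zeta> * taylor_coeff k n)" for n .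
  show "taylor_coeff f 0 = \<alpha> - \<zeta> * taylor_coeff k 0"
    and "taylor_coeff f (Suc m) = taylor_coeff k m - \<zeta> * taylor_coeff k (Suc m)"
    by (simp_all add: *)
qed

lemma bdecI_coeff:
  assumes f: "f holomorphic_on ball 0 1" and k: "\<And>m. taylor_coeff f (Suc m) = k m - \<zeta> * k (Suc m)"
    and B: "\<And>m. cmod (k m) \<le> B"
  obtains \<alpha> g where "bdec \<zeta> f \<alpha> g" "\<And>m. taylor_coeff g m = k m"
proof -
  obtain g where g: "g holomorphic_on ball 0 1" "\<And>m. taylor_coeff g m = k m"
    using ex_holomorphic_taylor[of k B] B by blast
  define \<alpha> where "\<alpha> = taylor_coeff f 0 + \<zeta> * k 0"
  have h: "(\<lambda>z. \<alpha> + (z - \<zeta>) * g z) holomorphic_on ball 0 1"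
    by (intro holomorphic_intros g)
  have b: "bdec \<zeta> (\<lambda>z. \<alpha> + (z - \<zeta>) * g z) \<alpha> g"
    by (simp add: bdec_def g)
  have "taylor_coeff f m = taylor_coeff (\<lambda>z. \<alpha> + (z - \<zeta>) * g z) m" for m
    by (cases m) (simp_all add: bdec_coeff[OF b] g k, simp add: \<alpha>_def)
  then have "bdec \<zeta> f \<alpha> g"
    using eq_on_disc_if_taylor_coeff_eq[OF f h] g by (auto simp: bdec_def)
  with g show ?thesis by (intro that)
qed

lemma Dloc_le_bdec:
  assumes "cmod \<zeta> = 1" "bdec \<zeta> f \<alpha> k"
  shows "Dloc f \<zeta> \<le> H2_normsq k"
  unfolding H2_normsq_def by (rule Dloc_le[OF assms(1) bdec_coeff(2)[OF assms(2)]])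

lemma Dloc_bdec_ex:
  assumes l: "cmod \<zeta> = 1" and f: "f holomorphic_on ball 0 1" and fin: "Dloc f \<zeta> < \<infinity>"
  obtains \<alpha> k where "bdec \<zeta> f \<alpha> k" "H2_normsq k \<le> Dloc f \<zeta>"
proof -
  obtain k where k: "\<And>m. taylor_coeff f (Suc m) = k m - \<zeta> * k (Suc m)" and K: "(\<Sum>m. ennreal ((cmod (k m))\<^sup>2)) \<le> Dloc f \<zeta>"
    using Dloc_ex[OF l fin] by blast
  define D where "D = enn2real (Dloc f \<zeta>)"
  have D: "Dloc f \<zeta> = ennreal D" "0 \<le> D"
    using fin by (auto simp: D_def less_top)
  have "(\<Sum>i\<in>{m}. (cmod (k i))\<^sup>2) \<le> D" for m
    by (rule sum_le_if_suminf_ennreal_le[OF _ K[unfolded D(1)] D(2)]) auto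
  then have "(cmod (k m))\<^sup>2 \<le> D" for m
    by simp
  then have "cmod (k m) \<le> sqrt D" for m
    by (simp add: real_le_rsqrt)
  from bdecI_coeff[OF f k this] obtain \<alpha> g where "bdec \<zeta> f \<alpha> g" "\<And>m. taylor_coeff g m = k m"
    by blast
  with K show ?thesis by (intro that[of \<alpha> g]) (simp_all add: H2_normsq_def)
qed

text \<open>The radial limit. It pins down the constant of a \<open>bdec\<close> whose quotient lies
  in the Hardy space, and it respects products and bounds.\<close>

definition bval :: "complex \<Rightarrow> (complex \<Rightarrow> complex) \<Rightarrow> complex \<Rightarrow> bool" where
  "bval \<zeta> f \<alpha> \<longleftrightarrow> ((\<lambda>r. f (of_real r * \<zeta>)) \<longlongrightarrow> \<alpha>) (at_left 1)"

lemma bval_unique: "bval \<zeta> f \<alpha> \<Longrightarrow> bval \<zeta> f \<beta> \<Longrightarrow> \<alpha> = \<beta>"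
  unfolding bval_def by (rule tendsto_unique[rotated]) auto

lemma bval_mult: "bval \<zeta> f \<alpha> \<Longrightarrow> bval \<zeta> g \<beta> \<Longrightarrow> bval \<zeta> (\<lambda>z. f z * g z) (\<alpha> * \<beta>)"
  unfolding bval_def by (rule tendsto_mult)

lemma eventually_in_disc: "cmod \<zeta> = 1 \<Longrightarrow> \<forall>\<^sub>F r in at_left 1. cmod (of_real r * \<zeta>) < 1"
  using eventually_at_left_real[OF zero_less_one] by (auto elim!: eventually_mono simp: norm_mult)

lemma bval_bound:
  assumes "cmod \<zeta> = 1" "bval \<zeta> f \<alpha>" "\<And>z. cmod z < 1 \<Longrightarrow> cmod (f z) \<le> B"
  shows "cmod \<alpha> \<le> B"
proof (rule tendsto_upperbound)
  show "((\<lambda>r. cmod (f (of_real r * \<zeta>))) \<longlongrightarrow> cmod \<alpha>) (at_left 1)"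
    using assms(2) unfolding bval_def by (intro tendsto_intros)
  show "\<forall>\<^sub>F r in at_left 1. cmod (f (of_real r * \<zeta>)) \<le> B"
    using eventually_in_disc[OF assms(1)] by eventually_elim (rule assms(3))
qed auto

text \<open>By the Hardy growth bound \<open>k\<close> grows along the radius at most like
  \<open>1 / sqrt (1 - r)\<close>, and the factor \<open>1 - r\<close> in front of it wins.\<close>

lemma bval_bdec:
  assumes l: "cmod \<zeta> = 1" and b: "bdec \<zeta> f \<alpha> k" and fin: "H2_normsq k < \<infinity>"
  shows "bval \<zeta> f \<alpha>"
proof -
  obtain K where K: "H2_normsq k = ennreal K" "0 \<le> K"
    using fin by (metis ennreal_cases infinity_ennreal_def order_less_irrefl)
  have k: "k holomorphic_on ball 0 1" using b by (simp add: bdec_def)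
  have "((\<lambda>r. sqrt K * sqrt (1 - r)) \<longlongrightarrow> sqrt K * sqrt (1 - 1)) (at_left (1::real))"
    by (intro tendsto_intros)
  then have "((\<lambda>r. sqrt K * sqrt (1 - r)) \<longlongrightarrow> 0) (at_left (1::real))"
    by simp
  moreover have "\<forall>\<^sub>F r in at_left 1. norm (f (of_real r * \<zeta>) - \<alpha>) \<le> sqrt K * sqrt (1 - r)"
    using eventually_at_left_real[OF zero_less_one]
  proof eventually_elim
    case (elim r)
    then have r: "0 < r" "r < 1" by auto
    have d: "cmod (of_real r * \<zeta>) = r" using r l by (simp add: norm_mult)
    have r2: "r\<^sup>2 < 1" using r by (simp add: power_less_one_iff abs_square_less_1)
    have eq: "f (of_real r * \<zeta>) - \<alpha> = (of_real r - 1) * \<zeta> * k (of_real r * \<zeta>)"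
      using b d r by (simp add: bdec_def algebra_simps)
    have "(cmod (f (of_real r * \<zeta>) - \<alpha>))\<^sup>2 = (1 - r)\<^sup>2 * (cmod (k (of_real r * \<zeta>)))\<^sup>2"
    proof -
      have "cmod (of_real r - 1) = cmod (of_real (r - 1))" by simp
      also have "\<dots> = 1 - r" unfolding norm_of_real using r by simp
      finally show ?thesis unfolding eq using l by (simp add: norm_mult power_mult_distrib)
    qed
    also have "\<dots> \<le> (1 - r)\<^sup>2 * (K / (1 - r\<^sup>2))"
      using H2_growth[OF k, of K "of_real r * \<zeta>"] K r d by (intro mult_left_mono) auto
    also have "\<dots> = K * (1 - r) * ((1 - r) / (1 - r\<^sup>2))"
      by (simp add: power2_eq_square)
    also have "\<dots> \<le> K * (1 - r) * 1"
      using r r2 K by (intro mult_left_mono) (auto simp: power2_eq_square mult_left_le)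
    finally show ?case
      using K by (simp add: real_le_rsqrt flip: real_sqrt_mult)
  qed
  ultimately have "((\<lambda>r. f (of_real r * \<zeta>) - \<alpha>) \<longlongrightarrow> 0) (at_left 1)"
    by (rule Lim_null_comparison[rotated])
  then show ?thesis
    unfolding bval_def by (rule LIM_zero_cancel)
qed

text \<open>The bound on \<open>\<alpha>\<close> is the decomposition read off at the
  origin.\<close>

lemma Dloc_bval_ex:
  assumes "cmod \<zeta> = 1" "f holomorphic_on ball 0 1" "Dloc f \<zeta> < \<infinity>"
  obtains \<alpha> k where "bdec \<zeta> f \<alpha> k" "H2_normsq k \<le> Dloc f \<zeta>" "bval \<zeta> f \<alpha>"
    "ennreal ((cmod \<alpha>)\<^sup>2) \<le> 2 * ennreal ((cmod (f 0))\<^sup>2) + 2 * Dloc f \<zeta>"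
proof -
  obtain \<alpha> k where b: "bdec \<zeta> f \<alpha> k" and K: "H2_normsq k \<le> Dloc f \<zeta>"
    using Dloc_bdec_ex[OF assms] by blast
  have "\<alpha> = f 0 + \<zeta> * taylor_coeff k 0"
    using bdec_coeff(1)[OF b] by (simp add: taylor_coeff_def)
  then have "(cmod \<alpha>)\<^sup>2 \<le> 2 * (cmod (f 0))\<^sup>2 + 2 * (cmod (taylor_coeff k 0))\<^sup>2"
    using cmod_add_sq_le[of "f 0" "\<zeta> * taylor_coeff k 0"] assms(1) by (simp add: norm_mult)
  then have "ennreal ((cmod \<alpha>)\<^sup>2) \<le> ennreal (2 * (cmod (f 0))\<^sup>2 + 2 * (cmod (taylor_coeff k 0))\<^sup>2)"
    by (rule ennreal_leI)
  also have "\<dots> = 2 * ennreal ((cmod (f 0))\<^sup>2) + 2 * ennreal ((cmod (taylor_coeff k 0))\<^sup>2)"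
    by (simp add: ennreal_mult)
  also have "\<dots> \<le> 2 * ennreal ((cmod (f 0))\<^sup>2) + 2 * Dloc f \<zeta>"
    using H2_normsq_ge_coeff[of k 0] K by (intro add_left_mono mult_left_mono) auto
  finally show ?thesis
    using b K bval_bdec[OF assms(1) b] assms(3) by (intro that) auto
qed

text \<open>If \<open>f = \<alpha> + (z - \<zeta>) k\<close> and
  \<open>q = \<beta> + (z - \<zeta>) g\<close>, then \<open>q f\<close> has the difference quotient
  \<open>\<alpha> g + q k\<close>. So \<open>q\<close> enters once through its sup norm and once
  through its own local integral, weighted by the boundary value of \<open>f\<close>.\<close>

lemma Dloc_mult_le:
  assumes l: "cmod \<zeta> = 1" and f: "f holomorphic_on ball 0 1" and \<alpha>: "bval \<zeta> f \<alpha>"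
    and q: "q holomorphic_on ball 0 1" "\<And>z. cmod z < 1 \<Longrightarrow> cmod (q z) \<le> B"
    and fin: "Dloc f \<zeta> < \<infinity>"
  shows "Dloc (\<lambda>z. q z * f z) \<zeta> \<le> 2 * ennreal ((cmod \<alpha>)\<^sup>2) * Dloc q \<zeta> + 2 * ennreal (B\<^sup>2) * Dloc f \<zeta>"
proof -
  obtain \<alpha>' k where b: "bdec \<zeta> f \<alpha>' k" and K: "H2_normsq k \<le> Dloc f \<zeta>" and "bval \<zeta> f \<alpha>'"
    using Dloc_bval_ex[OF l f fin] by blast
  then have [simp]: "\<alpha>' = \<alpha>" using \<alpha> bval_unique by blast
  have k: "k holomorphic_on ball 0 1" "H2_normsq k < \<infinity>"
    using b K fin by (auto simp: bdec_def)
  have qk: "H2_normsq (\<lambda>z. q z * k z) \<le> ennreal (B\<^sup>2) * Dloc f \<zeta>"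
    using H2_normsq_bounded_mult[OF q k] mult_left_mono[OF K] by (meson order_trans zero_le)
  \<comment> \<open>For \<open>\<alpha> = 0\<close> the bound must hold even if
    \<open>Dloc q \<zeta>\<close> is infinite, because 0 times infinity is 0 in
    \<open>ennreal\<close>; there the quotient of \<open>q\<close> is avoided altogether.\<close>
  consider "\<alpha> = 0" | "\<alpha> \<noteq> 0" "Dloc q \<zeta> = \<infinity>" | "Dloc q \<zeta> < \<infinity>"
    by (metis infinity_ennreal_def top.not_eq_extremum)
  then show ?thesis
  proof cases
    case 1
    have "bdec \<zeta> (\<lambda>z. q z * f z) 0 (\<lambda>z. q z * k z)"
      using b q k 1 by (auto simp: bdec_def intro!: holomorphic_intros)
    then have "Dloc (\<lambda>z. q z * f z) \<zeta> \<le> ennreal (B\<^sup>2) * Dloc f \<zeta>"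
      using Dloc_le_bdec[OF l] qk by (meson order_trans)
    also have "\<dots> \<le> 2 * ennreal (B\<^sup>2) * Dloc f \<zeta>"
      using mult_right_mono[of 1 "2::ennreal" "ennreal (B\<^sup>2) * Dloc f \<zeta>"] by (simp add: mult.assoc)
    finally show ?thesis using 1 by simp
  next
    case 2
    then show ?thesis by (simp add: ennreal_mult_top ennreal_top_mult)
  next
    case 3
    obtain \<beta> g where g: "bdec \<zeta> q \<beta> g" and G: "H2_normsq g \<le> Dloc q \<zeta>"
      using Dloc_bdec_ex[OF l q(1) 3] by blast
    have gh: "g holomorphic_on ball 0 1" using g by (simp add: bdec_def)
    have "bdec \<zeta> (\<lambda>z. q z * f z) (\<alpha> * \<beta>) (\<lambda>z. \<alpha> * g z + q z * k z)"
      unfolding bdec_def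
    proof (intro conjI allI impI holomorphic_intros gh q k)
      fix z :: complex assume z: "cmod z < 1"
      then have f: "f z = \<alpha> + (z - \<zeta>) * k z" and qq: "q z = \<beta> + (z - \<zeta>) * g z"
        using b g by (auto simp: bdec_def)
      have aq: "\<alpha> * q z = \<alpha> * \<beta> + (z - \<zeta>) * (\<alpha> * g z)"
        unfolding qq distrib_left by (simp only: mult.left_commute)
      have "q z * f z = \<alpha> * q z + (z - \<zeta>) * (q z * k z)"
        unfolding f by (simp only: algebra_simps)
      then show "q z * f z = \<alpha> * \<beta> + (z - \<zeta>) * (\<alpha> * g z + q z * k z)"
        unfolding aq by (simp only: distrib_left add.assoc)
    qed
    then have "Dloc (\<lambda>z. q z * f z) \<zeta> \<le> H2_normsq (\<lambda>z. \<alpha> * g z + q z * k z)"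
      by (rule Dloc_le_bdec[OF l])
    also have "\<dots> \<le> 2 * H2_normsq (\<lambda>z. \<alpha> * g z) + 2 * H2_normsq (\<lambda>z. q z * k z)"
      by (intro H2_normsq_add_le holomorphic_intros gh q k)
    also have "\<dots> \<le> 2 * (ennreal ((cmod \<alpha>)\<^sup>2) * Dloc q \<zeta>) + 2 * (ennreal (B\<^sup>2) * Dloc f \<zeta>)"
      unfolding H2_normsq_cmult[OF gh] by (intro add_mono mult_left_mono qk G) auto
    finally show ?thesis by (simp add: mult.assoc)
  qed
qed

section \<open>Reciprocals of functions with prescribed real part on the circle\<close>

text \<open>Two decompositions with Hardy space quotients share the radial limit, hence
  \<open>k\<close> agrees on the disc with the quotient that \<open>Dloc_bval_ex\<close> provides.
  With \<open>Dloc_le_bdec\<close> this makes \<open>Dloc\<close> equal to the Hardy norm of the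
  quotient.\<close>

lemma H2_normsq_le_Dloc:
  assumes l: "cmod \<zeta> = 1" and b: "bdec \<zeta> f \<alpha> k" and fin: "H2_normsq k < \<infinity>"
  shows "H2_normsq k \<le> Dloc f \<zeta>"
proof -
  have f: "f holomorphic_on ball 0 1" using bdec_holomorphic[OF b] .
  have "Dloc f \<zeta> < \<infinity>" using Dloc_le_bdec[OF l b] fin by (rule order_le_less_trans)
  then obtain \<alpha>' k' where b': "bdec \<zeta> f \<alpha>' k'" and K: "H2_normsq k' \<le> Dloc f \<zeta>" and v: "bval \<zeta> f \<alpha>'"
    using Dloc_bval_ex[OF l f] by metis
  have "\<alpha> = \<alpha>'" using v bval_bdec[OF l b fin] bval_unique by blast
  then have "k z = k' z" if "cmod z < 1" for z
  proof -
    have "(z - \<zeta>) * k z = (z - \<zeta>) * k' z" "z \<noteq> \<zeta>"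
      using b b' that l \<open>\<alpha> = \<alpha>'\<close> by (auto simp: bdec_def)
    then show ?thesis by simp
  qed
  then have "H2_normsq k = H2_normsq k'"
    using taylor_coeff_cong[of k' k] b' by (simp add: H2_normsq_def bdec_def)
  with K show ?thesis by simp
qed

lemma circle_taylor:
  assumes F: "F holomorphic_on ball 0 R" and R: "R > 1"
  shows "summable (\<lambda>m. cmod (taylor_coeff F m))" "F (circ t) = (\<Sum>m. taylor_coeff F m * circ t ^ m)"
proof -
  define r where "r = (1 + R) / 2"
  have r: "1 < r" "r < R" using R by (auto simp: r_def)
  have s: "(\<lambda>m. taylor_coeff F m * z ^ m) sums F z" if "cmod z < R" for z
    using holomorphic_power_series[OF F, of z] that by (simp add: taylor_coeff_def)
  have "summable (\<lambda>m. taylor_coeff F m * of_real r ^ m)"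
    using s[of "of_real r"] r by (auto simp: sums_iff)
  then have "summable (\<lambda>m. cmod (taylor_coeff F m * 1 ^ m))"
    by (rule powser_insidea) (use r in auto)
  then show "summable (\<lambda>m. cmod (taylor_coeff F m))" by simp
  show "F (circ t) = (\<Sum>m. taylor_coeff F m * circ t ^ m)"
    using s[of "circ t"] R by (simp add: sums_iff)
qed

text \<open>With \<open>R > 1\<close> the Taylor series is absolutely summable on the circle itself,
  so Parseval applies there directly. The last claim is the mean value property of
  \<open>z F(z)\<close> at the origin.\<close>

lemma
  assumes F: "F holomorphic_on ball 0 R" and R: "R > 1"
  shows H2_normsq_circle: "H2_normsq F = ennreal (integral {0..1} (\<lambda>t. (cmod (F (circ t)))\<^sup>2))"
    and circle_norm_sq_integrable: "(\<lambda>t. (cmod (F (circ t)))\<^sup>2) integrable_on {0..1}"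
    and circle_mean_zero: "((\<lambda>t. circ t * F (circ t)) has_integral 0) {0..1}"
proof -
  note s = circle_taylor(1)[OF F R] and Fc = circle_taylor(2)[OF F R]
  show "(\<lambda>t. (cmod (F (circ t)))\<^sup>2) integrable_on {0..1}"
    unfolding Fc using circ_parseval(1)[OF s] by blast
  have "integral {0..1} (\<lambda>t. (cmod (F (circ t)))\<^sup>2) = (\<Sum>m. (cmod (taylor_coeff F m))\<^sup>2)"
    unfolding Fc by (rule integral_unique[OF circ_parseval(1)[OF s]])
  moreover have "H2_normsq F = ennreal (\<Sum>m. (cmod (taylor_coeff F m))\<^sup>2)"
    unfolding H2_normsq_def by (intro suminf_ennreal2 circ_parseval(2)[OF s]) auto
  ultimately show "H2_normsq F = ennreal (integral {0..1} (\<lambda>t. (cmod (F (circ t)))\<^sup>2))"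
    by (simp only:)
  have "continuous_on UNIV (\<lambda>t. F (circ t))"
    by (rule continuous_on_compose2[OF holomorphic_on_imp_continuous_on[OF F]]) (use R in \<open>auto intro!: continuous_intros\<close>)
  then have c: "continuous_on {0..1} (\<lambda>t. circ t * F (circ t))"
    by (intro continuous_intros) (auto intro: continuous_on_subset)
  have "integral {0..1} (\<lambda>t. circ t * F (circ t)) = 0"
    using circ_coeff_neg[OF s, of 0] unfolding Fc[symmetric] by (simp add: mult.commute)
  then show "((\<lambda>t. circ t * F (circ t)) has_integral 0) {0..1}"
    using integrable_integral[OF integrable_continuous_real[OF c]] by simp
qed

lemma ex_difference_quotient:
  fixes F :: "complex \<Rightarrow> complex"
  assumes "F holomorphic_on S" "open S"
  obtains k where "k holomorphic_on S" "\<And>z. z \<in> S \<Longrightarrow> F z = F a + (z - a) * k z"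
proof -
  define k where "k = (\<lambda>z. if z = a then deriv (\<lambda>z. F z - F a) a else (F z - F a) / (z - a))"
  have "k holomorphic_on S"
    by (rule pole_theorem_open_0[of "\<lambda>z. F z - F a" S a]) (use assms in \<open>auto simp: k_def intro!: holomorphic_intros\<close>)
  moreover have "F z = F a + (z - a) * k z" for z
    by (simp add: k_def)
  ultimately show ?thesis by (intro that)
qed

text \<open>The right-hand side is the real part of a holomorphic function of \<open>A\<close>, \<open>p\<close>, \<open>q\<close> that
  vanishes to second order at the base point; this is what makes the local Dirichlet integrals
  of \<open>1 / A\<close>, \<open>p / A\<close>, \<open>q / A\<close> computable.\<close>
lemma norm_sq_difference_identity:
  fixes A B p p' q q' :: complex
  assumes A: "Re A = 1 + (cmod p)\<^sup>2 + (cmod q)\<^sup>2" and B: "Re B = 1 + (cmod p')\<^sup>2 + (cmod q')\<^sup>2"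
  shows "(cmod (1 / A - 1 / B))\<^sup>2 + (cmod (p / A - p' / B))\<^sup>2 + (cmod (q / A - q' / B))\<^sup>2
      - (cmod (1 / B))\<^sup>2 * ((cmod (p - p'))\<^sup>2 + (cmod (q - q'))\<^sup>2)
    = Re ((1 / A) * of_real ((cmod (1 / B))\<^sup>2) * ((B - A) * (A + cnj B - 2 * (1 + p * cnj p' + q * cnj q'))))"
proof -
  have "Re A \<noteq> 0" "Re B \<noteq> 0" using A B by (smt (verit) zero_le_power2)+
  then have nz: "A \<noteq> 0" "B \<noteq> 0" by auto
  \<comment> \<open>The common denominator; multiplied by it, the claim becomes polynomial in the
    six numbers and their conjugates.\<close>
  define N where "N = (cmod A)\<^sup>2 * (cmod B)\<^sup>2"
  have N: "N \<noteq> 0" using nz by (simp add: N_def)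
  have quot: "N * (cmod (x / A - y / B))\<^sup>2 = (cmod (x * B - y * A))\<^sup>2" for x y
  proof -
    have "x / A - y / B = (x * B - y * A) / (A * B)" using nz by (simp add: field_simps)
    then show ?thesis using nz by (simp add: N_def norm_divide norm_mult power_divide power_mult_distrib)
  qed
  have main: "(cmod (1 * B - 1 * A))\<^sup>2 + (cmod (p * B - p' * A))\<^sup>2 + (cmod (q * B - q' * A))\<^sup>2
      - (cmod A)\<^sup>2 * ((cmod (p - p'))\<^sup>2 + (cmod (q - q'))\<^sup>2)
    = Re (cnj A * ((B - A) * (A + cnj B - 2 * (1 + p * cnj p' + q * cnj q'))))"
  proof -
    define e where "e = 1 + p * cnj p' + q * cnj q'"
    have d: "(cmod (x - y))\<^sup>2 = (cmod x)\<^sup>2 + (cmod y)\<^sup>2 - 2 * Re (x * cnj y)" for x y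
      unfolding cmod_power2 by (simp add: power2_eq_square algebra_simps)
    have "B * cnj A + p * B * cnj (p' * A) + q * B * cnj (q' * A) = B * cnj A * e"
      by (simp add: e_def algebra_simps)
    from arg_cong[OF this, of Re]
    have 1: "Re (B * cnj A) + Re (p * B * cnj (p' * A)) + Re (q * B * cnj (q' * A)) = Re (B * cnj A * e)"
      by simp
    have 2: "(cmod (1 * B - 1 * A))\<^sup>2 + (cmod (p * B - p' * A))\<^sup>2 + (cmod (q * B - q' * A))\<^sup>2
        = (cmod B)\<^sup>2 * Re A + (cmod A)\<^sup>2 * Re B - 2 * Re (B * cnj A * e)"
      unfolding d A B 1[symmetric] by (simp add: norm_mult power_mult_distrib algebra_simps)
    have 3: "(cmod (p - p'))\<^sup>2 + (cmod (q - q'))\<^sup>2 = Re A + Re B - 2 * Re e"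
      unfolding d A B e_def by simp
    have "cnj A * ((B - A) * (A + cnj B - 2 * e)) = of_real ((cmod A)\<^sup>2) * B + of_real ((cmod B)\<^sup>2) * cnj A
        - 2 * (B * cnj A * e) - of_real ((cmod A)\<^sup>2) * A - of_real ((cmod A)\<^sup>2) * cnj B + 2 * (of_real ((cmod A)\<^sup>2) * e)"
      unfolding complex_norm_square by (simp add: algebra_simps)
    then have 4: "Re (cnj A * ((B - A) * (A + cnj B - 2 * e))) = Re (of_real ((cmod A)\<^sup>2) * B) + Re (of_real ((cmod B)\<^sup>2) * cnj A)
        - 2 * Re (B * cnj A * e) - Re (of_real ((cmod A)\<^sup>2) * A) - Re (of_real ((cmod A)\<^sup>2) * cnj B) + 2 * Re (of_real ((cmod A)\<^sup>2) * e)"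
      by simp
    have r: "Re (of_real x * y) = x * Re y" for x y by simp
    show ?thesis
      unfolding e_def[symmetric] 2 3 4 r by (simp add: algebra_simps)
  qed
  have "N * ((cmod (1 / A - 1 / B))\<^sup>2 + (cmod (p / A - p' / B))\<^sup>2 + (cmod (q / A - q' / B))\<^sup>2
      - (cmod (1 / B))\<^sup>2 * ((cmod (p - p'))\<^sup>2 + (cmod (q - q'))\<^sup>2))
    = (cmod (1 * B - 1 * A))\<^sup>2 + (cmod (p * B - p' * A))\<^sup>2 + (cmod (q * B - q' * A))\<^sup>2
      - (cmod A)\<^sup>2 * ((cmod (p - p'))\<^sup>2 + (cmod (q - q'))\<^sup>2)"
    unfolding right_diff_distrib distrib_left quot
    using nz by (simp add: N_def norm_divide power_divide)
  also have "\<dots> = N * Re ((1 / A) * of_real ((cmod (1 / B))\<^sup>2) * ((B - A) * (A + cnj B - 2 * (1 + p * cnj p' + q * cnj q'))))"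
  proof -
    have r: "Re (of_real x * y) = x * Re y" for x y by simp
    define X where "X = (B - A) * (A + cnj B - 2 * (1 + p * cnj p' + q * cnj q'))"
    have "of_real N * ((1 / A) * of_real ((cmod (1 / B))\<^sup>2)) = cnj A"
    proof -
      have "of_real N * ((1 / A) * of_real ((cmod (1 / B))\<^sup>2)) = of_real ((cmod A)\<^sup>2) / A"
        using nz by (simp add: N_def norm_divide power_divide)
      also have "\<dots> = cnj A"
        unfolding complex_norm_square using nz by simp
      finally show ?thesis .
    qed
    then have "cnj A * X = of_real N * ((1 / A) * of_real ((cmod (1 / B))\<^sup>2) * X)"
      by (metis mult.assoc)
    then have "Re (cnj A * X) = N * Re ((1 / A) * of_real ((cmod (1 / B))\<^sup>2) * X)"
      by (simp only: r)
    then show ?thesis unfolding main X_def .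
  qed
  finally show ?thesis using N by simp
qed

text \<open>On the circle \<open>(z - w)\<^sup>2 = - |z - w|\<^sup>2 w z\<close>. Divided by
  \<open>|z - w|\<^sup>2\<close>, the real part of a function with a double zero at \<open>w\<close>
  is therefore the real part of \<open>z\<close> times a holomorphic function, which has circle mean
  zero.\<close>

lemma on_circle_Re_part:
  assumes z: "cmod z = 1" and w: "cmod w = 1" and ne: "z \<noteq> w"
  shows "Re ((z - w)\<^sup>2 * h) = - (cmod (z - w))\<^sup>2 * Re (w * z * h)"
proof -
  have zz: "z * cnj z = 1" "w * cnj w = 1" using z w by (simp_all add: complex_norm_square[symmetric])
  have "(z - w)\<^sup>2 = - (of_real ((cmod (z - w))\<^sup>2) * (w * z))"
  proof -
    have "of_real ((cmod (z - w))\<^sup>2) * (w * z) = (z - w) * (w * (z * cnj z) - z * (w * cnj w))"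
      unfolding complex_norm_square by (simp add: algebra_simps)
    then show ?thesis by (simp add: zz power2_eq_square algebra_simps)
  qed
  then have "(z - w)\<^sup>2 * h = of_real (- (cmod (z - w))\<^sup>2) * (w * z * h)"
    by simp
  moreover have "Re (of_real x * y) = x * Re y" for x y by simp
  ultimately show ?thesis by (simp only:)
qed

text \<open>Dividing \<open>norm_sq_difference_identity\<close> by
  \<open>|z - \<zeta>|\<^sup>2\<close> and integrating over the circle gives an equality between
  Hardy norms of difference quotients, since the right-hand side has mean zero. The sup bounds come
  from \<open>x \<le> 1 + x\<^sup>2\<close> on the circle. The factor
  \<open>|u(\<zeta>)|\<^sup>2\<close> in the last claim is what later absorbs boundary
  values.\<close>

lemma outer_reciprocal:
  assumes hA: "A holomorphic_on UNIV" and hp: "p holomorphic_on UNIV" and hq: "q holomorphic_on UNIV"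
    and re: "\<And>z. cmod z = 1 \<Longrightarrow> Re (A z) = 1 + (cmod (p z))\<^sup>2 + (cmod (q z))\<^sup>2"
  defines "u \<equiv> \<lambda>z. 1 / A z"
  shows "u holomorphic_on ball 0 1"
    and "\<And>z. cmod z \<le> 1 \<Longrightarrow> cmod (u z) \<le> 1 \<and> cmod (u z * p z) \<le> 1 \<and> cmod (u z * q z) \<le> 1"
    and "\<And>\<zeta>. cmod \<zeta> = 1 \<Longrightarrow> Dloc u \<zeta> + Dloc (\<lambda>z. u z * p z) \<zeta> + Dloc (\<lambda>z. u z * q z) \<zeta>
           \<le> ennreal ((cmod (u \<zeta>))\<^sup>2) * (Dloc p \<zeta> + Dloc q \<zeta>)"
proof -
  have max: "cmod (F z) \<le> B" if F: "F holomorphic_on S" "open S" "cball 0 1 \<subseteq> S"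
    and "\<And>z. cmod z = 1 \<Longrightarrow> cmod (F z) \<le> B" "cmod z \<le> 1" for F S B z
  proof (rule maximum_modulus_frontier[where S = "cball 0 1" and f = F and \<xi> = z and B = B])
    show "F holomorphic_on interior (cball 0 1)"
      using holomorphic_on_subset[OF F(1) order_trans[OF ball_subset_cball F(3)]] by simp
    show "continuous_on (closure (cball 0 1)) F"
      using F by (auto intro: holomorphic_on_imp_continuous_on holomorphic_on_subset)
  qed (use that in auto)
  have reA: "Re (A z) \<ge> 1" if "cmod z \<le> 1" for z
  proof -
    \<comment> \<open>A lower bound for \<open>Re A\<close> is an upper bound for the modulus of
      \<open>exp (- A)\<close>, to which the maximum principle applies.\<close>
    have m: "cmod (exp (- A w)) \<le> exp (- 1)" if "cmod w = 1" for w
      using re[OF that] by simp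
    have h: "(\<lambda>z. exp (- A z)) holomorphic_on UNIV"
      by (intro holomorphic_intros hA)
    have "cmod (exp (- A z)) \<le> exp (- 1)"
      by (rule max[OF h open_UNIV subset_UNIV m that])
    then show ?thesis by simp
  qed
  have contA: "continuous_on UNIV A" using hA by (rule holomorphic_on_imp_continuous_on)
  have "open {z. 0 < Re (A z)}"
    by (intro open_Collect_less continuous_intros contA)
  moreover have "cball 0 1 \<subseteq> {z. 0 < Re (A z)}"
    using reA by (force intro: less_le_trans[OF zero_less_one])
  ultimately obtain \<epsilon> where \<epsilon>: "\<epsilon> > 0" "(\<Union>x\<in>cball 0 1. ball x \<epsilon>) \<subseteq> {z. 0 < Re (A z)}"
    using compact_subset_open_imp_ball_epsilon_subset[OF compact_cball] by metis
  \<comment> \<open>By compactness \<open>Re A\<close> stays positive slightly beyond the closed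
    disc, so \<open>u\<close> and the quotients below are holomorphic across the circle.\<close>
  define R where "R = 1 + \<epsilon>"
  have R: "R > 1" using \<epsilon> by (simp add: R_def)
  have Anz: "A z \<noteq> 0" if "z \<in> ball 0 R" for z
  proof -
    have "z \<in> (\<Union>x\<in>cball 0 1. ball x \<epsilon>)"
    proof (cases "cmod z \<le> 1")
      case True
      then show ?thesis using \<epsilon>(1) by (intro UN_I[of z]) auto
    next
      case False
      have "sgn z \<in> cball 0 1" by (simp add: norm_sgn)
      moreover have "dist (sgn z) z < \<epsilon>"
      proof -
        have "z = of_real (cmod z) * sgn z" by (simp add: sgn_eq)
        then have "sgn z - z = of_real (1 - cmod z) * sgn z" by (simp add: algebra_simps)
        then have "cmod (sgn z - z) = \<bar>1 - cmod z\<bar> * cmod (sgn z)" by (simp only: norm_mult norm_of_real)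
        then show ?thesis using False that by (auto simp: dist_norm norm_sgn R_def)
      qed
      ultimately show ?thesis by auto
    qed
    then have "0 < Re (A z)" using \<epsilon>(2) by blast
    then show ?thesis by auto
  qed
  have hu: "u holomorphic_on ball 0 R"
    unfolding u_def by (intro holomorphic_intros holomorphic_on_subset[OF hA]) (use Anz in auto)
  have sub: "ball 0 1 \<subseteq> ball (0::complex) R" "cball 0 1 \<subseteq> ball (0::complex) R" using R by auto
  show hu1: "u holomorphic_on ball 0 1" using hu sub by (auto intro: holomorphic_on_subset)
  have hR: "F holomorphic_on ball 0 R" if "F holomorphic_on UNIV" for F
    using that by (rule holomorphic_on_subset) auto
  have Abig: "cmod (A z) \<ge> 1 + (cmod (p z))\<^sup>2 + (cmod (q z))\<^sup>2" if "cmod z = 1" for z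
    using re[OF that] complex_Re_le_cmod[of "A z"] by simp
  have le1: "x \<le> 1 + x\<^sup>2 + y" if "0 \<le> y" for x y :: real
    using that sum_squares_bound[of x 1] by (smt (verit) power2_eq_square mult_1_right one_power2 zero_le_power2)
  have "cmod (u z) \<le> 1 \<and> cmod (u z * p z) \<le> 1 \<and> cmod (u z * q z) \<le> 1" if z: "cmod z = 1" for z
  proof -
    have 1: "cmod (A z) \<ge> 1" "cmod (A z) \<ge> cmod (p z)" "cmod (A z) \<ge> cmod (q z)"
      using Abig[OF z] le1[of "(cmod (q z))\<^sup>2" "cmod (p z)"] le1[of "(cmod (p z))\<^sup>2" "cmod (q z)"]
      by (smt (verit) zero_le_power2)+
    then show ?thesis by (auto simp: u_def norm_divide divide_le_eq)
  qed
  then show bnd: "cmod (u z) \<le> 1 \<and> cmod (u z * p z) \<le> 1 \<and> cmod (u z * q z) \<le> 1" if "cmod z \<le> 1" for z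
    using max[of u "ball 0 R" 1 z] max[of "\<lambda>z. u z * p z" "ball 0 R" 1 z] max[of "\<lambda>z. u z * q z" "ball 0 R" 1 z]
      that hu hR[OF hp] hR[OF hq] sub by (auto intro!: holomorphic_on_mult)
  fix \<zeta> :: complex assume l: "cmod \<zeta> = 1"
  define s where "s = u \<zeta>"
  obtain kA where kA: "kA holomorphic_on UNIV" "\<And>z. A z = A \<zeta> + (z - \<zeta>) * kA z"
    using ex_difference_quotient[OF hA open_UNIV] by (metis UNIV_I)
  obtain kp where kp: "kp holomorphic_on UNIV" "\<And>z. p z = p \<zeta> + (z - \<zeta>) * kp z"
    using ex_difference_quotient[OF hp open_UNIV] by (metis UNIV_I)
  obtain kq where kq: "kq holomorphic_on UNIV" "\<And>z. q z = q \<zeta> + (z - \<zeta>) * kq z"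
    using ex_difference_quotient[OF hq open_UNIV] by (metis UNIV_I)
  have Al: "A \<zeta> \<noteq> 0" using Anz[of \<zeta>] l R by auto
  \<comment> \<open>Difference quotients at \<open>\<zeta>\<close> of \<open>u\<close>,
    \<open>u p\<close> and \<open>u q\<close>: the first from \<open>1 / A - 1 / A(\<zeta>)\<close>,
    the other two by the product rule.\<close>
  define K1 where "K1 = (\<lambda>z. - u z * s * kA z)"
  define K2 where "K2 = (\<lambda>z. u z * kp z + p \<zeta> * K1 z)"
  define K3 where "K3 = (\<lambda>z. u z * kq z + q \<zeta> * K1 z)"
  have hK: "K1 holomorphic_on ball 0 R" "K2 holomorphic_on ball 0 R" "K3 holomorphic_on ball 0 R"
    unfolding K1_def K2_def K3_def by (intro holomorphic_intros hu hR kA kp kq)+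
  have u1: "u z = s + (z - \<zeta>) * K1 z" if "z \<in> ball 0 R" for z
  proof -
    have "u z - s = - (u z * s * (A z - A \<zeta>))"
      using Anz[OF that] Al by (simp add: u_def s_def field_simps)
    also have "A z - A \<zeta> = (z - \<zeta>) * kA z" using kA(2)[of z] by simp
    finally show ?thesis by (simp add: K1_def algebra_simps)
  qed
  have u2: "u z * p z = s * p \<zeta> + (z - \<zeta>) * K2 z" if "z \<in> ball 0 R" for z
  proof -
    have "u z * p z = p \<zeta> * u z + (z - \<zeta>) * (u z * kp z)"
      by (subst kp(2)) (simp add: algebra_simps)
    also have "p \<zeta> * u z = s * p \<zeta> + (z - \<zeta>) * (p \<zeta> * K1 z)"
      by (subst u1[OF that]) (simp add: algebra_simps)
    finally show ?thesis by (simp add: K2_def algebra_simps)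
  qed
  have u3: "u z * q z = s * q \<zeta> + (z - \<zeta>) * K3 z" if "z \<in> ball 0 R" for z
  proof -
    have "u z * q z = q \<zeta> * u z + (z - \<zeta>) * (u z * kq z)"
      by (subst kq(2)) (simp add: algebra_simps)
    also have "q \<zeta> * u z = s * q \<zeta> + (z - \<zeta>) * (q \<zeta> * K1 z)"
      by (subst u1[OF that]) (simp add: algebra_simps)
    finally show ?thesis by (simp add: K3_def algebra_simps)
  qed
  have h1: "F holomorphic_on ball 0 1" if "F holomorphic_on ball 0 R" for F
    using that sub by (auto intro: holomorphic_on_subset)
  have b: "bdec \<zeta> u s K1" "bdec \<zeta> (\<lambda>z. u z * p z) (s * p \<zeta>) K2" "bdec \<zeta> (\<lambda>z. u z * q z) (s * q \<zeta>) K3"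
    "bdec \<zeta> p (p \<zeta>) kp" "bdec \<zeta> q (q \<zeta>) kq"
    unfolding bdec_def by (intro conjI allI impI h1 hK hR kp kq u1 u2 u3; use R in simp)+
  \<comment> \<open>The last factor of the identity, \<open>A + cnj (A \<zeta>) - 2 (1 + p cnj (p
    \<zeta>) + q cnj (q \<zeta>))\<close>, vanishes at \<open>\<zeta>\<close> by \<open>re\<close>,
    and this is its difference quotient. Together with the zero of \<open>A \<zeta> - A z\<close> it
    yields the double zero.\<close>
  define kQ where "kQ = (\<lambda>z. kA z - 2 * cnj (p \<zeta>) * kp z - 2 * cnj (q \<zeta>) * kq z)"
  define H where "H = (\<lambda>z. \<zeta> * of_real ((cmod s)\<^sup>2) * u z * kA z * kQ z)"
  have hH: "H holomorphic_on ball 0 R"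
    unfolding H_def kQ_def by (intro holomorphic_intros hu hR kA kp kq)
  have point: "(cmod (K1 z))\<^sup>2 + (cmod (K2 z))\<^sup>2 + (cmod (K3 z))\<^sup>2 - (cmod s)\<^sup>2 * ((cmod (kp z))\<^sup>2 + (cmod (kq z))\<^sup>2) = Re (z * H z)"
    if z: "cmod z = 1" and ne: "z \<noteq> \<zeta>" for z
  proof -
    have zR: "z \<in> ball 0 R" using z R by simp
    define w where "w = z - \<zeta>"
    have w: "w \<noteq> 0" using ne by (simp add: w_def)
    have e: "1 / A z - 1 / A \<zeta> = w * K1 z" "p z / A z - p \<zeta> / A \<zeta> = w * K2 z" "q z / A z - q \<zeta> / A \<zeta> = w * K3 z"
      "p z - p \<zeta> = w * kp z" "q z - q \<zeta> = w * kq z"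
    proof -
      have "x - y = w * K" if "x = y + (z - \<zeta>) * K" for x y K
        using that by (simp add: w_def)
      note * = this[OF u1[OF zR]] this[OF u2[OF zR]] this[OF u3[OF zR]] this[OF kp(2)] this[OF kq(2)]
      show "1 / A z - 1 / A \<zeta> = w * K1 z" "p z / A z - p \<zeta> / A \<zeta> = w * K2 z" "q z / A z - q \<zeta> / A \<zeta> = w * K3 z"
        "p z - p \<zeta> = w * kp z" "q z - q \<zeta> = w * kq z"
        using * by (simp_all add: u_def s_def)
    qed
    have Aw: "A \<zeta> - A z = - (w * kA z)" using kA(2)[of z] by (simp add: w_def)
    have "A \<zeta> + cnj (A \<zeta>) = of_real (2 * Re (A \<zeta>))" by (simp add: complex_add_cnj)
    also have "\<dots> = 2 + 2 * p \<zeta> * cnj (p \<zeta>) + 2 * q \<zeta> * cnj (q \<zeta>)"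
      unfolding re[OF l] by (simp add: mult.assoc flip: complex_norm_square)
    finally have "cnj (A \<zeta>) = 2 + 2 * p \<zeta> * cnj (p \<zeta>) + 2 * q \<zeta> * cnj (q \<zeta>) - A \<zeta>"
      by (simp add: algebra_simps)
    then have Q: "A z + cnj (A \<zeta>) - 2 * (1 + p z * cnj (p \<zeta>) + q z * cnj (q \<zeta>)) = w * kQ z"
    proof -
      assume c: "cnj (A \<zeta>) = 2 + 2 * p \<zeta> * cnj (p \<zeta>) + 2 * q \<zeta> * cnj (q \<zeta>) - A \<zeta>"
      have "A z + cnj (A \<zeta>) - 2 * (1 + p z * cnj (p \<zeta>) + q z * cnj (q \<zeta>))
        = (A z - A \<zeta>) - 2 * cnj (p \<zeta>) * (p z - p \<zeta>) - 2 * cnj (q \<zeta>) * (q z - q \<zeta>)"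
        unfolding c by (simp add: algebra_simps)
      also have "\<dots> = w * kQ z"
        unfolding e kQ_def using Aw by (simp add: algebra_simps)
      finally show ?thesis .
    qed
    have "(cmod w)\<^sup>2 * ((cmod (K1 z))\<^sup>2 + (cmod (K2 z))\<^sup>2 + (cmod (K3 z))\<^sup>2 - (cmod s)\<^sup>2 * ((cmod (kp z))\<^sup>2 + (cmod (kq z))\<^sup>2))
      = (cmod (w * K1 z))\<^sup>2 + (cmod (w * K2 z))\<^sup>2 + (cmod (w * K3 z))\<^sup>2 - (cmod s)\<^sup>2 * ((cmod (w * kp z))\<^sup>2 + (cmod (w * kq z))\<^sup>2)"
      by (simp add: norm_mult power_mult_distrib algebra_simps)
    also have "\<dots> = Re ((1 / A z) * of_real ((cmod (1 / A \<zeta>))\<^sup>2) * ((A \<zeta> - A z) * (w * kQ z)))"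
      using norm_sq_difference_identity[OF re[OF z] re[OF l]] unfolding e Q by (simp add: s_def u_def)
    also have "\<dots> = Re (w\<^sup>2 * (- (u z * of_real ((cmod s)\<^sup>2) * kA z * kQ z)))"
      unfolding Aw s_def u_def by (simp add: power2_eq_square mult_ac)
    also have "\<dots> = - (cmod w)\<^sup>2 * Re (\<zeta> * z * (- (u z * of_real ((cmod s)\<^sup>2) * kA z * kQ z)))"
      unfolding w_def by (rule on_circle_Re_part[OF z l ne])
    also have "\<zeta> * z * (- (u z * of_real ((cmod s)\<^sup>2) * kA z * kQ z)) = - (z * H z)"
      by (simp add: H_def mult_ac)
    also have "- (cmod w)\<^sup>2 * Re (- (z * H z)) = (cmod w)\<^sup>2 * Re (z * H z)"
      by (simp only: uminus_complex.sel mult_minus_left mult_minus_right minus_minus)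
    finally show ?thesis using w by simp
  qed
  \<comment> \<open>The pointwise identity excludes \<open>z = \<zeta>\<close>; only finitely many
    parameters are affected, so the integral does not change.\<close>
  have fin: "finite {t \<in> {0..1}. circ t = \<zeta>}"
  proof (cases "{t \<in> {0..1}. circ t = \<zeta>} = {}")
    case False
    then obtain s where s: "s \<in> {0..1}" "circ s = \<zeta>" by blast
    have c: "circlepath 0 1 t = circ t" for t
      by (simp add: circlepath circ_def cis_conv_exp mult_ac)
    have "loop_free (circlepath 0 1)"
      using simple_path_circlepath[of 0 1] by (simp add: simple_path_def)
    then have "t = s \<or> t = 0 \<or> t = 1" if "t \<in> {0..1}" "circ t = \<zeta>" for t
      using that s unfolding loop_free_def c by metis
    then have "{t \<in> {0..1}. circ t = \<zeta>} \<subseteq> {s, 0, 1}" by blast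
    then show ?thesis by (rule finite_subset) simp
  qed (simp only: finite.emptyI)
  have "((\<lambda>t. Re (circ t * H (circ t))) has_integral 0) {0..1}"
    using has_integral_Re[OF circle_mean_zero[OF hH R]] by simp
  then have I0: "((\<lambda>t. (cmod (K1 (circ t)))\<^sup>2 + (cmod (K2 (circ t)))\<^sup>2 + (cmod (K3 (circ t)))\<^sup>2
      - (cmod s)\<^sup>2 * ((cmod (kp (circ t)))\<^sup>2 + (cmod (kq (circ t)))\<^sup>2)) has_integral 0) {0..1}"
    by (rule has_integral_spike_finite[OF fin, rotated]) (simp add: point)
  define J where "J = (\<lambda>F. integral {0..1} (\<lambda>t. (cmod (F (circ t)))\<^sup>2))"
  have J: "((\<lambda>t. (cmod (F (circ t)))\<^sup>2) has_integral J F) {0..1}" "H2_normsq F = ennreal (J F)" "0 \<le> J F"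
    if "F holomorphic_on ball 0 R" for F
    unfolding J_def using circle_norm_sq_integrable[OF that R] H2_normsq_circle[OF that R]
    by (auto intro: integrable_integral integral_nonneg)
  have "J K1 + J K2 + J K3 - (cmod s)\<^sup>2 * (J kp + J kq) = 0"
    by (rule has_integral_unique[OF _ I0])
       (intro has_integral_add has_integral_diff has_integral_mult_right J hK hR kp kq)
  then have "ennreal (J K1 + J K2 + J K3) = ennreal ((cmod s)\<^sup>2 * (J kp + J kq))" by simp
  then have eq: "H2_normsq K1 + H2_normsq K2 + H2_normsq K3 = ennreal ((cmod s)\<^sup>2) * (H2_normsq kp + H2_normsq kq)"
    using J(3)[OF hK(1)] J(3)[OF hK(2)] J(3)[OF hK(3)] J(3)[OF hR[OF kp(1)]] J(3)[OF hR[OF kq(1)]]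
    by (simp add: J(2) hK hR kp kq ennreal_mult ennreal_plus add_nonneg_nonneg)
  have "Dloc u \<zeta> + Dloc (\<lambda>z. u z * p z) \<zeta> + Dloc (\<lambda>z. u z * q z) \<zeta> \<le> H2_normsq K1 + H2_normsq K2 + H2_normsq K3"
    by (intro add_mono Dloc_le_bdec[OF l b(1)] Dloc_le_bdec[OF l b(2)] Dloc_le_bdec[OF l b(3)])
  also have "\<dots> \<le> ennreal ((cmod s)\<^sup>2) * (Dloc p \<zeta> + Dloc q \<zeta>)"
    unfolding eq
    by (intro mult_left_mono add_mono H2_normsq_le_Dloc[OF l b(4)] H2_normsq_le_Dloc[OF l b(5)])
       (auto simp: J(2) hR kp kq)
  finally show "Dloc u \<zeta> + Dloc (\<lambda>z. u z * p z) \<zeta> + Dloc (\<lambda>z. u z * q z) \<zeta>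
           \<le> ennreal ((cmod (u \<zeta>))\<^sup>2) * (Dloc p \<zeta> + Dloc q \<zeta>)"
    by (simp add: s_def)
qed

section \<open>Fejer means\<close>

definition fejer :: "nat \<Rightarrow> (complex \<Rightarrow> complex) \<Rightarrow> complex \<Rightarrow> complex" where
  "fejer n f z = (\<Sum>m\<le>n. of_real (1 - real m / real (Suc n)) * taylor_coeff f m * z ^ m)"

lemma holomorphic_fejer [holomorphic_intros]: "fejer n f holomorphic_on S"
  unfolding fejer_def[abs_def] by (intro holomorphic_intros)

lemma taylor_coeff_fejer:
  "taylor_coeff (fejer n f) m = (if m \<le> n then of_real (1 - real m / real (Suc n)) * taylor_coeff f m else 0)"
proof (rule taylor_coeff_eqI[of 1])
  fix z :: complex
  show "(\<lambda>m. (if m \<le> n then of_real (1 - real m / real (Suc n)) * taylor_coeff f m else 0) * z ^ m) sums fejer n f z"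
    using sums_If_finite_set[of "{..n}" "\<lambda>m. of_real (1 - real m / real (Suc n)) * taylor_coeff f m * z ^ m"]
    by (simp add: fejer_def if_distrib[of "\<lambda>x. x * _"] cong: if_cong)
qed simp

lemma cmod_taylor_coeff_fejer_le: "cmod (taylor_coeff (fejer n f) m) \<le> cmod (taylor_coeff f m)"
proof (cases "m \<le> n")
  case True
  then have "0 \<le> 1 - real m / real (Suc n)" "1 - real m / real (Suc n) \<le> 1"
    by (simp_all add: field_simps)
  then show ?thesis
    using True by (simp add: taylor_coeff_fejer norm_mult mult_left_le_one_le del: of_real_diff)
qed (simp add: taylor_coeff_fejer)

lemma taylor_coeff_fejer_tendsto: "(\<lambda>n. taylor_coeff (fejer n f) m) \<longlonglongrightarrow> taylor_coeff f m"
proof -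
  have "(\<lambda>n. real m / real (Suc n)) \<longlonglongrightarrow> 0"
    by (rule LIMSEQ_Suc[OF lim_const_over_n])
  then have "(\<lambda>n. of_real (1 - real m / real (Suc n)) * taylor_coeff f m) \<longlonglongrightarrow> of_real (1 - 0) * taylor_coeff f m"
    by (intro tendsto_intros)
  moreover have "\<forall>\<^sub>F n in sequentially. of_real (1 - real m / real (Suc n)) * taylor_coeff f m = taylor_coeff (fejer n f) m"
    using eventually_ge_at_top[of m] by eventually_elim (simp add: taylor_coeff_fejer)
  ultimately have "(\<lambda>n. taylor_coeff (fejer n f) m) \<longlonglongrightarrow> of_real (1 - 0) * taylor_coeff f m"
    by (rule Lim_transform_eventually)
  then show ?thesis by simp
qed

lemma H2_normsq_fejer_le: "H2_normsq (fejer n f) \<le> H2_normsq f"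
  unfolding H2_normsq_def
  by (intro suminf_le summableI ennreal_leI power_mono cmod_taylor_coeff_fejer_le norm_ge_zero)

lemma cmod_sum_sq_le: "(cmod (sum x A))\<^sup>2 \<le> real (card A) * (\<Sum>i\<in>A. (cmod (x i))\<^sup>2)"
proof -
  have "cmod (sum x A) \<le> (\<Sum>i\<in>A. \<bar>1\<bar> * \<bar>cmod (x i)\<bar>)"
    using norm_sum[of x A] by simp
  also have "\<dots> \<le> L2_set (\<lambda>_. 1) A * L2_set (\<lambda>i. cmod (x i)) A"
    by (rule L2_set_mult_ineq)
  finally have "(cmod (sum x A))\<^sup>2 \<le> (L2_set (\<lambda>_. 1) A * L2_set (\<lambda>i. cmod (x i)) A)\<^sup>2"
    by (intro power_mono) auto
  then show ?thesis by (simp add: L2_set_def power_mult_distrib sum_nonneg)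
qed

text \<open>Summation by parts of the Cesaro weights: the difference quotient of the Fejer mean is that of
  the function up to a factor at most one and an average.\<close>
definition fejer_quotient :: "nat \<Rightarrow> complex \<Rightarrow> (nat \<Rightarrow> complex) \<Rightarrow> nat \<Rightarrow> complex" where
  "fejer_quotient n \<zeta> k j = (if Suc j \<le> n then of_real (1 - real (Suc j) / real (Suc n)) * k j else 0)
     - (\<Sum>i\<in>{Suc j..n}. \<zeta> ^ (i - j) * k i) / of_nat (Suc n)"

lemma fejer_quotient_rec:
  assumes k: "\<And>m. taylor_coeff f (Suc m) = k m - \<zeta> * k (Suc m)"
  shows "taylor_coeff (fejer n f) (Suc m) = fejer_quotient n \<zeta> k m - \<zeta> * fejer_quotient n \<zeta> k (Suc m)"
proof (cases "Suc m \<le> n")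
  case True
  define W where "W = complex_of_nat (Suc n)"
  have W: "W \<noteq> 0" unfolding W_def by (rule of_nat_neq_0)
  define T where "T = (\<Sum>i\<in>{Suc (Suc m)..n}. \<zeta> ^ (i - m) * k i)"
  have "(\<Sum>i\<in>{Suc m..n}. \<zeta> ^ (i - m) * k i) = \<zeta> * k (Suc m) + T"
    unfolding T_def using True by (subst sum.atLeast_Suc_atMost) auto
  moreover have "\<zeta> * (\<Sum>i\<in>{Suc (Suc m)..n}. \<zeta> ^ (i - Suc m) * k i) = T"
    unfolding T_def sum_distrib_left
  proof (intro sum.cong refl)
    fix i assume "i \<in> {Suc (Suc m)..n}"
    then have "i - m = Suc (i - Suc m)" by auto
    then show "\<zeta> * (\<zeta> ^ (i - Suc m) * k i) = \<zeta> ^ (i - m) * k i" by simp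
  qed
  moreover have "(if Suc (Suc m) \<le> n then of_real (1 - real (Suc (Suc m)) / real (Suc n)) * k (Suc m) else 0)
      = (1 - of_nat (Suc (Suc m)) / W) * k (Suc m)"
  proof (cases "Suc (Suc m) \<le> n")
    case False
    \<comment> \<open>At index \<open>n + 1\<close> the Cesaro weight is 0, so the case distinction
      in \<open>fejer_quotient\<close> agrees with the plain formula.\<close>
    then have "Suc (Suc m) = Suc n" using True by simp
    then show ?thesis using False W unfolding W_def by (simp only:) simp
  qed (simp add: W_def)
  ultimately have "fejer_quotient n \<zeta> k m - \<zeta> * fejer_quotient n \<zeta> k (Suc m)
     = (1 - of_nat (Suc m) / W) * k m - (\<zeta> * k (Suc m) + T) / W - (\<zeta> * ((1 - of_nat (Suc (Suc m)) / W) * k (Suc m)) - T / W)"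
    using True by (simp add: fejer_quotient_def W_def right_diff_distrib)
  also have "\<dots> = (1 - of_nat (Suc m) / W) * (k m - \<zeta> * k (Suc m))"
    using W by (simp add: field_simps)
  finally show ?thesis
    using True by (simp add: taylor_coeff_fejer k W_def)
next
  case False
  then show ?thesis by (simp add: taylor_coeff_fejer fejer_quotient_def)
qed

text \<open>The constant is \<open>2 + 2\<close>: the damped part of the quotient is dominated
  termwise, and the averaged part has at most \<open>n\<close> non-zero terms, each of squared
  modulus at most \<open>n D / (n + 1)\<^sup>2\<close> by Cauchy-Schwarz.\<close>

lemma Dloc_fejer_le:
  assumes l: "cmod \<zeta> = 1"
  shows "Dloc (fejer n f) \<zeta> \<le> 4 * Dloc f \<zeta>"
proof (cases "Dloc f \<zeta> < \<infinity>")
  case True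
  obtain k where k: "\<And>m. taylor_coeff f (Suc m) = k m - \<zeta> * k (Suc m)" and K: "(\<Sum>m. ennreal ((cmod (k m))\<^sup>2)) \<le> Dloc f \<zeta>"
    using Dloc_ex[OF l True] by blast
  define D where "D = enn2real (Dloc f \<zeta>)"
  have D: "Dloc f \<zeta> = ennreal D" "0 \<le> D"
    using True by (auto simp: D_def less_top)
  have S: "(\<Sum>i\<in>A. (cmod (k i))\<^sup>2) \<le> D" if "finite A" for A
    by (rule sum_le_if_suminf_ennreal_le[OF _ K[unfolded D(1)] D(2) that]) auto
  define b where "b = (\<lambda>j. if Suc j \<le> n then of_real (1 - real (Suc j) / real (Suc n)) * k j else 0)"
  define c where "c = (\<lambda>j. - ((\<Sum>i\<in>{Suc j..n}. \<zeta> ^ (i - j) * k i) / of_nat (Suc n)))"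
  have kk: "fejer_quotient n \<zeta> k j = b j + c j" for j
    by (simp add: fejer_quotient_def b_def c_def)
  have B: "(\<Sum>j. ennreal ((cmod (b j))\<^sup>2)) \<le> Dloc f \<zeta>"
  proof (rule order_trans[OF _ K], intro suminf_le summableI ennreal_leI power_mono norm_ge_zero)
    fix j
    show "cmod (b j) \<le> cmod (k j)"
    proof (cases "Suc j \<le> n")
      case True
      then have "0 \<le> 1 - real (Suc j) / real (Suc n)" "1 - real (Suc j) / real (Suc n) \<le> 1"
        by (simp_all add: field_simps)
      then show ?thesis
        using True by (simp add: b_def norm_mult mult_left_le_one_le del: of_real_diff)
    qed (simp add: b_def)
  qed
  have cj: "(cmod (c j))\<^sup>2 \<le> (if j < n then real n * D / (real (Suc n))\<^sup>2 else 0)" for j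
  proof (cases "j < n")
    case True
    have "(cmod (\<Sum>i\<in>{Suc j..n}. \<zeta> ^ (i - j) * k i))\<^sup>2 \<le> real (card {Suc j..n}) * (\<Sum>i\<in>{Suc j..n}. (cmod (\<zeta> ^ (i - j) * k i))\<^sup>2)"
      by (rule cmod_sum_sq_le)
    also have "\<dots> = real (n - j) * (\<Sum>i\<in>{Suc j..n}. (cmod (k i))\<^sup>2)"
      using l by (simp add: norm_mult norm_power)
    also have "\<dots> \<le> real n * D"
      by (intro mult_mono S) (auto intro: sum_nonneg)
    finally show ?thesis
      using True by (simp add: c_def norm_divide power_divide divide_right_mono del: of_nat_Suc)
  qed (simp add: c_def)
  have C: "(\<Sum>j. ennreal ((cmod (c j))\<^sup>2)) \<le> ennreal D"
  proof (rule suminf_ennreal_le_realI)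
    fix N
    have "(\<Sum>j\<le>N. (cmod (c j))\<^sup>2) \<le> (\<Sum>j\<le>N. if j < n then real n * D / (real (Suc n))\<^sup>2 else 0)"
      by (intro sum_mono cj)
    also have "\<dots> = (\<Sum>j\<in>{..N} \<inter> {..<n}. real n * D / (real (Suc n))\<^sup>2)"
      by (simp add: sum.If_cases lessThan_def)
    also have "\<dots> \<le> (\<Sum>j\<in>{..<n}. real n * D / (real (Suc n))\<^sup>2)"
      using D by (intro sum_mono2) auto
    also have "\<dots> = (real n * real n / (real (Suc n))\<^sup>2) * D" by simp
    also have "\<dots> \<le> 1 * D"
      using D by (intro mult_right_mono) (auto simp: power2_eq_square divide_le_eq intro!: mult_mono)
    finally show "(\<Sum>j\<le>N. (cmod (c j))\<^sup>2) \<le> D" by simp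
  qed auto
  have "Dloc (fejer n f) \<zeta> \<le> (\<Sum>m. ennreal ((cmod (fejer_quotient n \<zeta> k m))\<^sup>2))"
    by (rule Dloc_le[OF l fejer_quotient_rec[OF k]])
  also have "\<dots> \<le> 2 * (\<Sum>m. ennreal ((cmod (b m))\<^sup>2)) + 2 * (\<Sum>m. ennreal ((cmod (c m))\<^sup>2))"
    using suminf_weighted_add_le[where w = "\<lambda>_. 1", OF kk zero_le_one] by (simp only: mult_1_left)
  also have "\<dots> \<le> 2 * Dloc f \<zeta> + 2 * Dloc f \<zeta>"
    using B C unfolding D(1) by (intro add_mono mult_left_mono) auto
  also have "\<dots> = 4 * Dloc f \<zeta>"
    by (simp flip: distrib_right)
  finally show ?thesis .
next
  case False
  then have "Dloc f \<zeta> = top" by (metis infinity_ennreal_def top.not_eq_extremum)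
  then show ?thesis by (simp add: ennreal_mult_top)
qed

text \<open>The recursion telescopes, so the Fejer mean at \<open>\<zeta>\<close> is
  \<open>taylor_coeff f 0 + \<zeta> * fejer_quotient n \<zeta> k 0\<close>: the quotient vanishes at
  index \<open>n\<close>. The averaged part of the remaining quotient is of order
  \<open>1 / sqrt n\<close>.\<close>

lemma fejer_boundary_tendsto:
  assumes l: "cmod \<zeta> = 1" and f: "f holomorphic_on ball 0 1" and fin: "Dloc f \<zeta> < \<infinity>" and v: "bval \<zeta> f \<alpha>"
  shows "(\<lambda>n. fejer n f \<zeta>) \<longlonglongrightarrow> \<alpha>"
proof -
  obtain \<alpha>' g where b: "bdec \<zeta> f \<alpha>' g" and G: "H2_normsq g \<le> Dloc f \<zeta>" and v': "bval \<zeta> f \<alpha>'"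
    using Dloc_bval_ex[OF l f fin] by blast
  then have [simp]: "\<alpha>' = \<alpha>" using v bval_unique by blast
  define k where "k = taylor_coeff g"
  have k: "taylor_coeff f (Suc m) = k m - \<zeta> * k (Suc m)" for m
    unfolding k_def by (rule bdec_coeff(2)[OF b])
  have \<alpha>: "\<alpha> = taylor_coeff f 0 + \<zeta> * k 0"
    using bdec_coeff(1)[OF b] by (simp add: k_def)
  define D where "D = enn2real (Dloc f \<zeta>)"
  have D: "Dloc f \<zeta> = ennreal D" "0 \<le> D"
    using fin by (auto simp: D_def less_top)
  have S: "(\<Sum>i\<in>A. (cmod (k i))\<^sup>2) \<le> D" if "finite A" for A
    using G unfolding k_def H2_normsq_def D(1)
    by (intro sum_le_if_suminf_ennreal_le[OF _ _ D(2) that]) auto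
  have tel: "(\<Sum>m\<le>N. taylor_coeff (fejer n f) m * \<zeta> ^ m)
      = taylor_coeff f 0 + \<zeta> * fejer_quotient n \<zeta> k 0 - \<zeta> ^ Suc N * fejer_quotient n \<zeta> k N" for n N
  proof (induction N)
    case 0
    then show ?case by (simp add: taylor_coeff_fejer)
  next
    case (Suc N)
    then show ?case by (simp add: fejer_quotient_rec[OF k] algebra_simps)
  qed
  have fz: "fejer n f \<zeta> = taylor_coeff f 0 + \<zeta> * fejer_quotient n \<zeta> k 0" for n
  proof -
    have "fejer n f \<zeta> = (\<Sum>m\<le>n. taylor_coeff (fejer n f) m * \<zeta> ^ m)"
      unfolding fejer_def[of n f \<zeta>] by (intro sum.cong refl) (simp add: taylor_coeff_fejer)
    then show ?thesis unfolding tel by (simp add: fejer_quotient_def)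
  qed
  have "(\<lambda>n. fejer_quotient n \<zeta> k 0) \<longlonglongrightarrow> k 0"
  proof -
    have "(\<lambda>n. (\<Sum>i\<in>{1..n}. \<zeta> ^ i * k i) / of_nat (Suc n)) \<longlonglongrightarrow> 0"
    proof (rule Lim_null_comparison)
      have "cmod ((\<Sum>i\<in>{1..n}. \<zeta> ^ i * k i) / of_nat (Suc n)) \<le> sqrt (D * inverse (real (Suc n)))" for n
      proof -
        have "(cmod (\<Sum>i\<in>{1..n}. \<zeta> ^ i * k i))\<^sup>2 \<le> real (card {1..n}) * (\<Sum>i\<in>{1..n}. (cmod (\<zeta> ^ i * k i))\<^sup>2)"
          by (rule cmod_sum_sq_le)
        also have "\<dots> \<le> real (Suc n) * D"
          using l by (intro mult_mono) (auto simp: norm_mult norm_power S intro: sum_nonneg)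
        finally have "(cmod ((\<Sum>i\<in>{1..n}. \<zeta> ^ i * k i) / of_nat (Suc n)))\<^sup>2 \<le> real (Suc n) * D / (real (Suc n))\<^sup>2"
          by (simp add: norm_divide power_divide divide_right_mono del: of_nat_Suc)
        also have "\<dots> = D * inverse (real (Suc n))"
          by (simp add: power2_eq_square field_simps del: of_nat_Suc)
        finally show ?thesis by (rule real_le_rsqrt)
      qed
      then show "\<forall>\<^sub>F n in sequentially. norm ((\<Sum>i\<in>{1..n}. \<zeta> ^ i * k i) / of_nat (Suc n)) \<le> sqrt (D * inverse (real (Suc n)))"
        by simp
      have "(\<lambda>n. sqrt (D * inverse (real (Suc n)))) \<longlonglongrightarrow> sqrt (D * 0)"
        by (intro tendsto_intros LIMSEQ_inverse_real_of_nat)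
      then show "(\<lambda>n. sqrt (D * inverse (real (Suc n)))) \<longlonglongrightarrow> 0" by simp
    qed
    moreover have "(\<lambda>n. of_real (1 - real 1 / real (Suc n)) * k 0) \<longlonglongrightarrow> of_real (1 - 0) * k 0"
      by (intro tendsto_intros LIMSEQ_Suc[OF lim_const_over_n])
    ultimately have "(\<lambda>n. of_real (1 - real 1 / real (Suc n)) * k 0 - (\<Sum>i\<in>{1..n}. \<zeta> ^ i * k i) / of_nat (Suc n)) \<longlonglongrightarrow> of_real (1 - 0) * k 0 - 0"
      by (rule tendsto_diff[rotated])
    moreover have "\<forall>\<^sub>F n in sequentially. of_real (1 - real 1 / real (Suc n)) * k 0 - (\<Sum>i\<in>{1..n}. \<zeta> ^ i * k i) / of_nat (Suc n) = fejer_quotient n \<zeta> k 0"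
      using eventually_ge_at_top[of 1] by eventually_elim (simp add: fejer_quotient_def)
    ultimately have "(\<lambda>n. fejer_quotient n \<zeta> k 0) \<longlonglongrightarrow> of_real (1 - 0) * k 0 - 0"
      by (rule Lim_transform_eventually)
    then show ?thesis by simp
  qed
  then have "(\<lambda>n. taylor_coeff f 0 + \<zeta> * fejer_quotient n \<zeta> k 0) \<longlonglongrightarrow> taylor_coeff f 0 + \<zeta> * k 0"
    by (intro tendsto_intros)
  then show ?thesis by (simp only: fz \<alpha>)
qed

text \<open>The Fejer mean is an average of \<open>f\<close> over rotations against the non-negative
  kernel \<open>|E|\<^sup>2 / (n + 1)\<close> of total mass one, so it inherits sup bounds.\<close>

lemma cmod_fejer_le:
  assumes f: "f holomorphic_on ball 0 1" "\<And>z. cmod z < 1 \<Longrightarrow> cmod (f z) \<le> B" and z: "cmod z < 1"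
  shows "cmod (fejer n f z) \<le> B"
proof -
  define E where "E = (\<lambda>t. \<Sum>j\<le>n. circ t ^ j)"
  define a where "a = (\<lambda>m. taylor_coeff f m * z ^ m)"
  have sa: "summable (\<lambda>m. cmod (a m))"
    unfolding a_def by (rule taylor_abs_summable[OF f(1) z])
  have Fa: "(\<Sum>m. a m * circ t ^ m) = f (z * circ t)" for t
    using taylor_sums[OF f(1), of "z * circ t"] z
    by (simp add: a_def sums_iff norm_mult power_mult_distrib mult_ac)
  have Ec: "continuous_on {0..1} (\<lambda>t. E t * cnj (E t))"
    unfolding E_def by (intro continuous_intros)
  have I: "((\<lambda>t. circ t ^ m * (E t * cnj (E t))) has_integral (if m \<le> n then of_nat (Suc n - m) else 0)) {0..1}" for m
  proof -
    have eq: "circ t ^ m * (E t * cnj (E t)) = (\<Sum>i\<le>n. \<Sum>j\<le>n. circ t ^ (m + i) * cnj (circ t) ^ j)" for t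
      by (simp only: E_def cnj_sum complex_cnj_power sum_product) (simp only: sum_distrib_left power_add mult.assoc)
    have "((\<lambda>t. circ t ^ m * (E t * cnj (E t))) has_integral (\<Sum>i\<le>n. \<Sum>j\<le>n. if m + i = j then 1 else 0)) {0..1}"
      unfolding eq by (intro has_integral_sum circ_orthogonal) auto
    moreover have "(\<Sum>i\<le>n. \<Sum>j\<le>n. if m + i = j then 1 else 0) = (if m \<le> n then of_nat (Suc n - m) else (0::complex))"
    proof -
      have "(\<Sum>i\<le>n. \<Sum>j\<le>n. if m + i = j then 1 else 0) = (\<Sum>i\<le>n. if m + i \<le> n then 1 else (0::complex))"
        by (intro sum.cong refl) (simp add: sum.delta)
      also have "\<dots> = of_nat (card {i. i \<le> n \<and> m + i \<le> n})"
        by (simp add: sum.If_cases) (simp add: Int_def)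
      also have "{i. i \<le> n \<and> m + i \<le> n} = (if m \<le> n then {..n - m} else {})" by auto
      finally show ?thesis by (auto simp: Suc_diff_le)
    qed
    ultimately show ?thesis by simp
  qed
  have "(\<lambda>m. a m * (if m \<le> n then of_nat (Suc n - m) else 0)) sums integral {0..1} (\<lambda>t. f (z * circ t) * (E t * cnj (E t)))"
    using circ_series_integral(1)[OF sa Ec] unfolding integral_unique[OF I] Fa .
  moreover have "(\<lambda>m. a m * (if m \<le> n then of_nat (Suc n - m) else 0)) sums (\<Sum>m\<le>n. a m * of_nat (Suc n - m))"
    using sums_If_finite_set[of "{..n}" "\<lambda>m. a m * of_nat (Suc n - m)"]
    by (simp add: if_distrib[of "\<lambda>x. _ * x"] cong: if_cong)
  ultimately have eq: "integral {0..1} (\<lambda>t. f (z * circ t) * (E t * cnj (E t))) = (\<Sum>m\<le>n. a m * of_nat (Suc n - m))"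
    by (rule sums_unique2)
  also have "\<dots> = of_nat (Suc n) * fejer n f z"
    unfolding fejer_def a_def sum_distrib_left
    by (intro sum.cong refl) (simp add: of_nat_diff field_simps del: of_nat_Suc)
  finally have F: "of_nat (Suc n) * fejer n f z = integral {0..1} (\<lambda>t. f (z * circ t) * (E t * cnj (E t)))" ..
  have I0: "((\<lambda>t. (cmod (E t))\<^sup>2) has_integral real (Suc n)) {0..1}"
    using has_integral_Re[OF I[of 0]] by (simp add: complex_norm_square[symmetric])
  have "cmod (integral {0..1} (\<lambda>t. f (z * circ t) * (E t * cnj (E t)))) \<le> integral {0..1} (\<lambda>t. B * (cmod (E t))\<^sup>2)"
  proof (rule integral_norm_bound_integral)
    show "(\<lambda>t. f (z * circ t) * (E t * cnj (E t))) integrable_on {0..1}"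
      using circ_series_integral(2)[OF sa Ec] unfolding Fa .
    show "(\<lambda>t. B * (cmod (E t))\<^sup>2) integrable_on {0..1}"
      using I0 by (intro integrable_on_mult_right) blast
    fix t
    have "cmod (f (z * circ t)) \<le> B" using z by (intro f(2)) (simp add: norm_mult)
    then show "cmod (f (z * circ t) * (E t * cnj (E t))) \<le> B * (cmod (E t))\<^sup>2"
      by (simp add: norm_mult power2_eq_square mult_right_mono)
  qed
  also have "\<dots> = B * real (Suc n)"
    using integral_unique[OF has_integral_mult_right[OF I0, of B]] by simp
  finally have "real (Suc n) * cmod (fejer n f z) \<le> real (Suc n) * B"
    unfolding F[symmetric] norm_mult by (simp add: mult.commute del: of_nat_Suc)
  then show ?thesis by (simp del: of_nat_Suc)
qed

section \<open>Bounded multipliers with controlled local Dirichlet integrals\<close>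

text \<open>Each partial sum of \<open>Dloc\<close> is continuous in finitely many coefficients. The
  weights \<open>X n\<close> allow converging boundary values to be carried to the limit together
  with the functions.\<close>

lemma Dloc_lower_semicontinuous:
  assumes c: "\<And>m. (\<lambda>n. taylor_coeff (F n) m) \<longlonglongrightarrow> taylor_coeff f m"
    and X: "X \<longlonglongrightarrow> x" "\<And>n. 0 \<le> X n" and le: "\<And>n. ennreal (X n) * Dloc (F n) \<zeta> \<le> C"
  shows "ennreal x * Dloc f \<zeta> \<le> C"
proof (cases C)
  case (real c)
  have x: "0 \<le> x" using X by (intro LIMSEQ_le_const) auto
  define T where "T = (\<lambda>f n. (cmod (\<Sum>m\<le>n. of_nat m * taylor_coeff f m * \<zeta> ^ m))\<^sup>2 / (real n * (real n + 1)))"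
  have T0: "0 \<le> T f n" for f n by (simp add: T_def)
  have DT: "Dloc f \<zeta> = (\<Sum>n. ennreal (T f n))" for f
    by (simp add: Dloc_def T_def)
  have e: "ennreal y * Dloc f \<zeta> = (\<Sum>n. ennreal (y * T f n))" if "0 \<le> y" for y f
    unfolding DT ennreal_mult[OF that T0] by (rule ennreal_suminf_cmult[symmetric])
  have "(\<Sum>n. ennreal (x * T f n)) \<le> ennreal c"
  proof (rule suminf_ennreal_le_realI)
    fix N
    have "(\<lambda>i. \<Sum>n\<le>N. X i * T (F i) n) \<longlonglongrightarrow> (\<Sum>n\<le>N. x * T f n)"
      unfolding T_def divide_inverse by (intro tendsto_intros X c)
    moreover have "(\<Sum>n\<le>N. X i * T (F i) n) \<le> c" for i
      using le[of i] X(2) real unfolding e[OF X(2)]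
      by (intro sum_le_if_suminf_ennreal_le[where f = "\<lambda>n. X i * T (F i) n"]) (auto simp: T0)
    ultimately show "(\<Sum>n\<le>N. x * T f n) \<le> c"
      by (intro LIMSEQ_le_const2) auto
  qed (simp add: T0 x)
  then show ?thesis using real e[OF x] by simp
qed simp

text \<open>Cantor's diagonal argument over the coefficient index.\<close>

lemma ex_subseq_pointwise:
  fixes X :: "nat \<Rightarrow> nat \<Rightarrow> complex"
  assumes "\<And>n m. cmod (X n m) \<le> B"
  obtains r a where "strict_mono r" "\<And>m. (\<lambda>n. X (r n) m) \<longlonglongrightarrow> a m"
proof -
  interpret subseqs "\<lambda>m s. convergent (\<lambda>n. X (s n) m)"
  proof
    fix m and s :: "nat \<Rightarrow> nat" assume "strict_mono s"
    have "bounded (range (\<lambda>n. X (s n) m))"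
      using assms by (auto simp: bounded_iff)
    then obtain l r where "strict_mono (r :: nat \<Rightarrow> nat)" "((\<lambda>n. X (s n) m) \<circ> r) \<longlonglongrightarrow> l"
      using bounded_imp_convergent_subsequence by blast
    then show "\<exists>r'. strict_mono r' \<and> convergent (\<lambda>n. X ((s \<circ> r') n) m)"
      by (auto simp: convergent_def o_def)
  qed
  have "convergent (\<lambda>n. X (diagseq n) m)" for m
  proof -
    have "convergent (\<lambda>n. X ((diagseq \<circ> (+) (Suc m)) n) m)"
    proof (rule diagseq_holds)
      fix n and s r :: "nat \<Rightarrow> nat"
      assume "strict_mono r" "convergent (\<lambda>i. X (s i) n)"
      then show "convergent (\<lambda>i. X ((s \<circ> r) i) n)"
        using convergent_subseq_convergent[of "\<lambda>i. X (s i) n" r] by (simp add: o_def)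
    qed
    then have "convergent (\<lambda>n. X (diagseq (n + Suc m)) m)"
      by (simp add: o_def add.commute)
    then show ?thesis
      by (rule iffD1[OF convergent_ignore_initial_segment])
  qed
  then have "\<forall>m. \<exists>a. (\<lambda>n. X (diagseq n) m) \<longlonglongrightarrow> a"
    by (simp add: convergent_def)
  then obtain a where "\<And>m. (\<lambda>n. X (diagseq n) m) \<longlonglongrightarrow> a m"
    by metis
  with subseq_diagseq show ?thesis by (intro that) auto
qed

lemma pointwise_limit_of_coeff_limit:
  assumes F: "\<And>n. F n holomorphic_on ball 0 1" and f: "f holomorphic_on ball 0 1"
    and c: "\<And>m. (\<lambda>n. taylor_coeff (F n) m) \<longlonglongrightarrow> taylor_coeff f m"
    and B: "\<And>n m. cmod (taylor_coeff (F n) m) \<le> B m" and s: "summable (\<lambda>m. B m * cmod z ^ m)"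
    and z: "cmod z < 1"
  shows "(\<lambda>n. F n z) \<longlonglongrightarrow> f z"
proof -
  have "(\<lambda>n. \<Sum>m. taylor_coeff (F n) m * z ^ m) \<longlonglongrightarrow> (\<Sum>m. taylor_coeff f m * z ^ m)"
  proof (rule tannerys_theorem[THEN conjunct2, THEN conjunct2, OF _ _ s])
    show "(\<lambda>n. taylor_coeff (F n) m * z ^ m) \<longlonglongrightarrow> taylor_coeff f m * z ^ m" for m
      by (intro tendsto_intros c)
    show "\<forall>\<^sub>F (m, n) in at_top \<times>\<^sub>F sequentially. norm (taylor_coeff (F n) m * z ^ m) \<le> B m * cmod z ^ m"
      by (intro always_eventually) (auto simp: norm_mult norm_power intro!: mult_right_mono B)
  qed simp
  then show ?thesis
    using taylor_sums[OF F z] taylor_sums[OF f z] by (simp add: sums_iff)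
qed

text \<open>The function is tested as a Hardy space multiplier on the constant 1.\<close>

lemma cmod_taylor_coeff_le_1:
  assumes u: "u holomorphic_on ball 0 1" "\<And>z. cmod z < 1 \<Longrightarrow> cmod (u z) \<le> 1"
  shows "cmod (taylor_coeff u m) \<le> 1"
proof -
  have one: "H2_normsq (\<lambda>_. 1) = 1"
  proof -
    have "H2_normsq (\<lambda>_. 1) = (\<Sum>m\<in>{0}. ennreal ((cmod (taylor_coeff (\<lambda>_. 1) m))\<^sup>2))"
      unfolding H2_normsq_def by (rule suminf_finite) (auto simp: taylor_coeff_const)
    then show ?thesis by (simp add: taylor_coeff_const)
  qed
  have "ennreal ((cmod (taylor_coeff u m))\<^sup>2) \<le> H2_normsq (\<lambda>z. u z * 1)"
    using H2_normsq_ge_coeff[of u m] by simp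
  also have "\<dots> \<le> ennreal (1\<^sup>2) * H2_normsq (\<lambda>_. 1)"
    by (rule H2_normsq_bounded_mult) (use u one in auto)
  finally have "(cmod (taylor_coeff u m))\<^sup>2 \<le> 1"
    by (simp add: one)
  then show ?thesis by (simp add: power2_le_iff_abs_le abs_square_le_1)
qed

text \<open>Analytic completion of the squared modulus of \<open>\<Sum>i\<le>N. a i * z ^ i\<close>
  on the circle: there the terms for \<open>(i, j)\<close> and \<open>(j, i)\<close> are conjugate,
  so keeping only \<open>j < i\<close> and doubling preserves the real part.\<close>

definition circle_majorant :: "nat \<Rightarrow> (nat \<Rightarrow> complex) \<Rightarrow> complex \<Rightarrow> complex" where
  "circle_majorant N a z = (\<Sum>i\<le>N. of_real ((cmod (a i))\<^sup>2) + 2 * (\<Sum>j<i. a i * cnj (a j) * z ^ (i - j)))"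

lemma Re_circle_majorant:
  assumes z: "cmod z = 1"
  shows "Re (circle_majorant N a z) = (cmod (\<Sum>i\<le>N. a i * z ^ i))\<^sup>2"
proof (induction N)
  case (Suc N)
  define S where "S = (\<Sum>i\<le>N. a i * z ^ i)"
  have zz: "z * cnj z = 1" using z by (simp add: complex_norm_square[symmetric])
  have "(\<Sum>j<Suc N. a (Suc N) * cnj (a j) * z ^ (Suc N - j)) = a (Suc N) * z ^ Suc N * cnj S"
    unfolding S_def cnj_sum sum_distrib_left lessThan_Suc_atMost
  proof (intro sum.cong refl)
    fix j assume "j \<in> {..N}"
    then have "z ^ Suc N = z ^ (Suc N - j) * z ^ j" by (simp flip: power_add)
    then have "z ^ Suc N * cnj z ^ j = z ^ (Suc N - j) * (z * cnj z) ^ j"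
      by (simp only: power_mult_distrib mult.assoc)
    then have e: "z ^ (Suc N - j) = z ^ Suc N * cnj z ^ j"
      by (simp only: zz power_one mult_1_right)
    show "a (Suc N) * cnj (a j) * z ^ (Suc N - j) = a (Suc N) * z ^ Suc N * cnj (a j * z ^ j)"
      unfolding e by (simp only: complex_cnj_mult complex_cnj_power mult_ac)
  qed
  then have "Re (circle_majorant (Suc N) a z) = Re (circle_majorant N a z) + (cmod (a (Suc N)))\<^sup>2 + 2 * Re (a (Suc N) * z ^ Suc N * cnj S)"
    unfolding circle_majorant_def by (subst sum.atMost_Suc) simp
  also have "\<dots> = (cmod S)\<^sup>2 + (cmod (a (Suc N) * z ^ Suc N))\<^sup>2 + 2 * Re (a (Suc N) * z ^ Suc N * cnj S)"
    unfolding Suc.IH S_def using z by (simp add: norm_mult norm_power)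
  also have "\<dots> = (cmod (S + a (Suc N) * z ^ Suc N))\<^sup>2"
    unfolding cmod_power2 by (simp add: power2_eq_square algebra_simps del: power_Suc)
  finally show ?case by (simp add: S_def)
qed (simp add: circle_majorant_def)

lemma holomorphic_circle_majorant [holomorphic_intros]: "circle_majorant N a holomorphic_on S"
  unfolding circle_majorant_def[abs_def] by (intro holomorphic_intros)

lemma circle_majorant_0: "circle_majorant N a 0 = of_real (\<Sum>i\<le>N. (cmod (a i))\<^sup>2)"
  unfolding circle_majorant_def by (simp add: power_0_left)

text \<open>\<open>u\<close> is a coefficientwise limit of reciprocals built from the Fejer
  polynomials of \<open>f\<close> and \<open>g\<close>, because \<open>outer_reciprocal\<close>
  works with entire functions. The Hardy norms bound \<open>A n 0\<close>, which keeps
  \<open>u 0\<close> away from 0; the constant 4 is that of \<open>Dloc_fejer_le\<close>. The last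
  two bounds come from \<open>|U n \<zeta>| |fejer n f \<zeta>| \<le> 1\<close> and the same for
  \<open>g\<close>.\<close>

lemma ex_multiplier:
  assumes f: "f holomorphic_on ball 0 1" "H2_normsq f < \<infinity>" and g: "g holomorphic_on ball 0 1" "H2_normsq g < \<infinity>"
  obtains u where "u holomorphic_on ball 0 1" "u 0 \<noteq> 0"
    "\<And>z. cmod z < 1 \<Longrightarrow> cmod (u z) \<le> 1 \<and> cmod (u z * f z) \<le> 1 \<and> cmod (u z * g z) \<le> 1"
    "\<And>\<zeta>. cmod \<zeta> = 1 \<Longrightarrow> Dloc u \<zeta> \<le> 4 * (Dloc f \<zeta> + Dloc g \<zeta>)
        \<and> Dloc (\<lambda>z. u z * f z) \<zeta> \<le> 4 * (Dloc f \<zeta> + Dloc g \<zeta>)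
        \<and> Dloc (\<lambda>z. u z * g z) \<zeta> \<le> 4 * (Dloc f \<zeta> + Dloc g \<zeta>)"
    "\<And>\<zeta> \<alpha>. cmod \<zeta> = 1 \<Longrightarrow> bval \<zeta> f \<alpha> \<Longrightarrow> Dloc f \<zeta> < \<infinity> \<Longrightarrow> ennreal ((cmod \<alpha>)\<^sup>2) * Dloc u \<zeta> \<le> 4 * (Dloc f \<zeta> + Dloc g \<zeta>)"
    "\<And>\<zeta> \<alpha>. cmod \<zeta> = 1 \<Longrightarrow> bval \<zeta> g \<alpha> \<Longrightarrow> Dloc g \<zeta> < \<infinity> \<Longrightarrow> ennreal ((cmod \<alpha>)\<^sup>2) * Dloc u \<zeta> \<le> 4 * (Dloc f \<zeta> + Dloc g \<zeta>)"
proof -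
  define V where "V = (\<lambda>n h. circle_majorant n (taylor_coeff (fejer n h)))"
  define A where "A = (\<lambda>n z. 1 + V n f z + V n g z)"
  define U where "U = (\<lambda>n z. 1 / A n z)"
  have hA: "A n holomorphic_on UNIV" for n
    unfolding A_def V_def by (intro holomorphic_intros)
  have fej: "(\<Sum>i\<le>n. taylor_coeff (fejer n h) i * z ^ i) = fejer n h z" for n h z
    unfolding fejer_def[of n h z] by (intro sum.cong refl) (simp add: taylor_coeff_fejer)
  have re: "Re (A n z) = 1 + (cmod (fejer n f z))\<^sup>2 + (cmod (fejer n g z))\<^sup>2" if "cmod z = 1" for n z
    unfolding A_def V_def using Re_circle_majorant[OF that] by (simp add: fej)
  have U1: "cmod (U n z) \<le> 1" "cmod (U n z * fejer n f z) \<le> 1" "cmod (U n z * fejer n g z) \<le> 1" if "cmod z \<le> 1" for n z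
  proof -
    have "cmod (1 / A n z) \<le> 1 \<and> cmod (1 / A n z * fejer n f z) \<le> 1 \<and> cmod (1 / A n z * fejer n g z) \<le> 1"
      by (rule outer_reciprocal(2)[OF hA holomorphic_fejer holomorphic_fejer re that])
    then show "cmod (U n z) \<le> 1" "cmod (U n z * fejer n f z) \<le> 1" "cmod (U n z * fejer n g z) \<le> 1"
      by (auto simp: U_def)
  qed
  have hU: "U n holomorphic_on ball 0 1" for n
    unfolding U_def by (rule outer_reciprocal(1)[OF hA holomorphic_fejer holomorphic_fejer re])
  have UD: "Dloc (U n) \<zeta> + Dloc (\<lambda>z. U n z * fejer n f z) \<zeta> + Dloc (\<lambda>z. U n z * fejer n g z) \<zeta>
        \<le> ennreal ((cmod (U n \<zeta>))\<^sup>2) * (4 * (Dloc f \<zeta> + Dloc g \<zeta>))" if l: "cmod \<zeta> = 1" for n \<zeta>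
  proof -
    have "Dloc (U n) \<zeta> + Dloc (\<lambda>z. U n z * fejer n f z) \<zeta> + Dloc (\<lambda>z. U n z * fejer n g z) \<zeta>
        \<le> ennreal ((cmod (U n \<zeta>))\<^sup>2) * (Dloc (fejer n f) \<zeta> + Dloc (fejer n g) \<zeta>)"
      unfolding U_def by (rule outer_reciprocal(3)[OF hA holomorphic_fejer holomorphic_fejer re l])
    also have "\<dots> \<le> ennreal ((cmod (U n \<zeta>))\<^sup>2) * (4 * (Dloc f \<zeta> + Dloc g \<zeta>))"
      unfolding distrib_left[of 4] by (intro mult_left_mono add_mono Dloc_fejer_le l) auto
    finally show ?thesis .
  qed
  \<comment> \<open>Any weight \<open>x\<close> with \<open>x |U n \<zeta>|\<^sup>2 \<le> 1\<close>
    is absorbed by the factor in \<open>UD\<close>. It is applied with \<open>x = 1\<close> and with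
    \<open>x\<close> the squared modulus of a Fejer mean at \<open>\<zeta>\<close>.\<close>
  have scale: "ennreal x * Dloc h \<zeta> \<le> 4 * (Dloc f \<zeta> + Dloc g \<zeta>)"
    if l: "cmod \<zeta> = 1" and h: "h \<in> {U n, \<lambda>z. U n z * fejer n f z, \<lambda>z. U n z * fejer n g z}"
      and x: "0 \<le> x" "x * (cmod (U n \<zeta>))\<^sup>2 \<le> 1" for x h n \<zeta>
  proof -
    have "Dloc h \<zeta> \<le> Dloc (U n) \<zeta> + Dloc (\<lambda>z. U n z * fejer n f z) \<zeta> + Dloc (\<lambda>z. U n z * fejer n g z) \<zeta>"
      using h by (auto simp: add.assoc add_increasing add_increasing2)
    then have "Dloc h \<zeta> \<le> ennreal ((cmod (U n \<zeta>))\<^sup>2) * (4 * (Dloc f \<zeta> + Dloc g \<zeta>))"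
      using UD[OF l, of n] by (rule order_trans)
    then have "ennreal x * Dloc h \<zeta> \<le> ennreal x * (ennreal ((cmod (U n \<zeta>))\<^sup>2) * (4 * (Dloc f \<zeta> + Dloc g \<zeta>)))"
      by (rule mult_left_mono) simp
    also have "\<dots> = ennreal (x * (cmod (U n \<zeta>))\<^sup>2) * (4 * (Dloc f \<zeta> + Dloc g \<zeta>))"
      using x(1) by (simp only: ennreal_mult zero_le_power2 mult.assoc)
    also have "\<dots> \<le> ennreal 1 * (4 * (Dloc f \<zeta> + Dloc g \<zeta>))"
      by (intro mult_right_mono ennreal_leI x) simp
    finally show ?thesis by simp
  qed
  have "cmod (taylor_coeff (U n) m) \<le> 1" for n m
    by (rule cmod_taylor_coeff_le_1[OF hU]) (use U1 in auto)
  from ex_subseq_pointwise[of "\<lambda>n. taylor_coeff (U n)", OF this]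
  obtain r a where r: "strict_mono r" and a: "\<And>m. (\<lambda>n. taylor_coeff (U (r n)) m) \<longlonglongrightarrow> a m"
    by blast
  have Uc: "cmod (taylor_coeff (U n) m) \<le> 1" for n m
    by (rule cmod_taylor_coeff_le_1[OF hU]) (use U1 in auto)
  have "cmod (a m) \<le> 1" for m
    by (rule LIMSEQ_le_const2[OF tendsto_norm[OF a]]) (use Uc in auto)
  then obtain u where u: "u holomorphic_on ball 0 1" and ua: "\<And>m. taylor_coeff u m = a m"
    using ex_holomorphic_taylor[of a 1] by blast
  have cu: "(\<lambda>n. taylor_coeff (U (r n)) m) \<longlonglongrightarrow> taylor_coeff u m" for m
    using a by (simp add: ua)
  have pu: "(\<lambda>n. U (r n) z) \<longlonglongrightarrow> u z" if z: "cmod z < 1" for z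
    by (rule pointwise_limit_of_coeff_limit[where B = "\<lambda>_. 1", OF hU u cu])
       (use Uc z in \<open>auto intro: summable_geometric\<close>)
  have cfe: "(\<lambda>n. taylor_coeff (fejer (r n) h) m) \<longlonglongrightarrow> taylor_coeff h m" for h m
    using LIMSEQ_subseq_LIMSEQ[OF taylor_coeff_fejer_tendsto r] by (simp add: o_def)
  have pfe: "(\<lambda>n. fejer (r n) h z) \<longlonglongrightarrow> h z" if h: "h holomorphic_on ball 0 1" and z: "cmod z < 1" for h z
    by (rule pointwise_limit_of_coeff_limit[where B = "\<lambda>m. cmod (taylor_coeff h m)", OF holomorphic_fejer h cfe])
       (use taylor_abs_summable[OF h z] z in \<open>auto simp: cmod_taylor_coeff_fejer_le norm_mult norm_power\<close>)
  have cprod: "(\<lambda>n. taylor_coeff (\<lambda>z. U (r n) z * fejer (r n) h z) m) \<longlonglongrightarrow> taylor_coeff (\<lambda>z. u z * h z) m"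
    if h: "h holomorphic_on ball 0 1" for h m
    unfolding taylor_coeff_mult[OF hU holomorphic_fejer] taylor_coeff_mult[OF u h]
    by (intro tendsto_intros cu cfe)
  show ?thesis
  proof (rule that[OF u])
    have A0: "cmod (A n 0) \<le> 1 + enn2real (H2_normsq f) + enn2real (H2_normsq g)" for n
    proof -
      have "(\<Sum>i\<le>n. (cmod (taylor_coeff (fejer n h) i))\<^sup>2) \<le> enn2real (H2_normsq h)" if "H2_normsq h < \<infinity>" for h
      proof (rule sum_le_if_suminf_ennreal_le)
        have "(\<Sum>i. ennreal ((cmod (taylor_coeff (fejer n h) i))\<^sup>2)) \<le> H2_normsq h"
          using H2_normsq_fejer_le[of n h] by (simp only: H2_normsq_def)
        also have "H2_normsq h = ennreal (enn2real (H2_normsq h))"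
          using that by (simp add: ennreal_enn2real_if)
        finally show "(\<Sum>i. ennreal ((cmod (taylor_coeff (fejer n h) i))\<^sup>2)) \<le> ennreal (enn2real (H2_normsq h))" .
      qed auto
      from this[OF f(2)] this[OF g(2)] show ?thesis
        unfolding A_def V_def circle_majorant_0
        by (intro norm_triangle_le add_mono) (auto simp: sum_nonneg simp del: of_real_sum)
    qed
    define c where "c = 1 + enn2real (H2_normsq f) + enn2real (H2_normsq g)"
    have c: "c > 0" by (simp add: c_def add_pos_nonneg)
    have "cmod (U (r n) 0) \<ge> 1 / c" for n
    proof -
      have "A (r n) 0 \<noteq> 0"
      proof
        assume "A (r n) 0 = 0"
        moreover have "Re (A (r n) 0) \<ge> 1"
          unfolding A_def V_def circle_majorant_0 by (simp add: sum_nonneg del: of_real_sum)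
        ultimately show False by simp
      qed
      then show ?thesis
        using A0[of "r n"] c by (simp add: U_def norm_divide c_def frac_le)
    qed
    then have "cmod (u 0) \<ge> 1 / c"
      by (intro LIMSEQ_le_const[OF tendsto_norm[OF pu]]) auto
    then show "u 0 \<noteq> 0" using c by (auto simp: divide_le_0_iff)
  next
    fix z :: complex assume z: "cmod z < 1"
    have "cmod (u z) \<le> 1"
      by (rule LIMSEQ_le_const2[OF tendsto_norm[OF pu[OF z]]]) (use U1 z in auto)
    moreover have "cmod (u z * f z) \<le> 1"
      by (rule LIMSEQ_le_const2[OF tendsto_norm[OF tendsto_mult[OF pu[OF z] pfe[OF f(1) z]]]]) (use U1 z in auto)
    moreover have "cmod (u z * g z) \<le> 1"
      by (rule LIMSEQ_le_const2[OF tendsto_norm[OF tendsto_mult[OF pu[OF z] pfe[OF g(1) z]]]]) (use U1 z in auto)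
    ultimately show "cmod (u z) \<le> 1 \<and> cmod (u z * f z) \<le> 1 \<and> cmod (u z * g z) \<le> 1" by blast
  next
    fix \<zeta> :: complex assume l: "cmod \<zeta> = 1"
    have one: "1 * (cmod (U n \<zeta>))\<^sup>2 \<le> 1" for n
      using U1(1)[of \<zeta> n] l by (simp add: power_le_one)
    have "ennreal 1 * Dloc u \<zeta> \<le> 4 * (Dloc f \<zeta> + Dloc g \<zeta>)"
      by (rule Dloc_lower_semicontinuous[OF cu tendsto_const _ scale[OF l _ _ one]]) auto
    moreover have "ennreal 1 * Dloc (\<lambda>z. u z * f z) \<zeta> \<le> 4 * (Dloc f \<zeta> + Dloc g \<zeta>)"
      by (rule Dloc_lower_semicontinuous[OF cprod[OF f(1)] tendsto_const _ scale[OF l _ _ one]]) auto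
    moreover have "ennreal 1 * Dloc (\<lambda>z. u z * g z) \<zeta> \<le> 4 * (Dloc f \<zeta> + Dloc g \<zeta>)"
      by (rule Dloc_lower_semicontinuous[OF cprod[OF g(1)] tendsto_const _ scale[OF l _ _ one]]) auto
    ultimately show "Dloc u \<zeta> \<le> 4 * (Dloc f \<zeta> + Dloc g \<zeta>)
        \<and> Dloc (\<lambda>z. u z * f z) \<zeta> \<le> 4 * (Dloc f \<zeta> + Dloc g \<zeta>)
        \<and> Dloc (\<lambda>z. u z * g z) \<zeta> \<le> 4 * (Dloc f \<zeta> + Dloc g \<zeta>)"
      by simp
  next
    fix \<zeta> \<alpha> :: complex assume l: "cmod \<zeta> = 1" and v: "bval \<zeta> f \<alpha>" and fin: "Dloc f \<zeta> < \<infinity>"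
    have "(\<lambda>n. (cmod (fejer (r n) f \<zeta>))\<^sup>2) \<longlonglongrightarrow> (cmod \<alpha>)\<^sup>2"
      using LIMSEQ_subseq_LIMSEQ[OF fejer_boundary_tendsto[OF l f(1) fin v] r]
      by (intro tendsto_intros) (simp add: o_def)
    moreover have "(cmod (fejer n f \<zeta>))\<^sup>2 * (cmod (U n \<zeta>))\<^sup>2 \<le> 1" for n
      using U1(2)[of \<zeta> n] l by (simp add: norm_mult power_mult_distrib[symmetric] power_le_one mult.commute)
    ultimately show "ennreal ((cmod \<alpha>)\<^sup>2) * Dloc u \<zeta> \<le> 4 * (Dloc f \<zeta> + Dloc g \<zeta>)"
      by (intro Dloc_lower_semicontinuous[OF cu] scale[OF l]) auto
  next
    fix \<zeta> \<alpha> :: complex assume l: "cmod \<zeta> = 1" and v: "bval \<zeta> g \<alpha>" and fin: "Dloc g \<zeta> < \<infinity>"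
    have "(\<lambda>n. (cmod (fejer (r n) g \<zeta>))\<^sup>2) \<longlonglongrightarrow> (cmod \<alpha>)\<^sup>2"
      using LIMSEQ_subseq_LIMSEQ[OF fejer_boundary_tendsto[OF l g(1) fin v] r]
      by (intro tendsto_intros) (simp add: o_def)
    moreover have "(cmod (fejer n g \<zeta>))\<^sup>2 * (cmod (U n \<zeta>))\<^sup>2 \<le> 1" for n
      using U1(3)[of \<zeta> n] l by (simp add: norm_mult power_mult_distrib[symmetric] power_le_one mult.commute)
    ultimately show "ennreal ((cmod \<alpha>)\<^sup>2) * Dloc u \<zeta> \<le> 4 * (Dloc f \<zeta> + Dloc g \<zeta>)"
      by (intro Dloc_lower_semicontinuous[OF cu] scale[OF l]) auto
  qed
qed

text \<open>The weight \<open>\<bar>f(\<zeta>)\<bar>\<^sup>2\<close> that multiplication by \<open>f\<close> puts on the local Dirichlet integral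
  of the multiplier is absorbed by one factor \<open>u\<close>, hence the square of \<open>u\<close>.\<close>
lemma ex_approximants:
  assumes f: "f holomorphic_on ball 0 1" "H2_normsq f < \<infinity>" and g: "g holomorphic_on ball 0 1" "H2_normsq g < \<infinity>"
  obtains u where "u holomorphic_on ball 0 1" "u 0 \<noteq> 0"
    "\<And>z. cmod z < 1 \<Longrightarrow> cmod (u z * (u z * f z)) \<le> 1 \<and> cmod (u z * (u z * g z)) \<le> 1"
    "\<And>\<zeta> n. cmod \<zeta> = 1 \<Longrightarrow> Dloc (\<lambda>z. fejer n (\<lambda>z. u z * (u z * g z)) z * f z) \<zeta> \<le> 130 * (Dloc f \<zeta> + Dloc g \<zeta>)"
    "\<And>\<zeta> n. cmod \<zeta> = 1 \<Longrightarrow> Dloc (\<lambda>z. fejer n (\<lambda>z. u z * (u z * f z)) z * g z) \<zeta> \<le> 130 * (Dloc f \<zeta> + Dloc g \<zeta>)"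
proof -
  obtain u where u: "u holomorphic_on ball 0 1" "u 0 \<noteq> 0"
    and bd: "\<And>z. cmod z < 1 \<Longrightarrow> cmod (u z) \<le> 1 \<and> cmod (u z * f z) \<le> 1 \<and> cmod (u z * g z) \<le> 1"
    and D: "\<And>\<zeta>. cmod \<zeta> = 1 \<Longrightarrow> Dloc u \<zeta> \<le> 4 * (Dloc f \<zeta> + Dloc g \<zeta>)
        \<and> Dloc (\<lambda>z. u z * f z) \<zeta> \<le> 4 * (Dloc f \<zeta> + Dloc g \<zeta>)
        \<and> Dloc (\<lambda>z. u z * g z) \<zeta> \<le> 4 * (Dloc f \<zeta> + Dloc g \<zeta>)"
    and wf: "\<And>\<zeta> \<alpha>. cmod \<zeta> = 1 \<Longrightarrow> bval \<zeta> f \<alpha> \<Longrightarrow> Dloc f \<zeta> < \<infinity> \<Longrightarrow> ennreal ((cmod \<alpha>)\<^sup>2) * Dloc u \<zeta> \<le> 4 * (Dloc f \<zeta> + Dloc g \<zeta>)"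
    and wg: "\<And>\<zeta> \<alpha>. cmod \<zeta> = 1 \<Longrightarrow> bval \<zeta> g \<alpha> \<Longrightarrow> Dloc g \<zeta> < \<infinity> \<Longrightarrow> ennreal ((cmod \<alpha>)\<^sup>2) * Dloc u \<zeta> \<le> 4 * (Dloc f \<zeta> + Dloc g \<zeta>)"
    by (rule ex_multiplier[OF f g]) (rule that, assumption+)
  have sq: "cmod (u z * (u z * h z)) \<le> 1" if "cmod z < 1" "cmod (u z * h z) \<le> 1" for z h
    using bd[OF that(1)] that(2) by (simp add: norm_mult mult_le_one)
  have main: "Dloc (\<lambda>z. fejer n (\<lambda>z. u z * (u z * h z)) z * k z) \<zeta> \<le> 130 * (Dloc f \<zeta> + Dloc g \<zeta>)"
    if l: "cmod \<zeta> = 1" and h: "h holomorphic_on ball 0 1" "\<And>z. cmod z < 1 \<Longrightarrow> cmod (u z * h z) \<le> 1"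
      "Dloc (\<lambda>z. u z * h z) \<zeta> \<le> 4 * (Dloc f \<zeta> + Dloc g \<zeta>)"
      and k: "k holomorphic_on ball 0 1" "\<And>z. cmod z < 1 \<Longrightarrow> cmod (u z * k z) \<le> 1" "Dloc k \<zeta> \<le> Dloc f \<zeta> + Dloc g \<zeta>"
      and w: "\<And>\<alpha>. bval \<zeta> k \<alpha> \<Longrightarrow> Dloc k \<zeta> < \<infinity> \<Longrightarrow> ennreal ((cmod \<alpha>)\<^sup>2) * Dloc u \<zeta> \<le> 4 * (Dloc f \<zeta> + Dloc g \<zeta>)"
    for n h k \<zeta>
  proof (cases "Dloc f \<zeta> + Dloc g \<zeta> < \<infinity>")
    case True
    define S where "S = Dloc f \<zeta> + Dloc g \<zeta>"
    have fin: "Dloc k \<zeta> < \<infinity>" using k(3) True by (rule order_le_less_trans)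
    have "Dloc u \<zeta> \<le> 4 * S" using D[OF l] by (simp add: S_def)
    also have "\<dots> < \<infinity>" using True by (simp add: S_def ennreal_mult_less_top)
    finally have finu: "Dloc u \<zeta> < \<infinity>" .
    obtain \<alpha> where \<alpha>: "bval \<zeta> k \<alpha>" using Dloc_bval_ex[OF l k(1) fin] by metis
    obtain \<beta> where \<beta>: "bval \<zeta> u \<beta>" using Dloc_bval_ex[OF l u(1) finu] by metis
    \<comment> \<open>The product \<open>u k\<close> has radial limit
      \<open>\<beta> \<alpha>\<close> and is bounded by 1, even where \<open>k\<close> alone is
      unbounded.\<close>
    have \<beta>\<alpha>: "(cmod \<alpha>)\<^sup>2 * (cmod \<beta>)\<^sup>2 \<le> 1"
      using bval_bound[OF l bval_mult[OF \<beta> \<alpha>] k(2)]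
      by (simp add: norm_mult power_mult_distrib[symmetric] power_le_one mult.commute)
    define \<phi> where "\<phi> = (\<lambda>z. u z * (u z * h z))"
    have h\<phi>: "\<phi> holomorphic_on ball 0 1" unfolding \<phi>_def by (intro holomorphic_intros u h)
    have b\<phi>: "cmod (\<phi> z) \<le> 1" if "cmod z < 1" for z
      unfolding \<phi>_def by (rule sq[of z h, OF that h(2)[OF that]])
    have "Dloc \<phi> \<zeta> = Dloc (\<lambda>z. (u z * h z) * u z) \<zeta>"
      by (simp add: \<phi>_def mult.commute)
    also have "\<dots> \<le> 2 * ennreal ((cmod \<beta>)\<^sup>2) * Dloc (\<lambda>z. u z * h z) \<zeta> + 2 * ennreal (1\<^sup>2) * Dloc u \<zeta>"
      by (rule Dloc_mult_le[OF l u(1) \<beta> _ h(2) finu]) (intro holomorphic_intros u h)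
    also have "\<dots> \<le> 2 * ennreal ((cmod \<beta>)\<^sup>2) * (4 * S) + 2 * Dloc u \<zeta>"
      using h(3) by (intro add_mono mult_left_mono) (auto simp: S_def)
    finally have "ennreal ((cmod \<alpha>)\<^sup>2) * Dloc \<phi> \<zeta> \<le> ennreal ((cmod \<alpha>)\<^sup>2) * (2 * ennreal ((cmod \<beta>)\<^sup>2) * (4 * S) + 2 * Dloc u \<zeta>)"
      by (rule mult_left_mono) simp
    also have "\<dots> = ennreal ((cmod \<alpha>)\<^sup>2 * (cmod \<beta>)\<^sup>2) * (8 * S) + 2 * (ennreal ((cmod \<alpha>)\<^sup>2) * Dloc u \<zeta>)"
      by (simp add: ennreal_mult distrib_left mult_ac)
    also have "\<dots> \<le> ennreal 1 * (8 * S) + 2 * (4 * S)"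
      using w[OF \<alpha> fin] by (intro add_mono mult_right_mono mult_left_mono ennreal_leI \<beta>\<alpha>) (auto simp: S_def)
    also have "\<dots> = 16 * S" by (simp flip: distrib_right)
    finally have \<phi>S: "ennreal ((cmod \<alpha>)\<^sup>2) * Dloc \<phi> \<zeta> \<le> 16 * S" .
    \<comment> \<open>Here 130 arises as \<open>8 * 16 + 2\<close>: the product bound contributes 2
      and the Fejer mean 4, applied to the weighted bound \<open>16 * S\<close> for
      \<open>\<phi>\<close>, and the sup term adds \<open>2 * S\<close>.\<close>
    have "Dloc (\<lambda>z. fejer n \<phi> z * k z) \<zeta> \<le> 2 * ennreal ((cmod \<alpha>)\<^sup>2) * Dloc (fejer n \<phi>) \<zeta> + 2 * ennreal (1\<^sup>2) * Dloc k \<zeta>"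
      by (rule Dloc_mult_le[OF l k(1) \<alpha> holomorphic_fejer cmod_fejer_le[OF h\<phi> b\<phi>] fin])
    also have "\<dots> \<le> 2 * ennreal ((cmod \<alpha>)\<^sup>2) * (4 * Dloc \<phi> \<zeta>) + 2 * ennreal (1\<^sup>2) * S"
      using k(3) by (intro add_mono mult_left_mono Dloc_fejer_le[OF l]) (auto simp: S_def)
    also have "\<dots> = 8 * (ennreal ((cmod \<alpha>)\<^sup>2) * Dloc \<phi> \<zeta>) + 2 * S"
    proof -
      have "2 * a * (4 * d) = (2 * 4) * (a * d)" for a d :: ennreal by (simp only: mult_ac)
      then show ?thesis by simp
    qed
    also have "\<dots> \<le> 8 * (16 * S) + 2 * S"
      by (intro add_mono mult_left_mono \<phi>S) auto
    also have "\<dots> = 130 * S"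
      by (simp flip: distrib_right mult.assoc)
    finally show ?thesis by (simp add: \<phi>_def S_def)
  next
    case False
    then have "Dloc f \<zeta> + Dloc g \<zeta> = top" by (metis infinity_ennreal_def top.not_eq_extremum)
    moreover have "(130::ennreal) * top = top" by (simp add: ennreal_mult_top)
    ultimately show ?thesis by (simp only: top_greatest)
  qed
  show ?thesis
  proof (rule that[OF u])
    show "cmod (u z * (u z * f z)) \<le> 1 \<and> cmod (u z * (u z * g z)) \<le> 1" if "cmod z < 1" for z
      using sq[of z f] sq[of z g] bd[OF that] that by blast
    show "Dloc (\<lambda>z. fejer n (\<lambda>z. u z * (u z * g z)) z * f z) \<zeta> \<le> 130 * (Dloc f \<zeta> + Dloc g \<zeta>)" if "cmod \<zeta> = 1" for \<zeta> n
      using D[OF that] bd wf[OF that] by (intro main[OF that] g f) (auto simp: add_increasing2)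
    show "Dloc (\<lambda>z. fejer n (\<lambda>z. u z * (u z * f z)) z * g z) \<zeta> \<le> 130 * (Dloc f \<zeta> + Dloc g \<zeta>)" if "cmod \<zeta> = 1" for \<zeta> n
      using D[OF that] bd wg[OF that] by (intro main[OF that] g f) (auto simp: add_increasing)
  qed
qed

section \<open>The Dirichlet integral\<close>

text \<open>The classical Dirichlet integral in coefficients. It enters both as the bound in
  \<open>D2loc_le\<close> and as the circle mean of \<open>Dloc\<close>.\<close>

definition Dir :: "(complex \<Rightarrow> complex) \<Rightarrow> ennreal" where
  "Dir f = (\<Sum>m. ennreal (real m * (cmod (taylor_coeff f m))\<^sup>2))"

lemma Dir_z_mult:
  assumes "f holomorphic_on ball 0 1"
  shows "Dir (\<lambda>z. z * f z) = Dir f + H2_normsq f"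
proof -
  have "(\<Sum>n. ennreal (real (n + 1) * (cmod (taylor_coeff (\<lambda>z. z * f z) (n + 1)))\<^sup>2)) = Dir (\<lambda>z. z * f z)"
    unfolding Dir_def by (rule suminf_ennreal_offset) simp
  moreover have "ennreal (real (n + 1) * (cmod (taylor_coeff (\<lambda>z. z * f z) (n + 1)))\<^sup>2)
      = ennreal (real n * (cmod (taylor_coeff f n))\<^sup>2) + ennreal ((cmod (taylor_coeff f n))\<^sup>2)" for n
    by (simp add: taylor_coeff_z_mult[OF assms] ennreal_plus[symmetric] algebra_simps del: ennreal_plus)
  ultimately have "Dir (\<lambda>z. z * f z) = (\<Sum>n. ennreal (real n * (cmod (taylor_coeff f n))\<^sup>2) + ennreal ((cmod (taylor_coeff f n))\<^sup>2))"
    by (simp only:)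
  also have "\<dots> = Dir f + H2_normsq f"
    unfolding Dir_def H2_normsq_def by (rule suminf_add[OF summableI summableI, symmetric])
  finally show ?thesis .
qed

lemma H2_normsq_le_Dir: "H2_normsq f \<le> ennreal ((cmod (taylor_coeff f 0))\<^sup>2) + Dir f"
proof -
  have "H2_normsq f \<le> (\<Sum>m. (if m = 0 then ennreal ((cmod (taylor_coeff f 0))\<^sup>2) else 0) + ennreal (real m * (cmod (taylor_coeff f m))\<^sup>2))"
    unfolding H2_normsq_def
  proof (intro suminf_le summableI)
    fix m
    show "ennreal ((cmod (taylor_coeff f m))\<^sup>2) \<le> (if m = 0 then ennreal ((cmod (taylor_coeff f 0))\<^sup>2) else 0) + ennreal (real m * (cmod (taylor_coeff f m))\<^sup>2)"
    proof (cases m)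
      case (Suc k)
      have "1 * (cmod (taylor_coeff f m))\<^sup>2 \<le> real m * (cmod (taylor_coeff f m))\<^sup>2"
        using Suc by (intro mult_right_mono) auto
      then show ?thesis using Suc by (simp add: ennreal_leI)
    qed simp
  qed
  also have "\<dots> = (\<Sum>m. if m = 0 then ennreal ((cmod (taylor_coeff f 0))\<^sup>2) else 0) + Dir f"
    unfolding Dir_def by (rule suminf_add[OF summableI summableI, symmetric])
  also have "(\<Sum>m::nat. if m = 0 then ennreal ((cmod (taylor_coeff f 0))\<^sup>2) else 0) = ennreal ((cmod (taylor_coeff f 0))\<^sup>2)"
    using suminf_finite[of "{0::nat}" "\<lambda>m. if m = 0 then ennreal ((cmod (taylor_coeff f 0))\<^sup>2) else 0"] by simp
  finally show ?thesis .
qed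

text \<open>The hypothesis makes \<open>f\<close> a constant plus \<open>z - \<zeta>\<close> times a
  function of finite Dirichlet integral. So finiteness at one boundary point already yields Hardy
  space membership for the elements of \<open>HH\<close>.\<close>

lemma D2loc_finite_imp:
  assumes l: "cmod \<zeta> = 1" and fin: "D2loc f \<zeta> < \<infinity>"
  shows "Dir f < \<infinity>" "H2_normsq f < \<infinity>"
proof -
  obtain k where k: "\<And>m. taylor_coeff f (Suc m) = k m - \<zeta> * k (Suc m)"
    and K: "(\<Sum>m. ennreal (real m * (cmod (k m))\<^sup>2)) \<le> D2loc f \<zeta>"
    using D2loc_ex[OF l fin] by blast
  define X where "X = (\<Sum>m. ennreal (real m * (cmod (k m))\<^sup>2))"
  have X: "X < top" using K fin unfolding X_def by (simp add: order_le_less_trans)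
  have "Dir f = (\<Sum>m. ennreal (real (m + 1) * (cmod (taylor_coeff f (m + 1)))\<^sup>2))"
    unfolding Dir_def by (rule suminf_ennreal_offset[symmetric]) simp
  also have "\<dots> \<le> 2 * (\<Sum>m. ennreal (real (m + 1) * (cmod (k m))\<^sup>2)) + 2 * (\<Sum>m. ennreal (real (m + 1) * (cmod (- (\<zeta> * k (m + 1))))\<^sup>2))"
    by (rule suminf_weighted_add_le[where a = "\<lambda>m. taylor_coeff f (m + 1)"]) (simp_all add: k)
  also have "(\<Sum>m. ennreal (real (m + 1) * (cmod (- (\<zeta> * k (m + 1))))\<^sup>2)) = (\<Sum>m. ennreal (real (m + 1) * (cmod (k (m + 1)))\<^sup>2))"
    using l by (simp only: norm_minus_cancel norm_mult mult_1_left)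
  also have "\<dots> = X"
    unfolding X_def by (rule suminf_ennreal_offset[where f = "\<lambda>m. ennreal (real m * (cmod (k m))\<^sup>2)"]) simp
  \<comment> \<open>The bound \<open>m + 1 \<le> 2 m\<close> fails only at \<open>m = 0\<close>;
    that term is split off, since \<open>X\<close> does not see \<open>k 0\<close>.\<close>
  also have "(\<Sum>m. ennreal (real (m + 1) * (cmod (k m))\<^sup>2)) \<le> (\<Sum>m. (if m = 0 then ennreal ((cmod (k 0))\<^sup>2) else 0) + 2 * ennreal (real m * (cmod (k m))\<^sup>2))"
  proof (intro suminf_le summableI)
    fix m
    show "ennreal (real (m + 1) * (cmod (k m))\<^sup>2) \<le> (if m = 0 then ennreal ((cmod (k 0))\<^sup>2) else 0) + 2 * ennreal (real m * (cmod (k m))\<^sup>2)"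
    proof (cases m)
      case (Suc j)
      have "real (m + 1) * (cmod (k m))\<^sup>2 \<le> 2 * (real m * (cmod (k m))\<^sup>2)"
        unfolding mult.assoc[symmetric] using Suc by (intro mult_right_mono) auto
      then have "ennreal (real (m + 1) * (cmod (k m))\<^sup>2) \<le> ennreal (2 * (real m * (cmod (k m))\<^sup>2))"
        by (rule ennreal_leI)
      also have "\<dots> = 2 * ennreal (real m * (cmod (k m))\<^sup>2)"
        by (subst ennreal_mult) auto
      finally show ?thesis using Suc by simp
    qed simp
  qed
  also have "\<dots> = (\<Sum>m::nat. if m = 0 then ennreal ((cmod (k 0))\<^sup>2) else 0) + 2 * X"
    unfolding X_def ennreal_suminf_cmult[symmetric] by (rule suminf_add[OF summableI summableI, symmetric])
  also have "(\<Sum>m::nat. if m = 0 then ennreal ((cmod (k 0))\<^sup>2) else 0) = ennreal ((cmod (k 0))\<^sup>2)"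
    using suminf_finite[of "{0::nat}" "\<lambda>m. if m = 0 then ennreal ((cmod (k 0))\<^sup>2) else 0"] by simp
  finally have "Dir f \<le> 2 * (ennreal ((cmod (k 0))\<^sup>2) + 2 * X) + 2 * X"
    by (simp add: add_mono mult_left_mono)
  also have "\<dots> < top"
    using X by (simp add: ennreal_mult_less_top)
  finally show D: "Dir f < \<infinity>" by simp
  show "H2_normsq f < \<infinity>"
    using D by (intro order_le_less_trans[OF H2_normsq_le_Dir]) simp
qed

text \<open>The difference quotient at \<open>\<zeta>\<close> is \<open>h\<close> itself, with
  boundary value 0. This is how a factor vanishing at an atom reduces second order integrals to
  \<open>Dir\<close>.\<close>

lemma D2loc_linear_mult_le:
  assumes l: "cmod \<zeta> = 1" and h: "h holomorphic_on ball 0 1"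
  shows "D2loc (\<lambda>z. (z - \<zeta>) * h z) \<zeta> \<le> Dir h"
proof -
  have "bdec \<zeta> (\<lambda>z. (z - \<zeta>) * h z) 0 h" by (simp add: bdec_def h)
  from bdec_coeff(2)[OF this] show ?thesis
    unfolding Dir_def by (rule D2loc_le[OF l])
qed

lemma taylor_coeff_linear_mult:
  assumes F: "F holomorphic_on ball 0 1"
  shows "taylor_coeff (\<lambda>z. (z - a) * F z) m = taylor_coeff (\<lambda>z. z * F z) m + taylor_coeff (\<lambda>z. - a * F z) m"
proof -
  have h: "(\<lambda>z. z * F z) holomorphic_on ball 0 1" "(\<lambda>z. - a * F z) holomorphic_on ball 0 1"
    by (intro holomorphic_intros F)+
  have "(\<lambda>z. (z - a) * F z) = (\<lambda>z. z * F z + - a * F z)" by (simp add: algebra_simps)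
  then show ?thesis by (simp only: taylor_coeff_add[OF h])
qed

lemma cmod_taylor_coeff_cmult_le:
  assumes "F holomorphic_on ball 0 1" "cmod a \<le> 1"
  shows "cmod (taylor_coeff (\<lambda>z. - a * F z) m) \<le> cmod (taylor_coeff F m)"
  unfolding taylor_coeff_cmult[OF assms(1)] using assms(2) by (simp add: norm_mult mult_left_le_one_le)

lemma H2_normsq_linear_mult_le:
  assumes F: "F holomorphic_on ball 0 1" and a: "cmod a \<le> 1"
  shows "H2_normsq (\<lambda>z. (z - a) * F z) \<le> 4 * H2_normsq F"
proof -
  have "H2_normsq (\<lambda>z. (z - a) * F z) \<le> 2 * H2_normsq (\<lambda>z. z * F z) + 2 * H2_normsq (\<lambda>z. - a * F z)"
    unfolding H2_normsq_def
    using suminf_weighted_add_le[where w = "\<lambda>_. 1", OF taylor_coeff_linear_mult[OF F] zero_le_one] by (simp only: mult_1_left)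
  also have "\<dots> \<le> 2 * H2_normsq F + 2 * H2_normsq F"
  proof (intro add_mono mult_left_mono)
    show "H2_normsq (\<lambda>z. - a * F z) \<le> H2_normsq F"
      unfolding H2_normsq_def
      by (intro suminf_le summableI ennreal_leI power_mono norm_ge_zero cmod_taylor_coeff_cmult_le F a)
  qed (auto simp: H2_normsq_z_mult[OF F])
  also have "\<dots> = 4 * H2_normsq F" by (simp flip: distrib_right)
  finally show ?thesis .
qed

lemma Dir_linear_mult_le:
  assumes F: "F holomorphic_on ball 0 1" and a: "cmod a \<le> 1"
  shows "Dir (\<lambda>z. (z - a) * F z) \<le> 2 * H2_normsq F + 4 * Dir F"
proof -
  have "Dir (\<lambda>z. (z - a) * F z) \<le> 2 * Dir (\<lambda>z. z * F z) + 2 * Dir (\<lambda>z. - a * F z)"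
    unfolding Dir_def
    by (rule suminf_weighted_add_le[where w = "\<lambda>m. real m", OF taylor_coeff_linear_mult[OF F]]) simp
  also have "\<dots> \<le> 2 * (Dir F + H2_normsq F) + 2 * Dir F"
  proof (intro add_mono mult_left_mono)
    show "Dir (\<lambda>z. - a * F z) \<le> Dir F"
      unfolding Dir_def
      by (intro suminf_le summableI ennreal_leI mult_left_mono power_mono norm_ge_zero cmod_taylor_coeff_cmult_le F a) simp
  qed (auto simp: Dir_z_mult[OF F])
  also have "\<dots> = 2 * H2_normsq F + (2 * Dir F + 2 * Dir F)"
    by (simp only: distrib_left add_ac)
  also have "2 * Dir F + 2 * Dir F = 4 * Dir F" by (simp flip: distrib_right)
  finally show ?thesis .
qed

lemma H2_normsq_one: "H2_normsq (\<lambda>_. 1) = 1"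
proof -
  have "H2_normsq (\<lambda>_. 1) = (\<Sum>m\<in>{0}. ennreal ((cmod (taylor_coeff (\<lambda>_. 1) m))\<^sup>2))"
    unfolding H2_normsq_def by (rule suminf_finite) (auto simp: taylor_coeff_const)
  then show ?thesis by (simp add: taylor_coeff_const)
qed

text \<open>The factor \<open>z - a\<close> has difference quotient 1 and is bounded by 2, and the
  boundary value of \<open>F\<close> is controlled by its Hardy norm and
  \<open>Dloc F \<zeta>\<close>; hence \<open>12 = 4 + 8\<close>.\<close>

lemma Dloc_linear_mult_le:
  assumes l: "cmod \<zeta> = 1" and F: "F holomorphic_on ball 0 1" and a: "cmod a \<le> 1"
  shows "Dloc (\<lambda>z. (z - a) * F z) \<zeta> \<le> 4 * H2_normsq F + 12 * Dloc F \<zeta>"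
proof (cases "Dloc F \<zeta> < \<infinity>")
  case True
  obtain \<alpha> where \<alpha>: "bval \<zeta> F \<alpha>" and A: "ennreal ((cmod \<alpha>)\<^sup>2) \<le> 2 * ennreal ((cmod (F 0))\<^sup>2) + 2 * Dloc F \<zeta>"
    using Dloc_bval_ex[OF l F True] by metis
  have F0: "ennreal ((cmod (F 0))\<^sup>2) \<le> H2_normsq F"
    using H2_normsq_ge_coeff[of F 0] by (simp add: taylor_coeff_def)
  have "bdec \<zeta> (\<lambda>z. z - a) (\<zeta> - a) (\<lambda>_. 1)" by (simp add: bdec_def)
  from Dloc_le_bdec[OF l this] have q: "Dloc (\<lambda>z. z - a) \<zeta> \<le> 1" by (simp add: H2_normsq_one)
  have "Dloc (\<lambda>z. (z - a) * F z) \<zeta> \<le> 2 * ennreal ((cmod \<alpha>)\<^sup>2) * Dloc (\<lambda>z. z - a) \<zeta> + 2 * ennreal (2\<^sup>2) * Dloc F \<zeta>"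
  proof (rule Dloc_mult_le[OF l F \<alpha> _ _ True])
    fix z :: complex assume "cmod z < 1"
    then show "cmod (z - a) \<le> 2" using norm_triangle_ineq4[of z a] a by simp
  qed (intro holomorphic_intros)
  also have "\<dots> \<le> 2 * (2 * H2_normsq F + 2 * Dloc F \<zeta>) * 1 + 2 * ennreal (2\<^sup>2) * Dloc F \<zeta>"
    using A F0 q by (intro add_mono mult_mono mult_left_mono order_refl order_trans[OF A]) auto
  also have "\<dots> = (2 * 2) * H2_normsq F + ((2 * 2) * Dloc F \<zeta> + (2 * 4) * Dloc F \<zeta>)"
    by (simp only: mult_1_right distrib_left mult.assoc add.assoc) simp
  also have "\<dots> = 4 * H2_normsq F + 12 * Dloc F \<zeta>"
    by (simp only: distrib_right[symmetric]) simp
  finally show ?thesis .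
next
  case False
  then have "Dloc F \<zeta> = top" by (metis infinity_ennreal_def top.not_eq_extremum)
  moreover have "4 * H2_normsq F + 12 * top = top" by (simp add: ennreal_mult_top)
  ultimately show ?thesis by (simp only: top_greatest)
qed

text \<open>Dividing by \<open>z\<close> shifts the quotient sequence at \<open>\<zeta>\<close> by
  one place. Dropping its first entry then shows that multiplication by \<open>z\<close> does not
  decrease either local integral.\<close>

lemma expansive_quotient:
  assumes f: "f holomorphic_on ball 0 1" and k: "\<And>m. taylor_coeff (\<lambda>z. z * f z) (Suc m) = k m - \<zeta> * k (Suc m)"
  shows "taylor_coeff f (Suc m) = k (Suc m) - \<zeta> * k (Suc (Suc m))"
  using k[of "Suc m"] by (simp add: taylor_coeff_z_mult[OF f])

lemma suminf_shift_le:
  fixes f :: "nat \<Rightarrow> ennreal"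
  shows "(\<Sum>m. f (Suc m)) \<le> (\<Sum>m. f m)"
proof -
  have "suminf f = (\<Sum>m. f (m + 1)) + (\<Sum>m<1. f m)"
    by (rule suminf_offset) (rule summableI)
  then show ?thesis by (simp only: Suc_eq_plus1) (simp only: le_iff_add, blast)
qed

lemma Dloc_le_z_mult:
  assumes l: "cmod \<zeta> = 1" and f: "f holomorphic_on ball 0 1"
  shows "Dloc f \<zeta> \<le> Dloc (\<lambda>z. z * f z) \<zeta>"
proof (cases "Dloc (\<lambda>z. z * f z) \<zeta> < \<infinity>")
  case True
  obtain k where k: "\<And>m. taylor_coeff (\<lambda>z. z * f z) (Suc m) = k m - \<zeta> * k (Suc m)"
    and K: "(\<Sum>m. ennreal ((cmod (k m))\<^sup>2)) \<le> Dloc (\<lambda>z. z * f z) \<zeta>"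
    using Dloc_ex[OF l True] by blast
  have "Dloc f \<zeta> \<le> (\<Sum>m. ennreal ((cmod (k (Suc m)))\<^sup>2))"
    by (rule Dloc_le[OF l expansive_quotient[OF f k]])
  also have "\<dots> \<le> (\<Sum>m. ennreal ((cmod (k m))\<^sup>2))"
    by (rule suminf_shift_le)
  finally show ?thesis using K by (rule order_trans)
next
  case False
  then have "Dloc (\<lambda>z. z * f z) \<zeta> = top" by (metis infinity_ennreal_def top.not_eq_extremum)
  then show ?thesis by (simp only: top_greatest)
qed

lemma D2loc_le_z_mult:
  assumes l: "cmod \<zeta> = 1" and f: "f holomorphic_on ball 0 1"
  shows "D2loc f \<zeta> \<le> D2loc (\<lambda>z. z * f z) \<zeta>"
proof (cases "D2loc (\<lambda>z. z * f z) \<zeta> < \<infinity>")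
  case True
  obtain k where k: "\<And>m. taylor_coeff (\<lambda>z. z * f z) (Suc m) = k m - \<zeta> * k (Suc m)"
    and K: "(\<Sum>m. ennreal (real m * (cmod (k m))\<^sup>2)) \<le> D2loc (\<lambda>z. z * f z) \<zeta>"
    using D2loc_ex[OF l True] by blast
  have "D2loc f \<zeta> \<le> (\<Sum>m. ennreal (real m * (cmod (k (Suc m)))\<^sup>2))"
    by (rule D2loc_le[OF l expansive_quotient[OF f k]])
  also have "\<dots> \<le> (\<Sum>m. ennreal (real (Suc m) * (cmod (k (Suc m)))\<^sup>2))"
    by (intro suminf_le summableI ennreal_leI mult_right_mono) auto
  also have "\<dots> \<le> (\<Sum>m. ennreal (real m * (cmod (k m))\<^sup>2))"
    by (rule suminf_shift_le)
  finally show ?thesis using K by (rule order_trans)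
next
  case False
  then have "D2loc (\<lambda>z. z * f z) \<zeta> = top" by (metis infinity_ennreal_def top.not_eq_extremum)
  then show ?thesis by (simp only: top_greatest)
qed

section \<open>The Dirichlet integral as a mean over the circle\<close>

lemma circ_parseval_finite:
  "(\<integral>\<^sup>+t. ennreal ((cmod (\<Sum>m\<le>n. b m * circ t ^ m))\<^sup>2) * indicator {0..1} t \<partial>lborel) = ennreal (\<Sum>m\<le>n. (cmod (b m))\<^sup>2)"
proof -
  define a where "a = (\<lambda>m. if m \<le> n then b m else 0)"
  have "summable (\<lambda>m. cmod (a m))"
    by (rule summable_finite[of "{..n}"]) (auto simp: a_def)
  note P = circ_parseval(1)[OF this]
  have 1: "(\<Sum>m. a m * circ t ^ m) = (\<Sum>m\<le>n. b m * circ t ^ m)" for t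
    by (subst suminf_finite[of "{..n}"]) (auto simp: a_def)
  have 2: "(\<Sum>m. (cmod (a m))\<^sup>2) = (\<Sum>m\<le>n. (cmod (b m))\<^sup>2)"
    by (subst suminf_finite[of "{..n}"]) (auto simp: a_def)
  have "(\<integral>\<^sup>+t. ennreal ((cmod (\<Sum>m\<le>n. b m * circ t ^ m))\<^sup>2) * indicator {0..1} t \<partial>lborel)
      = (\<integral>\<^sup>+t. ennreal (indicator {0..1} t * (cmod (\<Sum>m\<le>n. b m * circ t ^ m))\<^sup>2) \<partial>lborel)"
    by (intro nn_integral_cong) (simp split: split_indicator)
  also have "\<dots> = ennreal (\<Sum>m\<le>n. (cmod (b m))\<^sup>2)"
    using P unfolding 1 2 by (intro nn_integral_has_integral_lebesgue) auto
  finally show ?thesis .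
qed

lemma partial_sum_telescope:
  fixes x :: "nat \<Rightarrow> real"
  assumes "x 0 = 0"
  shows "(\<Sum>n\<le>N. (\<Sum>m\<le>n. x m) / (real n * (real n + 1))) = (\<Sum>m\<le>N. x m / real m) - (\<Sum>m\<le>N. x m) / (real N + 1)"
proof (induction N)
  case (Suc N)
  define X where "X = (\<Sum>m\<le>N. x m)"
  have "(X + x (Suc N)) / (real (Suc N) * (real (Suc N) + 1)) = x (Suc N) / real (Suc N) + X / (real N + 1) - (X + x (Suc N)) / (real (Suc N) + 1)"
    by (simp add: divide_simps) (simp add: algebra_simps)
  then show ?case using Suc by (simp add: X_def)
qed (use assms in simp)

text \<open>By Parseval the mean of the \<open>n\<close>-th term of \<open>Dloc\<close> involves
  only \<open>m\<^sup>2\<close> times the squared coefficients with \<open>m \<le> n\<close>, and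
  the sum of \<open>1 / (n (n + 1))\<close> over \<open>n \<ge> m\<close> is
  \<open>1 / m\<close>.\<close>

lemma Dir_eq_average: "Dir f = (\<integral>\<^sup>+t. Dloc f (circ t) * indicator {0..1} t \<partial>lborel)"
proof -
  define x where "x = (\<lambda>m. (real m)\<^sup>2 * (cmod (taylor_coeff f m))\<^sup>2)"
  have x0: "x 0 = 0" "\<And>m. 0 \<le> x m" by (simp_all add: x_def)
  define d where "d = (\<lambda>n. (\<Sum>m\<le>n. x m) / (real n * (real n + 1)))"
  have d0: "0 \<le> d n" for n unfolding d_def by (intro divide_nonneg_nonneg sum_nonneg x0) auto
  have I: "(\<integral>\<^sup>+t. Dloc f (circ t) * indicator {0..1} t \<partial>lborel) = (\<Sum>n. ennreal (d n))"
  proof -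
    define G where "G = (\<lambda>n t. cmod (\<Sum>m\<le>n. of_nat m * taylor_coeff f m * circ t ^ m))"
    have [measurable]: "G n \<in> borel_measurable borel" for n unfolding G_def by measurable
    have "(\<integral>\<^sup>+t. Dloc f (circ t) * indicator {0..1} t \<partial>lborel)
        = (\<integral>\<^sup>+t. (\<Sum>n. ennreal (1 / (real n * (real n + 1))) * (ennreal ((G n t)\<^sup>2) * indicator {0..1} t)) \<partial>lborel)"
    proof (intro nn_integral_cong)
      fix t
      have "Dloc f (circ t) = (\<Sum>n. ennreal (1 / (real n * (real n + 1))) * ennreal ((G n t)\<^sup>2))"
        unfolding Dloc_def G_def by (intro suminf_cong) (simp flip: ennreal_mult)
      then show "Dloc f (circ t) * indicator {0..1} t = (\<Sum>n. ennreal (1 / (real n * (real n + 1))) * (ennreal ((G n t)\<^sup>2) * indicator {0..1} t))"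
        by (simp only: ennreal_suminf_multc[symmetric] mult.assoc)
    qed
    also have "\<dots> = (\<Sum>n. \<integral>\<^sup>+t. ennreal (1 / (real n * (real n + 1))) * (ennreal ((G n t)\<^sup>2) * indicator {0..1} t) \<partial>lborel)"
      by (rule nn_integral_suminf) measurable
    also have "\<dots> = (\<Sum>n. ennreal (d n))"
    proof (intro suminf_cong)
      fix n
      have "(\<integral>\<^sup>+t. ennreal (1 / (real n * (real n + 1))) * (ennreal ((G n t)\<^sup>2) * indicator {0..1} t) \<partial>lborel)
          = ennreal (1 / (real n * (real n + 1))) * (\<integral>\<^sup>+t. ennreal ((G n t)\<^sup>2) * indicator {0..1} t \<partial>lborel)"
        by (rule nn_integral_cmult) measurable
      also have "(\<integral>\<^sup>+t. ennreal ((G n t)\<^sup>2) * indicator {0..1} t \<partial>lborel) = ennreal (\<Sum>m\<le>n. x m)"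
        unfolding G_def circ_parseval_finite by (simp add: x_def norm_mult power_mult_distrib)
      also have "ennreal (1 / (real n * (real n + 1))) * ennreal (\<Sum>m\<le>n. x m) = ennreal (d n)"
        unfolding d_def by (simp add: x0 sum_nonneg flip: ennreal_mult)
      finally show "(\<integral>\<^sup>+t. ennreal (1 / (real n * (real n + 1))) * (ennreal ((G n t)\<^sup>2) * indicator {0..1} t) \<partial>lborel) = ennreal (d n)" .
    qed
    finally show ?thesis .
  qed
  have D: "Dir f = (\<Sum>m. ennreal (x m / real m))"
    unfolding Dir_def x_def by (intro suminf_cong) (simp add: power2_eq_square)
  have tel: "(\<Sum>n\<le>N. d n) = (\<Sum>m\<le>N. x m / real m) - (\<Sum>m\<le>N. x m) / (real N + 1)" for N
    unfolding d_def by (rule partial_sum_telescope[of x, OF x0(1)])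
  have "(\<Sum>n. ennreal (d n)) \<le> (\<Sum>m. ennreal (x m / real m))"
    by (rule suminf_ennreal_le_suminf) (auto simp: tel d0 x0 intro!: divide_nonneg_nonneg sum_nonneg)
  moreover have "(\<Sum>m. ennreal (x m / real m)) \<le> (\<Sum>n. ennreal (d n))"
  proof (cases "(\<Sum>n. ennreal (d n))")
    case (real S)
    have dS: "(\<Sum>n\<le>N. d n) \<le> S" for N
      by (rule sum_le_if_suminf_ennreal_le) (use real d0 in auto)
    have "(\<Sum>m. ennreal (x m / real m)) \<le> ennreal S"
    proof (rule suminf_ennreal_le_realI)
      fix M
      \<comment> \<open>The cut \<open>M\<close> stays fixed while \<open>N\<close> grows, so that
        the error term tends to 0.\<close>
      have "(\<Sum>m\<le>M. x m / real m) \<le> S + (\<Sum>m\<le>M. x m) / (real N + 1)" if "N \<ge> M" for N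
      proof -
        have "(\<Sum>m\<le>M. x m / real m) - (\<Sum>m\<le>M. x m) / (real N + 1) = (\<Sum>m\<le>M. x m / real m - x m / (real N + 1))"
          by (simp add: sum_subtractf sum_divide_distrib)
        also have "\<dots> \<le> (\<Sum>m\<le>N. x m / real m - x m / (real N + 1))"
        proof (rule sum_mono2)
          fix m assume "m \<in> {..N} - {..M}"
          then show "0 \<le> x m / real m - x m / (real N + 1)"
            using x0(2)[of m] by (simp add: divide_left_mono)
        qed (use that in auto)
        also have "\<dots> = (\<Sum>n\<le>N. d n)"
          unfolding tel by (simp add: sum_subtractf sum_divide_distrib)
        also have "\<dots> \<le> S" by (rule dS)
        finally show ?thesis by simp
      qed
      moreover have "(\<lambda>N. S + (\<Sum>m\<le>M. x m) / (real N + 1)) \<longlonglongrightarrow> S + 0"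
      proof (intro tendsto_intros)
        have "(\<lambda>N. (\<Sum>m\<le>M. x m) / real (Suc N)) \<longlonglongrightarrow> 0"
          by (rule LIMSEQ_Suc[OF lim_const_over_n])
        then show "(\<lambda>N. (\<Sum>m\<le>M. x m) / (real N + 1)) \<longlonglongrightarrow> 0" by (simp add: add.commute)
      qed
      ultimately show "(\<Sum>m\<le>M. x m / real m) \<le> S"
        by (intro LIMSEQ_le_const[where X = "\<lambda>N. S + (\<Sum>m\<le>M. x m) / (real N + 1)"]) auto
    qed (simp add: x0)
    then show ?thesis using real by simp
  qed simp
  ultimately show ?thesis unfolding I D by (rule antisym[rotated])
qed

section \<open>The norm\<close>

lemma cmod_parallelogram: "(cmod (a + b))\<^sup>2 + (cmod (a - b))\<^sup>2 = 2 * (cmod a)\<^sup>2 + 2 * (cmod b)\<^sup>2"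
  unfolding cmod_power2 by (simp add: power2_eq_square algebra_simps)

lemma suminf_parallelogram:
  fixes a b :: "nat \<Rightarrow> complex" and w :: "nat \<Rightarrow> real"
  assumes w: "\<And>n. 0 \<le> w n"
  shows "(\<Sum>n. ennreal ((cmod (a n + b n))\<^sup>2 / w n)) + (\<Sum>n. ennreal ((cmod (a n - b n))\<^sup>2 / w n))
    = 2 * (\<Sum>n. ennreal ((cmod (a n))\<^sup>2 / w n)) + 2 * (\<Sum>n. ennreal ((cmod (b n))\<^sup>2 / w n))"
proof -
  have "ennreal ((cmod (a n + b n))\<^sup>2 / w n) + ennreal ((cmod (a n - b n))\<^sup>2 / w n)
      = 2 * ennreal ((cmod (a n))\<^sup>2 / w n) + 2 * ennreal ((cmod (b n))\<^sup>2 / w n)" for n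
  proof -
    have "ennreal ((cmod (a n + b n))\<^sup>2 / w n) + ennreal ((cmod (a n - b n))\<^sup>2 / w n)
        = ennreal (((cmod (a n + b n))\<^sup>2 + (cmod (a n - b n))\<^sup>2) / w n)"
      using w[of n] by (subst ennreal_plus[symmetric]) (auto simp: add_divide_distrib)
    also have "\<dots> = ennreal (2 * ((cmod (a n))\<^sup>2 / w n) + 2 * ((cmod (b n))\<^sup>2 / w n))"
      unfolding cmod_parallelogram by (simp add: add_divide_distrib)
    also have "\<dots> = 2 * ennreal ((cmod (a n))\<^sup>2 / w n) + 2 * ennreal ((cmod (b n))\<^sup>2 / w n)"
    proof -
      have "ennreal (2 * x + 2 * y) = 2 * ennreal x + 2 * ennreal y" if "0 \<le> x" "0 \<le> y" for x y
        using that by (simp add: ennreal_mult)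
      then show ?thesis using w[of n] by (simp only: divide_nonneg_nonneg zero_le_power2)
    qed
    finally show ?thesis .
  qed
  then show ?thesis
    unfolding ennreal_suminf_cmult[symmetric] suminf_add[OF summableI summableI] by (simp only:)
qed

text \<open>Fatou's lemma for counting measure.\<close>

lemma suminf_le_liminf:
  fixes t :: "nat \<Rightarrow> nat \<Rightarrow> real"
  assumes "\<And>n. (\<lambda>k. t k n) \<longlonglongrightarrow> s n"
  shows "(\<Sum>n. ennreal (s n)) \<le> liminf (\<lambda>k. \<Sum>n. ennreal (t k n))"
proof -
  have "ennreal (s n) = liminf (\<lambda>k. ennreal (t k n))" for n
    using tendsto_ennrealI[OF assms[of n]] by (intro lim_imp_Liminf[symmetric]) auto
  then have "(\<Sum>n. ennreal (s n)) = (\<integral>\<^sup>+n. liminf (\<lambda>k. ennreal (t k n)) \<partial>count_space UNIV)"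
    by (simp add: nn_integral_count_space_nat)
  also have "\<dots> \<le> liminf (\<lambda>k. \<integral>\<^sup>+n. ennreal (t k n) \<partial>count_space UNIV)"
    by (rule nn_integral_liminf) simp
  finally show ?thesis by (simp add: nn_integral_count_space_nat)
qed

lemma liminf_le_const:
  fixes X :: "nat \<Rightarrow> ennreal"
  assumes "\<And>k. X k \<le> C"
  shows "liminf X \<le> C"
  using Liminf_mono[of X "\<lambda>_. C" sequentially] assms Liminf_const[of sequentially C] by simp

text \<open>Roots are listed with multiplicity and may be 0: \<open>z ^ k\<close> times the product
  over the atoms is treated as one such polynomial, and estimates go by induction on the
  list.\<close>

fun linear_prod :: "complex list \<Rightarrow> complex \<Rightarrow> complex" where
  "linear_prod [] z = 1"
| "linear_prod (a # as) z = (z - a) * linear_prod as z"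

lemma holomorphic_linear_prod [holomorphic_intros]: "linear_prod as holomorphic_on S"
proof (induction as)
  case Nil
  then show ?case by simp
next
  case (Cons a as)
  have "(\<lambda>z. (z - a) * linear_prod as z) holomorphic_on S"
    by (intro holomorphic_intros Cons.IH)
  then show ?case by simp
qed

lemma linear_prod_remove1:
  "a \<in> set as \<Longrightarrow> linear_prod as z = (z - a) * linear_prod (remove1 a as) z"
  by (induction as) auto

section \<open>The space attached to a finite measure and finitely many atoms\<close>

locale dirichlet_setting =
  fixes \<mu> :: "complex measure" and n :: nat and lam :: "nat \<Rightarrow> complex" and c :: "nat \<Rightarrow> real"
  assumes sets_mu: "sets \<mu> = sets borel" and fin_mu: "finite_measure \<mu>"
    and sphere_mu: "emeasure \<mu> (UNIV - sphere 0 1) = 0"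
    and n: "n \<ge> 1" and lam: "\<And>j. j < n \<Longrightarrow> lam j \<in> sphere 0 1" and c: "\<And>j. j < n \<Longrightarrow> c j > 0"
begin

abbreviation \<nu> where "\<nu> \<equiv> dirac_sum n lam c"
abbreviation N where "N \<equiv> HH_normsq \<mu> \<nu>"
abbreviation \<H> where "\<H> \<equiv> HH \<mu> \<nu>"

lemma norm_lam: "j < n \<Longrightarrow> cmod (lam j) = 1"
  using lam by auto

text \<open>\<open>measure_of\<close> takes the intended values only for a countably additive set
  function. Exhibiting the sum of atoms as the image of a point measure on the indices settles this
  and makes its integrals finite sums.\<close>

lemma dirac_sum_eq_distr: "\<nu> = distr (point_measure {..<n} (\<lambda>j. ennreal (c j))) borel lam"
proof -
  let ?M = "distr (point_measure {..<n} (\<lambda>j. ennreal (c j))) borel lam"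
  have m: "lam \<in> measurable (point_measure {..<n} (\<lambda>j. ennreal (c j))) borel"
    by (simp add: measurable_def space_point_measure sets_point_measure)
  have "emeasure ?M X = (\<Sum>j<n. ennreal (c j) * indicator X (lam j))" if "X \<in> sets borel" for X
  proof -
    have "emeasure ?M X = emeasure (point_measure {..<n} (\<lambda>j. ennreal (c j))) (lam -` X \<inter> {..<n})"
      using that m by (subst emeasure_distr) (auto simp: space_point_measure)
    also have "\<dots> = (\<Sum>j\<in>lam -` X \<inter> {..<n}. ennreal (c j))"
      by (rule emeasure_point_measure_finite) auto
    also have "\<dots> = (\<Sum>j<n. ennreal (c j) * indicator X (lam j))"
      by (rule sum.mono_neutral_cong_left) (auto simp: indicator_def)
    finally show ?thesis .
  qed
  then have "measure_of UNIV (sets borel) (emeasure ?M) = \<nu>"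
    unfolding dirac_sum_def by (intro measure_of_eq) (auto simp: sets.sigma_sets_eq[of "borel :: complex measure", simplified])
  then show ?thesis
    using measure_of_of_measure[of ?M] by simp
qed

lemma sets_nu: "sets \<nu> = sets borel"
  unfolding dirac_sum_eq_distr by simp

lemma nn_integral_nu:
  assumes "f \<in> borel_measurable borel"
  shows "(\<integral>\<^sup>+\<zeta>. f \<zeta> \<partial>\<nu>) = (\<Sum>j<n. ennreal (c j) * f (lam j))"
proof -
  have m: "lam \<in> measurable (point_measure {..<n} (\<lambda>j. ennreal (c j))) borel"
    by (simp add: measurable_def space_point_measure sets_point_measure)
  show ?thesis
    unfolding dirac_sum_eq_distr
    using m assms by (subst nn_integral_distr) (simp_all add: nn_integral_point_measure_finite mult.commute)
qed

lemma emeasure_nu: "X \<in> sets borel \<Longrightarrow> emeasure \<nu> X = (\<Sum>j<n. ennreal (c j) * indicator X (lam j))"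
  using nn_integral_nu[of "indicator X"] sets_nu by simp

lemma fin_nu: "finite_measure \<nu>"
proof (rule finite_measureI)
  have "space \<nu> = UNIV" using sets_eq_imp_space_eq[OF sets_nu] by simp
  then show "emeasure \<nu> (space \<nu>) \<noteq> \<infinity>"
    by (simp add: emeasure_nu)
qed

lemma sphere_nu: "emeasure \<nu> (UNIV - sphere 0 1) = 0"
  using lam by (subst emeasure_nu) (auto intro!: sum.neutral borel_open)

lemma nu_nonzero: "emeasure \<nu> (space \<nu>) \<noteq> 0"
proof -
  have sp: "space \<nu> = UNIV" using sets_eq_imp_space_eq[OF sets_nu] by simp
  have e: "emeasure \<nu> (space \<nu>) = (\<Sum>j<n. ennreal (c j))"
    unfolding sp by (subst emeasure_nu) auto
  have "0 < ennreal (c 0)" using c[of 0] n by simp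
  also have "ennreal (c 0) \<le> (\<Sum>j<n. ennreal (c j))"
    using n by (intro member_le_sum) auto
  finally show ?thesis unfolding e by (rule less_imp_neq[THEN not_sym])
qed

lemma N_eq:
  assumes "f holomorphic_on ball 0 1"
  shows "N f = H2_normsq f + (\<integral>\<^sup>+\<zeta>. Dloc f \<zeta> \<partial>\<mu>) + (\<integral>\<^sup>+\<zeta>. D2loc f \<zeta> \<partial>\<nu>)"
  unfolding HH_normsq_def Dint_1_eq[OF sets_mu fin_mu sphere_mu assms] Dint_2_eq[OF sets_nu fin_nu sphere_nu assms] ..

lemma D2_eq: "(\<integral>\<^sup>+\<zeta>. D2loc f \<zeta> \<partial>\<nu>) = (\<Sum>j<n. ennreal (c j) * D2loc f (lam j))"
  by (rule nn_integral_nu) measurable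

text \<open>One atom of positive mass suffices, and \<open>n \<ge> 1\<close> provides it.\<close>

lemma D2_finite_imp:
  assumes "(\<integral>\<^sup>+\<zeta>. D2loc f \<zeta> \<partial>\<nu>) < \<infinity>"
  shows "Dir f < \<infinity>" "H2_normsq f < \<infinity>"
proof -
  have "ennreal (c 0) * D2loc f (lam 0) \<le> (\<Sum>j<n. ennreal (c j) * D2loc f (lam j))"
    using n by (intro member_le_sum) auto
  then have "ennreal (c 0) * D2loc f (lam 0) < top"
    using assms unfolding D2_eq by (simp add: order_le_less_trans)
  then have "D2loc f (lam 0) < \<infinity>"
    using c[of 0] n by (auto simp: ennreal_mult_less_top)
  then show "Dir f < \<infinity>" "H2_normsq f < \<infinity>"
    using D2loc_finite_imp[OF norm_lam[of 0]] n by auto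
qed

text \<open>Hardy space membership comes from the atoms through \<open>D2_finite_imp\<close>. If
  \<open>\<mu>\<close> is zero, \<open>Hsp\<close> switches to the Hardy space, but then the first
  order integral vanishes.\<close>

lemma HH_iff: "f \<in> \<H> \<longleftrightarrow> f holomorphic_on ball 0 1 \<and> N f < \<infinity>"
proof
  assume f: "f \<in> \<H>"
  then have h: "f holomorphic_on ball 0 1" and D2: "Dint \<nu> 2 f < \<infinity>"
    using nu_nonzero by (auto simp: HH_def Hsp_def)
  have H: "H2_normsq f < \<infinity>"
    using D2_finite_imp(2) D2 unfolding Dint_2_eq[OF sets_nu fin_nu sphere_nu h] by blast
  have "Dint \<mu> 1 f < \<infinity>"
  proof (cases "emeasure \<mu> (space \<mu>) = 0")
    case True
    then have "AE \<zeta> in \<mu>. Dloc f \<zeta> = 0"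
      by (intro AE_I[of _ _ "space \<mu>"]) auto
    then have "(\<integral>\<^sup>+\<zeta>. Dloc f \<zeta> \<partial>\<mu>) = (\<integral>\<^sup>+\<zeta>. 0 \<partial>\<mu>)"
      by (rule nn_integral_cong_AE)
    then show ?thesis
      unfolding Dint_1_eq[OF sets_mu fin_mu sphere_mu h] by simp
  next
    case False
    then show ?thesis using f by (simp add: HH_def Hsp_def)
  qed
  with H D2 h show "f holomorphic_on ball 0 1 \<and> N f < \<infinity>"
    by (simp add: HH_normsq_def)
next
  assume "f holomorphic_on ball 0 1 \<and> N f < \<infinity>"
  then have "f holomorphic_on ball 0 1" "H2_normsq f < top" "Dint \<mu> 1 f < top" "Dint \<nu> 2 f < top"
    by (auto simp: HH_normsq_def)
  then show "f \<in> \<H>" by (auto simp: HH_def Hsp_def H2_def)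
qed

lemma N_cong:
  assumes "f holomorphic_on ball 0 1" "g holomorphic_on ball 0 1" "\<And>m. taylor_coeff f m = taylor_coeff g m"
  shows "N f = N g"
proof -
  have "H2_normsq f = H2_normsq g" "Dloc f = Dloc g" "D2loc f = D2loc g"
    by (simp_all add: H2_normsq_def Dloc_def[abs_def] D2loc_def[abs_def] assms(3) fun_eq_iff)
  then show ?thesis using assms by (simp add: N_eq)
qed

lemma AE_circle_mu: "AE \<zeta> in \<mu>. cmod \<zeta> = 1"
  by (rule AE_sphere[OF sets_mu fin_mu sphere_mu])

lemma AE_circle_nu: "AE \<zeta> in \<nu>. cmod \<zeta> = 1"
  by (rule AE_sphere[OF sets_nu fin_nu sphere_nu])

lemma N_le_z_mult:
  assumes f: "f holomorphic_on ball 0 1"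
  shows "N f \<le> N (\<lambda>z. z * f z)"
proof -
  have h: "(\<lambda>z. z * f z) holomorphic_on ball 0 1" by (intro holomorphic_intros f)
  show ?thesis
    unfolding N_eq[OF f] N_eq[OF h] H2_normsq_z_mult[OF f]
    using AE_circle_mu AE_circle_nu
    by (intro add_mono order_refl nn_integral_mono_AE)
       (auto elim!: eventually_mono intro: Dloc_le_z_mult D2loc_le_z_mult f)
qed

text \<open>Stated in \<open>ennreal\<close> without finiteness, so that it also shows
  \<open>HH\<close> to be closed under sums and gives \<open>N_add_le\<close>.\<close>

lemma N_parallelogram:
  assumes f: "f holomorphic_on ball 0 1" and g: "g holomorphic_on ball 0 1"
  shows "N (\<lambda>z. f z + g z) + N (\<lambda>z. f z - g z) = 2 * N f + 2 * N g"
proof -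
  have h: "(\<lambda>z. f z + g z) holomorphic_on ball 0 1" "(\<lambda>z. f z - g z) holomorphic_on ball 0 1"
    by (intro holomorphic_intros f g)+
  note mm [measurable_cong] = sets_mu sets_nu
  have H: "H2_normsq (\<lambda>z. f z + g z) + H2_normsq (\<lambda>z. f z - g z) = 2 * H2_normsq f + 2 * H2_normsq g"
    unfolding H2_normsq_def taylor_coeff_add[OF f g] taylor_coeff_diff[OF f g]
    using suminf_parallelogram[of "\<lambda>_. 1"] by (simp only: div_by_1 zero_le_one)
  have D: "Dloc (\<lambda>z. f z + g z) \<zeta> + Dloc (\<lambda>z. f z - g z) \<zeta> = 2 * Dloc f \<zeta> + 2 * Dloc g \<zeta>" for \<zeta>
  proof -
    have pos: "0 \<le> real n * (real n + 1)" for n by simp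
    have "(\<Sum>m\<le>n. of_nat m * (taylor_coeff f m + taylor_coeff g m) * \<zeta> ^ m) = (\<Sum>m\<le>n. of_nat m * taylor_coeff f m * \<zeta> ^ m) + (\<Sum>m\<le>n. of_nat m * taylor_coeff g m * \<zeta> ^ m)"
      "(\<Sum>m\<le>n. of_nat m * (taylor_coeff f m - taylor_coeff g m) * \<zeta> ^ m) = (\<Sum>m\<le>n. of_nat m * taylor_coeff f m * \<zeta> ^ m) - (\<Sum>m\<le>n. of_nat m * taylor_coeff g m * \<zeta> ^ m)" for n
      by (simp_all add: sum.distrib[symmetric] sum_subtractf[symmetric] algebra_simps)
    then show ?thesis
      unfolding Dloc_def taylor_coeff_add[OF f g] taylor_coeff_diff[OF f g]
      using suminf_parallelogram[of "\<lambda>n. real n * (real n + 1)", OF pos] by (simp only:)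
  qed
  have D2: "D2loc (\<lambda>z. f z + g z) \<zeta> + D2loc (\<lambda>z. f z - g z) \<zeta> = 2 * D2loc f \<zeta> + 2 * D2loc g \<zeta>" for \<zeta>
  proof -
    have pos: "0 \<le> (real n - 1) * real n * (real n + 1)" for n by (cases n) auto
    have "(\<Sum>m\<le>n. of_nat m * (of_nat m - 1) * (taylor_coeff f m + taylor_coeff g m) * \<zeta> ^ m) = (\<Sum>m\<le>n. of_nat m * (of_nat m - 1) * taylor_coeff f m * \<zeta> ^ m) + (\<Sum>m\<le>n. of_nat m * (of_nat m - 1) * taylor_coeff g m * \<zeta> ^ m)"
      "(\<Sum>m\<le>n. of_nat m * (of_nat m - 1) * (taylor_coeff f m - taylor_coeff g m) * \<zeta> ^ m) = (\<Sum>m\<le>n. of_nat m * (of_nat m - 1) * taylor_coeff f m * \<zeta> ^ m) - (\<Sum>m\<le>n. of_nat m * (of_nat m - 1) * taylor_coeff g m * \<zeta> ^ m)" for n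
      by (simp_all add: sum.distrib[symmetric] sum_subtractf[symmetric] algebra_simps)
    then show ?thesis
      unfolding D2loc_def taylor_coeff_add[OF f g] taylor_coeff_diff[OF f g]
      using suminf_parallelogram[of "\<lambda>n. (real n - 1) * real n * (real n + 1)", OF pos] by (simp only:)
  qed
  have I1: "(\<integral>\<^sup>+\<zeta>. Dloc (\<lambda>z. f z + g z) \<zeta> \<partial>\<mu>) + (\<integral>\<^sup>+\<zeta>. Dloc (\<lambda>z. f z - g z) \<zeta> \<partial>\<mu>)
      = 2 * (\<integral>\<^sup>+\<zeta>. Dloc f \<zeta> \<partial>\<mu>) + 2 * (\<integral>\<^sup>+\<zeta>. Dloc g \<zeta> \<partial>\<mu>)"
    by (subst nn_integral_add[symmetric]) (auto simp: D nn_integral_add nn_integral_cmult)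
  have I2: "(\<integral>\<^sup>+\<zeta>. D2loc (\<lambda>z. f z + g z) \<zeta> \<partial>\<nu>) + (\<integral>\<^sup>+\<zeta>. D2loc (\<lambda>z. f z - g z) \<zeta> \<partial>\<nu>)
      = 2 * (\<integral>\<^sup>+\<zeta>. D2loc f \<zeta> \<partial>\<nu>) + 2 * (\<integral>\<^sup>+\<zeta>. D2loc g \<zeta> \<partial>\<nu>)"
    by (subst nn_integral_add[symmetric]) (auto simp: D2 nn_integral_add nn_integral_cmult)
  have "N (\<lambda>z. f z + g z) + N (\<lambda>z. f z - g z)
      = (H2_normsq (\<lambda>z. f z + g z) + H2_normsq (\<lambda>z. f z - g z))
        + ((\<integral>\<^sup>+\<zeta>. Dloc (\<lambda>z. f z + g z) \<zeta> \<partial>\<mu>) + (\<integral>\<^sup>+\<zeta>. Dloc (\<lambda>z. f z - g z) \<zeta> \<partial>\<mu>))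
        + ((\<integral>\<^sup>+\<zeta>. D2loc (\<lambda>z. f z + g z) \<zeta> \<partial>\<nu>) + (\<integral>\<^sup>+\<zeta>. D2loc (\<lambda>z. f z - g z) \<zeta> \<partial>\<nu>))"
    unfolding N_eq[OF h(1)] N_eq[OF h(2)] by (simp only: add_ac)
  also have "\<dots> = 2 * N f + 2 * N g"
    unfolding H I1 I2 N_eq[OF f] N_eq[OF g] by (simp only: distrib_left add_ac)
  finally show ?thesis .
qed

lemma N_cmult:
  assumes f: "f holomorphic_on ball 0 1"
  shows "N (\<lambda>z. a * f z) = ennreal ((cmod a)\<^sup>2) * N f"
proof -
  have h: "(\<lambda>z. a * f z) holomorphic_on ball 0 1" by (intro holomorphic_intros f)
  note mm [measurable_cong] = sets_mu sets_nu
  have D: "Dloc (\<lambda>z. a * f z) \<zeta> = ennreal ((cmod a)\<^sup>2) * Dloc f \<zeta>" for \<zeta>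
  proof -
    have "(\<Sum>m\<le>n. of_nat m * (a * taylor_coeff f m) * \<zeta> ^ m) = a * (\<Sum>m\<le>n. of_nat m * taylor_coeff f m * \<zeta> ^ m)" for n
      by (simp add: sum_distrib_left mult_ac)
    then show ?thesis
      unfolding Dloc_def taylor_coeff_cmult[OF f] ennreal_suminf_cmult[symmetric]
      by (simp only: norm_mult power_mult_distrib times_divide_eq_right[symmetric]) (intro suminf_cong ennreal_mult, auto)
  qed
  have D2: "D2loc (\<lambda>z. a * f z) \<zeta> = ennreal ((cmod a)\<^sup>2) * D2loc f \<zeta>" for \<zeta>
  proof -
    have pos: "0 \<le> (real n - 1) * real n * (real n + 1)" for n by (cases n) auto
    have "(\<Sum>m\<le>n. of_nat m * (of_nat m - 1) * (a * taylor_coeff f m) * \<zeta> ^ m) = a * (\<Sum>m\<le>n. of_nat m * (of_nat m - 1) * taylor_coeff f m * \<zeta> ^ m)" for n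
      by (simp add: sum_distrib_left mult_ac)
    then show ?thesis
      unfolding D2loc_def taylor_coeff_cmult[OF f] ennreal_suminf_cmult[symmetric]
      by (simp only: norm_mult power_mult_distrib times_divide_eq_right[symmetric]) (intro suminf_cong ennreal_mult, auto intro: divide_nonneg_nonneg pos)
  qed
  have "(\<integral>\<^sup>+\<zeta>. Dloc (\<lambda>z. a * f z) \<zeta> \<partial>\<mu>) = ennreal ((cmod a)\<^sup>2) * (\<integral>\<^sup>+\<zeta>. Dloc f \<zeta> \<partial>\<mu>)"
    unfolding D by (rule nn_integral_cmult) measurable
  moreover have "(\<integral>\<^sup>+\<zeta>. D2loc (\<lambda>z. a * f z) \<zeta> \<partial>\<nu>) = ennreal ((cmod a)\<^sup>2) * (\<integral>\<^sup>+\<zeta>. D2loc f \<zeta> \<partial>\<nu>)"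
    unfolding D2 by (rule nn_integral_cmult) measurable
  ultimately show ?thesis
    unfolding N_eq[OF h] N_eq[OF f] H2_normsq_cmult[OF f] by (simp only: distrib_left)
qed

text \<open>Fatou's lemma for each of the three summands. Bounding each by \<open>C\<close>
  separately costs the factor 3, which is harmless: the result is applied to arbitrarily small
  bounds or to obtain finiteness.\<close>

lemma N_lower_semicontinuous:
  assumes F: "\<And>k. F k holomorphic_on ball 0 1" and f: "f holomorphic_on ball 0 1"
    and lim: "\<And>m. (\<lambda>k. taylor_coeff (F k) m) \<longlonglongrightarrow> taylor_coeff f m"
    and le: "\<And>k. N (F k) \<le> C"
  shows "N f \<le> 3 * C"
proof -
  note mm [measurable_cong] = sets_mu sets_nu
  have parts: "H2_normsq (F k) \<le> C" "(\<integral>\<^sup>+\<zeta>. Dloc (F k) \<zeta> \<partial>\<mu>) \<le> C" "(\<integral>\<^sup>+\<zeta>. D2loc (F k) \<zeta> \<partial>\<nu>) \<le> C" for k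
    using le[of k] unfolding N_eq[OF F]
    by (auto intro: order_trans[rotated] simp: add_increasing2 add_increasing add.assoc)
  have "H2_normsq f \<le> C"
  proof (rule order_trans[OF _ liminf_le_const[OF parts(1)]])
    show "H2_normsq f \<le> liminf (\<lambda>k. H2_normsq (F k))"
      unfolding H2_normsq_def by (intro suminf_le_liminf tendsto_intros lim)
  qed
  moreover have "(\<integral>\<^sup>+\<zeta>. Dloc f \<zeta> \<partial>\<mu>) \<le> C"
  proof (rule order_trans[OF _ liminf_le_const[OF parts(2)]])
    have "(\<integral>\<^sup>+\<zeta>. Dloc f \<zeta> \<partial>\<mu>) \<le> (\<integral>\<^sup>+\<zeta>. liminf (\<lambda>k. Dloc (F k) \<zeta>) \<partial>\<mu>)"
      unfolding Dloc_def divide_inverse by (intro nn_integral_mono suminf_le_liminf tendsto_intros lim)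
    also have "\<dots> \<le> liminf (\<lambda>k. \<integral>\<^sup>+\<zeta>. Dloc (F k) \<zeta> \<partial>\<mu>)"
      by (rule nn_integral_liminf) measurable
    finally show "(\<integral>\<^sup>+\<zeta>. Dloc f \<zeta> \<partial>\<mu>) \<le> liminf (\<lambda>k. \<integral>\<^sup>+\<zeta>. Dloc (F k) \<zeta> \<partial>\<mu>)" .
  qed
  moreover have "(\<integral>\<^sup>+\<zeta>. D2loc f \<zeta> \<partial>\<nu>) \<le> C"
  proof (rule order_trans[OF _ liminf_le_const[OF parts(3)]])
    have "(\<integral>\<^sup>+\<zeta>. D2loc f \<zeta> \<partial>\<nu>) \<le> (\<integral>\<^sup>+\<zeta>. liminf (\<lambda>k. D2loc (F k) \<zeta>) \<partial>\<nu>)"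
      unfolding D2loc_def divide_inverse by (intro nn_integral_mono suminf_le_liminf tendsto_intros lim)
    also have "\<dots> \<le> liminf (\<lambda>k. \<integral>\<^sup>+\<zeta>. D2loc (F k) \<zeta> \<partial>\<nu>)"
      by (rule nn_integral_liminf) measurable
    finally show "(\<integral>\<^sup>+\<zeta>. D2loc f \<zeta> \<partial>\<nu>) \<le> liminf (\<lambda>k. \<integral>\<^sup>+\<zeta>. D2loc (F k) \<zeta> \<partial>\<nu>)" .
  qed
  ultimately have "N f \<le> C + C + C"
    unfolding N_eq[OF f] by (intro add_mono)
  also have "\<dots> = (1 + 1 + 1) * C" by (simp only: distrib_right mult_1_left)
  also have "\<dots> = 3 * C" by simp
  finally show ?thesis .
qed

lemma N_ge_coeff:
  assumes "f holomorphic_on ball 0 1"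
  shows "ennreal ((cmod (taylor_coeff f m))\<^sup>2) \<le> N f"
  unfolding N_eq[OF assms] using H2_normsq_ge_coeff[of f m] by (simp add: add_increasing2 add.assoc)

end

section \<open>Inner product and minimizing sequences\<close>

lemma complex_product_bound: "cmod (a * cnj b) \<le> (cmod a)\<^sup>2 + (cmod b)\<^sup>2"
proof -
  have "2 * (cmod a * cmod b) \<le> (cmod a)\<^sup>2 + (cmod b)\<^sup>2"
    using sum_squares_bound[of "cmod a" "cmod b"] by simp
  moreover have "0 \<le> cmod a * cmod b" by simp
  ultimately have "cmod a * cmod b \<le> (cmod a)\<^sup>2 + (cmod b)\<^sup>2" by linarith
  then show ?thesis by (simp add: norm_mult)
qed

lemma H2_inner_summable:
  assumes "H2_normsq f < \<infinity>" "H2_normsq g < \<infinity>"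
  shows "summable (\<lambda>k. taylor_coeff f k * cnj (taylor_coeff g k))"
  by (rule summable_norm_cancel, rule summable_comparison_test'[where N = 0])
     (use summable_add[OF H2_normsq_real(1)[OF assms(1)] H2_normsq_real(1)[OF assms(2)]] complex_product_bound in auto)

lemma H2_inner_add:
  assumes "f holomorphic_on ball 0 1" "g holomorphic_on ball 0 1"
    and "H2_normsq f < \<infinity>" "H2_normsq g < \<infinity>" "H2_normsq h < \<infinity>"
  shows "H2_inner (\<lambda>z. f z + g z) h = H2_inner f h + H2_inner g h"
  unfolding H2_inner_def taylor_coeff_add[OF assms(1,2)] distrib_right
  by (intro suminf_add[symmetric] H2_inner_summable assms)

lemma H2_inner_cmult:
  assumes "f holomorphic_on ball 0 1" "H2_normsq f < \<infinity>" "H2_normsq h < \<infinity>"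
  shows "H2_inner (\<lambda>z. a * f z) h = a * H2_inner f h"
  unfolding H2_inner_def taylor_coeff_cmult[OF assms(1)] mult.assoc
  by (intro suminf_mult H2_inner_summable assms)

lemma H2_inner_cnj:
  assumes "H2_normsq f < \<infinity>" "H2_normsq g < \<infinity>"
  shows "H2_inner g f = cnj (H2_inner f g)"
proof -
  have "(\<lambda>k. cnj (taylor_coeff f k * cnj (taylor_coeff g k))) sums cnj (H2_inner f g)"
    unfolding H2_inner_def using summable_sums[OF H2_inner_summable[OF assms]] by (subst sums_cnj)
  then show ?thesis
    unfolding H2_inner_def by (simp add: sums_iff mult.commute)
qed

lemma H2_inner_self:
  assumes "H2_normsq f < \<infinity>"
  shows "H2_inner f f = of_real (enn2real (H2_normsq f))"
proof -
  note s = H2_normsq_real[OF assms]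
  have e: "enn2real (H2_normsq f) = (\<Sum>k. (cmod (taylor_coeff f k))\<^sup>2)"
    unfolding s(2) by (intro enn2real_ennreal suminf_nonneg s(1)) auto
  show ?thesis
    unfolding H2_inner_def complex_norm_square[symmetric] e suminf_of_real[OF s(1)] ..
qed

text \<open>Extended by zero, so that it is Borel on the plane whatever \<open>f\<close> does
  outside the disc.\<close>

definition disc_deriv :: "nat \<Rightarrow> (complex \<Rightarrow> complex) \<Rightarrow> complex \<Rightarrow> complex" where
  "disc_deriv j f z = indicator (ball 0 1) z *\<^sub>R (deriv ^^ j) f z"

text \<open>Real-valued, for Bochner integration; for a finite measure on the circle
  \<open>enn2real\<close> loses nothing, since the Poisson integral is finite in the disc.\<close>

definition disc_weight :: "complex measure \<Rightarrow> nat \<Rightarrow> complex \<Rightarrow> real" where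
  "disc_weight \<nu> j z = indicator (ball 0 1) z * ((1 - (cmod z)\<^sup>2) ^ (j - 1) * enn2real (poisson \<nu> z))"

lemma disc_weight_nonneg: "0 \<le> disc_weight \<nu> j z"
  by (simp add: disc_weight_def indicator_def power_le_one)

lemma disc_deriv_measurable:
  assumes "f holomorphic_on ball 0 1"
  shows "disc_deriv j f \<in> borel_measurable borel"
  unfolding disc_deriv_def[abs_def]
  by (intro borel_measurable_continuous_on_indicator holomorphic_on_imp_continuous_on holomorphic_higher_deriv assms) auto

lemma disc_deriv_add:
  assumes "f holomorphic_on ball 0 1" "g holomorphic_on ball 0 1"
  shows "disc_deriv j (\<lambda>z. f z + g z) z = disc_deriv j f z + disc_deriv j g z"
  using higher_deriv_add[OF assms open_ball, of z j] by (simp add: disc_deriv_def indicator_def)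

lemma disc_deriv_cmult:
  assumes "f holomorphic_on ball 0 1"
  shows "disc_deriv j (\<lambda>z. a * f z) z = a * disc_deriv j f z"
  by (cases "cmod z < 1") (simp_all add: disc_deriv_def higher_deriv_cmult[OF assms])

lemma disc_deriv_cong:
  assumes "f holomorphic_on ball 0 1" "g holomorphic_on ball 0 1" "\<And>z. cmod z < 1 \<Longrightarrow> f z = g z"
  shows "disc_deriv j f z = disc_deriv j g z"
proof (cases "cmod z < 1")
  case True
  then have "(deriv ^^ j) f z = (deriv ^^ j) g z"
    using assms(3) by (intro higher_deriv_transform_within_open[OF assms(1,2) open_ball]) auto
  then show ?thesis by (simp add: disc_deriv_def)
qed (simp add: disc_deriv_def)

lemma Dinner_eq:
  "Dinner \<nu> j f g = complex_of_real (1 / (fact j * fact (j - 1))) *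
     (\<integral>z. disc_deriv j f z * cnj (disc_deriv j g z) * of_real (disc_weight \<nu> j z) \<partial>dA)"
  unfolding Dinner_def
  by (intro arg_cong2[where f = "(*)"] Bochner_Integration.integral_cong refl)
     (simp add: disc_deriv_def disc_weight_def indicator_def)

lemma Dinner_cong:
  assumes "g holomorphic_on ball 0 1" "g' holomorphic_on ball 0 1" "\<And>z. cmod z < 1 \<Longrightarrow> g z = g' z"
  shows "Dinner \<nu> j f g = Dinner \<nu> j f g'"
proof -
  have "disc_deriv j g z = disc_deriv j g' z" for z
    by (rule disc_deriv_cong) (use assms in auto)
  then show ?thesis by (simp add: Dinner_eq)
qed

context
  fixes \<nu> :: "complex measure"
  assumes sets_nu: "sets \<nu> = sets borel" and fin_nu: "finite_measure \<nu>"
    and sphere_nu: "emeasure \<nu> (UNIV - sphere 0 1) = 0"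
begin

lemma poisson_finite:
  assumes z: "cmod z < 1"
  shows "poisson \<nu> z < \<infinity>"
proof -
  interpret finite_measure \<nu> by (rule fin_nu)
  define C where "C = (1 - (cmod z)\<^sup>2) / (1 - cmod z)\<^sup>2"
  have "poisson \<nu> z \<le> (\<integral>\<^sup>+\<zeta>. ennreal C \<partial>\<nu>)"
    unfolding poisson_def
  proof (rule nn_integral_mono_AE)
    show "AE \<zeta> in \<nu>. ennreal ((1 - (cmod z)\<^sup>2) / (cmod (z - \<zeta>))\<^sup>2) \<le> ennreal C"
      using AE_sphere[OF sets_nu fin_nu sphere_nu]
    proof eventually_elim
      case (elim \<zeta>)
      have "1 - cmod z \<le> cmod (z - \<zeta>)"
        using norm_triangle_ineq2[of \<zeta> z] elim by (simp add: norm_minus_commute)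
      then have "(1 - cmod z)\<^sup>2 \<le> (cmod (z - \<zeta>))\<^sup>2" "0 < (1 - cmod z)\<^sup>2"
        using z by (auto intro: power_mono)
      then show ?case
        unfolding C_def using z by (intro ennreal_leI divide_left_mono mult_pos_pos) (auto simp: power_le_one)
    qed
  qed
  also have "\<dots> < \<infinity>"
    by (simp add: ennreal_mult_less_top emeasure_eq_measure)
  finally show ?thesis .
qed

lemma disc_weight_measurable: "disc_weight \<nu> j \<in> borel_measurable borel"
proof -
  interpret finite_measure \<nu> by (rule fin_nu)
  note [measurable_cong] = sets_nu
  have [measurable]: "ball (0::complex) 1 \<in> sets borel" by simp
  show ?thesis unfolding disc_weight_def[abs_def] poisson_def by measurable
qed

lemma Dint_eq_nn_integral:
  "Dint \<nu> j f = ennreal (1 / (fact j * fact (j - 1))) *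
     (\<integral>\<^sup>+z. ennreal ((cmod (disc_deriv j f z))\<^sup>2 * disc_weight \<nu> j z) \<partial>dA)"
  unfolding Dint_def
proof (rule arg_cong2[where f = "(*)", OF refl nn_integral_cong])
  fix z :: complex
  show "ennreal ((cmod ((deriv ^^ j) f z))\<^sup>2 * (1 - (cmod z)\<^sup>2) ^ (j - 1)) * poisson \<nu> z * indicator (ball 0 1) z
      = ennreal ((cmod (disc_deriv j f z))\<^sup>2 * disc_weight \<nu> j z)"
  proof (cases "cmod z < 1")
    case True
    then have "poisson \<nu> z = ennreal (enn2real (poisson \<nu> z))"
      using poisson_finite[OF True] by (simp add: ennreal_enn2real_if)
    moreover have "0 \<le> (cmod ((deriv ^^ j) f z))\<^sup>2 * (1 - (cmod z)\<^sup>2) ^ (j - 1)"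
      using True by (simp add: power_le_one)
    ultimately have "ennreal ((cmod ((deriv ^^ j) f z))\<^sup>2 * (1 - (cmod z)\<^sup>2) ^ (j - 1)) * poisson \<nu> z
        = ennreal ((cmod ((deriv ^^ j) f z))\<^sup>2 * (1 - (cmod z)\<^sup>2) ^ (j - 1) * enn2real (poisson \<nu> z))"
      by (metis ennreal_mult enn2real_nonneg)
    then show ?thesis using True by (simp add: disc_deriv_def disc_weight_def mult.assoc)
  qed (simp add: disc_deriv_def)
qed

lemma Dint_finite_integrable:
  assumes f: "f holomorphic_on ball 0 1" and fin: "Dint \<nu> j f < \<infinity>"
  shows "integrable dA (\<lambda>z. (cmod (disc_deriv j f z))\<^sup>2 * disc_weight \<nu> j z)"
proof (rule integrableI_nonneg)
  note [measurable] = disc_deriv_measurable[OF f] disc_weight_measurable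
  show "(\<lambda>z. (cmod (disc_deriv j f z))\<^sup>2 * disc_weight \<nu> j z) \<in> borel_measurable dA"
    by measurable
  have "ennreal (1 / (fact j * fact (j - 1))) \<noteq> 0"
    by (simp add: ennreal_eq_0_iff not_le)
  then show "(\<integral>\<^sup>+z. ennreal ((cmod (disc_deriv j f z))\<^sup>2 * disc_weight \<nu> j z) \<partial>dA) < \<infinity>"
    using fin unfolding Dint_eq_nn_integral by (auto simp: ennreal_mult_less_top)
qed (simp add: disc_weight_nonneg)

lemma Dinner_integrable:
  assumes f: "f holomorphic_on ball 0 1" "Dint \<nu> j f < \<infinity>" and g: "g holomorphic_on ball 0 1" "Dint \<nu> j g < \<infinity>"
  shows "integrable dA (\<lambda>z. disc_deriv j f z * cnj (disc_deriv j g z) * of_real (disc_weight \<nu> j z))"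
proof (rule Bochner_Integration.integrable_bound)
  note [measurable] = disc_deriv_measurable[OF f(1)] disc_deriv_measurable[OF g(1)] disc_weight_measurable
  have [measurable]: "cnj \<in> borel_measurable borel"
    by (intro borel_measurable_continuous_onI continuous_intros)
  show "(\<lambda>z. disc_deriv j f z * cnj (disc_deriv j g z) * of_real (disc_weight \<nu> j z)) \<in> borel_measurable dA"
    by measurable
  show "integrable dA (\<lambda>z. (cmod (disc_deriv j f z))\<^sup>2 * disc_weight \<nu> j z + (cmod (disc_deriv j g z))\<^sup>2 * disc_weight \<nu> j z)"
    by (intro Bochner_Integration.integrable_add Dint_finite_integrable f g)
  have "cmod (disc_deriv j f z * cnj (disc_deriv j g z) * of_real (disc_weight \<nu> j z))
      \<le> (cmod (disc_deriv j f z))\<^sup>2 * disc_weight \<nu> j z + (cmod (disc_deriv j g z))\<^sup>2 * disc_weight \<nu> j z" for z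
    using mult_right_mono[OF complex_product_bound[of "disc_deriv j f z" "disc_deriv j g z"] disc_weight_nonneg[of \<nu> j z]]
    by (simp add: norm_mult disc_weight_nonneg distrib_right)
  then show "AE z in dA. norm (disc_deriv j f z * cnj (disc_deriv j g z) * of_real (disc_weight \<nu> j z))
      \<le> norm ((cmod (disc_deriv j f z))\<^sup>2 * disc_weight \<nu> j z + (cmod (disc_deriv j g z))\<^sup>2 * disc_weight \<nu> j z)"
    by (intro AE_I2) (simp add: disc_weight_nonneg)
qed

lemma Dinner_add:
  assumes f: "f holomorphic_on ball 0 1" "Dint \<nu> j f < \<infinity>" and g: "g holomorphic_on ball 0 1" "Dint \<nu> j g < \<infinity>"
    and h: "h holomorphic_on ball 0 1" "Dint \<nu> j h < \<infinity>"
  shows "Dinner \<nu> j (\<lambda>z. f z + g z) h = Dinner \<nu> j f h + Dinner \<nu> j g h"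
  unfolding Dinner_eq disc_deriv_add[OF f(1) g(1)] distrib_right distrib_left[symmetric]
  by (subst Bochner_Integration.integral_add) (auto intro: Dinner_integrable f g h)

lemma Dinner_cmult:
  assumes f: "f holomorphic_on ball 0 1"
  shows "Dinner \<nu> j (\<lambda>z. a * f z) h = a * Dinner \<nu> j f h"
  unfolding Dinner_eq disc_deriv_cmult[OF f] mult.assoc integral_mult_right_zero
  by (simp only: mult_ac)

lemma Dinner_cnj: "Dinner \<nu> j g f = cnj (Dinner \<nu> j f g)"
proof -
  have "(\<integral>z. disc_deriv j g z * cnj (disc_deriv j f z) * of_real (disc_weight \<nu> j z) \<partial>dA)
      = (\<integral>z. cnj (disc_deriv j f z * cnj (disc_deriv j g z) * of_real (disc_weight \<nu> j z)) \<partial>dA)"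
    by (simp add: mult.commute)
  also have "\<dots> = cnj (\<integral>z. disc_deriv j f z * cnj (disc_deriv j g z) * of_real (disc_weight \<nu> j z) \<partial>dA)"
    by (rule Bochner_Integration.integral_cnj)
  finally show ?thesis unfolding Dinner_eq by simp
qed

lemma Dinner_self:
  assumes f: "f holomorphic_on ball 0 1" "Dint \<nu> j f < \<infinity>"
  shows "Dinner \<nu> j f f = of_real (enn2real (Dint \<nu> j f))"
proof -
  define I where "I = (\<integral>z. (cmod (disc_deriv j f z))\<^sup>2 * disc_weight \<nu> j z \<partial>dA)"
  have I: "0 \<le> I" unfolding I_def by (intro Bochner_Integration.integral_nonneg) (simp add: disc_weight_nonneg)
  have eq: "(\<integral>\<^sup>+z. ennreal ((cmod (disc_deriv j f z))\<^sup>2 * disc_weight \<nu> j z) \<partial>dA) = ennreal I"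
    unfolding I_def by (intro nn_integral_eq_integral Dint_finite_integrable f) (simp add: disc_weight_nonneg)
  have "Dint \<nu> j f = ennreal (1 / (fact j * fact (j - 1)) * I)"
    unfolding Dint_eq_nn_integral eq by (rule ennreal_mult[symmetric]) (use I in auto)
  then have "enn2real (Dint \<nu> j f) = 1 / (fact j * fact (j - 1)) * I"
    using I by simp
  moreover have "(\<integral>z. disc_deriv j f z * cnj (disc_deriv j f z) * of_real (disc_weight \<nu> j z) \<partial>dA) = of_real I"
    unfolding I_def complex_norm_square[symmetric] of_real_mult[symmetric] by (rule integral_complex_of_real)
  ultimately show ?thesis unfolding Dinner_eq by simp
qed

end

section \<open>Hilbert space structure of \<open>HH\<close>\<close>

context dirichlet_setting
begin

abbreviation inner where "inner \<equiv> HH_inner \<mu> \<nu>"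
text \<open>The square of the norm, as a real number; expansions and the parallelogram law are
  stated for it directly.\<close>

definition nrm :: "(complex \<Rightarrow> complex) \<Rightarrow> real" where "nrm f = enn2real (N f)"

lemma HH_dest:
  assumes "f \<in> \<H>"
  shows "f holomorphic_on ball 0 1" "N f < \<infinity>" "H2_normsq f < \<infinity>" "Dint \<mu> 1 f < \<infinity>" "Dint \<nu> 2 f < \<infinity>"
proof -
  show "f holomorphic_on ball 0 1" "N f < \<infinity>" using assms by (simp_all add: HH_iff)
  then show "H2_normsq f < \<infinity>" "Dint \<mu> 1 f < \<infinity>" "Dint \<nu> 2 f < \<infinity>" by (auto simp: HH_normsq_def)
qed

lemma N_nrm: "f \<in> \<H> \<Longrightarrow> N f = ennreal (nrm f)"
  using HH_dest(2)[of f] by (simp add: nrm_def ennreal_enn2real_if)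

lemma nrm_nonneg [simp]: "0 \<le> nrm f"
  by (simp add: nrm_def)

lemma HH_add:
  assumes "f \<in> \<H>" "g \<in> \<H>"
  shows "(\<lambda>z. f z + g z) \<in> \<H>" "(\<lambda>z. f z - g z) \<in> \<H>"
proof -
  have "N (\<lambda>z. f z + g z) + N (\<lambda>z. f z - g z) < top"
    unfolding N_parallelogram[OF HH_dest(1)[OF assms(1)] HH_dest(1)[OF assms(2)]]
    using HH_dest(2)[OF assms(1)] HH_dest(2)[OF assms(2)] by (simp add: ennreal_mult_less_top)
  then show "(\<lambda>z. f z + g z) \<in> \<H>" "(\<lambda>z. f z - g z) \<in> \<H>"
    using HH_dest(1)[OF assms(1)] HH_dest(1)[OF assms(2)] by (auto simp: HH_iff intro!: holomorphic_intros)
qed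

lemma HH_cmult:
  assumes "f \<in> \<H>"
  shows "(\<lambda>z. a * f z) \<in> \<H>"
  using HH_dest[OF assms] by (auto simp: HH_iff N_cmult ennreal_mult_less_top intro!: holomorphic_intros)

lemma nrm_parallelogram:
  assumes "f \<in> \<H>" "g \<in> \<H>"
  shows "nrm (\<lambda>z. f z + g z) + nrm (\<lambda>z. f z - g z) = 2 * nrm f + 2 * nrm g"
proof -
  have "ennreal (nrm (\<lambda>z. f z + g z) + nrm (\<lambda>z. f z - g z)) = ennreal (2 * nrm f + 2 * nrm g)"
    using N_parallelogram[OF HH_dest(1)[OF assms(1)] HH_dest(1)[OF assms(2)]]
    by (simp add: N_nrm assms HH_add ennreal_mult)
  then show ?thesis by (subst (asm) ennreal_inj) auto
qed

lemma nrm_cmult: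
  assumes "f \<in> \<H>"
  shows "nrm (\<lambda>z. a * f z) = (cmod a)\<^sup>2 * nrm f"
  unfolding nrm_def N_cmult[OF HH_dest(1)[OF assms]] by (simp add: enn2real_mult)

lemma nrm_diff_commute:
  assumes "f \<in> \<H>" "g \<in> \<H>"
  shows "nrm (\<lambda>z. f z - g z) = nrm (\<lambda>z. g z - f z)"
  using nrm_cmult[OF HH_add(2)[OF assms], of "- 1"] by simp

lemma inner_add:
  assumes "f \<in> \<H>" "g \<in> \<H>" "h \<in> \<H>"
  shows "inner (\<lambda>z. f z + g z) h = inner f h + inner g h"
  unfolding HH_inner_def
  using H2_inner_add[OF HH_dest(1)[OF assms(1)] HH_dest(1)[OF assms(2)] HH_dest(3)[OF assms(1)] HH_dest(3)[OF assms(2)] HH_dest(3)[OF assms(3)]]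
    Dinner_add[OF sets_mu fin_mu sphere_mu HH_dest(1)[OF assms(1)] HH_dest(4)[OF assms(1)] HH_dest(1)[OF assms(2)] HH_dest(4)[OF assms(2)] HH_dest(1)[OF assms(3)] HH_dest(4)[OF assms(3)]]
    Dinner_add[OF sets_nu fin_nu sphere_nu HH_dest(1)[OF assms(1)] HH_dest(5)[OF assms(1)] HH_dest(1)[OF assms(2)] HH_dest(5)[OF assms(2)] HH_dest(1)[OF assms(3)] HH_dest(5)[OF assms(3)]]
  by simp

lemma inner_cmult:
  assumes "f \<in> \<H>" "h \<in> \<H>"
  shows "inner (\<lambda>z. a * f z) h = a * inner f h"
  unfolding HH_inner_def
  using H2_inner_cmult[OF HH_dest(1)[OF assms(1)] HH_dest(3)[OF assms(1)] HH_dest(3)[OF assms(2)], of a]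
    Dinner_cmult[OF sets_mu fin_mu sphere_mu HH_dest(1)[OF assms(1)], of 1 a h]
    Dinner_cmult[OF sets_nu fin_nu sphere_nu HH_dest(1)[OF assms(1)], of 2 a h]
  by (simp add: distrib_left)

lemma inner_cnj:
  assumes "f \<in> \<H>" "g \<in> \<H>"
  shows "inner g f = cnj (inner f g)"
  unfolding HH_inner_def
  using H2_inner_cnj[OF HH_dest(3)[OF assms(1)] HH_dest(3)[OF assms(2)]]
    Dinner_cnj[OF sets_mu fin_mu sphere_mu, of 1 g f] Dinner_cnj[OF sets_nu fin_nu sphere_nu, of 2 g f]
  by simp

lemma inner_self:
  assumes "f \<in> \<H>"
  shows "inner f f = of_real (nrm f)"
proof -
  have "nrm f = enn2real (H2_normsq f) + enn2real (Dint \<mu> 1 f) + enn2real (Dint \<nu> 2 f)"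
    unfolding nrm_def HH_normsq_def using HH_dest[OF assms] by (simp add: enn2real_plus)
  then show ?thesis
    unfolding HH_inner_def
    using H2_inner_self[OF HH_dest(3)[OF assms]] Dinner_self[OF sets_mu fin_mu sphere_mu HH_dest(1)[OF assms] HH_dest(4)[OF assms]]
      Dinner_self[OF sets_nu fin_nu sphere_nu HH_dest(1)[OF assms] HH_dest(5)[OF assms]]
    by simp
qed

lemma inner_cong:
  assumes "g holomorphic_on ball 0 1" "g' holomorphic_on ball 0 1" "\<And>z. cmod z < 1 \<Longrightarrow> g z = g' z"
  shows "inner f g = inner f g'"
proof -
  have "taylor_coeff g = taylor_coeff g'"
    using taylor_coeff_cong[OF assms(2,3)] by blast
  then show ?thesis
    unfolding HH_inner_def H2_inner_def using Dinner_cong[OF assms] by simp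
qed

lemma nrm_add_eq:
  assumes f: "f \<in> \<H>" and g: "g \<in> \<H>"
  shows "nrm (\<lambda>z. f z + a * g z) = nrm f + 2 * Re (cnj a * inner f g) + (cmod a)\<^sup>2 * nrm g"
proof -
  have ag: "(\<lambda>z. a * g z) \<in> \<H>" and s: "(\<lambda>z. f z + a * g z) \<in> \<H>"
    by (intro HH_cmult HH_add f g)+
  have fa: "inner f (\<lambda>z. a * g z) = cnj a * inner f g"
    using inner_cnj[OF ag f] inner_cmult[OF g f, of a] inner_cnj[OF f g] by simp
  have "inner (\<lambda>z. f z + a * g z) h = inner f h + a * inner g h" if "h \<in> \<H>" for h
    using inner_add[OF f ag that] inner_cmult[OF g that, of a] by simp
  then have "inner (\<lambda>z. f z + a * g z) (\<lambda>z. f z + a * g z) = cnj (inner f f + a * inner g f) + a * cnj (inner f g + a * inner g g)"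
    using inner_cnj[OF s f] inner_cnj[OF s g] f g s by simp
  then have "of_real (nrm (\<lambda>z. f z + a * g z)) = cnj (of_real (nrm f) + a * cnj (inner f g)) + a * cnj (inner f g + a * of_real (nrm g))"
    unfolding inner_self[OF s] inner_self[OF f] inner_self[OF g] inner_cnj[OF f g] .
  then have "Re (of_real (nrm (\<lambda>z. f z + a * g z))) = Re (cnj (of_real (nrm f) + a * cnj (inner f g)) + a * cnj (inner f g + a * of_real (nrm g)))"
    by (rule arg_cong)
  then show ?thesis
    unfolding cmod_power2 by (simp add: power2_eq_square algebra_simps)
qed

text \<open>The square norm of \<open>f - g / t\<close> is non-negative, and multiplying this by
  \<open>t\<close> bounds the cross term. This takes the place of the triangle inequality, with
  \<open>t\<close> sent to 0 afterwards.\<close>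

lemma nrm_add_le:
  assumes f: "f \<in> \<H>" and g: "g \<in> \<H>" and t: "t > 0"
  shows "nrm (\<lambda>z. f z + g z) \<le> (1 + t) * nrm f + (1 + 1 / t) * nrm g"
proof -
  have "nrm (\<lambda>z. f z + of_real (- 1 / t) * g z) = nrm f + 2 * Re (cnj (of_real (- 1 / t)) * inner f g) + (cmod (of_real (- 1 / t)))\<^sup>2 * nrm g"
    by (rule nrm_add_eq[OF f g])
  then have "0 \<le> nrm f + 2 * Re (cnj (of_real (- 1 / t)) * inner f g) + (cmod (of_real (- 1 / t)))\<^sup>2 * nrm g"
    by (metis nrm_nonneg)
  then have "0 \<le> nrm f - 2 / t * Re (inner f g) + (1 / t)\<^sup>2 * nrm g"
    unfolding norm_of_real using t by simp
  then have "0 \<le> t * (nrm f - 2 / t * Re (inner f g) + (1 / t)\<^sup>2 * nrm g)"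
    using t by simp
  also have "\<dots> = t * nrm f - 2 * Re (inner f g) + nrm g / t"
    using t by (simp add: field_simps power2_eq_square)
  finally show ?thesis
    using nrm_add_eq[OF f g, of 1] by (simp add: algebra_simps)
qed

text \<open>Coefficients are dominated by the norm and hence converge. Lower semicontinuity, applied
  to \<open>F k - F l\<close> as \<open>l\<close> grows, shows that the convergence is in
  norm.\<close>

lemma HH_complete:
  assumes F: "\<And>k. F k \<in> \<H>" and C: "\<And>\<epsilon>. \<epsilon> > 0 \<Longrightarrow> \<exists>K. \<forall>k\<ge>K. \<forall>l\<ge>K. nrm (\<lambda>z. F k z - F l z) \<le> \<epsilon>"
  obtains f where "f \<in> \<H>" "(\<lambda>k. N (\<lambda>z. F k z - f z)) \<longlonglongrightarrow> 0" "\<And>m. (\<lambda>k. taylor_coeff (F k) m) \<longlonglongrightarrow> taylor_coeff f m"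
    "(\<lambda>k. nrm (\<lambda>z. F k z - f z)) \<longlonglongrightarrow> 0"
proof -
  have co: "(cmod (taylor_coeff (F k) m - taylor_coeff (F l) m))\<^sup>2 \<le> nrm (\<lambda>z. F k z - F l z)" for k l m
    using N_ge_coeff[OF HH_dest(1)[OF HH_add(2)[OF F[of k] F[of l]]], of m]
    by (simp add: taylor_coeff_diff HH_dest(1)[OF F] N_nrm[OF HH_add(2)[OF F F]])
  have "Cauchy (\<lambda>k. taylor_coeff (F k) m)" for m
  proof (rule metric_CauchyI)
    fix e :: real assume e: "e > 0"
    then have "(e / 2)\<^sup>2 > 0" by simp
    from C[OF this] obtain K where "\<forall>k\<ge>K. \<forall>l\<ge>K. nrm (\<lambda>z. F k z - F l z) \<le> (e / 2)\<^sup>2" by (rule exE)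
    then have K: "nrm (\<lambda>z. F k z - F l z) \<le> (e / 2)\<^sup>2" if "k \<ge> K" "l \<ge> K" for k l using that by blast
    have "dist (taylor_coeff (F k) m) (taylor_coeff (F l) m) < e" if "k \<ge> K" "l \<ge> K" for k l
    proof -
      have "(cmod (taylor_coeff (F k) m - taylor_coeff (F l) m))\<^sup>2 \<le> (e / 2)\<^sup>2"
        by (rule order_trans[OF co K[OF that]])
      then have "cmod (taylor_coeff (F k) m - taylor_coeff (F l) m) \<le> e / 2"
        by (rule power2_le_imp_le) (use e in simp)
      then show ?thesis using e by (simp add: dist_norm)
    qed
    then show "\<exists>M. \<forall>k\<ge>M. \<forall>l\<ge>M. dist (taylor_coeff (F k) m) (taylor_coeff (F l) m) < e" by blast
  qed
  then have "\<forall>m. \<exists>a. (\<lambda>k. taylor_coeff (F k) m) \<longlonglongrightarrow> a"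
    by (simp add: Cauchy_convergent_iff convergent_def)
  then obtain a where a: "\<And>m. (\<lambda>k. taylor_coeff (F k) m) \<longlonglongrightarrow> a m" by metis
  from C[OF zero_less_one] obtain K1 where "\<forall>k\<ge>K1. \<forall>l\<ge>K1. nrm (\<lambda>z. F k z - F l z) \<le> 1" by (rule exE)
  then have K1: "nrm (\<lambda>z. F k z - F l z) \<le> 1" if "k \<ge> K1" "l \<ge> K1" for k l using that by blast
  have "cmod (a m) \<le> sqrt (nrm (F K1)) + 1" for m
  proof -
    have "cmod (taylor_coeff (F k) m) \<le> sqrt (nrm (F K1)) + 1" if "k \<ge> K1" for k
    proof -
      have "(cmod (taylor_coeff (F k) m - taylor_coeff (F K1) m))\<^sup>2 \<le> 1\<^sup>2"
        using order_trans[OF co[of k m K1] K1[OF that order_refl]] by simp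
      then have "cmod (taylor_coeff (F k) m - taylor_coeff (F K1) m) \<le> 1"
        by (rule power2_le_imp_le) simp
      moreover have "cmod (taylor_coeff (F K1) m) \<le> sqrt (nrm (F K1))"
        using N_ge_coeff[OF HH_dest(1)[OF F[of K1]], of m] by (intro real_le_rsqrt) (simp add: N_nrm F)
      ultimately show ?thesis
        using norm_triangle_sub[of "taylor_coeff (F k) m" "taylor_coeff (F K1) m"] by linarith
    qed
    then show ?thesis
      by (intro LIMSEQ_le_const2[OF tendsto_norm[OF a]]) auto
  qed
  then obtain f where f: "f holomorphic_on ball 0 1" and fa: "\<And>m. taylor_coeff f m = a m"
    using ex_holomorphic_taylor[of a] by blast
  have lsc: "N (\<lambda>z. F k z - f z) \<le> 3 * ennreal \<epsilon>" if K: "\<And>l. l \<ge> K \<Longrightarrow> nrm (\<lambda>z. F k z - F l z) \<le> \<epsilon>" for k K \<epsilon>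
  proof (rule N_lower_semicontinuous[where F = "\<lambda>l z. F k z - F (l + K) z"])
    show "(\<lambda>l. taylor_coeff (\<lambda>z. F k z - F (l + K) z) m) \<longlonglongrightarrow> taylor_coeff (\<lambda>z. F k z - f z) m" for m
      unfolding taylor_coeff_diff[OF HH_dest(1)[OF F] HH_dest(1)[OF F]] taylor_coeff_diff[OF HH_dest(1)[OF F] f] fa
      by (intro tendsto_intros LIMSEQ_ignore_initial_segment a)
    show "N (\<lambda>z. F k z - F (l + K) z) \<le> ennreal \<epsilon>" for l
      using K[of "l + K"] by (simp add: N_nrm HH_add F ennreal_leI)
  qed (auto intro!: holomorphic_intros HH_dest(1)[OF F] f)
  have fH: "f \<in> \<H>"
  proof -
    have "N (\<lambda>z. F K1 z - f z) \<le> 3 * ennreal 1"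
      by (rule lsc[of K1]) (use K1 in auto)
    then have "N (\<lambda>z. F K1 z - f z) < \<infinity>"
      by (rule order_le_less_trans) (simp add: ennreal_mult_less_top)
    then have "(\<lambda>z. F K1 z - f z) \<in> \<H>"
      by (auto simp: HH_iff intro!: holomorphic_intros HH_dest(1)[OF F] f)
    from HH_add(2)[OF F this, of K1] show ?thesis by simp
  qed
  have lim: "(\<lambda>k. nrm (\<lambda>z. F k z - f z)) \<longlonglongrightarrow> 0"
  proof (rule LIMSEQ_I)
    fix e :: real assume e: "e > 0"
    \<comment> \<open>Lower semicontinuity costs a factor 3, so \<open>e / 6\<close> leaves
      \<open>e / 2\<close>.\<close>
    then have "e / 6 > 0" by simp
    from C[OF this] obtain K where "\<forall>k\<ge>K. \<forall>l\<ge>K. nrm (\<lambda>z. F k z - F l z) \<le> e / 6" by (rule exE)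
    then have K: "nrm (\<lambda>z. F k z - F l z) \<le> e / 6" if "k \<ge> K" "l \<ge> K" for k l using that by blast
    have "norm (nrm (\<lambda>z. F k z - f z) - 0) < e" if "k \<ge> K" for k
    proof -
      have "ennreal (nrm (\<lambda>z. F k z - f z)) \<le> 3 * ennreal (e / 6)"
        unfolding N_nrm[OF HH_add(2)[OF F fH], symmetric] by (rule lsc[of K]) (use K that in auto)
      also have "\<dots> = ennreal (e / 2)"
        using e by (simp flip: ennreal_numeral ennreal_mult)
      finally have "nrm (\<lambda>z. F k z - f z) \<le> e / 2"
        using e by simp
      then show ?thesis using e by simp
    qed
    then show "\<exists>K. \<forall>k\<ge>K. norm (nrm (\<lambda>z. F k z - f z) - 0) < e" by blast
  qed
  have "(\<lambda>k. N (\<lambda>z. F k z - f z)) \<longlonglongrightarrow> 0"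
    using tendsto_ennrealI[OF lim] by (simp add: N_nrm HH_add F fH)
  then show ?thesis
    using fH lim a by (intro that[of f]) (simp_all add: fa)
qed

text \<open>The classical nearest-point argument, for a decreasing family of midpoint-convex sets. A
  constant family serves for orthogonal projection, a shrinking one for Mazur's theorem. The limit
  is only located in \<open>HH\<close>; that it satisfies more is shown at each use.\<close>

lemma minimizing_sequence:
  assumes K: "\<And>i. K i \<subseteq> \<H>" and dec: "\<And>i j. i \<le> j \<Longrightarrow> K j \<subseteq> K i"
    and mid: "\<And>i f g. f \<in> K i \<Longrightarrow> g \<in> K i \<Longrightarrow> (\<lambda>z. 1 / 2 * (f z + g z)) \<in> K i"
    and bd: "\<And>i. \<exists>f\<in>K i. nrm f \<le> D"
  obtains Y y d where "\<And>i. Y i \<in> K i" "y \<in> \<H>" "(\<lambda>k. N (\<lambda>z. Y k z - y z)) \<longlonglongrightarrow> 0"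
    "\<And>m. (\<lambda>k. taylor_coeff (Y k) m) \<longlonglongrightarrow> taylor_coeff y m" "(\<lambda>k. nrm (\<lambda>z. Y k z - y z)) \<longlonglongrightarrow> 0"
    "(\<lambda>k. nrm (Y k)) \<longlonglongrightarrow> d" "\<And>f. (\<And>i. f \<in> K i) \<Longrightarrow> d \<le> nrm f"
    "\<And>\<epsilon>. \<epsilon> > 0 \<Longrightarrow> \<exists>J. \<forall>k\<ge>J. \<forall>l\<ge>J. nrm (\<lambda>z. Y k z - Y l z) \<le> \<epsilon>"
proof -
  define \<delta> where "\<delta> = (\<lambda>i. Inf (nrm ` K i))"
  have bb: "bdd_below (nrm ` K i)" for i by (rule bdd_belowI[of _ 0]) auto
  have ne: "K i \<noteq> {}" for i using bd[of i] by auto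
  have \<delta>le: "\<delta> i \<le> nrm f" if "f \<in> K i" for i f
    unfolding \<delta>_def using that bb by (intro cInf_lower) auto
  have inc: "incseq \<delta>"
  proof (rule incseq_SucI)
    show "\<delta> i \<le> \<delta> (Suc i)" for i
      unfolding \<delta>_def using dec[of i "Suc i"] ne bb by (intro cInf_superset_mono) auto
  qed
  have "\<delta> i \<le> D" for i using bd[of i] \<delta>le by (meson order_trans)
  then obtain d where d: "\<delta> \<longlonglongrightarrow> d" and \<delta>d: "\<And>i. \<delta> i \<le> d"
    using incseq_convergent[OF inc] by blast
  define r where "r = (\<lambda>i. 1 / real (Suc i))"
  have r0: "r \<longlonglongrightarrow> 0" unfolding r_def by (rule LIMSEQ_Suc[OF lim_const_over_n])
  have "\<exists>f\<in>K i. nrm f < \<delta> i + r i" for i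
  proof -
    have "Inf (nrm ` K i) < \<delta> i + r i" by (simp add: \<delta>_def r_def)
    then show ?thesis using cInf_lessD[of "nrm ` K i"] ne[of i] by auto
  qed
  then obtain Y where Y: "\<And>i. Y i \<in> K i" "\<And>i. nrm (Y i) < \<delta> i + r i" by metis
  have YH: "Y i \<in> \<H>" for i using Y(1) K by blast
  \<comment> \<open>\<open>Y j\<close> also lies in \<open>K i\<close>, so the midpoint has square
    norm at least \<open>\<delta> i\<close>, and the parallelogram law bounds the
    difference.\<close>
  have est: "nrm (\<lambda>z. Y i z - Y j z) \<le> 2 * (d - \<delta> i) + 4 * r i" if "i \<le> j" for i j
  proof -
    have "\<delta> i \<le> nrm (\<lambda>z. 1 / 2 * (Y i z + Y j z))"
      using Y(1) dec[OF that] by (intro \<delta>le mid) auto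
    also have "\<dots> = (1 / 4) * nrm (\<lambda>z. Y i z + Y j z)"
      unfolding nrm_cmult[OF HH_add(1)[OF YH YH]] by (simp add: power2_eq_square)
    finally have "4 * \<delta> i \<le> nrm (\<lambda>z. Y i z + Y j z)" by simp
    moreover have "r j \<le> r i" using that by (simp add: r_def divide_left_mono)
    moreover have aux: "T \<le> 2 * (d - a) + 4 * p" if "4 * a \<le> S" "q \<le> p" "S + T = 2 * x + 2 * y" "x < a + p" "y < b + q" "b \<le> d"
      for S T x y a b p q :: real
    proof -
      have "T = 2 * x + 2 * y - S" using that(3) by simp
      then have "T \<le> 2 * (a + p) + 2 * (b + q) - 4 * a" using that(1,4,5) by argo
      then show ?thesis using that(2,6) by argo
    qed
    ultimately show ?thesis
      using aux[OF _ _ nrm_parallelogram[OF YH[of i] YH[of j]] Y(2)[of i] Y(2)[of j] \<delta>d[of j]] by blast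
  qed
  have e0: "(\<lambda>i. 2 * (d - \<delta> i) + 4 * r i) \<longlonglongrightarrow> 2 * (d - d) + 4 * 0"
    by (intro tendsto_intros d r0)
  have cau: "\<exists>J. \<forall>k\<ge>J. \<forall>l\<ge>J. nrm (\<lambda>z. Y k z - Y l z) \<le> \<epsilon>" if \<epsilon>: "\<epsilon> > 0" for \<epsilon>
  proof -
    have "\<forall>\<^sub>F i in sequentially. 2 * (d - \<delta> i) + 4 * r i < \<epsilon>"
      using order_tendstoD(2)[OF e0, of \<epsilon>] \<epsilon> by simp
    then obtain J where J: "\<And>i. i \<ge> J \<Longrightarrow> 2 * (d - \<delta> i) + 4 * r i < \<epsilon>"
      by (auto simp: eventually_sequentially)
    have "nrm (\<lambda>z. Y k z - Y l z) \<le> \<epsilon>" if "k \<ge> J" "l \<ge> J" for k l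
    proof (cases "k \<le> l")
      case True
      then show ?thesis using est[OF True] J[OF that(1)] by linarith
    next
      case False
      then show ?thesis
        using est[of l k] J[OF that(2)] nrm_diff_commute[OF YH[of k] YH[of l]] by linarith
    qed
    then show ?thesis by blast
  qed
  from HH_complete[OF YH cau] obtain y where y: "y \<in> \<H>" "(\<lambda>k. N (\<lambda>z. Y k z - y z)) \<longlonglongrightarrow> 0"
    "\<And>m. (\<lambda>k. taylor_coeff (Y k) m) \<longlonglongrightarrow> taylor_coeff y m" "(\<lambda>k. nrm (\<lambda>z. Y k z - y z)) \<longlonglongrightarrow> 0"
    by blast
  have "(\<lambda>k. nrm (Y k)) \<longlonglongrightarrow> d"
  proof (rule tendsto_sandwich[OF _ _ d])
    have "(\<lambda>i. \<delta> i + r i) \<longlonglongrightarrow> d + 0"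
      by (intro tendsto_intros d r0)
    then show "(\<lambda>i. \<delta> i + r i) \<longlonglongrightarrow> d" by simp
    show "\<forall>\<^sub>F i in sequentially. \<delta> i \<le> nrm (Y i)" by (intro always_eventually allI \<delta>le Y(1))
    show "\<forall>\<^sub>F i in sequentially. nrm (Y i) \<le> \<delta> i + r i" by (intro always_eventually allI less_imp_le Y(2))
  qed
  moreover have "d \<le> nrm f" if "\<And>i. f \<in> K i" for f
    using \<delta>le that by (intro LIMSEQ_le_const2[OF d]) auto
  ultimately show ?thesis
    using Y(1) y cau by (intro that[of Y y d]) auto
qed

end

section \<open>Invariant subspaces\<close>

lemma linear_prod_append: "linear_prod (as @ bs) z = linear_prod as z * linear_prod bs z"
  by (induction as) auto

lemma linear_prod_replicate_0: "linear_prod (replicate k 0) z = z ^ k"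
  by (induction k) auto

lemma taylor_coeff_power_mult:
  assumes "F holomorphic_on ball 0 1"
  shows "taylor_coeff (\<lambda>z. z ^ k * F z) m = (if m < k then 0 else taylor_coeff F (m - k))"
proof (induction k arbitrary: m)
  case (Suc k)
  have "taylor_coeff (\<lambda>z. z * (z ^ k * F z)) m = (case m of 0 \<Rightarrow> 0 | Suc m \<Rightarrow> taylor_coeff (\<lambda>z. z ^ k * F z) m)"
    by (intro taylor_coeff_z_mult holomorphic_intros assms)
  then show ?case by (auto simp: Suc.IH mult.assoc split: nat.splits)
qed simp

lemma fejer_shift:
  "fejer i F z = taylor_coeff F 0 + z * (\<Sum>m<i. taylor_coeff (fejer i F) (Suc m) * z ^ m)"
proof -
  have "fejer i F z = (\<Sum>m<Suc i. taylor_coeff (fejer i F) m * z ^ m)"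
    unfolding fejer_def[of i F z] lessThan_Suc_atMost by (intro sum.cong refl) (simp add: taylor_coeff_fejer[of i F])
  also have "\<dots> = taylor_coeff F 0 + (\<Sum>m<i. taylor_coeff (fejer i F) (Suc m) * z ^ Suc m)"
    unfolding sum.lessThan_Suc_shift by (simp add: taylor_coeff_fejer[of i F 0])
  finally show ?thesis by (simp add: sum_distrib_left mult_ac)
qed

lemma taylor_coeff_mult_tendsto:
  assumes q: "\<And>i. q i holomorphic_on ball 0 1" "\<And>m. (\<lambda>i. taylor_coeff (q i) m) \<longlonglongrightarrow> taylor_coeff r m"
    and r: "r holomorphic_on ball 0 1" and f: "f holomorphic_on ball 0 1"
  shows "(\<lambda>i. taylor_coeff (\<lambda>z. q i z * f z) m) \<longlonglongrightarrow> taylor_coeff (\<lambda>z. r z * f z) m"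
  unfolding taylor_coeff_mult[OF q(1) f] taylor_coeff_mult[OF r f]
  by (intro tendsto_sum tendsto_mult q(2) tendsto_const)

lemma zero_if_quadratic_nonneg:
  fixes w :: complex
  assumes S: "0 \<le> S" and le: "\<And>a. 0 \<le> 2 * Re (cnj a * w) + (cmod a)\<^sup>2 * S"
  shows "w = 0"
proof -
  \<comment> \<open>Testing with \<open>a = - \<tau> w\<close> lets the linear term win:
    \<open>\<tau> S \<le> 1\<close> leaves a factor of at most -1.\<close>
  define \<tau> where "\<tau> = 1 / (S + 1)"
  have \<tau>: "\<tau> > 0" "\<tau> * S \<le> 1" using S by (auto simp: \<tau>_def divide_simps)
  have "cnj (of_real (- \<tau>) * w) * w = of_real (- \<tau> * (cmod w)\<^sup>2)"
    unfolding of_real_mult complex_norm_square by (simp add: mult_ac)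
  then have "0 \<le> 2 * (- \<tau> * (cmod w)\<^sup>2) + (cmod (of_real (- \<tau>) * w))\<^sup>2 * S"
    using le[of "of_real (- \<tau>) * w"] by (simp only: Re_complex_of_real)
  also have "\<dots> = \<tau> * (cmod w)\<^sup>2 * (\<tau> * S - 2)"
    using \<tau> by (simp add: norm_mult power2_eq_square algebra_simps)
  also have "\<dots> \<le> \<tau> * (cmod w)\<^sup>2 * (- 1)"
    using \<tau> by (intro mult_left_mono) auto
  finally have "(cmod w)\<^sup>2 \<le> 0" using \<tau>(1) by (simp add: mult_le_0_iff)
  then show ?thesis by simp
qed

section \<open>An auxiliary norm and polynomial factors\<close>

context dirichlet_setting
begin

text \<open>The norm with its second order part replaced by \<open>Dir\<close>. Sup bounds and first
  order local bounds control it, and a factor vanishing at the atoms leads from it back to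
  \<open>N\<close>.\<close>

definition T :: "(complex \<Rightarrow> complex) \<Rightarrow> ennreal" where
  "T F = H2_normsq F + (\<integral>\<^sup>+\<zeta>. Dloc F \<zeta> \<partial>\<mu>) + Dir F"

text \<open>The cost of one linear factor: 12 is the constant of \<open>Dloc_linear_mult_le\<close>,
  and 4 times the mass of \<open>\<mu>\<close> comes from integrating its Hardy term.\<close>

definition mult_const :: ennreal where
  "mult_const = 12 + 4 * emeasure \<mu> (space \<mu>)"

lemma mult_const_finite: "mult_const < \<infinity>"
  using finite_measure.emeasure_finite[OF fin_mu, of "space \<mu>"]
  by (auto simp: mult_const_def ennreal_mult_less_top top.not_eq_extremum)

lemma Dloc_measurable_mu: "Dloc F \<in> borel_measurable \<mu>"
  using Dloc_borel_measurable measurable_cong_sets[OF sets_mu refl] by blast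

lemma T_linear_mult_le:
  assumes F: "F holomorphic_on ball 0 1" and a: "cmod a \<le> 1"
  shows "T (\<lambda>z. (z - a) * F z) \<le> mult_const * T F"
proof -
  have "(\<integral>\<^sup>+\<zeta>. Dloc (\<lambda>z. (z - a) * F z) \<zeta> \<partial>\<mu>) \<le> (\<integral>\<^sup>+\<zeta>. 4 * H2_normsq F + 12 * Dloc F \<zeta> \<partial>\<mu>)"
    using AE_circle_mu by (intro nn_integral_mono_AE) (auto elim!: eventually_mono intro!: Dloc_linear_mult_le F a)
  also have "\<dots> = 4 * H2_normsq F * emeasure \<mu> (space \<mu>) + 12 * (\<integral>\<^sup>+\<zeta>. Dloc F \<zeta> \<partial>\<mu>)"
    using Dloc_measurable_mu by (simp add: nn_integral_add nn_integral_cmult)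
  finally have D: "(\<integral>\<^sup>+\<zeta>. Dloc (\<lambda>z. (z - a) * F z) \<zeta> \<partial>\<mu>)
      \<le> 4 * H2_normsq F * emeasure \<mu> (space \<mu>) + 12 * (\<integral>\<^sup>+\<zeta>. Dloc F \<zeta> \<partial>\<mu>)" .
  have "T (\<lambda>z. (z - a) * F z) \<le> 4 * H2_normsq F + (4 * H2_normsq F * emeasure \<mu> (space \<mu>) + 12 * (\<integral>\<^sup>+\<zeta>. Dloc F \<zeta> \<partial>\<mu>))
      + (2 * H2_normsq F + 4 * Dir F)"
    unfolding T_def by (intro add_mono D H2_normsq_linear_mult_le Dir_linear_mult_le F a)
  also have "\<dots> = (6 + 4 * emeasure \<mu> (space \<mu>)) * H2_normsq F + 12 * (\<integral>\<^sup>+\<zeta>. Dloc F \<zeta> \<partial>\<mu>) + 4 * Dir F"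
  proof -
    have "6 * H2_normsq F = 4 * H2_normsq F + 2 * H2_normsq F" by (simp flip: distrib_right)
    then have "(6 + 4 * emeasure \<mu> (space \<mu>)) * H2_normsq F
        = 4 * H2_normsq F + 2 * H2_normsq F + 4 * emeasure \<mu> (space \<mu>) * H2_normsq F"
      by (simp only: distrib_right)
    then show ?thesis by (simp only: add_ac mult_ac)
  qed
  also have "\<dots> \<le> mult_const * H2_normsq F + mult_const * (\<integral>\<^sup>+\<zeta>. Dloc F \<zeta> \<partial>\<mu>) + mult_const * Dir F"
  proof (intro add_mono mult_right_mono)
    show "6 + 4 * emeasure \<mu> (space \<mu>) \<le> mult_const" unfolding mult_const_def by (intro add_right_mono) simp
    show "12 \<le> mult_const" unfolding mult_const_def by simp
    then show "4 \<le> mult_const" by (rule order_trans[rotated]) simp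
  qed simp_all
  finally show ?thesis unfolding T_def by (simp only: distrib_left)
qed

lemma T_linear_prod_le:
  assumes F: "F holomorphic_on ball 0 1" and as: "\<And>a. a \<in> set as \<Longrightarrow> cmod a \<le> 1"
  shows "T (\<lambda>z. linear_prod as z * F z) \<le> mult_const ^ length as * T F"
  using as
proof (induction as)
  case (Cons a as)
  have "T (\<lambda>z. (z - a) * (linear_prod as z * F z)) \<le> mult_const * T (\<lambda>z. linear_prod as z * F z)"
    using Cons.prems by (intro T_linear_mult_le holomorphic_intros F) auto
  also have "\<dots> \<le> mult_const * (mult_const ^ length as * T F)"
    using Cons by (intro mult_left_mono) auto
  finally show ?case by (simp add: mult_ac)
qed simp

text \<open>For each atom its own factor is split off the list; \<open>D2loc_linear_mult_le\<close>
  then leaves \<open>Dir\<close> of the product over the remaining roots.\<close>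

lemma N_linear_prod_le:
  assumes as: "\<And>a. a \<in> set as \<Longrightarrow> cmod a \<le> 1" "\<And>j. j < n \<Longrightarrow> lam j \<in> set as"
  obtains C where "C < \<infinity>" "\<And>F. F holomorphic_on ball 0 1 \<Longrightarrow> N (\<lambda>z. linear_prod as z * F z) \<le> C * T F"
proof -
  define E where "E = mult_const ^ (length as - 1)"
  define C where "C = mult_const ^ length as + (\<Sum>j<n. ennreal (c j) * E)"
  have pw: "mult_const ^ l < \<infinity>" for l
    using mult_const_finite by (induction l) (auto simp: ennreal_mult_less_top)
  have "C < \<infinity>"
    unfolding C_def E_def using pw by (auto simp: ennreal_mult_less_top)
  moreover have "N (\<lambda>z. linear_prod as z * F z) \<le> C * T F" if F: "F holomorphic_on ball 0 1" for F
  proof -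
    have d: "D2loc (\<lambda>z. linear_prod as z * F z) (lam j) \<le> E * T F" if j: "j < n" for j
    proof -
      have eq: "(\<lambda>z. linear_prod as z * F z) = (\<lambda>z. (z - lam j) * (linear_prod (remove1 (lam j) as) z * F z))"
        by (rule ext) (simp add: linear_prod_remove1[OF as(2)[OF j]])
      have "D2loc (\<lambda>z. linear_prod as z * F z) (lam j) \<le> Dir (\<lambda>z. linear_prod (remove1 (lam j) as) z * F z)"
        unfolding eq by (intro D2loc_linear_mult_le norm_lam j holomorphic_intros F)
      also have "\<dots> \<le> T (\<lambda>z. linear_prod (remove1 (lam j) as) z * F z)"
        unfolding T_def by simp
      also have "\<dots> \<le> mult_const ^ length (remove1 (lam j) as) * T F"
        by (rule T_linear_prod_le[OF F]) (rule as(1), erule subsetD[OF set_remove1_subset])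
      finally show ?thesis
        unfolding E_def by (simp add: length_remove1 as(2)[OF j])
    qed
    have "N (\<lambda>z. linear_prod as z * F z) \<le> T (\<lambda>z. linear_prod as z * F z)
        + (\<Sum>j<n. ennreal (c j) * D2loc (\<lambda>z. linear_prod as z * F z) (lam j))"
      unfolding N_eq[OF holomorphic_on_mult[OF holomorphic_linear_prod F]] D2_eq T_def
      by (intro add_right_mono) simp
    also have "\<dots> \<le> mult_const ^ length as * T F + (\<Sum>j<n. ennreal (c j) * (E * T F))"
      by (intro add_mono sum_mono mult_left_mono d T_linear_prod_le F as) auto
    also have "\<dots> = C * T F"
      unfolding C_def by (simp add: distrib_right sum_distrib_right mult.assoc)
    finally show ?thesis .
  qed
  ultimately show ?thesis by (rule that)
qed

lemma T_finite:
  assumes "f \<in> \<H>"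
  shows "T f < \<infinity>"
proof -
  have f: "H2_normsq f + (\<integral>\<^sup>+\<zeta>. Dloc f \<zeta> \<partial>\<mu>) + (\<integral>\<^sup>+\<zeta>. D2loc f \<zeta> \<partial>\<nu>) < \<infinity>"
    using HH_dest(2)[OF assms] unfolding N_eq[OF HH_dest(1)[OF assms]] .
  then have "(\<integral>\<^sup>+\<zeta>. D2loc f \<zeta> \<partial>\<nu>) < \<infinity>" by (rule order_le_less_trans[rotated]) simp
  then have "Dir f < \<infinity>" by (rule D2_finite_imp)
  then show ?thesis using f unfolding T_def by (simp only: infinity_ennreal_def ennreal_add_less_top)
qed

text \<open>The pointwise bound is integrated twice, against \<open>\<mu>\<close> and against arc
  length; the latter gives \<open>Dir\<close> by \<open>Dir_eq_average\<close>.\<close>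

lemma T_mult_le:
  assumes q: "q holomorphic_on ball 0 1" "\<And>z. cmod z < 1 \<Longrightarrow> cmod (q z) \<le> 1"
    and f: "f \<in> \<H>" and g: "g \<in> \<H>"
    and le: "\<And>\<zeta>. cmod \<zeta> = 1 \<Longrightarrow> Dloc (\<lambda>z. q z * f z) \<zeta> \<le> 130 * (Dloc f \<zeta> + Dloc g \<zeta>)"
  shows "T (\<lambda>z. q z * f z) \<le> 130 * (T f + T g)"
proof -
  have "H2_normsq (\<lambda>z. q z * f z) \<le> ennreal (1\<^sup>2) * H2_normsq f"
    by (rule H2_normsq_bounded_mult[OF q HH_dest(1)[OF f] HH_dest(3)[OF f]])
  also have "\<dots> \<le> 130 * (H2_normsq f + H2_normsq g)"
    by (intro mult_mono) auto
  finally have H: "H2_normsq (\<lambda>z. q z * f z) \<le> 130 * (H2_normsq f + H2_normsq g)" .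
  have "(\<integral>\<^sup>+\<zeta>. Dloc (\<lambda>z. q z * f z) \<zeta> \<partial>\<mu>) \<le> (\<integral>\<^sup>+\<zeta>. 130 * (Dloc f \<zeta> + Dloc g \<zeta>) \<partial>\<mu>)"
  proof (rule nn_integral_mono_AE)
    show "AE \<zeta> in \<mu>. Dloc (\<lambda>z. q z * f z) \<zeta> \<le> 130 * (Dloc f \<zeta> + Dloc g \<zeta>)"
      using AE_circle_mu by eventually_elim (rule le)
  qed
  also have "\<dots> = 130 * ((\<integral>\<^sup>+\<zeta>. Dloc f \<zeta> \<partial>\<mu>) + (\<integral>\<^sup>+\<zeta>. Dloc g \<zeta> \<partial>\<mu>))"
    using Dloc_measurable_mu by (simp add: nn_integral_add nn_integral_cmult)
  finally have D: "(\<integral>\<^sup>+\<zeta>. Dloc (\<lambda>z. q z * f z) \<zeta> \<partial>\<mu>) \<le> 130 * ((\<integral>\<^sup>+\<zeta>. Dloc f \<zeta> \<partial>\<mu>) + (\<integral>\<^sup>+\<zeta>. Dloc g \<zeta> \<partial>\<mu>))" .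
  have m: "(\<lambda>t. Dloc F (circ t) * indicator {0..1} t) \<in> borel_measurable lborel" for F
  proof (rule borel_measurable_times_ennreal)
    have "circ \<in> borel_measurable borel"
      unfolding circ_def by (intro borel_measurable_continuous_onI continuous_intros)
    then show "(\<lambda>t. Dloc F (circ t)) \<in> borel_measurable lborel"
      using measurable_compose[OF _ Dloc_borel_measurable, of circ borel] by simp
  qed simp
  have "Dir (\<lambda>z. q z * f z) \<le> (\<integral>\<^sup>+t. 130 * (Dloc f (circ t) * indicator {0..1} t + Dloc g (circ t) * indicator {0..1} t) \<partial>lborel)"
    unfolding Dir_eq_average
  proof (rule nn_integral_mono)
    show "Dloc (\<lambda>z. q z * f z) (circ t) * indicator {0..1} t
        \<le> 130 * (Dloc f (circ t) * indicator {0..1} t + Dloc g (circ t) * indicator {0..1} t)" for t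
      using le[of "circ t"] by (auto simp: circ_def indicator_def)
  qed
  also have "\<dots> = 130 * (Dir f + Dir g)"
    unfolding Dir_eq_average using m by (simp add: nn_integral_add nn_integral_cmult)
  finally have "Dir (\<lambda>z. q z * f z) \<le> 130 * (Dir f + Dir g)" .
  then have "T (\<lambda>z. q z * f z) \<le> 130 * (H2_normsq f + H2_normsq g)
      + 130 * ((\<integral>\<^sup>+\<zeta>. Dloc f \<zeta> \<partial>\<mu>) + (\<integral>\<^sup>+\<zeta>. Dloc g \<zeta> \<partial>\<mu>)) + 130 * (Dir f + Dir g)"
    unfolding T_def by (intro add_mono H D)
  also have "\<dots> = 130 * (T f + T g)"
    unfolding T_def by (simp only: distrib_left add_ac)
  finally show ?thesis .
qed

lemma N_add_le:
  assumes "f holomorphic_on ball 0 1" "g holomorphic_on ball 0 1"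
  shows "N (\<lambda>z. f z + g z) \<le> 2 * N f + 2 * N g" "N (\<lambda>z. f z - g z) \<le> 2 * N f + 2 * N g"
  unfolding N_parallelogram[OF assms, symmetric] by simp_all

lemma N_le_power_mult:
  assumes f: "f holomorphic_on ball 0 1"
  shows "N f \<le> N (\<lambda>z. z ^ k * f z)"
proof (induction k)
  case (Suc k)
  have "N (\<lambda>z. z ^ k * f z) \<le> N (\<lambda>z. z * (z ^ k * f z))"
    by (intro N_le_z_mult holomorphic_intros f)
  with Suc show ?case by (simp add: mult.assoc)
qed simp

text \<open>Division by \<open>z ^ k\<close> does not increase the norm, since multiplication by
  \<open>z\<close> is expansive.\<close>

lemma HH_factor:
  assumes F: "F \<in> \<H>" and z: "\<And>m. m < k \<Longrightarrow> taylor_coeff F m = 0"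
  obtains G where "G \<in> \<H>" "\<And>z. cmod z < 1 \<Longrightarrow> F z = z ^ k * G z" "\<And>m. taylor_coeff G m = taylor_coeff F (m + k)"
proof -
  have "cmod (taylor_coeff F m) \<le> sqrt (nrm F)" for m
    using N_ge_coeff[OF HH_dest(1)[OF F], of m] by (intro real_le_rsqrt) (simp add: N_nrm F)
  then obtain G where G: "G holomorphic_on ball 0 1" "\<And>m. taylor_coeff G m = taylor_coeff F (m + k)"
    using ex_holomorphic_taylor[of "\<lambda>m. taylor_coeff F (m + k)"] by blast
  have h: "(\<lambda>z. z ^ k * G z) holomorphic_on ball 0 1" by (intro holomorphic_intros G)
  have c: "taylor_coeff F m = taylor_coeff (\<lambda>z. z ^ k * G z) m" for m
    by (simp add: taylor_coeff_power_mult[OF G(1)] G(2) z)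
  have "N G \<le> N F"
    unfolding N_cong[OF HH_dest(1)[OF F] h c] by (rule N_le_power_mult[OF G(1)])
  then have "G \<in> \<H>" using HH_dest(2)[OF F] G(1) by (auto simp: HH_iff)
  then show ?thesis
    using eq_on_disc_if_taylor_coeff_eq[OF HH_dest(1)[OF F] h c] G(2) by (intro that) auto
qed

lemma N_zero: "N (\<lambda>z. 0) = 0"
  using N_cmult[of "\<lambda>z. 0" 0] by simp

end

section \<open>Closure properties of an invariant subspace\<close>

locale invariant_subspace = dirichlet_setting +
  fixes M :: "(complex \<Rightarrow> complex) set"
  assumes invariant: "closed_z_invariant_subspace \<mu> \<nu> M"
begin

lemma M_HH: "f \<in> M \<Longrightarrow> f \<in> \<H>"
  using invariant unfolding closed_z_invariant_subspace_def by blast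

lemmas M_dest = HH_dest[OF M_HH]

lemma M_zero: "(\<lambda>_. 0) \<in> M"
  using invariant unfolding closed_z_invariant_subspace_def by blast

lemma M_add: "f \<in> M \<Longrightarrow> g \<in> M \<Longrightarrow> (\<lambda>z. f z + g z) \<in> M"
  using invariant unfolding closed_z_invariant_subspace_def by blast

lemma M_cmult: "f \<in> M \<Longrightarrow> (\<lambda>z. a * f z) \<in> M"
  using invariant unfolding closed_z_invariant_subspace_def by blast

lemma M_z: "f \<in> M \<Longrightarrow> (\<lambda>z. z * f z) \<in> M"
  using invariant unfolding closed_z_invariant_subspace_def by blast

lemma M_closed:
  assumes "\<And>k. F k \<in> M" "f \<in> \<H>" "(\<lambda>k. N (\<lambda>z. F k z - f z)) \<longlonglongrightarrow> 0"
  shows "f \<in> M"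
  using invariant assms unfolding closed_z_invariant_subspace_def by blast

lemma M_diff: "f \<in> M \<Longrightarrow> g \<in> M \<Longrightarrow> (\<lambda>z. f z - g z) \<in> M"
  using M_add[OF _ M_cmult[of g "- 1"], of f] by simp

text \<open>Functions that agree on the disc have distance 0, so closedness makes \<open>M\<close>
  insensitive to values outside the disc.\<close>

lemma M_taylor_cong:
  assumes f: "f \<in> M" and g: "g holomorphic_on ball 0 1" and eq: "\<And>m. taylor_coeff f m = taylor_coeff g m"
  shows "g \<in> M"
proof (rule M_closed[of "\<lambda>_. f"])
  show "g \<in> \<H>"
    using M_dest(2)[OF f] g unfolding HH_iff N_cong[OF M_dest(1)[OF f] g eq] by blast
  have "N (\<lambda>z. f z - g z) = N (\<lambda>z. 0)"
    by (intro N_cong holomorphic_intros M_dest(1) f g) (simp add: taylor_coeff_diff M_dest(1)[OF f] g eq taylor_coeff_const)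
  then show "(\<lambda>k. N (\<lambda>z. f z - g z)) \<longlonglongrightarrow> 0" by (simp add: N_zero)
qed (rule f)

lemma M_cong:
  assumes "f \<in> M" "g holomorphic_on ball 0 1" "\<And>z. cmod z < 1 \<Longrightarrow> f z = g z"
  shows "g \<in> M"
  using taylor_coeff_cong[OF assms(2,3)] by (intro M_taylor_cong[OF assms(1,2)])

lemma M_power_mult: "f \<in> M \<Longrightarrow> (\<lambda>z. z ^ k * f z) \<in> M"
proof (induction k)
  case (Suc k)
  then show ?case using M_z[of "\<lambda>z. z ^ k * f z"] by (simp add: mult.assoc)
qed simp

lemma M_poly_mult: "f \<in> M \<Longrightarrow> (\<lambda>z. (\<Sum>m<k. a m * z ^ m) * f z) \<in> M"
proof (induction k)
  case 0
  then show ?case using M_zero by simp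
next
  case (Suc k)
  then show ?case
    using M_add[OF _ M_cmult[OF M_power_mult[of f k], of "a k"], of "\<lambda>z. (\<Sum>m<k. a m * z ^ m) * f z"]
    by (simp add: distrib_right mult.assoc)
qed

lemma M_linear_prod_mult: "f \<in> M \<Longrightarrow> (\<lambda>z. linear_prod as z * f z) \<in> M"
proof (induction as)
  case (Cons a as)
  then have "(\<lambda>z. linear_prod as z * f z) \<in> M" by blast
  from M_diff[OF M_z[OF this] M_cmult[OF this, of a]] show ?case
    by (simp add: algebra_simps)
qed simp

text \<open>Mazur's theorem in coefficient form: bounded sequences converging coefficientwise are those
  converging weakly, and \<^term>\<open>M\<close> is weakly closed. The sets \<^term>\<open>K i\<close> play the role of the closed convex
  hulls of the tails.\<close>

lemma M_weakly_closed:
  assumes A: "\<And>k. A k \<in> M" "\<And>k. nrm (A k) \<le> D" and b: "\<And>m. (\<lambda>k. taylor_coeff (A k) m) \<longlonglongrightarrow> b m"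
  obtains f where "f \<in> M" "\<And>m. taylor_coeff f m = b m"
proof -
  \<comment> \<open>Every bound that a coefficient satisfies along the tail from \<open>i\<close> on
    is inherited. Such conditions survive midpoints and get stronger as \<open>i\<close>
    grows.\<close>
  define K where "K = (\<lambda>i. {f \<in> M. \<forall>m \<epsilon>. (\<forall>k\<ge>i. cmod (taylor_coeff (A k) m - b m) \<le> \<epsilon>) \<longrightarrow> cmod (taylor_coeff f m - b m) \<le> \<epsilon>})"
  have AK: "A i \<in> K i" for i unfolding K_def using A(1) by blast
  have KH: "K i \<subseteq> \<H>" for i unfolding K_def using M_HH by blast
  have dec: "K j \<subseteq> K i" if "i \<le> j" for i j unfolding K_def using that by (blast intro: order_trans)
  have mid: "(\<lambda>z. 1 / 2 * (f z + g z)) \<in> K i" if f: "f \<in> K i" and g: "g \<in> K i" for i f g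
    unfolding K_def
  proof (intro CollectI conjI allI impI)
    have fg: "f \<in> M" "g \<in> M" using f g unfolding K_def by blast+
    then show "(\<lambda>z. 1 / 2 * (f z + g z)) \<in> M" by (intro M_cmult M_add)
    fix m \<epsilon> assume le: "\<forall>k\<ge>i. cmod (taylor_coeff (A k) m - b m) \<le> \<epsilon>"
    then have "cmod (taylor_coeff f m - b m) \<le> \<epsilon>" "cmod (taylor_coeff g m - b m) \<le> \<epsilon>"
      using f g unfolding K_def by blast+
    moreover have "cmod ((taylor_coeff f m - b m) + (taylor_coeff g m - b m)) \<le> cmod (taylor_coeff f m - b m) + cmod (taylor_coeff g m - b m)"
      by (rule norm_triangle_ineq)
    moreover have "taylor_coeff (\<lambda>z. 1 / 2 * (f z + g z)) m = 1 / 2 * (taylor_coeff f m + taylor_coeff g m)"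
      using fg[THEN M_dest(1)] by (simp only: taylor_coeff_cmult taylor_coeff_add holomorphic_on_add)
    then have "taylor_coeff (\<lambda>z. 1 / 2 * (f z + g z)) m - b m = 1 / 2 * ((taylor_coeff f m - b m) + (taylor_coeff g m - b m))"
      by (simp add: field_simps)
    then have "cmod (taylor_coeff (\<lambda>z. 1 / 2 * (f z + g z)) m - b m) = 1 / 2 * cmod ((taylor_coeff f m - b m) + (taylor_coeff g m - b m))"
      by (simp only: norm_mult) simp
    ultimately show "cmod (taylor_coeff (\<lambda>z. 1 / 2 * (f z + g z)) m - b m) \<le> \<epsilon>" by linarith
  qed
  have bd: "\<exists>f\<in>K i. nrm f \<le> D" for i using AK A(2) by blast
  obtain Y y d where Y: "\<And>i. Y i \<in> K i" and y: "y \<in> \<H>" "(\<lambda>k. N (\<lambda>z. Y k z - y z)) \<longlonglongrightarrow> 0"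
    "\<And>m. (\<lambda>k. taylor_coeff (Y k) m) \<longlonglongrightarrow> taylor_coeff y m"
    by (rule minimizing_sequence[OF KH dec mid bd]) (assumption+, rule that, assumption+)
  have yM: "y \<in> M"
    using Y unfolding K_def by (intro M_closed[OF _ y(1,2)]) blast
  have "taylor_coeff y m = b m" for m
  proof (rule LIMSEQ_unique[OF y(3)])
    show "(\<lambda>k. taylor_coeff (Y k) m) \<longlonglongrightarrow> b m"
    proof (rule LIMSEQ_I)
      fix e :: real assume e: "e > 0"
      obtain i where i: "\<forall>k\<ge>i. norm (taylor_coeff (A k) m - b m) < e / 2"
        using LIMSEQ_D[OF b half_gt_zero[OF e]] by (rule exE)
      have "norm (taylor_coeff (Y k) m - b m) < e" if "k \<ge> i" for k
      proof -
        have "\<forall>l\<ge>i. cmod (taylor_coeff (A l) m - b m) \<le> e / 2" using i less_imp_le by blast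
        moreover have "Y k \<in> K i" using Y dec[OF that] by blast
        ultimately have "cmod (taylor_coeff (Y k) m - b m) \<le> e / 2" unfolding K_def by blast
        then show ?thesis using e by simp
      qed
      then show "\<exists>no. \<forall>k\<ge>no. norm (taylor_coeff (Y k) m - b m) < e" by blast
    qed
  qed
  with yM show ?thesis by (rule that)
qed

text \<open>With \<open>P\<close> the product over the other roots,
  \<open>P z h - (z - a) P h = a P h\<close>, so non-zero roots can be removed one at a
  time.\<close>

lemma M_strip_linear_prod:
  assumes h: "(\<lambda>z. z * h z) \<in> M" and as: "\<And>a. a \<in> set as \<Longrightarrow> a \<noteq> 0" and p: "(\<lambda>z. linear_prod as z * h z) \<in> M"
  shows "h \<in> M"
  using as p
proof (induction as)
  case (Cons a as)
  have "(\<lambda>z. inverse a * (linear_prod as z * (z * h z) - linear_prod (a # as) z * h z)) \<in> M"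
    by (intro M_cmult M_diff[OF M_linear_prod_mult[OF h]] Cons.prems(2))
  also have "(\<lambda>z. inverse a * (linear_prod as z * (z * h z) - linear_prod (a # as) z * h z)) = (\<lambda>z. linear_prod as z * h z)"
    using Cons.prems(1)[of a] by (auto simp: field_simps)
  finally have "(\<lambda>z. linear_prod as z * h z) \<in> M" .
  show ?case
  proof (rule Cons.IH)
    show "b \<noteq> 0" if "b \<in> set as" for b using Cons.prems(1) that by simp
  qed fact
qed simp

end

section \<open>Division by the coordinate function and the wandering subspace\<close>

context invariant_subspace
begin

text \<open>The key step. With \<^term>\<open>f = (\<lambda>z. z ^ k * f' z)\<close>, \<^term>\<open>g = (\<lambda>z. z ^ k * g' z)\<close> and Fejer means \<^term>\<open>q i\<close>,
  \<^term>\<open>q' i\<close> of \<^term>\<open>(\<lambda>z. (u z)\<^sup>2 * g' z)\<close>, \<^term>\<open>(\<lambda>z. (u z)\<^sup>2 * f' z)\<close>, the element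
  \<^term>\<open>A i\<close> of \<^term>\<open>M\<close> is \<^term>\<open>p z * ((q i z - \<kappa>) * f z - q' i z * g z) / z\<close>; the factor \<^term>\<open>p\<close>, vanishing
  at the points \<^term>\<open>lam j\<close>, reduces the second order integrals to Dirichlet integrals. Since
  \<^term>\<open>q i z * f' z - q' i z * g' z\<close> tends to 0, \<^term>\<open>A i\<close> converges weakly to a multiple of \<^term>\<open>p z * f z / z\<close>.\<close>

lemma M_divide_linear_prod:
  assumes f: "f \<in> M" and g: "g \<in> M" and f0: "\<And>m. m \<le> k \<Longrightarrow> taylor_coeff f m = 0"
    and g0: "\<And>m. m < k \<Longrightarrow> taylor_coeff g m = 0" and gk: "taylor_coeff g k \<noteq> 0"
    and h: "h holomorphic_on ball 0 1" and fh: "\<And>z. cmod z < 1 \<Longrightarrow> f z = z * h z"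
  shows "(\<lambda>z. linear_prod (map lam [0..<n]) z * h z) \<in> M"
proof -
  obtain f' where f': "f' \<in> \<H>" and ff: "\<And>z. cmod z < 1 \<Longrightarrow> f z = z ^ k * f' z"
    and tf: "\<And>m. taylor_coeff f' m = taylor_coeff f (m + k)"
    by (rule HH_factor[OF M_HH[OF f], of k]) (simp add: f0, rule that, assumption+)
  obtain g' where g': "g' \<in> \<H>" and gg: "\<And>z. cmod z < 1 \<Longrightarrow> g z = z ^ k * g' z"
    and tg: "\<And>m. taylor_coeff g' m = taylor_coeff g (m + k)"
    by (rule HH_factor[OF M_HH[OF g], of k]) (simp add: g0, rule that, assumption+)
  note hf = HH_dest(1)[OF f'] and hg = HH_dest(1)[OF g']
  obtain u where u: "u holomorphic_on ball 0 1" "u 0 \<noteq> 0"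
    "\<And>z. cmod z < 1 \<Longrightarrow> cmod (u z * (u z * f' z)) \<le> 1 \<and> cmod (u z * (u z * g' z)) \<le> 1"
    "\<And>\<zeta> n. cmod \<zeta> = 1 \<Longrightarrow> Dloc (\<lambda>z. fejer n (\<lambda>z. u z * (u z * g' z)) z * f' z) \<zeta> \<le> 130 * (Dloc f' \<zeta> + Dloc g' \<zeta>)"
    "\<And>\<zeta> n. cmod \<zeta> = 1 \<Longrightarrow> Dloc (\<lambda>z. fejer n (\<lambda>z. u z * (u z * f' z)) z * g' z) \<zeta> \<le> 130 * (Dloc f' \<zeta> + Dloc g' \<zeta>)"
    by (rule ex_approximants[OF hf HH_dest(3)[OF f'] hg HH_dest(3)[OF g']]) (rule that, assumption+)
  define G where "G = (\<lambda>z. u z * (u z * g' z))"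
  define F where "F = (\<lambda>z. u z * (u z * f' z))"
  have GF: "G holomorphic_on ball 0 1" "F holomorphic_on ball 0 1"
    unfolding G_def F_def by (intro holomorphic_intros u hf hg)+
  \<comment> \<open>The common constant term of all \<open>q i\<close>, as the Cesaro weight at
    index 0 is 1. It is non-zero because \<open>u 0\<close> is, and because \<open>g\<close>
    vanishes to order exactly \<open>k\<close>.\<close>
  define \<kappa> where "\<kappa> = taylor_coeff G 0"
  have c0: "taylor_coeff X 0 = X 0" for X by (simp add: taylor_coeff_def)
  have \<kappa>: "\<kappa> \<noteq> 0"
    using u(2) gk tg[of 0] by (simp add: \<kappa>_def c0 G_def)
  \<comment> \<open>\<open>f\<close> vanishes to order at least \<open>k + 1\<close>, so
    \<open>f'\<close> vanishes at 0 and every \<open>q' i\<close> is divisible by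
    \<open>z\<close>.\<close>
  have F0: "taylor_coeff F 0 = 0"
    using f0[of k] tf[of 0] by (simp add: c0 F_def)
  define q where "q = (\<lambda>i. fejer i G)"
  define q' where "q' = (\<lambda>i. fejer i F)"
  have qh: "q i holomorphic_on ball 0 1" "q' i holomorphic_on ball 0 1" for i
    unfolding q_def q'_def by (intro holomorphic_intros)+
  define p where "p = linear_prod (map lam [0..<n])"
  \<comment> \<open>The factor \<open>z ^ k\<close> is included because the estimates are made for
    \<open>f'\<close> and \<open>g'\<close> instead of \<open>f\<close> and
    \<open>g\<close>.\<close>
  define as where "as = replicate k 0 @ map lam [0..<n]"
  have las: "linear_prod as z = z ^ k * p z" for z
    by (simp add: as_def p_def linear_prod_append linear_prod_replicate_0)
  have ph: "p holomorphic_on ball 0 1" and lh: "linear_prod as holomorphic_on ball 0 1"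
    unfolding p_def by (rule holomorphic_linear_prod)+
  \<comment> \<open>This is \<open>(q i - \<kappa>) / z\<close> written as a polynomial, so that
    \<open>A i\<close> visibly lies in \<open>M\<close>.\<close>
  define sq where "sq = (\<lambda>i z. \<Sum>m<i. taylor_coeff (q i) (Suc m) * z ^ m)"
  define sq' where "sq' = (\<lambda>i z. \<Sum>m<i. taylor_coeff (q' i) (Suc m) * z ^ m)"
  define A where "A = (\<lambda>i z. p z * (sq i z * f z) - p z * (sq' i z * g z))"
  have AM: "A i \<in> M" for i
    unfolding A_def sq_def sq'_def p_def by (intro M_diff M_linear_prod_mult M_poly_mult f g)
  define R where "R = (\<lambda>i z. q i z * f' z - q' i z * g' z - \<kappa> * f' z)"
  have Rh: "R i holomorphic_on ball 0 1" for i
    unfolding R_def by (intro holomorphic_intros qh hf hg)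
  have zA: "z * A i z = linear_prod as z * R i z" if z: "cmod z < 1" for i z
  proof -
    have 1: "z * sq i z = q i z - \<kappa>"
      using fejer_shift[of i G z] by (simp add: q_def sq_def \<kappa>_def)
    have 2: "z * sq' i z = q' i z"
      using fejer_shift[of i F z] by (simp add: q'_def sq'_def F0)
    have "z * A i z = p z * ((z * sq i z) * f z) - p z * ((z * sq' i z) * g z)"
      unfolding A_def by (simp add: algebra_simps)
    also have "\<dots> = linear_prod as z * R i z"
      unfolding 1 2 las R_def ff[OF z] gg[OF z] by (simp add: algebra_simps)
    finally show ?thesis .
  qed
  have cong: "taylor_coeff (\<lambda>z. z * A i z) m = taylor_coeff (\<lambda>z. linear_prod as z * R i z) m" for i m
    by (intro taylor_coeff_cong holomorphic_intros Rh zA)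
  obtain C where C: "C < \<infinity>" "\<And>X. X holomorphic_on ball 0 1 \<Longrightarrow> N (\<lambda>z. linear_prod as z * X z) \<le> C * T X"
  proof (rule N_linear_prod_le[of as])
    show "cmod a \<le> 1" if "a \<in> set as" for a
      using that norm_lam by (auto simp: as_def split: if_splits)
    show "lam j \<in> set as" if "j < n" for j
      using that by (auto simp: as_def)
  qed (rule that, assumption+)
  define E where "E = C * (130 * (T f' + T g'))"
  define B where "B = 2 * (2 * E + 2 * E) + 2 * (ennreal ((cmod \<kappa>)\<^sup>2) * (C * T f'))"
  have fin: "B < \<infinity>"
    unfolding B_def E_def using C(1) T_finite[OF f'] T_finite[OF g'] by (simp add: ennreal_mult_less_top)
  have NA: "N (A i) \<le> B" for i
  proof -
    have b: "cmod (G z) \<le> 1" "cmod (F z) \<le> 1" if "cmod z < 1" for z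
      unfolding G_def F_def using u(3)[OF that] by blast+
    have bq: "cmod (q i z) \<le> 1" if "cmod z < 1" for z
      unfolding q_def by (rule cmod_fejer_le[OF GF(1) b(1) that])
    have bq': "cmod (q' i z) \<le> 1" if "cmod z < 1" for z
      unfolding q'_def by (rule cmod_fejer_le[OF GF(2) b(2) that])
    have Tq: "T (\<lambda>z. q i z * f' z) \<le> 130 * (T f' + T g')"
      by (rule T_mult_le[OF qh(1) bq f' g']) (assumption, unfold q_def G_def, rule u(4))
    have Tq': "T (\<lambda>z. q' i z * g' z) \<le> 130 * (T g' + T f')"
      by (rule T_mult_le[OF qh(2) bq' g' f']) (assumption, unfold q'_def F_def, subst add.commute, rule u(5))
    define X Y Z where "X = (\<lambda>z. linear_prod as z * (q i z * f' z))" and "Y = (\<lambda>z. linear_prod as z * (q' i z * g' z))"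
      and "Z = (\<lambda>z. linear_prod as z * f' z)"
    have hol: "X holomorphic_on ball 0 1" "Y holomorphic_on ball 0 1" "Z holomorphic_on ball 0 1"
      unfolding X_def Y_def Z_def by (intro holomorphic_intros qh hf hg)+
    have X: "N X \<le> E"
      unfolding X_def E_def by (rule order_trans[OF C(2) mult_left_mono[OF Tq]]) (auto intro!: holomorphic_intros qh hf)
    have Y: "N Y \<le> E"
      unfolding Y_def E_def add.commute[of "T f'"]
      by (rule order_trans[OF C(2) mult_left_mono[OF Tq']]) (auto intro!: holomorphic_intros qh hg)
    have Z: "N Z \<le> C * T f'"
      unfolding Z_def by (rule C(2)[OF hf])
    \<comment> \<open>Expansiveness undoes the division by \<open>z\<close> at no cost.\<close>
    have "N (A i) \<le> N (\<lambda>z. z * A i z)"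
      by (rule N_le_z_mult[OF M_dest(1)[OF AM]])
    also have "\<dots> = N (\<lambda>z. linear_prod as z * R i z)"
      by (intro N_cong cong holomorphic_intros Rh M_dest(1) AM)
    also have "(\<lambda>z. linear_prod as z * R i z) = (\<lambda>z. (X z - Y z) - \<kappa> * Z z)"
      by (rule ext) (simp add: X_def Y_def Z_def R_def algebra_simps)
    also have "N \<dots> \<le> 2 * N (\<lambda>z. X z - Y z) + 2 * N (\<lambda>z. \<kappa> * Z z)"
      by (intro N_add_le holomorphic_intros hol)
    also have "\<dots> \<le> 2 * (2 * N X + 2 * N Y) + 2 * (ennreal ((cmod \<kappa>)\<^sup>2) * N Z)"
      unfolding N_cmult[OF hol(3)] by (intro add_mono mult_left_mono N_add_le(2) hol) auto
    also have "\<dots> \<le> B"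
      unfolding B_def by (intro add_mono mult_left_mono X Y Z) auto
    finally show ?thesis .
  qed
  have nrmA: "nrm (A i) \<le> enn2real B" for i
    unfolding nrm_def using NA fin by (intro enn2real_mono) auto
  have lim: "(\<lambda>i. taylor_coeff (A i) m) \<longlonglongrightarrow> taylor_coeff (\<lambda>z. - \<kappa> * (p z * h z)) m" for m
  proof -
    have "(\<lambda>i. taylor_coeff (\<lambda>z. q i z * f' z) m) \<longlonglongrightarrow> taylor_coeff (\<lambda>z. G z * f' z) m" for m
      unfolding q_def by (intro taylor_coeff_mult_tendsto holomorphic_fejer taylor_coeff_fejer_tendsto GF hf)
    moreover have "(\<lambda>i. taylor_coeff (\<lambda>z. q' i z * g' z) m) \<longlonglongrightarrow> taylor_coeff (\<lambda>z. F z * g' z) m" for m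
      unfolding q'_def by (intro taylor_coeff_mult_tendsto holomorphic_fejer taylor_coeff_fejer_tendsto GF hg)
    \<comment> \<open>Both products equal \<open>u\<^sup>2 f' g'\<close>; their limits cancel and
      only \<open>- \<kappa> f'\<close> survives.\<close>
    moreover have "(\<lambda>z. F z * g' z) = (\<lambda>z. G z * f' z)"
      by (rule ext) (simp add: F_def G_def)
    ultimately have 0: "(\<lambda>i. taylor_coeff (\<lambda>z. q i z * f' z) m - taylor_coeff (\<lambda>z. q' i z * g' z) m - taylor_coeff (\<lambda>z. \<kappa> * f' z) m)
        \<longlonglongrightarrow> taylor_coeff (\<lambda>z. G z * f' z) m - taylor_coeff (\<lambda>z. G z * f' z) m - taylor_coeff (\<lambda>z. \<kappa> * f' z) m" for m
      by (intro tendsto_diff tendsto_const) simp_all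
    have Rlim: "(\<lambda>i. taylor_coeff (R i) m) \<longlonglongrightarrow> taylor_coeff (\<lambda>z. - \<kappa> * f' z) m" for m
    proof -
      have eq: "taylor_coeff (R i) m = taylor_coeff (\<lambda>z. q i z * f' z) m - taylor_coeff (\<lambda>z. q' i z * g' z) m - taylor_coeff (\<lambda>z. \<kappa> * f' z) m" for i
      proof -
        have a: "(\<lambda>z. q i z * f' z) holomorphic_on ball 0 1" "(\<lambda>z. q' i z * g' z) holomorphic_on ball 0 1"
          "(\<lambda>z. \<kappa> * f' z) holomorphic_on ball 0 1"
          by (intro holomorphic_intros qh hf hg)+
        show ?thesis
          unfolding R_def taylor_coeff_diff[OF holomorphic_on_diff[OF a(1,2)] a(3)] taylor_coeff_diff[OF a(1,2)] ..
      qed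
      show ?thesis
        using 0[of m] unfolding eq taylor_coeff_cmult[OF hf] by simp
    qed
    have "(\<lambda>i. taylor_coeff (\<lambda>z. R i z * linear_prod as z) (Suc m)) \<longlonglongrightarrow> taylor_coeff (\<lambda>z. (- \<kappa> * f' z) * linear_prod as z) (Suc m)"
      by (intro taylor_coeff_mult_tendsto Rh Rlim lh holomorphic_intros hf)
    moreover have "taylor_coeff (\<lambda>z. R i z * linear_prod as z) (Suc m) = taylor_coeff (A i) m" for i
      using cong[of i "Suc m"] unfolding taylor_coeff_z_mult[OF M_dest(1)[OF AM]] by (simp add: mult.commute)
    moreover have "taylor_coeff (\<lambda>z. (- \<kappa> * f' z) * linear_prod as z) (Suc m) = taylor_coeff (\<lambda>z. - \<kappa> * (p z * h z)) m"
    proof -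
      have eq: "- \<kappa> * f' z * linear_prod as z = z * (- \<kappa> * (p z * h z))" if "cmod z < 1" for z
        using ff[OF that] fh[OF that] by (simp add: las)
      have k: "(\<lambda>z. - \<kappa> * (p z * h z)) holomorphic_on ball 0 1" by (intro holomorphic_intros ph h)
      have "taylor_coeff (\<lambda>z. (- \<kappa> * f' z) * linear_prod as z) (Suc m) = taylor_coeff (\<lambda>z. z * (- \<kappa> * (p z * h z))) (Suc m)"
        by (intro taylor_coeff_cong eq holomorphic_intros ph h)
      then show ?thesis unfolding taylor_coeff_z_mult[OF k] by simp
    qed
    ultimately show ?thesis by simp
  qed
  obtain e where e: "e \<in> M" "\<And>m. taylor_coeff e m = taylor_coeff (\<lambda>z. - \<kappa> * (p z * h z)) m"
    by (rule M_weakly_closed[OF AM nrmA lim]) (rule that, assumption+)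
  have "(\<lambda>z. - \<kappa> * (p z * h z)) \<in> M"
    by (rule M_taylor_cong[OF e(1) _ e(2)]) (intro holomorphic_intros ph h)
  then have "(\<lambda>z. inverse (- \<kappa>) * (- \<kappa> * (p z * h z))) \<in> M"
    by (rule M_cmult)
  also have "(\<lambda>z. inverse (- \<kappa>) * (- \<kappa> * (p z * h z))) = (\<lambda>z. p z * h z)"
    using \<kappa> by (auto simp: field_simps)
  finally show ?thesis unfolding p_def .
qed

lemma M_divide:
  assumes f: "f \<in> M" and g: "g \<in> M" and f0: "\<And>m. m \<le> k \<Longrightarrow> taylor_coeff f m = 0"
    and g0: "\<And>m. m < k \<Longrightarrow> taylor_coeff g m = 0" and gk: "taylor_coeff g k \<noteq> 0"
    and h: "h holomorphic_on ball 0 1" and fh: "\<And>z. cmod z < 1 \<Longrightarrow> f z = z * h z"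
  shows "h \<in> M"
proof (rule M_strip_linear_prod)
  show "(\<lambda>z. z * h z) \<in> M"
    by (rule M_cong[OF f _ fh]) (intro holomorphic_intros h)
  show "a \<noteq> 0" if "a \<in> set (map lam [0..<n])" for a
    using that by (auto dest!: norm_lam)
qed (rule M_divide_linear_prod[OF assms])

text \<open>The element of \<open>g - z M\<close> of least norm. Expansiveness passes the Cauchy
  property from \<open>Y\<close> to \<open>H\<close>, so the limit of \<open>H\<close> exists and
  lies in \<open>M\<close>; this is the closedness of \<open>z M\<close>.\<close>

lemma projection:
  assumes g: "g \<in> M"
  obtains h where "h \<in> M" "(\<lambda>z. g z - z * h z) \<in> wandering \<mu> \<nu> M"
proof -
  define K where "K = {F. \<exists>h\<in>M. F = (\<lambda>z. g z - z * h z)}"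
  have KI: "F \<in> K" if "h \<in> M" "F = (\<lambda>z. g z - z * h z)" for F h
    using that unfolding K_def by blast
  have KM: "F \<in> M" if "F \<in> K" for F
    using that unfolding K_def by (auto intro!: M_diff g M_z)
  have KH: "K \<subseteq> \<H>" using KM M_HH by blast
  have mid: "(\<lambda>z. 1 / 2 * (F z + F' z)) \<in> K" if "F \<in> K" "F' \<in> K" for F F'
  proof -
    from that obtain h h' where h: "h \<in> M" "h' \<in> M" "F = (\<lambda>z. g z - z * h z)" "F' = (\<lambda>z. g z - z * h' z)"
      unfolding K_def by blast
    have "(\<lambda>z. 1 / 2 * (F z + F' z)) = (\<lambda>z. g z - z * (1 / 2 * (h z + h' z)))"
      by (simp add: h(3,4) field_simps)
    then show ?thesis by (rule KI[OF M_cmult[OF M_add[OF h(1,2)]]])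
  qed
  have gK: "g \<in> K" by (rule KI[OF M_zero]) simp
  have bd: "\<exists>F\<in>K. nrm F \<le> nrm g" using gK by blast
  obtain Y y d where Y: "\<And>i::nat. Y i \<in> K" and y: "y \<in> \<H>"
    "\<And>m. (\<lambda>k. taylor_coeff (Y k) m) \<longlonglongrightarrow> taylor_coeff y m" "(\<lambda>k. nrm (\<lambda>z. Y k z - y z)) \<longlonglongrightarrow> 0"
    "(\<lambda>k. nrm (Y k)) \<longlonglongrightarrow> d" "\<And>f. f \<in> K \<Longrightarrow> d \<le> nrm f"
    and cau: "\<And>\<epsilon>. \<epsilon> > 0 \<Longrightarrow> \<exists>J. \<forall>k\<ge>J. \<forall>l\<ge>J. nrm (\<lambda>z. Y k z - Y l z) \<le> \<epsilon>"
  proof (rule minimizing_sequence[of "\<lambda>_. K", OF KH order_refl mid bd])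
    fix Y y d
    assume a: "\<And>i::nat. Y i \<in> K" "y \<in> \<H>" "\<And>m. (\<lambda>k. taylor_coeff (Y k) m) \<longlonglongrightarrow> taylor_coeff y m"
      "(\<lambda>k. nrm (\<lambda>z. Y k z - y z)) \<longlonglongrightarrow> 0" "(\<lambda>k. nrm (Y k)) \<longlonglongrightarrow> d"
      and m: "\<And>f. (\<And>i::nat. f \<in> K) \<Longrightarrow> d \<le> nrm f"
      and c: "\<And>\<epsilon>. \<epsilon> > 0 \<Longrightarrow> \<exists>J. \<forall>k\<ge>J. \<forall>l\<ge>J. nrm (\<lambda>z. Y k z - Y l z) \<le> \<epsilon>"
    have "d \<le> nrm f" if "f \<in> K" for f by (rule m) (rule that)
    then show thesis by (rule that[OF a _ c])
  qed assumption+
  have "\<forall>i. \<exists>h\<in>M. Y i = (\<lambda>z. g z - z * h z)" using Y unfolding K_def by blast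
  then obtain H where H: "\<And>i. H i \<in> M" "\<And>i. Y i = (\<lambda>z. g z - z * H i z)" by metis
  have HY: "nrm (\<lambda>z. H k z - H l z) \<le> nrm (\<lambda>z. Y k z - Y l z)" for k l
  proof -
    have hM: "(\<lambda>z. H l z - H k z) \<in> M" by (intro M_diff H)
    have "nrm (\<lambda>z. H k z - H l z) = nrm (\<lambda>z. H l z - H k z)"
      by (intro nrm_diff_commute M_HH H)
    also have "\<dots> \<le> nrm (\<lambda>z. z * (H l z - H k z))"
      unfolding nrm_def using N_le_z_mult[OF M_dest(1)[OF hM]] M_dest(2)[OF M_z[OF hM]] by (intro enn2real_mono) auto
    also have "(\<lambda>z. z * (H l z - H k z)) = (\<lambda>z. Y k z - Y l z)"
      by (simp add: H(2) algebra_simps)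
    finally show ?thesis .
  qed
  have "\<exists>J. \<forall>k\<ge>J. \<forall>l\<ge>J. nrm (\<lambda>z. H k z - H l z) \<le> \<epsilon>" if "\<epsilon> > 0" for \<epsilon>
    using cau[OF that] order_trans[OF HY] by meson
  then obtain h where h: "h \<in> \<H>" "(\<lambda>k. N (\<lambda>z. H k z - h z)) \<longlonglongrightarrow> 0" "\<And>m. (\<lambda>k. taylor_coeff (H k) m) \<longlonglongrightarrow> taylor_coeff h m"
    by (rule HH_complete[OF M_HH[OF H(1)]]) (assumption+, rule that, assumption+)
  have hM: "h \<in> M" by (rule M_closed[OF H(1) h(1,2)])
  define e where "e = (\<lambda>z. g z - z * h z)"
  have eM: "e \<in> M" unfolding e_def by (intro M_diff g M_z hM)
  have eK: "e \<in> K" by (rule KI[OF hM e_def])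
  have sub: "taylor_coeff (\<lambda>z. g z - z * X z) m = taylor_coeff g m - (case m of 0 \<Rightarrow> 0 | Suc j \<Rightarrow> taylor_coeff X j)" if "X \<in> M" for X m
    unfolding taylor_coeff_diff[OF M_dest(1)[OF g] M_dest(1)[OF M_z[OF that]]] taylor_coeff_z_mult[OF M_dest(1)[OF that]] ..
  have "taylor_coeff y m = taylor_coeff e m" for m
  proof (rule LIMSEQ_unique[OF y(2)])
    show "(\<lambda>k. taylor_coeff (Y k) m) \<longlonglongrightarrow> taylor_coeff e m"
      unfolding H(2) e_def sub[OF H(1)] sub[OF hM] by (cases m) (auto intro!: tendsto_intros h(3))
  qed
  then have ye: "nrm e = nrm y"
    unfolding nrm_def using N_cong[OF HH_dest(1)[OF y(1)] M_dest(1)[OF eM]] by simp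
  \<comment> \<open>As \<open>k\<close> grows the distance term disappears for each fixed
    \<open>t\<close>; afterwards \<open>t\<close> tends to 0.\<close>
  have yd: "nrm y \<le> (1 + t) * d" if t: "t > 0" for t
  proof (rule LIMSEQ_le_const)
    have "(\<lambda>k. (1 + t) * nrm (Y k) + (1 + 1 / t) * nrm (\<lambda>z. Y k z - y z)) \<longlonglongrightarrow> (1 + t) * d + (1 + 1 / t) * 0"
      by (intro tendsto_intros y)
    then show "(\<lambda>k. (1 + t) * nrm (Y k) + (1 + 1 / t) * nrm (\<lambda>z. Y k z - y z)) \<longlonglongrightarrow> (1 + t) * d" by simp
    have "nrm y \<le> (1 + t) * nrm (Y k) + (1 + 1 / t) * nrm (\<lambda>z. Y k z - y z)" for k
    proof -
      have Yk: "Y k \<in> \<H>" using Y KH by blast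
      have "nrm (\<lambda>z. Y k z + (y z - Y k z)) \<le> (1 + t) * nrm (Y k) + (1 + 1 / t) * nrm (\<lambda>z. y z - Y k z)"
        by (intro nrm_add_le Yk HH_add y(1) t)
      then show ?thesis unfolding nrm_diff_commute[OF y(1) Yk] by simp
    qed
    then show "\<exists>J. \<forall>k\<ge>J. nrm y \<le> (1 + t) * nrm (Y k) + (1 + 1 / t) * nrm (\<lambda>z. Y k z - y z)" by blast
  qed
  have "nrm y \<le> d"
  proof (rule LIMSEQ_le_const)
    have "(\<lambda>i. (1 + 1 / real (Suc i)) * d) \<longlonglongrightarrow> (1 + 0) * d"
      by (intro tendsto_intros LIMSEQ_Suc[OF lim_const_over_n])
    then show "(\<lambda>i. (1 + 1 / real (Suc i)) * d) \<longlonglongrightarrow> d" by simp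
    show "\<exists>J. \<forall>i\<ge>J. nrm y \<le> (1 + 1 / real (Suc i)) * d"
      using yd[of "1 / real (Suc i)" for i] by simp
  qed
  then have ed: "nrm e \<le> d" using ye by simp
  \<comment> \<open>First order condition at the minimum: adding any complex multiple of
    \<open>z s\<close> to \<open>e\<close> stays in \<open>K\<close>.\<close>
  have "inner e (\<lambda>z. z * s z) = 0" if s: "s \<in> M" for s
  proof (rule zero_if_quadratic_nonneg[of "nrm (\<lambda>z. z * s z)"])
    have sH: "(\<lambda>z. z * s z) \<in> \<H>" by (intro M_HH M_z s)
    fix a :: complex
    have "(\<lambda>z. e z + a * (z * s z)) = (\<lambda>z. g z - z * (h z - a * s z))"
      by (simp add: e_def algebra_simps)
    then have "(\<lambda>z. e z + a * (z * s z)) \<in> K"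
      by (rule KI[OF M_diff[OF hM M_cmult[OF s]]])
    then have "d \<le> nrm (\<lambda>z. e z + a * (z * s z))" by (rule y(5))
    also have "\<dots> = nrm e + 2 * Re (cnj a * inner e (\<lambda>z. z * s z)) + (cmod a)\<^sup>2 * nrm (\<lambda>z. z * s z)"
      by (rule nrm_add_eq[OF M_HH[OF eM] sH])
    finally show "0 \<le> 2 * Re (cnj a * inner e (\<lambda>z. z * s z)) + (cmod a)\<^sup>2 * nrm (\<lambda>z. z * s z)"
      using ed by linarith
  qed simp
  then have "e \<in> wandering \<mu> \<nu> M" unfolding wandering_def using eM by blast
  then show ?thesis unfolding e_def by (rule that[OF hM])
qed

text \<open>\<open>k\<close> is the lowest order of vanishing in \<open>M\<close>. Subtracting
  \<open>z h\<close> cannot change the \<open>k\<close>-th coefficient, as \<open>h\<close> has none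
  below \<open>k\<close>, so \<open>e\<close> has order exactly \<open>k\<close>. For
  \<open>f\<close> in the wandering subspace a multiple of \<open>e\<close> is subtracted to raise
  the order; by \<open>M_divide\<close> the difference lies in \<open>z M\<close>, and being
  wandering as well it is orthogonal to itself.\<close>

lemma dim_one_wandering:
  assumes "f0 \<in> M" "z0 \<in> ball 0 1" "f0 z0 \<noteq> 0"
  shows "dim_one_on_disc (wandering \<mu> \<nu> M)"
proof -
  have zero: "F z = 0" if "F \<in> M" "\<And>m. taylor_coeff F m = 0" "cmod z < 1" for F z
    using that by (intro eq_on_disc_if_taylor_coeff_eq[of F "\<lambda>_. 0"] M_dest(1) holomorphic_intros) (auto simp: taylor_coeff_const)
  define P where "P = (\<lambda>k. \<exists>F\<in>M. taylor_coeff F k \<noteq> 0)"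
  have "\<exists>k. P k"
    using zero[OF assms(1), of z0] assms unfolding P_def by auto
  then have Pk: "P (LEAST k. P k)" by (rule LeastI_ex)
  define k where "k = (LEAST k. P k)"
  have low: "taylor_coeff F m = 0" if "F \<in> M" "m < k" for F m
    using not_less_Least[of m P] that unfolding k_def P_def by blast
  obtain g where g: "g \<in> M" "taylor_coeff g k \<noteq> 0"
    using Pk unfolding k_def[symmetric] unfolding P_def by blast
  obtain h where h: "h \<in> M" and e: "(\<lambda>z. g z - z * h z) \<in> wandering \<mu> \<nu> M"
    by (rule projection[OF g(1)])
  define e where "e = (\<lambda>z. g z - z * h z)"
  have eW: "e \<in> wandering \<mu> \<nu> M" using e unfolding e_def .
  have eM: "e \<in> M" using eW unfolding wandering_def by blast
  have "taylor_coeff e k = taylor_coeff g k - (case k of 0 \<Rightarrow> 0 | Suc j \<Rightarrow> taylor_coeff h j)"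
    unfolding e_def taylor_coeff_diff[OF M_dest(1)[OF g(1)] M_dest(1)[OF M_z[OF h]]] taylor_coeff_z_mult[OF M_dest(1)[OF h]] ..
  then have ek: "taylor_coeff e k \<noteq> 0"
    using g(2) low[OF h] by (simp split: nat.splits)
  have "\<exists>z\<in>ball 0 1. e z \<noteq> 0"
  proof (rule ccontr)
    assume "\<not> (\<exists>z\<in>ball 0 1. e z \<noteq> 0)"
    then have "taylor_coeff e k = taylor_coeff (\<lambda>_. 0) k" by (intro taylor_coeff_cong) auto
    then show False using ek by (simp add: taylor_coeff_const)
  qed
  moreover have "\<exists>a. \<forall>z\<in>ball 0 1. f z = a * e z" if f: "f \<in> wandering \<mu> \<nu> M" for f
  proof -
    have fM: "f \<in> M" using f unfolding wandering_def by blast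
    define a where "a = taylor_coeff f k / taylor_coeff e k"
    define F where "F = (\<lambda>z. f z + (- a) * e z)"
    have FM: "F \<in> M" unfolding F_def by (intro M_add M_cmult fM eM)
    have ae: "(\<lambda>z. (- a) * e z) \<in> M" by (intro M_cmult eM)
    have "taylor_coeff F k = taylor_coeff f k + (- a) * taylor_coeff e k"
      unfolding F_def taylor_coeff_add[OF M_dest(1)[OF fM] M_dest(1)[OF ae]] taylor_coeff_cmult[OF M_dest(1)[OF eM]] ..
    then have Fk: "taylor_coeff F k = 0" using ek by (simp add: a_def)
    have F0: "taylor_coeff F m = 0" if "m \<le> k" for m
      using low[OF FM, of m] Fk that by (cases "m = k") auto
    obtain H where H: "H \<in> \<H>" "\<And>z. cmod z < 1 \<Longrightarrow> F z = z ^ 1 * H z"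
      by (rule HH_factor[OF M_HH[OF FM], of 1]) (simp add: F0, rule that, assumption+)
    have FH: "F z = z * H z" if "cmod z < 1" for z using H(2)[OF that] by simp
    have HM: "H \<in> M"
      by (rule M_divide[OF FM g(1) F0 low[OF g(1)] g(2) HH_dest(1)[OF H(1)] FH])
    have zH: "(\<lambda>z. z * H z) \<in> \<H>" by (intro M_HH M_z HM)
    have "inner F F = inner F (\<lambda>z. z * H z)"
      by (rule inner_cong[OF M_dest(1)[OF FM] HH_dest(1)[OF zH] FH])
    also have "\<dots> = inner f (\<lambda>z. z * H z) + (- a) * inner e (\<lambda>z. z * H z)"
      unfolding F_def inner_add[OF M_HH[OF fM] M_HH[OF ae] zH] inner_cmult[OF M_HH[OF eM] zH] ..
    also have "\<dots> = 0"
      using f eW HM unfolding wandering_def by simp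
    finally have "nrm F = 0" unfolding inner_self[OF M_HH[OF FM]] by simp
    then have "taylor_coeff F m = 0" for m
      using N_ge_coeff[OF M_dest(1)[OF FM], of m] unfolding N_nrm[OF M_HH[OF FM]] by simp
    then have "F z = 0" if "cmod z < 1" for z using zero[OF FM _ that] by blast
    then show ?thesis unfolding F_def by (intro exI[of _ a]) auto
  qed
  ultimately show ?thesis unfolding dim_one_on_disc_def using eW by blast
qed

end

theorem theorem4p5:
  fixes \<mu> :: "complex measure" and n :: nat and lam :: "nat \<Rightarrow> complex"
    and c :: "nat \<Rightarrow> real" and M :: "(complex \<Rightarrow> complex) set"
  assumes "sets \<mu> = sets borel" and "finite_measure \<mu>"
    and "emeasure \<mu> (UNIV - sphere 0 1) = 0"
    and "n \<ge> 1"
    and "\<forall>j<n. lam j \<in> sphere 0 1" and "inj_on lam {..<n}"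
    and "\<forall>j<n. c j > 0"
    and "closed_z_invariant_subspace \<mu> (dirac_sum n lam c) M"
    and "\<exists>f\<in>M. \<exists>z\<in>ball 0 1. f z \<noteq> 0"
  shows "dim_one_on_disc (wandering \<mu> (dirac_sum n lam c) M)"
proof -
  interpret invariant_subspace \<mu> n lam c M
  proof (intro invariant_subspace.intro dirichlet_setting.intro invariant_subspace_axioms.intro)
    show "lam j \<in> sphere 0 1" if "j < n" for j by (rule assms(5)[rule_format, OF that])
    show "c j > 0" if "j < n" for j by (rule assms(7)[rule_format, OF that])
  qed (rule assms)+
  from assms(9) obtain f z where "f \<in> M" "z \<in> ball 0 1" "f z \<noteq> 0" by (elim bexE)
  then show ?thesis by (rule dim_one_wandering)
qed

end
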